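(* Let $R$ be a local ring with maximal ideal $P$ (not necessarily principal) satisfying $P^2=0$, with residue field $k$, and let $A\in M_n(k)$. There exists a bijection between the sets $\omega^{-1}(\xi_0)$ and $\mathrm{Ext}^1_{k[t]}(M^A,M^A)\otimes_kP$ which preserves the action of $G_A$.
   Context: $R$ is commutative; $P$ is viewed as a $k$-vector space. $M^A$ is the $k[t]$-module $k^n$ with $t$ acting by $A$, also viewed as an $R[t]$-module via $R[t]\to k[t]$; $M^A\otimes_kP$ has $t$ acting through $M^A$. $\omega:\mathrm{Ext}^1_{R[t]}(M^A,M^A\otimes_kP)\to\mathrm{Ext}^1_R(M^A,M^A\otimes_kP)$ is the map induced by the forgetful functor from $R[t]$-modules to $R$-modules (here $\mathrm{Ext}^1(M,N)$ classifies extensions $0\to N\to E\to M\to0$). $\xi_0\in\mathrm{Ext}^1_R(M^A,M^A\otimes_kP)$ is the class of $0\to P^n\to R^n\to k^n\to0$, the $n$-fold direct sum of $0\to P\to R\to k\to0$, with $M^A\otimes_kP=P^n$ and $M^A=k^n$ as $R$-modules. $G_A$ is the centralizer of $A$ in $\mathrm{GL}_n(k)$, i.e. $\mathrm{Aut}_{k[t]}(M^A)$. It acts diagonally on these groups: on $\mathrm{Ext}^1_{R[t]}(M^A,M^A\otimes_kP)$ (and over $R$), for classes $\xi,\xi'$ of $0\to M^A\otimes P\xrightarrow{i}E\xrightarrow{s}M^A\to0$ and $0\to M^A\otimes P\xrightarrow{i'}E'\xrightarrow{s'}M^A\to0$, ${}^g\xi=\xi'$ iff there is a homomorphism $\phi:E\to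 E'$ with $\phi i=i'(g\otimes1)$ and $s'\phi=gs$; on $\mathrm{Ext}^1_{k[t]}(M^A,M^A)\otimes_kP$ it acts on the first factor by the analogous diagonal action and trivially on $P$. The set $\omega^{-1}(\xi_0)$ is stable under $G_A$. *)

theory Defs
  imports "HOL-Algebra.Algebra"
begin

section \<open>Rings, matrices and modules\<close>

definition local_ring :: "('r, 'x) ring_scheme \<Rightarrow> 'r set \<Rightarrow> bool" where
  "local_ring R P \<longleftrightarrow> cring R \<and> maximalideal P R \<and> (\<forall>I. maximalideal I R \<longrightarrow> I = P)"

text \<open>The multiplicative monoid of \<open>n \<times> n\<close> matrices. Indices run from \<open>0\<close> to \<open>n - 1\<close>, and
  vectors and matrices are extensional functions.\<close>

definition matrix_monoid :: "('k, 'x) ring_scheme \<Rightarrow> nat \<Rightarrow> (nat \<times> nat \<Rightarrow> 'k) monoid" where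
  "matrix_monoid K n =
    \<lparr>carrier = {..<n} \<times> {..<n} \<rightarrow>\<^sub>E carrier K,
     monoid.mult = (\<lambda>A B. \<lambda>(i, j)\<in>{..<n} \<times> {..<n}. \<Oplus>\<^bsub>K\<^esub>l\<in>{..<n}. A (i, l) \<otimes>\<^bsub>K\<^esub> B (l, j)),
     monoid.one = (\<lambda>(i, j)\<in>{..<n} \<times> {..<n}. if i = j then \<one>\<^bsub>K\<^esub> else \<zero>\<^bsub>K\<^esub>)\<rparr>"

definition mat_vec ::
  "('k, 'x) ring_scheme \<Rightarrow> nat \<Rightarrow> (nat \<times> nat \<Rightarrow> 'k) \<Rightarrow> (nat \<Rightarrow> 'k) \<Rightarrow> nat \<Rightarrow> 'k" where
  "mat_vec K n A v = (\<lambda>i\<in>{..<n}. \<Oplus>\<^bsub>K\<^esub>j\<in>{..<n}. A (i, j) \<otimes>\<^bsub>K\<^esub> v j)"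

definition GL_centralizer ::
  "('k, 'x) ring_scheme \<Rightarrow> nat \<Rightarrow> (nat \<times> nat \<Rightarrow> 'k) \<Rightarrow> (nat \<times> nat \<Rightarrow> 'k) set" where
  "GL_centralizer K n A =
    {g \<in> Units (matrix_monoid K n). g \<otimes>\<^bsub>matrix_monoid K n\<^esub> A = A \<otimes>\<^bsub>matrix_monoid K n\<^esub> g}"

text \<open>The library's module record extends the ring record. The fields \<open>mult\<close> and \<open>one\<close>
  play no role for modules and are left undefined.\<close>

definition mod_hom ::
  "('s, 'x) ring_scheme \<Rightarrow> ('s, 'm) module \<Rightarrow> ('s, 'n) module \<Rightarrow> ('m \<Rightarrow> 'n) set" where
  "mod_hom S M N =
    {f \<in> carrier M \<rightarrow> carrier N.
      (\<forall>x\<in>carrier M. \<forall>y\<in>carrier M. f (x \<oplus>\<^bsub>M\<^esub> y) = f x \<oplus>\<^bsub>N\<^esub> f y) \<and>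
      (\<forall>a\<in>carrier S. \<forall>x\<in>carrier M. f (a \<odot>\<^bsub>M\<^esub> x) = a \<odot>\<^bsub>N\<^esub> f x)}"

definition restrict_scalars :: "('r \<Rightarrow> 's) \<Rightarrow> ('s, 'm) module \<Rightarrow> ('r, 'm) module" where
  "restrict_scalars \<phi> M =
    \<lparr>carrier = carrier M, monoid.mult = undefined, monoid.one = undefined, ring.zero = \<zero>\<^bsub>M\<^esub>, ring.add = ring.add M,
     smult = (\<lambda>r x. \<phi> r \<odot>\<^bsub>M\<^esub> x)\<rparr>"

definition direct_sum ::
  "('s, 'm) module \<Rightarrow> ('s, 'n) module \<Rightarrow> ('s, 'm \<times> 'n) module" where
  "direct_sum M N =
    \<lparr>carrier = carrier M \<times> carrier N, monoid.mult = undefined, monoid.one = undefined,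
     ring.zero = (\<zero>\<^bsub>M\<^esub>, \<zero>\<^bsub>N\<^esub>),
     ring.add = (\<lambda>(x, y) (x', y'). (x \<oplus>\<^bsub>M\<^esub> x', y \<oplus>\<^bsub>N\<^esub> y')),
     smult = (\<lambda>a (x, y). (a \<odot>\<^bsub>M\<^esub> x, a \<odot>\<^bsub>N\<^esub> y))\<rparr>"

definition free_module :: "('k, 'x) ring_scheme \<Rightarrow> nat \<Rightarrow> ('k, nat \<Rightarrow> 'k) module" where
  "free_module K n =
    \<lparr>carrier = {..<n} \<rightarrow>\<^sub>E carrier K, monoid.mult = undefined, monoid.one = undefined,
     ring.zero = (\<lambda>i\<in>{..<n}. \<zero>\<^bsub>K\<^esub>),
     ring.add = (\<lambda>v w. \<lambda>i\<in>{..<n}. v i \<oplus>\<^bsub>K\<^esub> w i),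
     smult = (\<lambda>a v. \<lambda>i\<in>{..<n}. a \<otimes>\<^bsub>K\<^esub> v i)\<rparr>"

definition const_poly :: "('r, 'x) ring_scheme \<Rightarrow> 'r \<Rightarrow> nat \<Rightarrow> 'r" where
  "const_poly R r = monom (UP R) r 0"

text \<open>The \<open>k[t]\<close>-module \<open>M\<^sup>A\<close>: a polynomial \<open>p\<close> acts on \<open>k\<^sup>n\<close> as \<open>p(A)\<close>.\<close>

definition matrix_module ::
  "('k, 'x) ring_scheme \<Rightarrow> nat \<Rightarrow> (nat \<times> nat \<Rightarrow> 'k) \<Rightarrow> (nat \<Rightarrow> 'k, nat \<Rightarrow> 'k) module" where
  "matrix_module K n A =
    (let V = free_module K n in
      \<lparr>carrier = carrier V, monoid.mult = undefined, monoid.one = undefined, ring.zero = \<zero>\<^bsub>V\<^esub>, ring.add = ring.add V,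
       smult = (\<lambda>p v. \<Oplus>\<^bsub>V\<^esub>i\<in>{..deg K p}. coeff (UP K) p i \<odot>\<^bsub>V\<^esub> ((mat_vec K n A) ^^ i) v)\<rparr>)"

section \<open>Tensor products\<close>

text \<open>\<open>M \<otimes>\<^sub>K N\<close> is the free abelian group on \<open>M \<times> N\<close> modulo the bilinearity and balancing
  relations.\<close>

definition tensor_relations ::
  "('k, 'x) ring_scheme \<Rightarrow> ('k, 'm) module \<Rightarrow> ('k, 'n) module \<Rightarrow> (('m \<times> 'n) \<Rightarrow>\<^sub>0 int) set" where
  "tensor_relations K M N =
    {frag_of (x \<oplus>\<^bsub>M\<^esub> x', y) - frag_of (x, y) - frag_of (x', y) | x x' y.
        x \<in> carrier M \<and> x' \<in> carrier M \<and> y \<in> carrier N} \<union>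
    {frag_of (x, y \<oplus>\<^bsub>N\<^esub> y') - frag_of (x, y) - frag_of (x, y') | x y y'.
        x \<in> carrier M \<and> y \<in> carrier N \<and> y' \<in> carrier N} \<union>
    {frag_of (a \<odot>\<^bsub>M\<^esub> x, y) - frag_of (x, a \<odot>\<^bsub>N\<^esub> y) | a x y.
        a \<in> carrier K \<and> x \<in> carrier M \<and> y \<in> carrier N}"

definition tensor_kernel ::
  "('k, 'x) ring_scheme \<Rightarrow> ('k, 'm) module \<Rightarrow> ('k, 'n) module \<Rightarrow> (('m \<times> 'n) \<Rightarrow>\<^sub>0 int) set" where
  "tensor_kernel K M N =
    generate (free_Abelian_group (carrier M \<times> carrier N)) (tensor_relations K M N)"

definition tensor_group ::
  "('k, 'x) ring_scheme \<Rightarrow> ('k, 'm) module \<Rightarrow> ('k, 'n) module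
    \<Rightarrow> (('m \<times> 'n) \<Rightarrow>\<^sub>0 int) set monoid" where
  "tensor_group K M N =
    free_Abelian_group (carrier M \<times> carrier N) Mod tensor_kernel K M N"

definition tensor_elem ::
  "('k, 'x) ring_scheme \<Rightarrow> ('k, 'm) module \<Rightarrow> ('k, 'n) module \<Rightarrow> 'm \<Rightarrow> 'n
    \<Rightarrow> (('m \<times> 'n) \<Rightarrow>\<^sub>0 int) set" where
  "tensor_elem K M N x y =
    tensor_kernel K M N #>\<^bsub>free_Abelian_group (carrier M \<times> carrier N)\<^esub> frag_of (x, y)"

text \<open>The homomorphism from a tensor product to \<open>G\<close> (written multiplicatively) with
  \<open>x \<otimes> y \<mapsto> b (x, y)\<close>. When \<open>b\<close> is biadditive and balanced, the image below is a singleton, as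
  the value does not depend on the representative \<open>c\<close> of the coset \<open>z\<close>.\<close>

definition tensor_lift ::
  "('g, 'y) monoid_scheme \<Rightarrow> ('m \<times> 'n \<Rightarrow> 'g) \<Rightarrow> (('m \<times> 'n) \<Rightarrow>\<^sub>0 int) set \<Rightarrow> 'g" where
  "tensor_lift G b z =
    the_elem ((\<lambda>c. finprod G (\<lambda>u. b u [^]\<^bsub>G\<^esub> Poly_Mapping.lookup c u) (Poly_Mapping.keys c)) ` z)"

definition tensor_map ::
  "('k, 'x) ring_scheme \<Rightarrow> ('k, 'm) module \<Rightarrow> ('k, 'n) module \<Rightarrow> ('m \<Rightarrow> 'm) \<Rightarrow> ('n \<Rightarrow> 'n)
    \<Rightarrow> (('m \<times> 'n) \<Rightarrow>\<^sub>0 int) set \<Rightarrow> (('m \<times> 'n) \<Rightarrow>\<^sub>0 int) set" where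
  "tensor_map K M N f g =
    tensor_lift (tensor_group K M N) (\<lambda>(x, y). tensor_elem K M N (f x) (g y))"

text \<open>\<open>M \<otimes>\<^sub>K N\<close> with scalars from another ring acting through \<open>M\<close> by \<open>act\<close>.\<close>

definition tensor_module ::
  "('k, 'x) ring_scheme \<Rightarrow> ('k, 'm) module \<Rightarrow> ('k, 'n) module \<Rightarrow> ('s \<Rightarrow> 'm \<Rightarrow> 'm)
    \<Rightarrow> ('s, (('m \<times> 'n) \<Rightarrow>\<^sub>0 int) set) module" where
  "tensor_module K M N act =
    \<lparr>carrier = carrier (tensor_group K M N), monoid.mult = undefined, monoid.one = undefined,
     ring.zero = \<one>\<^bsub>tensor_group K M N\<^esub>, ring.add = monoid.mult (tensor_group K M N),
     smult = (\<lambda>s. tensor_map K M N (act s) id)\<rparr>"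

section \<open>Extensions\<close>

text \<open>A short exact sequence \<open>0 \<rightarrow> N \<rightarrow> E \<rightarrow> M \<rightarrow> 0\<close>, with carrier type \<open>'e\<close> for \<open>E\<close>.\<close>

record ('s, 'n, 'e, 'm) extension =
  ext_mid :: "('s, 'e) module"
  ext_in :: "'n \<Rightarrow> 'e"
  ext_out :: "'e \<Rightarrow> 'm"

definition is_extension ::
  "('s, 'x) ring_scheme \<Rightarrow> ('s, 'm) module \<Rightarrow> ('s, 'n) module
    \<Rightarrow> ('s, 'n, 'e, 'm) extension \<Rightarrow> bool" where
  "is_extension S M N U \<longleftrightarrow>
    module S (ext_mid U) \<and>
    ext_in U \<in> mod_hom S N (ext_mid U) \<and> ext_out U \<in> mod_hom S (ext_mid U) M \<and>
    inj_on (ext_in U) (carrier N) \<and> ext_out U ` carrier (ext_mid U) = carrier M \<and>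
    ext_in U ` carrier N = {e \<in> carrier (ext_mid U). ext_out U e = \<zero>\<^bsub>M\<^esub>}"

text \<open>There is a morphism of extensions from \<open>U\<close> (an extension by \<open>N\<close>) to \<open>V\<close> which is
  \<open>\<alpha>\<close> on the submodules and \<open>\<beta>\<close> on the quotients.\<close>

definition ext_morphism ::
  "('s, 'x) ring_scheme \<Rightarrow> ('s, 'n) module \<Rightarrow> ('n \<Rightarrow> 'n') \<Rightarrow> ('m \<Rightarrow> 'm')
    \<Rightarrow> ('s, 'n, 'e, 'm) extension \<Rightarrow> ('s, 'n', 'e', 'm') extension \<Rightarrow> bool" where
  "ext_morphism S N \<alpha> \<beta> U V \<longleftrightarrow>
    (\<exists>\<phi>\<in>mod_hom S (ext_mid U) (ext_mid V).
      (\<forall>x\<in>carrier N. \<phi> (ext_in U x) = ext_in V (\<alpha> x)) \<and>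
      (\<forall>e\<in>carrier (ext_mid U). ext_out V (\<phi> e) = \<beta> (ext_out U e)))"

text \<open>Equivalence classes consist of extensions whose middle term is carried by a subset of
  the type \<open>'n \<times> 'm\<close>. This loses nothing: by \<open>ext_class_nonempty\<close> below, an extension on any
  type is equivalent to such a one.\<close>

type_synonym ('s, 'n, 'm) ext = "('s, 'n, 'n \<times> 'm, 'm) extension"

definition ext_class ::
  "('s, 'x) ring_scheme \<Rightarrow> ('s, 'm) module \<Rightarrow> ('s, 'n) module
    \<Rightarrow> ('s, 'n, 'e, 'm) extension \<Rightarrow> ('s, 'n, 'm) ext set" where
  "ext_class S M N U = {V. is_extension S M N V \<and> ext_morphism S N id id U V}"

definition Ext1 ::
  "('s, 'x) ring_scheme \<Rightarrow> ('s, 'm) module \<Rightarrow> ('s, 'n) module \<Rightarrow> ('s, 'n, 'm) ext set set" where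
  "Ext1 S M N = {ext_class S M N U | U :: ('s, 'n, 'm) ext. is_extension S M N U}"

text \<open>The class \<open>\<xi>'\<close> reached from \<open>\<xi>\<close> by a morphism \<open>(\<alpha>, \<phi>, \<beta>)\<close> of extensions. For
  \<open>\<beta> = id\<close> this is the pushout along \<open>\<alpha>\<close>; for automorphisms \<open>\<alpha>\<close> and \<open>\<beta>\<close> given by a group
  element it is the diagonal action.\<close>

definition ext_transport ::
  "('s, 'x) ring_scheme \<Rightarrow> ('s, 'm) module \<Rightarrow> ('s, 'n) module \<Rightarrow> ('n \<Rightarrow> 'n) \<Rightarrow> ('m \<Rightarrow> 'm)
    \<Rightarrow> ('s, 'n, 'm) ext set \<Rightarrow> ('s, 'n, 'm) ext set" where
  "ext_transport S M N \<alpha> \<beta> \<xi> =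
    {V. is_extension S M N V \<and> (\<exists>U\<in>\<xi>. ext_morphism S N \<alpha> \<beta> U V)}"

text \<open>The extension \<open>0 \<rightarrow> N \<oplus> N \<rightarrow> E \<times>\<^sub>M E' \<rightarrow> M \<rightarrow> 0\<close>. Its pushout along the sum map
  \<open>N \<oplus> N \<rightarrow> N\<close> is the Baer sum.\<close>

definition ext_fibre_product ::
  "('s, 'n, 'e, 'm) extension \<Rightarrow> ('s, 'n, 'e', 'm) extension
    \<Rightarrow> ('s, 'n \<times> 'n, 'e \<times> 'e', 'm) extension" where
  "ext_fibre_product U V =
    \<lparr>ext_mid = (direct_sum (ext_mid U) (ext_mid V))
       \<lparr>carrier := {(e, e'). e \<in> carrier (ext_mid U) \<and> e' \<in> carrier (ext_mid V) \<and>
          ext_out U e = ext_out V e'}\<rparr>,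
     ext_in = map_prod (ext_in U) (ext_in V),
     ext_out = (\<lambda>(e, e'). ext_out U e)\<rparr>"

definition baer_sum ::
  "('s, 'x) ring_scheme \<Rightarrow> ('s, 'm) module \<Rightarrow> ('s, 'n) module
    \<Rightarrow> ('s, 'n, 'm) ext set \<Rightarrow> ('s, 'n, 'm) ext set \<Rightarrow> ('s, 'n, 'm) ext set" where
  "baer_sum S M N \<xi> \<zeta> =
    {W. is_extension S M N W \<and>
      (\<exists>U\<in>\<xi>. \<exists>V\<in>\<zeta>. ext_morphism S (direct_sum N N) (\<lambda>(a, b). a \<oplus>\<^bsub>N\<^esub> b) id
        (ext_fibre_product U V) W)}"

definition split_extension ::
  "('s, 'm) module \<Rightarrow> ('s, 'n) module \<Rightarrow> ('s, 'n, 'm) ext" where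
  "split_extension M N =
    \<lparr>ext_mid = direct_sum N M, ext_in = (\<lambda>x. (x, \<zero>\<^bsub>M\<^esub>)), ext_out = snd\<rparr>"

definition Ext1_module ::
  "('s, 'x) ring_scheme \<Rightarrow> ('s, 'm) module \<Rightarrow> ('s, 'n) module
    \<Rightarrow> ('s, ('s, 'n, 'm) ext set) module" where
  "Ext1_module S M N =
    \<lparr>carrier = Ext1 S M N, monoid.mult = undefined, monoid.one = undefined,
     ring.zero = ext_class S M N (split_extension M N), ring.add = baer_sum S M N,
     smult = (\<lambda>a. ext_transport S M N (\<lambda>x. a \<odot>\<^bsub>N\<^esub> x) id)\<rparr>"

definition ext_restrict_scalars ::
  "('r \<Rightarrow> 's) \<Rightarrow> ('s, 'n, 'e, 'm) extension \<Rightarrow> ('r, 'n, 'e, 'm) extension" where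
  "ext_restrict_scalars \<phi> U =
    \<lparr>ext_mid = restrict_scalars \<phi> (ext_mid U), ext_in = ext_in U, ext_out = ext_out U\<rparr>"

lemma ext_class_nonempty:
  fixes U :: "('s, 'n, 'e, 'm) extension"
  assumes M: "module S M" and N: "module S N" and U: "is_extension S M N U"
  shows "ext_class S M N U \<noteq> {}"
proof -
  define E i s where "E = ext_mid U" and "i = ext_in U" and "s = ext_out U"
  interpret M: module S M by (fact M)
  interpret N: module S N by (fact N)
  interpret E: module S E using U by (simp add: is_extension_def E_def)
  have i: "i \<in> mod_hom S N E" and s: "s \<in> mod_hom S E M" and inj_i: "inj_on i (carrier N)"
    and surj_s: "s ` carrier E = carrier M"
    and exact: "i ` carrier N = {e \<in> carrier E. s e = \<zero>\<^bsub>M\<^esub>}"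
    using U by (simp_all add: is_extension_def E_def i_def s_def)
  have s_closed: "\<And>e. e \<in> carrier E \<Longrightarrow> s e \<in> carrier M"
    and s_add: "\<And>e e'. e \<in> carrier E \<Longrightarrow> e' \<in> carrier E \<Longrightarrow> s (e \<oplus>\<^bsub>E\<^esub> e') = s e \<oplus>\<^bsub>M\<^esub> s e'"
    and s_smult: "\<And>a e. a \<in> carrier S \<Longrightarrow> e \<in> carrier E \<Longrightarrow> s (a \<odot>\<^bsub>E\<^esub> e) = a \<odot>\<^bsub>M\<^esub> s e"
    using s by (auto simp: mod_hom_def)
  have i_closed: "\<And>x. x \<in> carrier N \<Longrightarrow> i x \<in> carrier E"
    and i_add: "\<And>x y. x \<in> carrier N \<Longrightarrow> y \<in> carrier N \<Longrightarrow> i (x \<oplus>\<^bsub>N\<^esub> y) = i x \<oplus>\<^bsub>E\<^esub> i y"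
    and i_smult: "\<And>a x. a \<in> carrier S \<Longrightarrow> x \<in> carrier N \<Longrightarrow> i (a \<odot>\<^bsub>N\<^esub> x) = a \<odot>\<^bsub>E\<^esub> i x"
    using i by (auto simp: mod_hom_def)
  have s_zero: "s \<zero>\<^bsub>E\<^esub> = \<zero>\<^bsub>M\<^esub>"
    using s_add[of "\<zero>\<^bsub>E\<^esub>" "\<zero>\<^bsub>E\<^esub>"] s_closed[of "\<zero>\<^bsub>E\<^esub>"]
    by (simp add: M.M.add.r_cancel_one')
  have s_minus: "s (\<ominus>\<^bsub>E\<^esub> e) = \<ominus>\<^bsub>M\<^esub> s e" if "e \<in> carrier E" for e
    using s_add[of "\<ominus>\<^bsub>E\<^esub> e" e] that s_zero s_closed
    by (metis E.M.a_inv_closed E.M.l_neg M.M.minus_equality)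
  define \<sigma> where "\<sigma> = inv_into (carrier E) s"
  have \<sigma>: "\<sigma> x \<in> carrier E" "s (\<sigma> x) = x" if "x \<in> carrier M" for x
    using that surj_s by (auto simp: \<sigma>_def inv_into_into f_inv_into_f)
  define h where "h e = (inv_into (carrier N) i (e \<oplus>\<^bsub>E\<^esub> \<ominus>\<^bsub>E\<^esub> \<sigma> (s e)), s e)" for e
  have mem: "e \<oplus>\<^bsub>E\<^esub> \<ominus>\<^bsub>E\<^esub> \<sigma> (s e) \<in> i ` carrier N" if "e \<in> carrier E" for e
  proof -
    have "s (e \<oplus>\<^bsub>E\<^esub> \<ominus>\<^bsub>E\<^esub> \<sigma> (s e)) = s e \<oplus>\<^bsub>M\<^esub> s (\<ominus>\<^bsub>E\<^esub> \<sigma> (s e))"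
      using that \<sigma> s_closed by (intro s_add) auto
    also have "\<dots> = \<zero>\<^bsub>M\<^esub>"
      using that \<sigma> s_closed by (simp add: s_minus M.M.r_neg)
    finally show ?thesis
      using that \<sigma> s_closed by (simp add: exact)
  qed
  have inj: "inj_on h (carrier E)"
  proof (rule inj_onI)
    fix e e' assume e: "e \<in> carrier E" "e' \<in> carrier E" "h e = h e'"
    have "s e = s e'" and
      *: "inv_into (carrier N) i (e \<oplus>\<^bsub>E\<^esub> \<ominus>\<^bsub>E\<^esub> \<sigma> (s e)) =
          inv_into (carrier N) i (e' \<oplus>\<^bsub>E\<^esub> \<ominus>\<^bsub>E\<^esub> \<sigma> (s e'))"
      using e(3) unfolding h_def prod.inject by blast+
    then have "e \<oplus>\<^bsub>E\<^esub> \<ominus>\<^bsub>E\<^esub> \<sigma> (s e) = e' \<oplus>\<^bsub>E\<^esub> \<ominus>\<^bsub>E\<^esub> \<sigma> (s e)"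
      using arg_cong[OF *, of i] f_inv_into_f[OF mem[OF e(1)]] f_inv_into_f[OF mem[OF e(2)]]
      by metis
    moreover have "\<sigma> (s e) \<in> carrier E"
      using e(1) \<sigma>(1) s_closed by blast
    ultimately show "e = e'"
      using e(1,2) by (metis E.M.a_inv_closed E.M.add.r_cancel)
  qed
  define k where "k = inv_into (carrier E) h"
  have kh [simp]: "k (h e) = e" if "e \<in> carrier E" for e
    using that inj by (simp add: k_def)
  define E' :: "('s, 'n \<times> 'm) module" where "E' = \<lparr>carrier = h ` carrier E, monoid.mult = undefined, monoid.one = undefined,
    ring.zero = h \<zero>\<^bsub>E\<^esub>, ring.add = (\<lambda>x y. h (k x \<oplus>\<^bsub>E\<^esub> k y)), smult = (\<lambda>a x. h (a \<odot>\<^bsub>E\<^esub> k x))\<rparr>"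
  have "module S E'"
  proof (rule moduleI)
    show "abelian_group E'"
    proof (rule abelian_groupI)
      show "\<exists>y\<in>carrier E'. y \<oplus>\<^bsub>E'\<^esub> x = \<zero>\<^bsub>E'\<^esub>" if x: "x \<in> carrier E'" for x
      proof -
        obtain e where "e \<in> carrier E" "x = h e"
          using x by (auto simp: E'_def)
        then show ?thesis
          by (intro bexI[of _ "h (\<ominus>\<^bsub>E\<^esub> e)"]) (simp_all add: E'_def E.M.l_neg)
      qed
    qed (auto simp: E'_def E.M.a_ac)
  qed (auto simp: E'_def E.smult_l_distr E.smult_r_distr E.smult_assoc1 M.cring_axioms)
  moreover have "(h \<circ> i) ` carrier N = {x \<in> carrier E'. (s \<circ> k) x = \<zero>\<^bsub>M\<^esub>}"
  proof -
    have "(h \<circ> i) ` carrier N = h ` {e \<in> carrier E. s e = \<zero>\<^bsub>M\<^esub>}"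
      by (simp only: image_comp[symmetric] exact)
    also have "\<dots> = {x \<in> carrier E'. (s \<circ> k) x = \<zero>\<^bsub>M\<^esub>}"
      unfolding E'_def by (auto simp del: split_paired_All split_paired_Ex)
    finally show ?thesis .
  qed
  moreover have "(s \<circ> k) ` carrier E' = carrier M"
    by (simp add: E'_def image_image surj_s)
  moreover have "inj_on (h \<circ> i) (carrier N)"
    by (intro comp_inj_on inj_i inj_on_subset[OF inj] image_subsetI i_closed)
  moreover have "h \<circ> i \<in> mod_hom S N E'" "s \<circ> k \<in> mod_hom S E' M"
    by (auto simp: mod_hom_def E'_def i_closed i_add i_smult s_closed s_add s_smult)
  ultimately have "is_extension S M N \<lparr>ext_mid = E', ext_in = h \<circ> i, ext_out = s \<circ> k\<rparr>"
    by (simp add: is_extension_def)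
  moreover have "ext_morphism S N id id U \<lparr>ext_mid = E', ext_in = h \<circ> i, ext_out = s \<circ> k\<rparr>"
    unfolding ext_morphism_def
    by (rule bexI[of _ h])
      (auto simp: mod_hom_def E'_def E_def[symmetric] i_def[symmetric] s_def[symmetric])
  ultimately show ?thesis
    by (auto simp: ext_class_def)
qed

section \<open>The modules and extensions attached to a matrix over the residue field\<close>

text \<open>\<open>P\<close> as a vector space over \<open>k = R/P\<close>. If \<open>P\<^sup>2 = 0\<close>, the products \<open>r \<otimes> p\<close>, for \<open>r\<close> in a
  fixed coset \<open>a\<close>, all agree.\<close>

definition ideal_space :: "('r, 'x) ring_scheme \<Rightarrow> 'r set \<Rightarrow> ('r set, 'r) module" where
  "ideal_space R P =
    \<lparr>carrier = P, monoid.mult = undefined, monoid.one = undefined, ring.zero = \<zero>\<^bsub>R\<^esub>, ring.add = ring.add R,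
     smult = (\<lambda>a p. the_elem ((\<lambda>r. r \<otimes>\<^bsub>R\<^esub> p) ` a))\<rparr>"

definition poly_residue :: "('r, 'x) ring_scheme \<Rightarrow> 'r set \<Rightarrow> (nat \<Rightarrow> 'r) \<Rightarrow> nat \<Rightarrow> 'r set" where
  "poly_residue R P p = (\<lambda>i. P +>\<^bsub>R\<^esub> coeff (UP R) p i)"

context
  fixes R :: "('r, 'x) ring_scheme" and P :: "'r set" and n :: nat and A :: "nat \<times> nat \<Rightarrow> 'r set"
begin

text \<open>\<open>M\<^sup>A\<close> and \<open>M\<^sup>A \<otimes>\<^sub>k P\<close> over \<open>R[t]\<close>.\<close>

definition MA :: "(nat \<Rightarrow> 'r, nat \<Rightarrow> 'r set) module" where
  "MA = restrict_scalars (poly_residue R P) (matrix_module (R Quot P) n A)"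

definition MA_tensor_P :: "(nat \<Rightarrow> 'r, ((nat \<Rightarrow> 'r set) \<times> 'r \<Rightarrow>\<^sub>0 int) set) module" where
  "MA_tensor_P =
    tensor_module (R Quot P) (free_module (R Quot P) n) (ideal_space R P) (smult MA)"

text \<open>\<open>M\<^sup>A\<close> and \<open>M\<^sup>A \<otimes>\<^sub>k P\<close> over \<open>R\<close>.\<close>

definition MA_base :: "('r, nat \<Rightarrow> 'r set) module" where
  "MA_base = restrict_scalars (const_poly R) MA"

definition MA_tensor_P_base :: "('r, ((nat \<Rightarrow> 'r set) \<times> 'r \<Rightarrow>\<^sub>0 int) set) module" where
  "MA_tensor_P_base = restrict_scalars (const_poly R) MA_tensor_P"

definition omega ::
  "(nat \<Rightarrow> 'r, ((nat \<Rightarrow> 'r set) \<times> 'r \<Rightarrow>\<^sub>0 int) set, nat \<Rightarrow> 'r set) ext set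
    \<Rightarrow> ('r, ((nat \<Rightarrow> 'r set) \<times> 'r \<Rightarrow>\<^sub>0 int) set, nat \<Rightarrow> 'r set) ext set" where
  "omega \<xi> = (\<Union>U\<in>\<xi>. ext_class R MA_base MA_tensor_P_base (ext_restrict_scalars (const_poly R) U))"

text \<open>\<open>0 \<rightarrow> P\<^sup>n \<rightarrow> R\<^sup>n \<rightarrow> k\<^sup>n \<rightarrow> 0\<close>, where \<open>M\<^sup>A \<otimes>\<^sub>k P\<close> is identified with \<open>P\<^sup>n\<close> by
  \<open>v \<otimes> p \<mapsto> (v\<^sub>1 p, \<dots>, v\<^sub>n p)\<close>.\<close>

definition xi0_extension ::
  "('r, ((nat \<Rightarrow> 'r set) \<times> 'r \<Rightarrow>\<^sub>0 int) set, nat \<Rightarrow> 'r, nat \<Rightarrow> 'r set) extension" where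
  "xi0_extension =
    \<lparr>ext_mid = free_module R n,
     ext_in = tensor_lift (add_monoid (free_module R n))
       (\<lambda>(v, p). \<lambda>i\<in>{..<n}. v i \<odot>\<^bsub>ideal_space R P\<^esub> p),
     ext_out = (\<lambda>x. \<lambda>i\<in>{..<n}. P +>\<^bsub>R\<^esub> x i)\<rparr>"

definition xi0 :: "('r, ((nat \<Rightarrow> 'r set) \<times> 'r \<Rightarrow>\<^sub>0 int) set, nat \<Rightarrow> 'r set) ext set" where
  "xi0 = ext_class R MA_base MA_tensor_P_base xi0_extension"

definition omega_fibre ::
  "(nat \<Rightarrow> 'r, ((nat \<Rightarrow> 'r set) \<times> 'r \<Rightarrow>\<^sub>0 int) set, nat \<Rightarrow> 'r set) ext set set" where
  "omega_fibre = {\<xi> \<in> Ext1 (UP R) MA MA_tensor_P. omega \<xi> = xi0}"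

definition fibre_action ::
  "(nat \<times> nat \<Rightarrow> 'r set)
    \<Rightarrow> (nat \<Rightarrow> 'r, ((nat \<Rightarrow> 'r set) \<times> 'r \<Rightarrow>\<^sub>0 int) set, nat \<Rightarrow> 'r set) ext set
    \<Rightarrow> (nat \<Rightarrow> 'r, ((nat \<Rightarrow> 'r set) \<times> 'r \<Rightarrow>\<^sub>0 int) set, nat \<Rightarrow> 'r set) ext set" where
  "fibre_action g =
    ext_transport (UP R) MA MA_tensor_P
      (tensor_map (R Quot P) (free_module (R Quot P) n) (ideal_space R P)
        (mat_vec (R Quot P) n g) id)
      (mat_vec (R Quot P) n g)"

text \<open>\<open>Ext\<^sup>1\<close> of \<open>M\<^sup>A\<close> with itself over \<open>k[t]\<close>, as a \<open>k\<close>-vector space.\<close>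

definition Ext1_MA_space ::
  "('r set, (nat \<Rightarrow> 'r set, nat \<Rightarrow> 'r set, nat \<Rightarrow> 'r set) ext set) module" where
  "Ext1_MA_space =
    restrict_scalars (const_poly (R Quot P))
      (Ext1_module (UP (R Quot P)) (matrix_module (R Quot P) n A) (matrix_module (R Quot P) n A))"

definition Ext1_MA_tensor_P ::
  "('r set, ((nat \<Rightarrow> 'r set, nat \<Rightarrow> 'r set, nat \<Rightarrow> 'r set) ext set \<times> 'r \<Rightarrow>\<^sub>0 int) set) module" where
  "Ext1_MA_tensor_P =
    tensor_module (R Quot P) Ext1_MA_space (ideal_space R P) (smult Ext1_MA_space)"

definition Ext1_MA_tensor_P_action ::
  "(nat \<times> nat \<Rightarrow> 'r set)
    \<Rightarrow> ((nat \<Rightarrow> 'r set, nat \<Rightarrow> 'r set, nat \<Rightarrow> 'r set) ext set \<times> 'r \<Rightarrow>\<^sub>0 int) set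
    \<Rightarrow> ((nat \<Rightarrow> 'r set, nat \<Rightarrow> 'r set, nat \<Rightarrow> 'r set) ext set \<times> 'r \<Rightarrow>\<^sub>0 int) set" where
  "Ext1_MA_tensor_P_action g =
    tensor_map (R Quot P) Ext1_MA_space (ideal_space R P)
      (ext_transport (UP (R Quot P)) (matrix_module (R Quot P) n A) (matrix_module (R Quot P) n A)
        (mat_vec (R Quot P) n g) (mat_vec (R Quot P) n g))
      id"

end

end

theory Submission
  imports Defs
begin

text \<open>Write \<open>k = R/P\<close>. Both sides of the bijection are quotients of sets of matrices, and the theorem compares the
two quotients.

The fibre. An extension in \<open>\<omega>\<^sup>-\<^sup>1(\<xi>\<^sub>0)\<close> is \<open>R\<^sup>n\<close> as an extension of \<open>R\<close>-modules, so it is given by the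
matrix \<open>B\<close> by which \<open>t\<close> acts, a lift of \<open>A\<close> (\<open>omega_fibre_eq\<close>). Two lifts \<open>B\<close> and \<open>B'\<close> give the same class
iff \<open>\<gamma>B = B'\<gamma>\<close> for some \<open>\<gamma> = 1 + Y\<close> with \<open>Y\<close> over \<open>P\<close>. Because \<open>P\<^sup>2 = 0\<close>, this says that
\<open>B' - B = YB\<^sub>0 - B\<^sub>0Y\<close>, where \<open>B\<^sub>0\<close> is any lift of \<open>A\<close> (\<open>lifted_class_eq_iff_commutator\<close>).

The tensor product. An extension of \<open>M\<^sup>A\<close> by itself over \<open>k[t]\<close> splits over \<open>k\<close>, and \<open>t\<close> acts by a block
matrix with \<open>A\<close> twice on the diagonal and some \<open>c\<close> off it. The classes of \<open>c\<close> and \<open>c'\<close> agree iff \<open>c' - c\<close> is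
a commutator \<open>hA - Ah\<close> (\<open>Ext1_matrix_module\<close>, \<open>coupled_class_eq_iff\<close>). So \<open>Ext\<^sup>1\<close> is \<open>M\<^sub>n(k)\<close> modulo
commutators with \<open>A\<close>. Tensored with \<open>P\<close>, it is \<open>M\<^sub>n(P)\<close> modulo the matrices \<open>YB\<^sub>0 - B\<^sub>0Y\<close>, by the map
\<open>pC \<mapsto> [c] \<otimes> p\<close> for \<open>C\<close> over \<open>R\<close> with reduction \<open>c\<close> (\<open>matrix_tensor_surj\<close>,
\<open>matrix_tensor_inner_derivation\<close>, \<open>matrix_tensor_kernel\<close>). Hence sending the class of the lift \<open>B\<close> to the image
of \<open>B - B\<^sub>0\<close> is a bijection, for every choice of \<open>B\<^sub>0\<close>.

Equivariance. If \<open>\<gamma>\<close> lifts \<open>g\<close>, then \<open>g\<close> sends the class of \<open>B\<close> to that of \<open>\<gamma>B\<gamma>\<^sup>-\<^sup>1\<close>, and it acts on the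
image of a matrix \<open>H\<close> over \<open>P\<close> by \<open>H \<mapsto> \<gamma>H\<gamma>\<^sup>-\<^sup>1\<close> (\<open>matrix_tensor_conjugate\<close>). So the bijection is
equivariant once \<open>B\<^sub>0\<close> can be fixed by the whole group: one lift \<open>B\<^sub>0\<close> is wanted such that every matrix that
commutes with \<open>A\<close> has a lift that commutes with \<open>B\<^sub>0\<close>. This is \<open>centralizer_lift\<close>, the heart of the proof. Decompose
\<open>M\<^sup>A\<close> as a direct sum of \<open>k[t]/(f\<^sub>i)\<close> where each \<open>f\<^sub>i\<close> divides the next (\<open>matrix_invariant_factors\<close>), and
lift the \<open>f\<^sub>i\<close> to monic \<open>F\<^sub>i\<close> over \<open>R\<close> that still divide one another (\<open>chain_lift\<close>). Let \<open>B\<^sub>0\<close> be the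
action of \<open>t\<close> on the sum of the \<open>R[t]/(F\<^sub>i)\<close>. An endomorphism of \<open>M\<^sup>A\<close> is a matrix of polynomials \<open>q\<close> such
that \<open>f\<^sub>j\<close> divides \<open>f\<^sub>iq\<close>, and as \<open>F\<^sub>i\<close> and \<open>F\<^sub>j\<close> are comparable for divisibility, \<open>q\<close> has a lift \<open>Q\<close>
such that \<open>F\<^sub>j\<close> divides \<open>F\<^sub>iQ\<close> (\<open>divisibility_lift\<close>).\<close>

section \<open>Homomorphisms of modules\<close>

lemma PiE_app: "v \<in> I \<rightarrow>\<^sub>E A \<Longrightarrow> i \<in> I \<Longrightarrow> v i \<in> A"
  by auto

lemma restrict_eqI: "x \<in> I \<rightarrow>\<^sub>E A \<Longrightarrow> (\<And>i. i \<in> I \<Longrightarrow> f i = x i) \<Longrightarrow> (\<lambda>i\<in>I. f i) = x"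
  by (rule ext) (metis PiE_arb restrict_apply)

lemma mod_hom_closed: "f \<in> mod_hom S M N \<Longrightarrow> x \<in> carrier M \<Longrightarrow> f x \<in> carrier N"
  by (auto simp: mod_hom_def)

lemma mod_hom_add:
  "f \<in> mod_hom S M N \<Longrightarrow> x \<in> carrier M \<Longrightarrow> y \<in> carrier M \<Longrightarrow> f (x \<oplus>\<^bsub>M\<^esub> y) = f x \<oplus>\<^bsub>N\<^esub> f y"
  by (auto simp: mod_hom_def)

lemma mod_hom_smult:
  "f \<in> mod_hom S M N \<Longrightarrow> a \<in> carrier S \<Longrightarrow> x \<in> carrier M \<Longrightarrow> f (a \<odot>\<^bsub>M\<^esub> x) = a \<odot>\<^bsub>N\<^esub> f x"
  by (auto simp: mod_hom_def)

lemma mod_homI: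
  assumes "\<And>x. x \<in> carrier M \<Longrightarrow> f x \<in> carrier N"
    and "\<And>x y. x \<in> carrier M \<Longrightarrow> y \<in> carrier M \<Longrightarrow> f (x \<oplus>\<^bsub>M\<^esub> y) = f x \<oplus>\<^bsub>N\<^esub> f y"
    and "\<And>a x. a \<in> carrier S \<Longrightarrow> x \<in> carrier M \<Longrightarrow> f (a \<odot>\<^bsub>M\<^esub> x) = a \<odot>\<^bsub>N\<^esub> f x"
  shows "f \<in> mod_hom S M N"
  using assms by (auto simp: mod_hom_def)

lemma additive_zero:
  assumes "abelian_group M" "abelian_group N"
    and "\<And>x. x \<in> carrier M \<Longrightarrow> f x \<in> carrier N"
    and "\<And>x y. x \<in> carrier M \<Longrightarrow> y \<in> carrier M \<Longrightarrow> f (x \<oplus>\<^bsub>M\<^esub> y) = f x \<oplus>\<^bsub>N\<^esub> f y"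
  shows "f \<zero>\<^bsub>M\<^esub> = \<zero>\<^bsub>N\<^esub>"
proof -
  interpret M: abelian_group M by fact
  interpret N: abelian_group N by fact
  show ?thesis
    using assms(4)[of "\<zero>\<^bsub>M\<^esub>" "\<zero>\<^bsub>M\<^esub>"] assms(3)[of "\<zero>\<^bsub>M\<^esub>"] by (simp add: N.add.r_cancel_one')
qed

lemma additive_finsum:
  assumes "abelian_group M" "abelian_group N"
    and "\<And>x. x \<in> carrier M \<Longrightarrow> f x \<in> carrier N"
    and "\<And>x y. x \<in> carrier M \<Longrightarrow> y \<in> carrier M \<Longrightarrow> f (x \<oplus>\<^bsub>M\<^esub> y) = f x \<oplus>\<^bsub>N\<^esub> f y"
    and "g \<in> A \<rightarrow> carrier M"
  shows "f (finsum M g A) = finsum N (\<lambda>a. f (g a)) A"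
proof -
  interpret M: abelian_group M by fact
  interpret N: abelian_group N by fact
  note z = additive_zero[OF assms(1-4), simplified]
  show ?thesis
    using assms(5)
  proof (induction A rule: infinite_finite_induct)
    case (insert x F)
    then have "f (finsum M g (insert x F)) = f (g x \<oplus>\<^bsub>M\<^esub> finsum M g F)"
      by (subst M.finsum_insert) auto
    also have "\<dots> = f (g x) \<oplus>\<^bsub>N\<^esub> f (finsum M g F)"
      using insert by (intro assms(4) M.finsum_closed) auto
    also have "\<dots> = finsum N (\<lambda>a. f (g a)) (insert x F)"
      using insert assms(3) by (subst N.finsum_insert) (auto simp: Pi_iff)
    finally show ?case .
  qed (simp_all add: z M.finsum_infinite N.finsum_infinite)
qed

lemma mod_hom_zero:
  assumes "module S M" "module S N" "f \<in> mod_hom S M N"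
  shows "f \<zero>\<^bsub>M\<^esub> = \<zero>\<^bsub>N\<^esub>"
  using assms by (intro additive_zero) (auto simp: module_def mod_hom_closed mod_hom_add)

lemma mod_hom_minus:
  assumes "module S M" "module S N" "f \<in> mod_hom S M N" "x \<in> carrier M"
  shows "f (\<ominus>\<^bsub>M\<^esub> x) = \<ominus>\<^bsub>N\<^esub> f x"
proof -
  interpret M: module S M by fact
  interpret N: module S N by fact
  have "f (\<ominus>\<^bsub>M\<^esub> x) \<oplus>\<^bsub>N\<^esub> f x = \<zero>\<^bsub>N\<^esub>"
    using mod_hom_add[OF assms(3), of "\<ominus>\<^bsub>M\<^esub> x" x] assms mod_hom_zero[OF assms(1-3)]
    by (simp add: M.M.l_neg)
  from N.M.minus_equality[OF this] show ?thesis
    using assms mod_hom_closed[OF assms(3)] by simp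
qed

lemma mod_hom_diff:
  assumes "module S M" "module S N" "f \<in> mod_hom S M N" "x \<in> carrier M" "y \<in> carrier M"
  shows "f (x \<ominus>\<^bsub>M\<^esub> y) = f x \<ominus>\<^bsub>N\<^esub> f y"
proof -
  interpret M: module S M by fact
  show ?thesis
    using assms by (simp add: a_minus_def mod_hom_add mod_hom_minus)
qed

lemma mod_hom_finsum:
  assumes "module S M" "module S N" "f \<in> mod_hom S M N" "g \<in> A \<rightarrow> carrier M"
  shows "f (finsum M g A) = finsum N (\<lambda>a. f (g a)) A"
  using assms by (intro additive_finsum) (auto simp: module_def mod_hom_closed mod_hom_add)

lemma mod_hom_id: "(\<lambda>x. x) \<in> mod_hom S M M"
  by (auto simp: mod_hom_def)

lemma mod_hom_comp: "f \<in> mod_hom S M N \<Longrightarrow> g \<in> mod_hom S N L \<Longrightarrow> (\<lambda>x. g (f x)) \<in> mod_hom S M L"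
  by (auto simp: mod_hom_def Pi_iff)

lemma mod_hom_funpow: "f \<in> mod_hom S M M \<Longrightarrow> f ^^ k \<in> mod_hom S M M"
  by (induction k) (auto simp: mod_hom_def Pi_iff)

section \<open>Free modules\<close>

abbreviation vectors :: "('k, 'x) ring_scheme \<Rightarrow> nat \<Rightarrow> (nat \<Rightarrow> 'k) set" where
  "vectors K n \<equiv> {..<n} \<rightarrow>\<^sub>E carrier K"

abbreviation matrices :: "('k, 'x) ring_scheme \<Rightarrow> nat \<Rightarrow> (nat \<times> nat \<Rightarrow> 'k) set" where
  "matrices K n \<equiv> {..<n} \<times> {..<n} \<rightarrow>\<^sub>E carrier K"

text \<open>The index set is arbitrary because besides \<open>{..<n}\<close> it will be the set of positions in a matrix, and the
monomial basis of a direct sum of cyclic \<open>R[t]\<close>-modules.\<close>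

definition free_on :: "('k, 'x) ring_scheme \<Rightarrow> 'i set \<Rightarrow> ('k, 'i \<Rightarrow> 'k) module" where
  "free_on K I =
    \<lparr>carrier = I \<rightarrow>\<^sub>E carrier K, monoid.mult = undefined, monoid.one = undefined,
     ring.zero = (\<lambda>i\<in>I. \<zero>\<^bsub>K\<^esub>),
     ring.add = (\<lambda>v w. \<lambda>i\<in>I. v i \<oplus>\<^bsub>K\<^esub> w i),
     smult = (\<lambda>a v. \<lambda>i\<in>I. a \<otimes>\<^bsub>K\<^esub> v i)\<rparr>"

lemma free_module_eq: "free_module K n = free_on K {..<n}"
  by (simp add: free_module_def free_on_def)

lemma free_on_simps [simp]:
  "carrier (free_on K I) = (I \<rightarrow>\<^sub>E carrier K)"
  "\<zero>\<^bsub>free_on K I\<^esub> = (\<lambda>i\<in>I. \<zero>\<^bsub>K\<^esub>)"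
  "v \<oplus>\<^bsub>free_on K I\<^esub> w = (\<lambda>i\<in>I. v i \<oplus>\<^bsub>K\<^esub> w i)"
  "a \<odot>\<^bsub>free_on K I\<^esub> v = (\<lambda>i\<in>I. a \<otimes>\<^bsub>K\<^esub> v i)"
  by (simp_all add: free_on_def)

lemma (in cring) free_on_module: "module R (free_on R I)"
proof (rule moduleI)
  show "abelian_group (free_on R I)"
  proof (rule abelian_groupI)
    fix x assume x: "x \<in> carrier (free_on R I)"
    show "\<exists>y\<in>carrier (free_on R I). y \<oplus>\<^bsub>free_on R I\<^esub> x = \<zero>\<^bsub>free_on R I\<^esub>"
      using x by (intro bexI[of _ "\<lambda>i\<in>I. \<ominus> x i"]) (auto simp: PiE_app l_neg intro!: restrict_ext)
  qed (auto simp: PiE_app a_ac intro!: restrict_ext restrict_eqI)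
qed (auto simp: PiE_app is_cring l_distr r_distr m_assoc intro!: restrict_ext restrict_eqI)

definition unit_vec :: "('k, 'x) ring_scheme \<Rightarrow> 'i set \<Rightarrow> 'i \<Rightarrow> 'i \<Rightarrow> 'k" where
  "unit_vec K I j = (\<lambda>i\<in>I. if i = j then \<one>\<^bsub>K\<^esub> else \<zero>\<^bsub>K\<^esub>)"

lemma (in cring) unit_vec_closed [simp]: "unit_vec R I j \<in> I \<rightarrow>\<^sub>E carrier R"
  by (auto simp: unit_vec_def)

lemma (in cring) unit_vec_app [simp]: "i \<in> I \<Longrightarrow> unit_vec R I j i \<in> carrier R"
  by (auto simp: unit_vec_def)

lemma (in cring) finsum_free_on:
  assumes "finite A" "g \<in> A \<rightarrow> (I \<rightarrow>\<^sub>E carrier R)"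
  shows "finsum (free_on R I) g A = (\<lambda>i\<in>I. \<Oplus>a\<in>A. g a i)"
proof -
  interpret F: module R "free_on R I" by (rule free_on_module)
  show ?thesis
    using assms
  proof (induction A rule: finite_induct)
    case (insert x F)
    have "(\<Oplus>a\<in>insert x F. g a i) = g x i \<oplus> (\<Oplus>a\<in>F. g a i)" if "i \<in> I" for i
      using insert(1,2,4) that by (intro finsum_insert) (auto simp: Pi_iff PiE_app)
    with insert show ?case
      by (subst F.M.finsum_insert) (auto simp: Pi_iff PiE_app intro!: restrict_ext)
  qed auto
qed

definition lincomb :: "('k, 'm) module \<Rightarrow> 'i set \<Rightarrow> ('i \<Rightarrow> 'm) \<Rightarrow> ('i \<Rightarrow> 'k) \<Rightarrow> 'm" where
  "lincomb E I u v = (\<Oplus>\<^bsub>E\<^esub>i\<in>I. v i \<odot>\<^bsub>E\<^esub> u i)"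

lemma lincomb_closed:
  assumes "module S E" "\<And>i. i \<in> I \<Longrightarrow> u i \<in> carrier E" "\<And>i. i \<in> I \<Longrightarrow> v i \<in> carrier S"
  shows "lincomb E I u v \<in> carrier E"
proof -
  interpret E: module S E by fact
  show ?thesis using assms by (auto simp: lincomb_def intro!: E.M.finsum_closed)
qed

lemma lincomb_hom:
  assumes "module S E" "\<And>i. i \<in> I \<Longrightarrow> u i \<in> carrier E" "finite I"
  shows "lincomb E I u \<in> mod_hom S (free_on S I) E"
proof -
  interpret E: module S E by fact
  show ?thesis
  proof (rule mod_homI)
    fix x y assume xy: "x \<in> carrier (free_on S I)" "y \<in> carrier (free_on S I)"
    have "lincomb E I u (x \<oplus>\<^bsub>free_on S I\<^esub> y) = (\<Oplus>\<^bsub>E\<^esub>i\<in>I. x i \<odot>\<^bsub>E\<^esub> u i \<oplus>\<^bsub>E\<^esub> y i \<odot>\<^bsub>E\<^esub> u i)"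
      unfolding lincomb_def using xy assms
      by (intro E.M.finsum_cong') (auto simp: E.smult_l_distr PiE_app)
    also have "\<dots> = lincomb E I u x \<oplus>\<^bsub>E\<^esub> lincomb E I u y"
      unfolding lincomb_def using xy assms by (intro E.M.finsum_addf) auto
    finally show "lincomb E I u (x \<oplus>\<^bsub>free_on S I\<^esub> y) = lincomb E I u x \<oplus>\<^bsub>E\<^esub> lincomb E I u y" .
  next
    fix a x assume xy: "a \<in> carrier S" "x \<in> carrier (free_on S I)"
    have "lincomb E I u (a \<odot>\<^bsub>free_on S I\<^esub> x) = (\<Oplus>\<^bsub>E\<^esub>i\<in>I. a \<odot>\<^bsub>E\<^esub> (x i \<odot>\<^bsub>E\<^esub> u i))"
      unfolding lincomb_def using xy assms
      by (intro E.M.finsum_cong') (auto simp: E.smult_assoc1 PiE_app)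
    also have "\<dots> = a \<odot>\<^bsub>E\<^esub> lincomb E I u x"
      unfolding lincomb_def using xy assms by (subst E.finsum_smult_ldistr) auto
    finally show "lincomb E I u (a \<odot>\<^bsub>free_on S I\<^esub> x) = a \<odot>\<^bsub>E\<^esub> lincomb E I u x" .
  qed (use assms in \<open>auto intro!: lincomb_closed\<close>)
qed

lemma lincomb_unit_vec:
  assumes "module S E" "\<And>i. i \<in> I \<Longrightarrow> u i \<in> carrier E" "finite I" "j \<in> I"
  shows "lincomb E I u (unit_vec S I j) = u j"
proof -
  interpret E: module S E by fact
  have "lincomb E I u (unit_vec S I j) = (\<Oplus>\<^bsub>E\<^esub>i\<in>I. if j = i then u i else \<zero>\<^bsub>E\<^esub>)"
    unfolding lincomb_def using assms
    by (intro E.M.finsum_cong') (auto simp: unit_vec_def)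
  also have "\<dots> = u j" using assms by (intro E.M.finsum_singleton) auto
  finally show ?thesis .
qed

lemma (in cring) lincomb_unit_vecs:
  assumes "finite I" "v \<in> I \<rightarrow>\<^sub>E carrier R"
  shows "lincomb (free_on R I) I (unit_vec R I) v = v"
proof -
  have "lincomb (free_on R I) I (unit_vec R I) v = (\<lambda>i\<in>I. \<Oplus>a\<in>I. if i = a then v a else \<zero>)"
    unfolding lincomb_def using assms
    by (subst finsum_free_on) (auto simp: PiE_app unit_vec_def intro!: restrict_ext finsum_cong')
  also have "\<dots> = v"
    using PiE_app[OF assms(2)] assms(1) by (intro restrict_eqI[OF assms(2)]) (auto simp: finsum_singleton)
  finally show ?thesis .
qed

lemma hom_eq_lincomb:
  assumes "module S E" "f \<in> mod_hom S (free_on S I) E" "finite I" "v \<in> I \<rightarrow>\<^sub>E carrier S"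
  shows "f v = lincomb E I (\<lambda>i. f (unit_vec S I i)) v"
proof -
  interpret E: module S E by fact
  interpret F: module S "free_on S I" by (rule E.R.free_on_module)
  have "f v = f (lincomb (free_on S I) I (unit_vec S I) v)"
    using assms by (simp add: E.R.lincomb_unit_vecs)
  also have "\<dots> = (\<Oplus>\<^bsub>E\<^esub>i\<in>I. f (v i \<odot>\<^bsub>free_on S I\<^esub> unit_vec S I i))"
    unfolding lincomb_def
    using assms by (intro mod_hom_finsum[OF F.module_axioms]) (auto simp: PiE_app)
  also have "\<dots> = lincomb E I (\<lambda>i. f (unit_vec S I i)) v"
    unfolding lincomb_def
    using assms mod_hom_smult[OF assms(2)] mod_hom_closed[OF assms(2)]
    by (intro E.M.finsum_cong') (auto simp: PiE_app E.R.unit_vec_closed simp del: free_on_simps(4))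
  finally show ?thesis .
qed

lemma hom_eqI_unit_vec:
  assumes "module S E" "f \<in> mod_hom S (free_on S I) E" "g \<in> mod_hom S (free_on S I) E"
    "finite I" "v \<in> I \<rightarrow>\<^sub>E carrier S" "\<And>i. i \<in> I \<Longrightarrow> f (unit_vec S I i) = g (unit_vec S I i)"
  shows "f v = g v"
proof -
  interpret E: module S E by fact
  show ?thesis
    unfolding hom_eq_lincomb[OF assms(1,2,4,5)] hom_eq_lincomb[OF assms(1,3,4,5)] lincomb_def
    using assms mod_hom_closed[OF assms(3)] by (intro E.M.finsum_cong') (auto simp: PiE_app)
qed

section \<open>The ring of square matrices\<close>

text \<open>The product is that of \<open>matrix_monoid\<close>, so that commuting with \<open>A\<close> has the same meaning in both structures.\<close>

definition mat_ring :: "('k, 'x) ring_scheme \<Rightarrow> nat \<Rightarrow> (nat \<times> nat \<Rightarrow> 'k) ring" where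
  "mat_ring K n =
    \<lparr>carrier = matrices K n,
     monoid.mult = monoid.mult (matrix_monoid K n), monoid.one = \<one>\<^bsub>matrix_monoid K n\<^esub>,
     ring.zero = (\<lambda>_\<in>{..<n} \<times> {..<n}. \<zero>\<^bsub>K\<^esub>),
     ring.add = (\<lambda>A B. \<lambda>u\<in>{..<n} \<times> {..<n}. A u \<oplus>\<^bsub>K\<^esub> B u)\<rparr>"

lemma mat_ring_simps [simp]:
  "carrier (mat_ring K n) = (matrices K n)"
  "A \<oplus>\<^bsub>mat_ring K n\<^esub> B = (\<lambda>u\<in>{..<n} \<times> {..<n}. A u \<oplus>\<^bsub>K\<^esub> B u)"
  "\<zero>\<^bsub>mat_ring K n\<^esub> = (\<lambda>_\<in>{..<n} \<times> {..<n}. \<zero>\<^bsub>K\<^esub>)"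
  by (simp_all add: mat_ring_def)

context cring begin

lemma mat_vec_eq_lincomb:
  assumes "A \<in> matrices R n" "v \<in> vectors R n"
  shows "mat_vec R n A v = lincomb (free_on R {..<n}) {..<n} (\<lambda>j. \<lambda>i\<in>{..<n}. A (i, j)) v"
proof -
  note [simp] = PiE_app[OF assms(1)] PiE_app[OF assms(2)]
  have "lincomb (free_on R {..<n}) {..<n} (\<lambda>j. \<lambda>i\<in>{..<n}. A (i, j)) v
      = (\<lambda>i\<in>{..<n}. \<Oplus>a\<in>{..<n}. (v a \<odot>\<^bsub>free_on R {..<n}\<^esub> (\<lambda>i\<in>{..<n}. A (i, a))) i)"
    unfolding lincomb_def by (rule finsum_free_on) auto
  also have "\<dots> = mat_vec R n A v"
    unfolding mat_vec_def by (intro restrict_ext finsum_cong') (auto simp: m_comm)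
  finally show ?thesis by simp
qed

lemma mat_vec_hom:
  assumes A: "A \<in> matrices R n"
  shows "mat_vec R n A \<in> mod_hom R (free_on R {..<n}) (free_on R {..<n})"
proof -
  interpret F: module R "free_on R {..<n}" by (rule free_on_module)
  have "lincomb (free_on R {..<n}) {..<n} (\<lambda>j. \<lambda>i\<in>{..<n}. A (i, j)) \<in> mod_hom R (free_on R {..<n}) (free_on R {..<n})"
    using A by (intro lincomb_hom free_on_module) auto
  note L = mod_hom_closed[OF this] mod_hom_add[OF this] mod_hom_smult[OF this]
  show ?thesis
  proof (rule mod_homI)
    fix x y assume "x \<in> carrier (free_on R {..<n})" "y \<in> carrier (free_on R {..<n})"
    then show "mat_vec R n A (x \<oplus>\<^bsub>free_on R {..<n}\<^esub> y) = mat_vec R n A x \<oplus>\<^bsub>free_on R {..<n}\<^esub> mat_vec R n A y"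
      using L(2)[of x y] F.M.a_closed[of x y]
      by (simp only: mat_vec_eq_lincomb[OF A] free_on_simps(1))
  next
    fix a x assume "a \<in> carrier R" "x \<in> carrier (free_on R {..<n})"
    then show "mat_vec R n A (a \<odot>\<^bsub>free_on R {..<n}\<^esub> x) = a \<odot>\<^bsub>free_on R {..<n}\<^esub> mat_vec R n A x"
      using L(3)[of a x] F.smult_closed[of a x]
      by (simp only: mat_vec_eq_lincomb[OF A] free_on_simps(1))
  qed (use L(1) in \<open>simp only: mat_vec_eq_lincomb[OF A] free_on_simps(1)\<close>)
qed

lemma mat_vec_closed:
  "A \<in> matrices R n \<Longrightarrow> v \<in> vectors R n \<Longrightarrow> mat_vec R n A v \<in> vectors R n"
  using mod_hom_closed[OF mat_vec_hom] by simp

lemma mat_vec_unit_vec: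
  assumes "A \<in> matrices R n" "j < n"
  shows "mat_vec R n A (unit_vec R {..<n} j) = (\<lambda>i\<in>{..<n}. A (i, j))"
proof -
  have "lincomb (free_on R {..<n}) {..<n} (\<lambda>j. \<lambda>i\<in>{..<n}. A (i, j)) (unit_vec R {..<n} j) = (\<lambda>i\<in>{..<n}. A (i, j))"
    using assms by (subst lincomb_unit_vec[OF free_on_module]) auto
  then show ?thesis using assms by (simp add: mat_vec_eq_lincomb)
qed

lemma matrix_of_hom:
  assumes f: "f \<in> mod_hom R (free_on R {..<n}) (free_on R {..<n})"
  obtains A where "A \<in> matrices R n"
    "\<And>v. v \<in> vectors R n \<Longrightarrow> f v = mat_vec R n A v"
proof
  define A where "A = (\<lambda>(i, j)\<in>{..<n} \<times> {..<n}. f (unit_vec R {..<n} j) i)"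
  have fc: "f (unit_vec R {..<n} j) \<in> vectors R n" for j
    using mod_hom_closed[OF f, of "unit_vec R {..<n} j"] by simp
  show A: "A \<in> matrices R n"
    using PiE_app[OF fc] by (auto simp: A_def)
  show "f v = mat_vec R n A v" if "v \<in> vectors R n" for v
  proof (rule hom_eqI_unit_vec[OF free_on_module f mat_vec_hom[OF A]])
    fix i assume "i \<in> {..<n}"
    then show "f (unit_vec R {..<n} i) = mat_vec R n A (unit_vec R {..<n} i)"
      using fc[of i] A by (simp add: mat_vec_unit_vec) (rule sym, rule restrict_eqI[OF fc], simp add: A_def)
  qed (use that in auto)
qed

lemma matrix_eqI:
  assumes "A \<in> matrices R n" "B \<in> matrices R n"
    and "\<And>v. v \<in> vectors R n \<Longrightarrow> mat_vec R n A v = mat_vec R n B v"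
  shows "A = B"
proof (rule PiE_ext[OF assms(1,2)])
  fix u assume "u \<in> {..<n} \<times> {..<n}"
  then obtain i j where u: "u = (i, j)" "i < n" "j < n" by auto
  have "(\<lambda>i\<in>{..<n}. A (i, j)) = (\<lambda>i\<in>{..<n}. B (i, j))"
    using assms(3)[OF unit_vec_closed[of _ j]] mat_vec_unit_vec[OF assms(1) u(3)] mat_vec_unit_vec[OF assms(2) u(3)] by simp
  then show "A u = B u" using u by (metis lessThan_iff restrict_apply')
qed

lemma matrix_mult_closed:
  assumes "A \<in> matrices R n" "B \<in> matrices R n"
  shows "A \<otimes>\<^bsub>mat_ring R n\<^esub> B \<in> matrices R n"
  using PiE_app[OF assms(1)] PiE_app[OF assms(2)]
  by (auto simp: mat_ring_def matrix_monoid_def intro!: finsum_closed)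

lemma mat_vec_mult:
  assumes A: "A \<in> matrices R n" and B: "B \<in> matrices R n"
    and v: "v \<in> vectors R n"
  shows "mat_vec R n (A \<otimes>\<^bsub>mat_ring R n\<^esub> B) v = mat_vec R n A (mat_vec R n B v)"
proof (rule hom_eqI_unit_vec[OF free_on_module, where g = "\<lambda>v. mat_vec R n A (mat_vec R n B v)"])
  show "mat_vec R n (A \<otimes>\<^bsub>mat_ring R n\<^esub> B) \<in> mod_hom R (free_on R {..<n}) (free_on R {..<n})"
    by (intro mat_vec_hom matrix_mult_closed A B)
  show "(\<lambda>v. mat_vec R n A (mat_vec R n B v)) \<in> mod_hom R (free_on R {..<n}) (free_on R {..<n})"
    by (intro mod_hom_comp[OF mat_vec_hom mat_vec_hom] A B)
  fix j assume "j \<in> {..<n}"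
  then have j: "j < n" by simp
  show "mat_vec R n (A \<otimes>\<^bsub>mat_ring R n\<^esub> B) (unit_vec R {..<n} j) = mat_vec R n A (mat_vec R n B (unit_vec R {..<n} j))"
    unfolding mat_vec_unit_vec[OF matrix_mult_closed[OF A B] j] mat_vec_unit_vec[OF B j]
    using PiE_app[OF A] PiE_app[OF B] j
    by (auto simp: mat_vec_def mat_ring_def matrix_monoid_def intro!: restrict_ext finsum_cong')
qed (use v in auto)

lemma mat_vec_one:
  assumes v: "v \<in> vectors R n"
  shows "mat_vec R n \<one>\<^bsub>mat_ring R n\<^esub> v = v"
proof -
  have "mat_vec R n \<one>\<^bsub>mat_ring R n\<^esub> v = (\<lambda>i\<in>{..<n}. \<Oplus>a\<in>{..<n}. if i = a then v a else \<zero>)"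
    unfolding mat_vec_def using PiE_app[OF v]
    by (auto simp: mat_ring_def matrix_monoid_def intro!: restrict_ext finsum_cong')
  also have "\<dots> = v"
    using PiE_app[OF v] by (intro restrict_eqI[OF v]) (auto simp: finsum_singleton)
  finally show ?thesis .
qed

lemma matrix_one_closed: "\<one>\<^bsub>mat_ring R n\<^esub> \<in> matrices R n"
  by (auto simp: mat_ring_def matrix_monoid_def)

lemma mat_vec_add:
  assumes A: "A \<in> matrices R n" and B: "B \<in> matrices R n"
    and v: "v \<in> vectors R n"
  shows "mat_vec R n (A \<oplus>\<^bsub>mat_ring R n\<^esub> B) v = mat_vec R n A v \<oplus>\<^bsub>free_on R {..<n}\<^esub> mat_vec R n B v"
proof -
  have "mat_vec R n (A \<oplus>\<^bsub>mat_ring R n\<^esub> B) v = (\<lambda>i\<in>{..<n}. \<Oplus>j\<in>{..<n}. A (i, j) \<otimes> v j \<oplus> B (i, j) \<otimes> v j)"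
    using PiE_app[OF A] PiE_app[OF B] PiE_app[OF v]
    by (auto simp: mat_vec_def l_distr intro!: restrict_ext finsum_cong')
  also have "\<dots> = (\<lambda>i\<in>{..<n}. (\<Oplus>j\<in>{..<n}. A (i, j) \<otimes> v j) \<oplus> (\<Oplus>j\<in>{..<n}. B (i, j) \<otimes> v j))"
    using PiE_app[OF A] PiE_app[OF B] PiE_app[OF v] by (intro restrict_ext finsum_addf) auto
  finally show ?thesis by (simp add: mat_vec_def cong: restrict_cong)
qed

text \<open>Matrices act faithfully on vectors, so the laws of multiplication follow from those of composition.\<close>

lemma mat_ring_ring: "ring (mat_ring R n)"
proof (rule ringI)
  interpret F: module R "free_on R {..<n}" by (rule free_on_module)
  interpret U: module R "free_on R ({..<n} \<times> {..<n})" by (rule free_on_module)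
  have U: "carrier (mat_ring R n) = carrier (free_on R ({..<n} \<times> {..<n}))"
    "\<zero>\<^bsub>mat_ring R n\<^esub> = \<zero>\<^bsub>free_on R ({..<n} \<times> {..<n})\<^esub>"
    "\<And>x y. x \<oplus>\<^bsub>mat_ring R n\<^esub> y = x \<oplus>\<^bsub>free_on R ({..<n} \<times> {..<n})\<^esub> y"
    by simp_all
  show "abelian_group (mat_ring R n)"
  proof (rule abelian_groupI, unfold U)
    fix x assume "x \<in> carrier (free_on R ({..<n} \<times> {..<n}))"
    then show "\<exists>y\<in>carrier (free_on R ({..<n} \<times> {..<n})). y \<oplus>\<^bsub>free_on R ({..<n} \<times> {..<n})\<^esub> x = \<zero>\<^bsub>free_on R ({..<n} \<times> {..<n})\<^esub>"
      using U.M.l_neg U.M.a_inv_closed by blast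
  qed ((rule U.M.a_closed U.M.a_assoc U.M.a_comm U.M.l_zero U.M.zero_closed; assumption)+)
  have carr: "carrier (mat_ring R n) = (matrices R n)" by simp
  have add: "Z \<oplus>\<^bsub>mat_ring R n\<^esub> Y \<in> matrices R n"
    if "Z \<in> matrices R n" "Y \<in> matrices R n" for Z Y
    using PiE_app[OF that(1)] PiE_app[OF that(2)] by auto
  note [simp del] = mat_ring_simps free_on_simps
  note c [simp] = add matrix_mult_closed matrix_one_closed mat_vec_closed mat_vec_mult mat_vec_add mat_vec_one carr
  show "monoid (mat_ring R n)"
  proof (rule monoidI, unfold carr)
    fix A B C assume [simp]: "A \<in> matrices R n" "B \<in> matrices R n"
      "C \<in> matrices R n"
    show "A \<otimes>\<^bsub>mat_ring R n\<^esub> B \<otimes>\<^bsub>mat_ring R n\<^esub> C = A \<otimes>\<^bsub>mat_ring R n\<^esub> (B \<otimes>\<^bsub>mat_ring R n\<^esub> C)"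
      by (rule matrix_eqI[of _ n]) simp_all
  next
    fix A assume [simp]: "A \<in> matrices R n"
    show "\<one>\<^bsub>mat_ring R n\<^esub> \<otimes>\<^bsub>mat_ring R n\<^esub> A = A" "A \<otimes>\<^bsub>mat_ring R n\<^esub> \<one>\<^bsub>mat_ring R n\<^esub> = A"
      by (rule matrix_eqI[of _ n]; simp)+
  qed simp_all
  fix A B C assume "A \<in> carrier (mat_ring R n)" "B \<in> carrier (mat_ring R n)" "C \<in> carrier (mat_ring R n)"
  then have [simp]: "A \<in> matrices R n" "B \<in> matrices R n" and
    C [simp]: "C \<in> matrices R n"
    by simp_all
  show "(A \<oplus>\<^bsub>mat_ring R n\<^esub> B) \<otimes>\<^bsub>mat_ring R n\<^esub> C = A \<otimes>\<^bsub>mat_ring R n\<^esub> C \<oplus>\<^bsub>mat_ring R n\<^esub> B \<otimes>\<^bsub>mat_ring R n\<^esub> C"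
    by (rule matrix_eqI[of _ n]) simp_all
  show "C \<otimes>\<^bsub>mat_ring R n\<^esub> (A \<oplus>\<^bsub>mat_ring R n\<^esub> B) = C \<otimes>\<^bsub>mat_ring R n\<^esub> A \<oplus>\<^bsub>mat_ring R n\<^esub> C \<otimes>\<^bsub>mat_ring R n\<^esub> B"
    by (rule matrix_eqI[of _ n])
      (simp_all add: mod_hom_add[OF mat_vec_hom[OF C], unfolded free_on_simps(1)])
qed

end

section \<open>Modules over polynomial rings\<close>

lemma restrict_scalars_simps [simp]:
  "carrier (restrict_scalars \<phi> M) = carrier M"
  "\<zero>\<^bsub>restrict_scalars \<phi> M\<^esub> = \<zero>\<^bsub>M\<^esub>"
  "x \<oplus>\<^bsub>restrict_scalars \<phi> M\<^esub> y = x \<oplus>\<^bsub>M\<^esub> y"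
  "a \<odot>\<^bsub>restrict_scalars \<phi> M\<^esub> x = \<phi> a \<odot>\<^bsub>M\<^esub> x"
  by (simp_all add: restrict_scalars_def)

lemma restrict_scalars_module:
  assumes "cring S" "module S' M" and \<phi>: "\<phi> \<in> ring_hom S S'"
  shows "module S (restrict_scalars \<phi> M)"
proof -
  interpret M: module S' M by fact
  have c: "\<And>a. a \<in> carrier S \<Longrightarrow> \<phi> a \<in> carrier S'"
    using \<phi> by (auto simp: ring_hom_def)
  show ?thesis
  proof (rule moduleI)
    show "abelian_group (restrict_scalars \<phi> M)"
    proof (rule abelian_groupI, unfold restrict_scalars_simps)
      fix x assume "x \<in> carrier M"
      then show "\<exists>y\<in>carrier M. y \<oplus>\<^bsub>M\<^esub> x = \<zero>\<^bsub>M\<^esub>"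
        using M.M.l_neg M.M.a_inv_closed by blast
    qed (auto simp: M.M.a_ac)
  qed (use assms c in \<open>auto simp: M.smult_l_distr M.smult_r_distr M.smult_assoc1 ring_hom_add ring_hom_mult ring_hom_one\<close>)
qed

text \<open>An \<open>S[t]\<close>-module is an \<open>S\<close>-module \<open>E\<close> with an endomorphism \<open>T\<close>, the action of \<open>t\<close>. All modules over
polynomial rings below arise in this way.\<close>

definition poly_module ::
  "('s, 'x) ring_scheme \<Rightarrow> ('s, 'm) module \<Rightarrow> ('m \<Rightarrow> 'm) \<Rightarrow> (nat \<Rightarrow> 's, 'm) module" where
  "poly_module S E T =
    \<lparr>carrier = carrier E, monoid.mult = undefined, monoid.one = undefined, ring.zero = \<zero>\<^bsub>E\<^esub>,
     ring.add = ring.add E,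
     smult = (\<lambda>p v. \<Oplus>\<^bsub>E\<^esub>i\<in>{..deg S p}. up_ring.coeff (UP S) p i \<odot>\<^bsub>E\<^esub> (T ^^ i) v)\<rparr>"

lemma matrix_module_eq:
  "matrix_module K n A = poly_module K (free_on K {..<n}) (mat_vec K n A)"
  by (simp add: matrix_module_def poly_module_def free_module_eq Let_def)

lemma poly_module_simps [simp]:
  "carrier (poly_module S E T) = carrier E"
  "\<zero>\<^bsub>poly_module S E T\<^esub> = \<zero>\<^bsub>E\<^esub>"
  "x \<oplus>\<^bsub>poly_module S E T\<^esub> y = x \<oplus>\<^bsub>E\<^esub> y"
  by (simp_all add: poly_module_def)

lemma (in UP_ring) UP_induct [consumes 1, case_names monom add]:
  assumes "p \<in> carrier P"
    and monom: "\<And>a k. a \<in> carrier R \<Longrightarrow> Q (up_ring.monom P a k)"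
    and add: "\<And>p q. p \<in> carrier P \<Longrightarrow> q \<in> carrier P \<Longrightarrow> Q p \<Longrightarrow> Q q \<Longrightarrow> Q (p \<oplus>\<^bsub>P\<^esub> q)"
  shows "Q p"
proof -
  have "Q (\<Oplus>\<^bsub>P\<^esub> i \<in> A. up_ring.monom P (up_ring.coeff P p i) i)" if "finite A" for A
    using that
  proof (induction A rule: finite_induct)
    case empty
    show ?case using monom[of \<zero> 0] by simp
  next
    case (insert x F)
    then show ?case
      using assms(1) monom add by (subst P.finsum_insert) (auto intro!: add P.finsum_closed)
  qed
  from this[of "{..deg R p}"] show ?thesis using up_repr[OF assms(1)] by simp
qed

lemma poly_smult_le:
  assumes "module S E" "T \<in> mod_hom S E E" "p \<in> carrier (UP S)" "v \<in> carrier E" "deg S p \<le> m"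
  shows "p \<odot>\<^bsub>poly_module S E T\<^esub> v = (\<Oplus>\<^bsub>E\<^esub>i\<in>{..m}. up_ring.coeff (UP S) p i \<odot>\<^bsub>E\<^esub> (T ^^ i) v)"
proof -
  interpret E: module S E by fact
  interpret UP_cring S "UP S" by (rule UP_cring.intro) (rule E.R.cring_axioms)
  have T: "(T ^^ i) v \<in> carrier E" for i
    using mod_hom_closed[OF mod_hom_funpow[OF assms(2)] assms(4)] .
  have "(\<Oplus>\<^bsub>E\<^esub>i\<in>{..deg S p}. up_ring.coeff (UP S) p i \<odot>\<^bsub>E\<^esub> (T ^^ i) v) = (\<Oplus>\<^bsub>E\<^esub>i\<in>{..m}. up_ring.coeff (UP S) p i \<odot>\<^bsub>E\<^esub> (T ^^ i) v)"
    using assms T by (intro E.M.add.finprod_mono_neutral_cong_left) (auto simp: deg_aboveD)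
  then show ?thesis by (simp add: poly_module_def)
qed

lemma poly_smult_monom:
  assumes "module S E" "T \<in> mod_hom S E E" "a \<in> carrier S" "v \<in> carrier E"
  shows "up_ring.monom (UP S) a k \<odot>\<^bsub>poly_module S E T\<^esub> v = a \<odot>\<^bsub>E\<^esub> (T ^^ k) v"
proof -
  interpret E: module S E by fact
  interpret UP_cring S "UP S" by (rule UP_cring.intro) (rule E.R.cring_axioms)
  have T: "(T ^^ i) v \<in> carrier E" for i
    using mod_hom_closed[OF mod_hom_funpow[OF assms(2)] assms(4)] .
  have "up_ring.monom (UP S) a k \<odot>\<^bsub>poly_module S E T\<^esub> v
      = (\<Oplus>\<^bsub>E\<^esub>i\<in>{..k}. up_ring.coeff (UP S) (up_ring.monom (UP S) a k) i \<odot>\<^bsub>E\<^esub> (T ^^ i) v)"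
    using assms deg_monom_le by (intro poly_smult_le) auto
  also have "\<dots> = (\<Oplus>\<^bsub>E\<^esub>i\<in>{..k}. if k = i then a \<odot>\<^bsub>E\<^esub> (T ^^ i) v else \<zero>\<^bsub>E\<^esub>)"
    using assms T by (intro E.M.finsum_cong') auto
  also have "\<dots> = a \<odot>\<^bsub>E\<^esub> (T ^^ k) v"
    using assms T by (intro E.M.finsum_singleton) auto
  finally show ?thesis .
qed

lemma poly_smult_closed:
  assumes "module S E" "T \<in> mod_hom S E E" "p \<in> carrier (UP S)" "v \<in> carrier E"
  shows "p \<odot>\<^bsub>poly_module S E T\<^esub> v \<in> carrier E"
proof -
  interpret E: module S E by fact
  interpret UP_cring S "UP S" by (rule UP_cring.intro) (rule E.R.cring_axioms)
  show ?thesis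
    unfolding poly_smult_le[OF assms order_refl]
    using assms mod_hom_closed[OF mod_hom_funpow[OF assms(2)] assms(4)] by (intro E.M.finsum_closed) auto
qed

lemma poly_smult_l_distr:
  assumes "module S E" "T \<in> mod_hom S E E" "p \<in> carrier (UP S)" "q \<in> carrier (UP S)" "v \<in> carrier E"
  shows "(p \<oplus>\<^bsub>UP S\<^esub> q) \<odot>\<^bsub>poly_module S E T\<^esub> v = p \<odot>\<^bsub>poly_module S E T\<^esub> v \<oplus>\<^bsub>E\<^esub> q \<odot>\<^bsub>poly_module S E T\<^esub> v"
proof -
  interpret E: module S E by fact
  interpret UP_cring S "UP S" by (rule UP_cring.intro) (rule E.R.cring_axioms)
  have T: "(T ^^ i) v \<in> carrier E" for i
    using mod_hom_closed[OF mod_hom_funpow[OF assms(2)] assms(5)] .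
  let ?m = "max (deg S p) (deg S q)"
  have "(p \<oplus>\<^bsub>UP S\<^esub> q) \<odot>\<^bsub>poly_module S E T\<^esub> v
      = (\<Oplus>\<^bsub>E\<^esub>i\<in>{..?m}. up_ring.coeff (UP S) (p \<oplus>\<^bsub>UP S\<^esub> q) i \<odot>\<^bsub>E\<^esub> (T ^^ i) v)"
    using assms deg_add by (intro poly_smult_le) auto
  also have "\<dots> = (\<Oplus>\<^bsub>E\<^esub>i\<in>{..?m}. up_ring.coeff (UP S) p i \<odot>\<^bsub>E\<^esub> (T ^^ i) v \<oplus>\<^bsub>E\<^esub> up_ring.coeff (UP S) q i \<odot>\<^bsub>E\<^esub> (T ^^ i) v)"
    using assms T by (intro E.M.finsum_cong') (auto simp: E.smult_l_distr)
  also have "\<dots> = (\<Oplus>\<^bsub>E\<^esub>i\<in>{..?m}. up_ring.coeff (UP S) p i \<odot>\<^bsub>E\<^esub> (T ^^ i) v) \<oplus>\<^bsub>E\<^esub> (\<Oplus>\<^bsub>E\<^esub>i\<in>{..?m}. up_ring.coeff (UP S) q i \<odot>\<^bsub>E\<^esub> (T ^^ i) v)"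
    using assms T by (intro E.M.finsum_addf) auto
  also have "\<dots> = p \<odot>\<^bsub>poly_module S E T\<^esub> v \<oplus>\<^bsub>E\<^esub> q \<odot>\<^bsub>poly_module S E T\<^esub> v"
    using assms by (subst (1 2) poly_smult_le[where m = ?m]) auto
  finally show ?thesis .
qed

lemma poly_smult_r_distr:
  assumes "module S E" "T \<in> mod_hom S E E" "p \<in> carrier (UP S)" "v \<in> carrier E" "w \<in> carrier E"
  shows "p \<odot>\<^bsub>poly_module S E T\<^esub> (v \<oplus>\<^bsub>E\<^esub> w) = p \<odot>\<^bsub>poly_module S E T\<^esub> v \<oplus>\<^bsub>E\<^esub> p \<odot>\<^bsub>poly_module S E T\<^esub> w"
proof -
  interpret E: module S E by fact
  interpret UP_cring S "UP S" by (rule UP_cring.intro) (rule E.R.cring_axioms)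
  have T: "(T ^^ i) x \<in> carrier E" if "x \<in> carrier E" for i x
    using mod_hom_closed[OF mod_hom_funpow[OF assms(2)] that] .
  have "p \<odot>\<^bsub>poly_module S E T\<^esub> (v \<oplus>\<^bsub>E\<^esub> w)
      = (\<Oplus>\<^bsub>E\<^esub>i\<in>{..deg S p}. up_ring.coeff (UP S) p i \<odot>\<^bsub>E\<^esub> (T ^^ i) (v \<oplus>\<^bsub>E\<^esub> w))"
    using assms by (intro poly_smult_le) auto
  also have "\<dots> = (\<Oplus>\<^bsub>E\<^esub>i\<in>{..deg S p}. up_ring.coeff (UP S) p i \<odot>\<^bsub>E\<^esub> (T ^^ i) v \<oplus>\<^bsub>E\<^esub> up_ring.coeff (UP S) p i \<odot>\<^bsub>E\<^esub> (T ^^ i) w)"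
    using assms T by (intro E.M.finsum_cong') (auto simp: E.smult_r_distr mod_hom_add[OF mod_hom_funpow[OF assms(2)]])
  also have "\<dots> = (\<Oplus>\<^bsub>E\<^esub>i\<in>{..deg S p}. up_ring.coeff (UP S) p i \<odot>\<^bsub>E\<^esub> (T ^^ i) v) \<oplus>\<^bsub>E\<^esub> (\<Oplus>\<^bsub>E\<^esub>i\<in>{..deg S p}. up_ring.coeff (UP S) p i \<odot>\<^bsub>E\<^esub> (T ^^ i) w)"
    using assms T by (intro E.M.finsum_addf) auto
  also have "\<dots> = p \<odot>\<^bsub>poly_module S E T\<^esub> v \<oplus>\<^bsub>E\<^esub> p \<odot>\<^bsub>poly_module S E T\<^esub> w"
    by (simp add: poly_module_def)
  finally show ?thesis .
qed

lemma poly_module_module: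
  assumes E: "module S E" and T: "T \<in> mod_hom S E E"
  shows "module (UP S) (poly_module S E T)"
proof -
  interpret E: module S E by fact
  interpret UP_cring S "UP S" by (rule UP_cring.intro) (rule E.R.cring_axioms)
  have Tc: "(T ^^ i) x \<in> carrier E" if "x \<in> carrier E" for i x
    using mod_hom_closed[OF mod_hom_funpow[OF T] that] .
  note closed = poly_smult_closed[OF E T] and ld = poly_smult_l_distr[OF E T]
    and rd = poly_smult_r_distr[OF E T] and mon = poly_smult_monom[OF E T]
  have mm: "(up_ring.monom (UP S) a k \<otimes>\<^bsub>UP S\<^esub> q) \<odot>\<^bsub>poly_module S E T\<^esub> v
      = up_ring.monom (UP S) a k \<odot>\<^bsub>poly_module S E T\<^esub> (q \<odot>\<^bsub>poly_module S E T\<^esub> v)"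
    if "a \<in> carrier S" "q \<in> carrier (UP S)" "v \<in> carrier E" for a k q v
    using that(2)
  proof (induction q rule: UP_induct)
    case (monom b l)
    have *: "up_ring.monom (UP S) a k \<otimes>\<^bsub>UP S\<^esub> up_ring.monom (UP S) b l = up_ring.monom (UP S) (a \<otimes>\<^bsub>S\<^esub> b) (k + l)"
      using that monom by (simp add: monom_mult)
    show ?case
      unfolding * using that monom
      by (simp add: mon Tc mod_hom_smult[OF mod_hom_funpow[OF T]] E.smult_assoc1 funpow_add del: monom_mult)
  next
    case (add p q)
    then show ?case
      using that by (simp add: P.r_distr ld rd closed)
  qed
  have assoc: "(p \<otimes>\<^bsub>UP S\<^esub> q) \<odot>\<^bsub>poly_module S E T\<^esub> v = p \<odot>\<^bsub>poly_module S E T\<^esub> (q \<odot>\<^bsub>poly_module S E T\<^esub> v)"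
    if "p \<in> carrier (UP S)" "q \<in> carrier (UP S)" "v \<in> carrier E" for p q v
    using that(1)
  proof (induction p rule: UP_induct)
    case (monom a k)
    then show ?case using mm that by simp
  next
    case (add p p')
    then show ?case
      using that by (simp add: P.l_distr ld closed)
  qed
  show ?thesis
  proof (rule moduleI)
    show "abelian_group (poly_module S E T)"
    proof (rule abelian_groupI, unfold poly_module_simps)
      fix x assume "x \<in> carrier E"
      then show "\<exists>y\<in>carrier E. y \<oplus>\<^bsub>E\<^esub> x = \<zero>\<^bsub>E\<^esub>"
        using E.M.l_neg E.M.a_inv_closed by blast
    qed (auto simp: E.M.a_ac)
    fix x assume "x \<in> carrier (poly_module S E T)"
    then show "\<one>\<^bsub>UP S\<^esub> \<odot>\<^bsub>poly_module S E T\<^esub> x = x"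
      using mon[of "\<one>\<^bsub>S\<^esub>" x 0] by simp
  qed (simp_all add: P.cring_axioms closed ld rd assoc)
qed

definition poly_var :: "('s, 'x) ring_scheme \<Rightarrow> nat \<Rightarrow> 's" where
  "poly_var S = up_ring.monom (UP S) \<one>\<^bsub>S\<^esub> 1"

lemma poly_var_closed [simp]: "cring S \<Longrightarrow> poly_var S \<in> carrier (UP S)"
  unfolding poly_var_def
  by (rule UP_ring.monom_closed) (simp_all add: UP_ring_def cring.axioms cring.cring_simprules)

lemma const_poly_closed [simp]: "cring S \<Longrightarrow> a \<in> carrier S \<Longrightarrow> const_poly S a \<in> carrier (UP S)"
  unfolding const_poly_def
  by (rule UP_ring.monom_closed) (simp_all add: UP_ring_def cring.axioms cring.cring_simprules)

lemma const_poly_hom: "cring S \<Longrightarrow> const_poly S \<in> ring_hom S (UP S)"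
  unfolding const_poly_def
  by (rule UP_ring.const_ring_hom) (simp add: UP_ring_def cring.axioms)

lemma poly_module_const:
  assumes "module S E" "T \<in> mod_hom S E E" "a \<in> carrier S" "v \<in> carrier E"
  shows "const_poly S a \<odot>\<^bsub>poly_module S E T\<^esub> v = a \<odot>\<^bsub>E\<^esub> v"
  using poly_smult_monom[OF assms, of 0] by (simp add: const_poly_def)

lemma poly_module_var:
  assumes "module S E" "T \<in> mod_hom S E E" "v \<in> carrier E"
  shows "poly_var S \<odot>\<^bsub>poly_module S E T\<^esub> v = T v"
proof -
  interpret E: module S E by fact
  show ?thesis
    using poly_smult_monom[OF assms(1,2) E.R.one_closed assms(3), of 1] mod_hom_closed[OF assms(2,3)]
    by (simp add: poly_var_def)
qed

text \<open>The constants and the variable generate the polynomial ring, so linearity is checked on them.\<close>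

lemma UP_mod_homI:
  assumes L: "module (UP S) L" and Y: "module (UP S) Y" and S: "cring S"
    and closed: "\<And>x. x \<in> carrier L \<Longrightarrow> f x \<in> carrier Y"
    and add: "\<And>x y. x \<in> carrier L \<Longrightarrow> y \<in> carrier L \<Longrightarrow> f (x \<oplus>\<^bsub>L\<^esub> y) = f x \<oplus>\<^bsub>Y\<^esub> f y"
    and const: "\<And>a x. a \<in> carrier S \<Longrightarrow> x \<in> carrier L \<Longrightarrow> f (const_poly S a \<odot>\<^bsub>L\<^esub> x) = const_poly S a \<odot>\<^bsub>Y\<^esub> f x"
    and var: "\<And>x. x \<in> carrier L \<Longrightarrow> f (poly_var S \<odot>\<^bsub>L\<^esub> x) = poly_var S \<odot>\<^bsub>Y\<^esub> f x"
  shows "f \<in> mod_hom (UP S) L Y"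
proof -
  interpret S: cring S by fact
  interpret L: module "UP S" L by fact
  interpret Y: module "UP S" Y by fact
  interpret UP_cring S "UP S" by (rule UP_cring.intro) (rule S)
  have pow: "f (up_ring.monom (UP S) \<one>\<^bsub>S\<^esub> k \<odot>\<^bsub>L\<^esub> x) = up_ring.monom (UP S) \<one>\<^bsub>S\<^esub> k \<odot>\<^bsub>Y\<^esub> f x" if "x \<in> carrier L" for k x
  proof (induction k)
    case 0
    then show ?case using that closed by simp
  next
    case (Suc k)
    have *: "up_ring.monom (UP S) \<one>\<^bsub>S\<^esub> (Suc k) = poly_var S \<otimes>\<^bsub>UP S\<^esub> up_ring.monom (UP S) \<one>\<^bsub>S\<^esub> k"
      unfolding poly_var_def by (simp flip: monom_mult)
    show ?case
      unfolding * using that Suc S by (simp add: L.smult_assoc1 Y.smult_assoc1 var closed)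
  qed
  show ?thesis
  proof (rule mod_homI)
    fix p x assume p: "p \<in> carrier (UP S)" and x: "x \<in> carrier L"
    show "f (p \<odot>\<^bsub>L\<^esub> x) = p \<odot>\<^bsub>Y\<^esub> f x"
      using p
    proof (induction p rule: UP_induct)
      case (monom a k)
      have *: "up_ring.monom (UP S) a k = const_poly S a \<otimes>\<^bsub>UP S\<^esub> up_ring.monom (UP S) \<one>\<^bsub>S\<^esub> k"
        unfolding const_poly_def using monom by (simp flip: monom_mult)
      show ?case
        unfolding * using monom x S by (simp add: L.smult_assoc1 Y.smult_assoc1 const pow closed)
    next
      case (add p q)
      then show ?case using x by (simp add: L.smult_l_distr Y.smult_l_distr assms(5) closed)
    qed
  qed (use closed add in auto)
qed

lemma poly_module_hom:
  assumes "module S E" "module S E'" "T \<in> mod_hom S E E" "T' \<in> mod_hom S E' E'" "f \<in> mod_hom S E E'"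
    and "\<And>x. x \<in> carrier E \<Longrightarrow> f (T x) = T' (f x)"
  shows "f \<in> mod_hom (UP S) (poly_module S E T) (poly_module S E' T')"
proof -
  interpret E: module S E by fact
  show ?thesis
    using mod_hom_closed[OF assms(5)] mod_hom_add[OF assms(5)] mod_hom_smult[OF assms(5)] assms(6)
    by (intro UP_mod_homI poly_module_module assms)
      (simp_all add: poly_module_const[OF assms(1,3)] poly_module_const[OF assms(2,4)]
        poly_module_var[OF assms(1,3)] poly_module_var[OF assms(2,4)] E.R.cring_axioms)
qed

lemma poly_module_homD:
  assumes "module S E" "module S E'" "T \<in> mod_hom S E E" "T' \<in> mod_hom S E' E'"
    and f: "f \<in> mod_hom (UP S) (poly_module S E T) (poly_module S E' T')"
  shows "f \<in> mod_hom S E E'" "x \<in> carrier E \<Longrightarrow> f (T x) = T' (f x)"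
proof -
  interpret E: module S E by fact
  have cl: "\<And>x. x \<in> carrier E \<Longrightarrow> f x \<in> carrier E'"
    using mod_hom_closed[OF f] by simp
  show "f \<in> mod_hom S E E'"
  proof (rule mod_homI)
    fix a x assume "a \<in> carrier S" "x \<in> carrier E"
    then show "f (a \<odot>\<^bsub>E\<^esub> x) = a \<odot>\<^bsub>E'\<^esub> f x"
      using mod_hom_smult[OF f, of "const_poly S a" x] cl
      by (simp add: poly_module_const[OF assms(1,3)] poly_module_const[OF assms(2,4)] E.R.cring_axioms)
  qed (use cl mod_hom_add[OF f] in auto)
  assume "x \<in> carrier E"
  then show "f (T x) = T' (f x)"
    using mod_hom_smult[OF f, of "poly_var S" x] cl
    by (simp add: poly_module_var[OF assms(1,3)] poly_module_var[OF assms(2,4)] E.R.cring_axioms)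
qed

section \<open>Morphisms of extensions\<close>

lemma is_extensionD:
  assumes "is_extension S M N U"
  shows "module S (ext_mid U)" "ext_in U \<in> mod_hom S N (ext_mid U)" "ext_out U \<in> mod_hom S (ext_mid U) M"
    "inj_on (ext_in U) (carrier N)" "ext_out U ` carrier (ext_mid U) = carrier M"
    "\<And>e. e \<in> carrier (ext_mid U) \<Longrightarrow> ext_out U e = \<zero>\<^bsub>M\<^esub> \<Longrightarrow> \<exists>x\<in>carrier N. e = ext_in U x"
    "\<And>x. x \<in> carrier N \<Longrightarrow> ext_out U (ext_in U x) = \<zero>\<^bsub>M\<^esub>"
  using assms unfolding is_extension_def by (simp_all, blast+)

lemma ext_morphismI:
  assumes "\<phi> \<in> mod_hom S (ext_mid U) (ext_mid V)"
    "\<And>x. x \<in> carrier N \<Longrightarrow> \<phi> (ext_in U x) = ext_in V (\<alpha> x)"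
    "\<And>e. e \<in> carrier (ext_mid U) \<Longrightarrow> ext_out V (\<phi> e) = \<beta> (ext_out U e)"
  shows "ext_morphism S N \<alpha> \<beta> U V"
  using assms by (auto simp: ext_morphism_def)

lemma ext_morphismE:
  assumes "ext_morphism S N \<alpha> \<beta> U V"
  obtains \<phi> where "\<phi> \<in> mod_hom S (ext_mid U) (ext_mid V)"
    "\<And>x. x \<in> carrier N \<Longrightarrow> \<phi> (ext_in U x) = ext_in V (\<alpha> x)"
    "\<And>e. e \<in> carrier (ext_mid U) \<Longrightarrow> ext_out V (\<phi> e) = \<beta> (ext_out U e)"
  using assms by (auto simp: ext_morphism_def)

lemma ext_morphism_comp:
  assumes U: "is_extension S M L U" and V: "ext_morphism S L \<alpha> \<beta> U V" and W: "ext_morphism S N \<alpha>' \<beta>' V W"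
    and "\<And>x. x \<in> carrier L \<Longrightarrow> \<alpha> x \<in> carrier N"
    and "\<And>x. x \<in> carrier L \<Longrightarrow> \<gamma> x = \<alpha>' (\<alpha> x)" "\<And>y. y \<in> carrier M \<Longrightarrow> \<delta> y = \<beta>' (\<beta> y)"
  shows "ext_morphism S L \<gamma> \<delta> U W"
proof -
  obtain \<phi> where \<phi>: "\<phi> \<in> mod_hom S (ext_mid U) (ext_mid V)"
    "\<And>x. x \<in> carrier L \<Longrightarrow> \<phi> (ext_in U x) = ext_in V (\<alpha> x)"
    "\<And>e. e \<in> carrier (ext_mid U) \<Longrightarrow> ext_out V (\<phi> e) = \<beta> (ext_out U e)"
    using V by (rule ext_morphismE) blast
  obtain \<psi> where \<psi>: "\<psi> \<in> mod_hom S (ext_mid V) (ext_mid W)"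
    "\<And>x. x \<in> carrier N \<Longrightarrow> \<psi> (ext_in V x) = ext_in W (\<alpha>' x)"
    "\<And>e. e \<in> carrier (ext_mid V) \<Longrightarrow> ext_out W (\<psi> e) = \<beta>' (ext_out V e)"
    using W by (rule ext_morphismE) blast
  show ?thesis
  proof (rule ext_morphismI[OF mod_hom_comp[OF \<phi>(1) \<psi>(1)]])
    fix e assume "e \<in> carrier (ext_mid U)"
    then show "ext_out W (\<psi> (\<phi> e)) = \<delta> (ext_out U e)"
      using \<phi> \<psi> assms(6) mod_hom_closed[OF is_extensionD(3)[OF U]] mod_hom_closed[OF \<phi>(1)] by simp
  qed (use \<phi> \<psi> assms in simp)
qed

text \<open>The morphism into \<open>U'\<close> determines \<open>U'\<close> as a pushout: \<open>U'\<close> is generated by the image of \<open>U\<close> and by \<open>N\<close>, and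
the relations between them are forced by \<open>\<alpha>\<close>. Equality of classes, the diagonal action and the Baer sum are all
computed with this lemma.\<close>

lemma pushout_unique:
  fixes U :: "('s, 'l, 'e, 'm) extension" and U' :: "('s, 'n, 'f, 'm) extension"
    and V :: "('s, 'n, 'g, 'm) extension"
  assumes M: "module S M" and N: "module S N" and L: "module S L"
    and U: "is_extension S M L U" and U': "is_extension S M N U'" and V: "is_extension S M N V"
    and \<alpha>: "\<And>x. x \<in> carrier L \<Longrightarrow> \<alpha> x \<in> carrier N" and \<beta>: "bij_betw \<beta> (carrier M) (carrier M)"
    and UU': "ext_morphism S L \<alpha> \<beta> U U'" and UV: "ext_morphism S L \<alpha> \<beta> U V"
  shows "ext_morphism S N id id U' V"
proof -
  obtain \<phi> where \<phi>: "\<phi> \<in> mod_hom S (ext_mid U) (ext_mid U')"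
    "\<And>x. x \<in> carrier L \<Longrightarrow> \<phi> (ext_in U x) = ext_in U' (\<alpha> x)"
    "\<And>e. e \<in> carrier (ext_mid U) \<Longrightarrow> ext_out U' (\<phi> e) = \<beta> (ext_out U e)"
    using UU' by (rule ext_morphismE) blast
  obtain \<psi> where \<psi>: "\<psi> \<in> mod_hom S (ext_mid U) (ext_mid V)"
    "\<And>x. x \<in> carrier L \<Longrightarrow> \<psi> (ext_in U x) = ext_in V (\<alpha> x)"
    "\<And>e. e \<in> carrier (ext_mid U) \<Longrightarrow> ext_out V (\<psi> e) = \<beta> (ext_out U e)"
    using UV by (rule ext_morphismE) blast
  interpret M: module S M by fact
  interpret N: module S N by fact
  interpret E: module S "ext_mid U" by (rule is_extensionD(1)[OF U])
  interpret E': module S "ext_mid U'" by (rule is_extensionD(1)[OF U'])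
  interpret F: module S "ext_mid V" by (rule is_extensionD(1)[OF V])
  define i where "i = ext_in U" define s where "s = ext_out U"
  define i' where "i' = ext_in U'" define s' where "s' = ext_out U'"
  define j where "j = ext_in V" define r where "r = ext_out V"
  note defs = i_def s_def i'_def s'_def j_def r_def
  note u = is_extensionD[OF U, folded defs] and u' = is_extensionD[OF U', folded defs] and v = is_extensionD[OF V, folded defs]
  note \<phi> = \<phi>[folded defs] and \<psi> = \<psi>[folded defs]
  note cl [simp] = mod_hom_closed[OF u(2)] mod_hom_closed[OF u(3)] mod_hom_closed[OF u'(2)] mod_hom_closed[OF u'(3)]
    mod_hom_closed[OF v(2)] mod_hom_closed[OF v(3)] mod_hom_closed[OF \<phi>(1)] mod_hom_closed[OF \<psi>(1)] \<alpha>
  note ad = mod_hom_add[OF u'(2)] mod_hom_add[OF u'(3)] mod_hom_add[OF v(2)] mod_hom_add[OF v(3)]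
    mod_hom_add[OF \<phi>(1)] mod_hom_add[OF \<psi>(1)]
  note sm = mod_hom_smult[OF u'(2)] mod_hom_smult[OF v(2)] mod_hom_smult[OF \<phi>(1)] mod_hom_smult[OF \<psi>(1)]
  \<comment> \<open>The graph of the morphism: \<open>\<phi> e + i' x \<mapsto> \<psi> e + j x\<close>.\<close>
  define R where "R e' y \<longleftrightarrow> (\<exists>e\<in>carrier (ext_mid U). \<exists>x\<in>carrier N. e' = \<phi> e \<oplus>\<^bsub>ext_mid U'\<^esub> i' x \<and> y = \<psi> e \<oplus>\<^bsub>ext_mid V\<^esub> j x)" for e' y
  have ex: "\<exists>y. R e' y" if e': "e' \<in> carrier (ext_mid U')" for e'
  proof -
    have "s' e' \<in> \<beta> ` s ` carrier (ext_mid U)"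
      using \<beta> e' u(5) by (simp add: bij_betw_def)
    then obtain e where e: "e \<in> carrier (ext_mid U)" "\<beta> (s e) = s' e'" by auto
    have "s' (e' \<ominus>\<^bsub>ext_mid U'\<^esub> \<phi> e) = s' e' \<ominus>\<^bsub>M\<^esub> s' (\<phi> e)"
      using e e' by (intro mod_hom_diff[OF E'.module_axioms M u'(3)]) auto
    also have "\<dots> = \<zero>\<^bsub>M\<^esub>" using e e' \<phi>(3) by (simp add: a_minus_def M.M.r_neg)
    finally obtain x where x: "x \<in> carrier N" "e' \<ominus>\<^bsub>ext_mid U'\<^esub> \<phi> e = i' x"
      using u'(6)[of "e' \<ominus>\<^bsub>ext_mid U'\<^esub> \<phi> e"] e e' by auto
    have "e' = \<phi> e \<oplus>\<^bsub>ext_mid U'\<^esub> (e' \<ominus>\<^bsub>ext_mid U'\<^esub> \<phi> e)"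
      using e e' by (simp add: a_minus_def E'.M.a_lcomm[of "\<phi> e" e'] E'.M.r_neg)
    then show ?thesis unfolding R_def using x e by metis
  qed
  have un: "y = z" if "R e' y" "R e' z" for e' y z
  proof -
    obtain e x e1 x1 where e: "e \<in> carrier (ext_mid U)" "x \<in> carrier N" "e1 \<in> carrier (ext_mid U)" "x1 \<in> carrier N"
      and eq: "\<phi> e \<oplus>\<^bsub>ext_mid U'\<^esub> i' x = \<phi> e1 \<oplus>\<^bsub>ext_mid U'\<^esub> i' x1"
      and yz: "y = \<psi> e \<oplus>\<^bsub>ext_mid V\<^esub> j x" "z = \<psi> e1 \<oplus>\<^bsub>ext_mid V\<^esub> j x1"
      using \<open>R e' y\<close> \<open>R e' z\<close> unfolding R_def by metis
    have "s' (\<phi> e \<oplus>\<^bsub>ext_mid U'\<^esub> i' x) = s' (\<phi> e1 \<oplus>\<^bsub>ext_mid U'\<^esub> i' x1)" using eq by simp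
    then have "\<beta> (s e) = \<beta> (s e1)" using e u'(7) bij_betwE[OF \<beta>] by (simp add: ad \<phi>(3))
    then have se: "s e = s e1" using \<beta> e by (auto simp: bij_betw_def inj_on_def)
    have "s (e \<ominus>\<^bsub>ext_mid U\<^esub> e1) = \<zero>\<^bsub>M\<^esub>"
      using e se by (simp add: mod_hom_diff[OF E.module_axioms M u(3)]) (simp add: a_minus_def M.M.r_neg)
    then obtain m where m: "m \<in> carrier L" "e \<ominus>\<^bsub>ext_mid U\<^esub> e1 = i m"
      using u(6)[of "e \<ominus>\<^bsub>ext_mid U\<^esub> e1"] e by auto
    have em: "e = e1 \<oplus>\<^bsub>ext_mid U\<^esub> i m"
      unfolding m(2)[symmetric] using e by (simp add: a_minus_def E.M.a_lcomm[of e1 e] E.M.r_neg)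
    have "\<phi> e1 \<oplus>\<^bsub>ext_mid U'\<^esub> i' (\<alpha> m \<oplus>\<^bsub>N\<^esub> x) = \<phi> e1 \<oplus>\<^bsub>ext_mid U'\<^esub> i' x1"
      unfolding eq[symmetric] em using e m by (simp add: ad \<phi>(2) E'.M.a_assoc)
    then have "i' (\<alpha> m \<oplus>\<^bsub>N\<^esub> x) = i' x1" using e m by simp
    then have "\<alpha> m \<oplus>\<^bsub>N\<^esub> x = x1" using u'(4) e m by (auto simp: inj_on_def)
    then show ?thesis
      unfolding yz em using e m by (auto simp: ad \<psi>(2) F.M.a_assoc)
  qed
  define \<chi> where "\<chi> e' = (THE y. R e' y)" for e'
  have \<chi>: "R e' (\<chi> e')" if "e' \<in> carrier (ext_mid U')" for e'
    using ex[OF that] un unfolding \<chi>_def by (metis theI)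
  have \<chi>I: "\<chi> e' = y" if "R e' y" for e' y
    unfolding \<chi>_def using that un by (intro the_equality) auto
  have Radd: "R (a \<oplus>\<^bsub>ext_mid U'\<^esub> b) (y \<oplus>\<^bsub>ext_mid V\<^esub> z)" if "R a y" "R b z" for a b y z
  proof -
    obtain e x where e: "e \<in> carrier (ext_mid U)" "x \<in> carrier N"
      "a = \<phi> e \<oplus>\<^bsub>ext_mid U'\<^esub> i' x" "y = \<psi> e \<oplus>\<^bsub>ext_mid V\<^esub> j x"
      using \<open>R a y\<close> unfolding R_def by blast
    obtain e1 x1 where e1: "e1 \<in> carrier (ext_mid U)" "x1 \<in> carrier N"
      "b = \<phi> e1 \<oplus>\<^bsub>ext_mid U'\<^esub> i' x1" "z = \<psi> e1 \<oplus>\<^bsub>ext_mid V\<^esub> j x1"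
      using \<open>R b z\<close> unfolding R_def by blast
    show ?thesis
      unfolding R_def using e e1
      by (intro bexI[of _ "e \<oplus>\<^bsub>ext_mid U\<^esub> e1"] bexI[of _ "x \<oplus>\<^bsub>N\<^esub> x1"]) (simp_all add: ad E'.M.a_ac F.M.a_ac)
  qed
  have Rsm: "R (c \<odot>\<^bsub>ext_mid U'\<^esub> a) (c \<odot>\<^bsub>ext_mid V\<^esub> y)" if "R a y" "c \<in> carrier S" for a c y
  proof -
    obtain e x where e: "e \<in> carrier (ext_mid U)" "x \<in> carrier N"
      "a = \<phi> e \<oplus>\<^bsub>ext_mid U'\<^esub> i' x" "y = \<psi> e \<oplus>\<^bsub>ext_mid V\<^esub> j x"
      using \<open>R a y\<close> unfolding R_def by blast
    show ?thesis
      unfolding R_def using e that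
      by (intro bexI[of _ "c \<odot>\<^bsub>ext_mid U\<^esub> e"] bexI[of _ "c \<odot>\<^bsub>N\<^esub> x"]) (simp_all add: sm E'.smult_r_distr F.smult_r_distr)
  qed
  have Rcl: "y \<in> carrier (ext_mid V)" "r y = s' a" if "R a y" for a y
    using that u'(7) v(7) unfolding R_def by (auto simp: ad \<phi>(3) \<psi>(3))
  have Rin: "R (i' x) (j x)" if "x \<in> carrier N" for x
    unfolding R_def using that mod_hom_zero[OF E.module_axioms E'.module_axioms \<phi>(1)] mod_hom_zero[OF E.module_axioms F.module_axioms \<psi>(1)]
    by (intro bexI[of _ "\<zero>\<^bsub>ext_mid U\<^esub>"] bexI[of _ x]) simp_all
  show ?thesis
  proof (rule ext_morphismI[of \<chi>])
    show "\<chi> \<in> mod_hom S (ext_mid U') (ext_mid V)"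
      using \<chi> Rcl Radd Rsm by (intro mod_homI) (auto intro: \<chi>I)
  qed (use \<chi>I Rin Rcl \<chi> in \<open>auto simp: i'_def j_def s'_def r_def\<close>)
qed

lemma ext_morphism_refl: "ext_morphism S N id id U U"
  by (rule ext_morphismI[OF mod_hom_id]) auto

text \<open>Both extensions are pushouts of \<open>U\<close> along the identity.\<close>

lemma ext_morphism_sym:
  assumes "module S M" "module S N" "is_extension S M N U" "is_extension S M N V" "ext_morphism S N id id U V"
  shows "ext_morphism S N id id V U"
  using assms by (intro pushout_unique[OF assms(1,2,2,3,4,3) _ _ assms(5) ext_morphism_refl]) auto

lemma ext_class_eq_iff:
  assumes M: "module S M" and N: "module S N" and U: "is_extension S M N U" and V: "is_extension S M N V"
  shows "ext_class S M N U = ext_class S M N V \<longleftrightarrow> ext_morphism S N id id U V"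
proof
  assume "ext_class S M N U = ext_class S M N V"
  then obtain Y where "Y \<in> ext_class S M N U" "Y \<in> ext_class S M N V"
    using ext_class_nonempty[OF M N U] by auto
  then have Y: "is_extension S M N Y" "ext_morphism S N id id U Y" "ext_morphism S N id id V Y"
    by (auto simp: ext_class_def)
  show "ext_morphism S N id id U V"
    by (rule ext_morphism_comp[OF U Y(2) ext_morphism_sym[OF M N V Y(1,3)]]) auto
next
  assume UV: "ext_morphism S N id id U V"
  note VU = ext_morphism_sym[OF M N U V UV]
  show "ext_class S M N U = ext_class S M N V"
    unfolding ext_class_def
    using ext_morphism_comp[OF V VU, of N id id _ id id] ext_morphism_comp[OF U UV, of N id id _ id id]
    by auto
qed

lemma ext_class_in_Ext1:
  assumes M: "module S M" and N: "module S N" and U: "is_extension S M N U"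
  shows "ext_class S M N U \<in> Ext1 S M N"
proof -
  obtain Y where "Y \<in> ext_class S M N U"
    using ext_class_nonempty[OF M N U] by auto
  then have Y: "is_extension S M N Y" "ext_morphism S N id id U Y"
    by (auto simp: ext_class_def)
  then have "ext_class S M N U = ext_class S M N Y"
    using ext_class_eq_iff[OF M N U Y(1)] by simp
  with Y show ?thesis by (auto simp: Ext1_def)
qed

text \<open>A single morphism, between extensions on arbitrary carrier types, determines the transported class.\<close>

lemma ext_transport_class:
  fixes U :: "('s, 'n, 'e, 'm) extension" and V :: "('s, 'n, 'f, 'm) extension"
  assumes M: "module S M" and N: "module S N" and U: "is_extension S M N U" and V: "is_extension S M N V"
    and \<alpha>: "\<And>x. x \<in> carrier N \<Longrightarrow> \<alpha> x \<in> carrier N" and \<beta>: "bij_betw \<beta> (carrier M) (carrier M)"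
    and UV: "ext_morphism S N \<alpha> \<beta> U V"
  shows "ext_transport S M N \<alpha> \<beta> (ext_class S M N U) = ext_class S M N V"
proof (intro Set.set_eqI iffI)
  fix Y assume "Y \<in> ext_transport S M N \<alpha> \<beta> (ext_class S M N U)"
  then obtain W :: "('s, 'n, 'm) ext" where Y: "is_extension S M N Y" and W: "ext_morphism S N id id U W" and WX: "ext_morphism S N \<alpha> \<beta> W Y"
    by (auto simp: ext_transport_def ext_class_def)
  have "ext_morphism S N \<alpha> \<beta> U Y"
    by (rule ext_morphism_comp[OF U W WX]) auto
  then have "ext_morphism S N id id V Y"
    using pushout_unique[OF M N N U V Y \<alpha> \<beta> UV] by blast
  with Y show "Y \<in> ext_class S M N V" by (simp add: ext_class_def)
next
  fix Y assume "Y \<in> ext_class S M N V"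
  then have Y: "is_extension S M N Y" "ext_morphism S N id id V Y" by (auto simp: ext_class_def)
  obtain W :: "('s, 'n, 'm) ext" where W: "is_extension S M N W" "ext_morphism S N id id U W"
    using ext_class_nonempty[OF M N U] by (auto simp: ext_class_def)
  have "ext_morphism S N \<alpha> \<beta> W V"
    by (rule ext_morphism_comp[OF W(1) ext_morphism_sym[OF M N U W] UV]) auto
  then have "ext_morphism S N \<alpha> \<beta> W Y"
    by (rule ext_morphism_comp[OF W(1) _ Y(2)]) (use \<alpha> in auto)
  then show "Y \<in> ext_transport S M N \<alpha> \<beta> (ext_class S M N U)"
    using Y W by (auto simp: ext_transport_def ext_class_def)
qed

lemma direct_sum_simps [simp]:
  "carrier (direct_sum M N) = carrier M \<times> carrier N"
  "\<zero>\<^bsub>direct_sum M N\<^esub> = (\<zero>\<^bsub>M\<^esub>, \<zero>\<^bsub>N\<^esub>)"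
  "(x, y) \<oplus>\<^bsub>direct_sum M N\<^esub> (x', y') = (x \<oplus>\<^bsub>M\<^esub> x', y \<oplus>\<^bsub>N\<^esub> y')"
  "a \<odot>\<^bsub>direct_sum M N\<^esub> (x, y) = (a \<odot>\<^bsub>M\<^esub> x, a \<odot>\<^bsub>N\<^esub> y)"
  by (simp_all add: direct_sum_def)

lemma direct_sum_module:
  assumes "module S M" "module S N"
  shows "module S (direct_sum M N)"
proof -
  interpret M: module S M by fact
  interpret N: module S N by fact
  show ?thesis
  proof (rule moduleI)
    show "abelian_group (direct_sum M N)"
    proof (rule abelian_groupI)
      fix x assume "x \<in> carrier (direct_sum M N)"
      then obtain a b where "x = (a, b)" "a \<in> carrier M" "b \<in> carrier N" by auto
      then show "\<exists>y\<in>carrier (direct_sum M N). y \<oplus>\<^bsub>direct_sum M N\<^esub> x = \<zero>\<^bsub>direct_sum M N\<^esub>"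
        by (intro bexI[of _ "(\<ominus>\<^bsub>M\<^esub> a, \<ominus>\<^bsub>N\<^esub> b)"]) (simp_all add: M.M.l_neg N.M.l_neg)
    qed (auto simp: M.M.a_ac N.M.a_ac)
  qed (auto simp: M.R.cring_axioms M.smult_l_distr M.smult_r_distr M.smult_assoc1 N.smult_l_distr N.smult_r_distr N.smult_assoc1)
qed

lemma ext_fibre_product_extension:
  assumes M: "module S M" and N: "module S N" and U: "is_extension S M N U" and V: "is_extension S M N V"
  shows "is_extension S M (direct_sum N N) (ext_fibre_product U V)"
proof -
  interpret M: module S M by fact
  interpret N: module S N by fact
  note u = is_extensionD[OF U] and v = is_extensionD[OF V]
  interpret E: module S "ext_mid U" by (rule u(1))
  interpret F: module S "ext_mid V" by (rule v(1))
  note cl [simp] = mod_hom_closed[OF u(2)] mod_hom_closed[OF u(3)] mod_hom_closed[OF v(2)] mod_hom_closed[OF v(3)]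
    mod_hom_add[OF u(2)] mod_hom_add[OF u(3)] mod_hom_add[OF v(2)] mod_hom_add[OF v(3)]
    mod_hom_smult[OF u(2)] mod_hom_smult[OF u(3)] mod_hom_smult[OF v(2)] mod_hom_smult[OF v(3)]
    u(7) v(7) mod_hom_zero[OF u(1) M u(3)] mod_hom_zero[OF v(1) M v(3)]
    mod_hom_minus[OF u(1) M u(3)] mod_hom_minus[OF v(1) M v(3)]
  define G where "G = ext_mid (ext_fibre_product U V)"
  have G: "carrier G = {(e, e'). e \<in> carrier (ext_mid U) \<and> e' \<in> carrier (ext_mid V) \<and> ext_out U e = ext_out V e'}"
    "\<zero>\<^bsub>G\<^esub> = (\<zero>\<^bsub>ext_mid U\<^esub>, \<zero>\<^bsub>ext_mid V\<^esub>)"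
    "\<And>x y x' y'. (x, y) \<oplus>\<^bsub>G\<^esub> (x', y') = (x \<oplus>\<^bsub>ext_mid U\<^esub> x', y \<oplus>\<^bsub>ext_mid V\<^esub> y')"
    "\<And>a x y. a \<odot>\<^bsub>G\<^esub> (x, y) = (a \<odot>\<^bsub>ext_mid U\<^esub> x, a \<odot>\<^bsub>ext_mid V\<^esub> y)"
    by (simp_all add: G_def ext_fibre_product_def direct_sum_def)
  have "module S G"
  proof (rule moduleI)
    show "abelian_group G"
    proof (rule abelian_groupI)
      fix x assume "x \<in> carrier G"
      then obtain a b where x: "x = (a, b)" "a \<in> carrier (ext_mid U)" "b \<in> carrier (ext_mid V)" "ext_out U a = ext_out V b"
        by (auto simp: G)
      then show "\<exists>y\<in>carrier G. y \<oplus>\<^bsub>G\<^esub> x = \<zero>\<^bsub>G\<^esub>"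
        by (intro bexI[of _ "(\<ominus>\<^bsub>ext_mid U\<^esub> a, \<ominus>\<^bsub>ext_mid V\<^esub> b)"]) (simp_all add: G E.M.l_neg F.M.l_neg)
    qed (auto simp: G E.M.a_ac F.M.a_ac)
  qed (auto simp: G M.R.cring_axioms E.smult_l_distr E.smult_r_distr E.smult_assoc1 F.smult_l_distr F.smult_r_distr F.smult_assoc1)
  moreover have "ext_in (ext_fibre_product U V) \<in> mod_hom S (direct_sum N N) G"
    by (rule mod_homI) (auto simp: G ext_fibre_product_def)
  moreover have "ext_out (ext_fibre_product U V) \<in> mod_hom S G M"
    by (rule mod_homI) (auto simp: G ext_fibre_product_def)
  moreover have "inj_on (ext_in (ext_fibre_product U V)) (carrier (direct_sum N N))"
    using u(4) v(4) by (auto simp: inj_on_def ext_fibre_product_def)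
  moreover have "ext_out (ext_fibre_product U V) ` carrier G = carrier M"
  proof (intro Set.set_eqI iffI)
    fix y assume "y \<in> carrier M"
    then have "y \<in> ext_out U ` carrier (ext_mid U)" "y \<in> ext_out V ` carrier (ext_mid V)"
      using u(5) v(5) by auto
    then obtain e e' where "e \<in> carrier (ext_mid U)" "e' \<in> carrier (ext_mid V)" "ext_out U e = y" "ext_out V e' = y"
      by auto
    then show "y \<in> ext_out (ext_fibre_product U V) ` carrier G"
      by (intro image_eqI[of _ _ "(e, e')"]) (auto simp: G ext_fibre_product_def)
  qed (auto simp: G ext_fibre_product_def)
  moreover have "ext_in (ext_fibre_product U V) ` carrier (direct_sum N N)
      = {e \<in> carrier G. ext_out (ext_fibre_product U V) e = \<zero>\<^bsub>M\<^esub>}"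
  proof (intro Set.set_eqI iffI)
    fix x assume "x \<in> {e \<in> carrier G. ext_out (ext_fibre_product U V) e = \<zero>\<^bsub>M\<^esub>}"
    then obtain e e' where x: "x = (e, e')" and e: "e \<in> carrier (ext_mid U)" "e' \<in> carrier (ext_mid V)"
      "ext_out U e = \<zero>\<^bsub>M\<^esub>" "ext_out V e' = \<zero>\<^bsub>M\<^esub>"
      by (auto simp: G ext_fibre_product_def)
    obtain a b where "a \<in> carrier N" "e = ext_in U a" "b \<in> carrier N" "e' = ext_in V b"
      using u(6)[OF e(1,3)] v(6)[OF e(2,4)] by auto
    with x show "x \<in> ext_in (ext_fibre_product U V) ` carrier (direct_sum N N)"
      by (intro image_eqI[of _ _ "(a, b)"]) (auto simp: ext_fibre_product_def)
  qed (auto simp: G ext_fibre_product_def)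
  ultimately show ?thesis
    unfolding is_extension_def G_def by blast
qed

lemma ext_fibre_product_morphism:
  assumes U: "ext_morphism S N id id U U'" and V: "ext_morphism S N id id V V'"
  shows "ext_morphism S (direct_sum N N) id id (ext_fibre_product U V) (ext_fibre_product U' V')"
proof -
  obtain \<phi> where \<phi>: "\<phi> \<in> mod_hom S (ext_mid U) (ext_mid U')"
    "\<And>x. x \<in> carrier N \<Longrightarrow> \<phi> (ext_in U x) = ext_in U' (id x)"
    "\<And>e. e \<in> carrier (ext_mid U) \<Longrightarrow> ext_out U' (\<phi> e) = id (ext_out U e)"
    using U by (rule ext_morphismE) blast
  obtain \<psi> where \<psi>: "\<psi> \<in> mod_hom S (ext_mid V) (ext_mid V')"
    "\<And>x. x \<in> carrier N \<Longrightarrow> \<psi> (ext_in V x) = ext_in V' (id x)"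
    "\<And>e. e \<in> carrier (ext_mid V) \<Longrightarrow> ext_out V' (\<psi> e) = id (ext_out V e)"
    using V by (rule ext_morphismE) blast
  show ?thesis
    by (rule ext_morphismI[of "map_prod \<phi> \<psi>"])
      (use \<phi> \<psi> in \<open>auto intro!: mod_homI simp: ext_fibre_product_def direct_sum_def
        mod_hom_closed[OF \<phi>(1)] mod_hom_closed[OF \<psi>(1)] mod_hom_add[OF \<phi>(1)] mod_hom_add[OF \<psi>(1)]
        mod_hom_smult[OF \<phi>(1)] mod_hom_smult[OF \<psi>(1)]\<close>)
qed

text \<open>As for \<open>ext_transport_class\<close>: one morphism out of the fibre product determines the sum.\<close>

lemma baer_sum_class:
  fixes U :: "('s, 'n, 'e, 'm) extension" and V :: "('s, 'n, 'f, 'm) extension"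
    and W :: "('s, 'n, 'g, 'm) extension"
  assumes M: "module S M" and N: "module S N" and U: "is_extension S M N U" and V: "is_extension S M N V"
    and W: "is_extension S M N W"
    and UVW: "ext_morphism S (direct_sum N N) (\<lambda>(a, b). a \<oplus>\<^bsub>N\<^esub> b) id (ext_fibre_product U V) W"
  shows "baer_sum S M N (ext_class S M N U) (ext_class S M N V) = ext_class S M N W"
proof -
  interpret N: module S N by fact
  note NN = direct_sum_module[OF N N]
  note UV = ext_fibre_product_extension[OF M N U V]
  show ?thesis
  proof (intro Set.set_eqI iffI)
    fix Y assume "Y \<in> baer_sum S M N (ext_class S M N U) (ext_class S M N V)"
    then obtain U1 V1 :: "('s, 'n, 'm) ext" where Y: "is_extension S M N Y" and U1: "ext_morphism S N id id U U1"
      and V1: "ext_morphism S N id id V V1"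
      and *: "ext_morphism S (direct_sum N N) (\<lambda>(a, b). a \<oplus>\<^bsub>N\<^esub> b) id (ext_fibre_product U1 V1) Y"
      by (auto simp: baer_sum_def ext_class_def)
    have "ext_morphism S (direct_sum N N) (\<lambda>(a, b). a \<oplus>\<^bsub>N\<^esub> b) id (ext_fibre_product U V) Y"
      by (rule ext_morphism_comp[OF UV ext_fibre_product_morphism[OF U1 V1] *]) auto
    then have "ext_morphism S N id id W Y"
      by (intro pushout_unique[OF M N NN UV W Y _ _ UVW]) auto
    with Y show "Y \<in> ext_class S M N W" by (simp add: ext_class_def)
  next
    fix Y assume "Y \<in> ext_class S M N W"
    then have Y: "is_extension S M N Y" "ext_morphism S N id id W Y" by (auto simp: ext_class_def)
    obtain U1 V1 :: "('s, 'n, 'm) ext" where U1: "is_extension S M N U1" "ext_morphism S N id id U U1"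
      and V1: "is_extension S M N V1" "ext_morphism S N id id V V1"
      using ext_class_nonempty[OF M N U] ext_class_nonempty[OF M N V] by (auto simp: ext_class_def)
    note UV1 = ext_fibre_product_extension[OF M N U1(1) V1(1)]
    have "ext_morphism S (direct_sum N N) (\<lambda>(a, b). a \<oplus>\<^bsub>N\<^esub> b) id (ext_fibre_product U1 V1) W"
      by (rule ext_morphism_comp[OF UV1 ext_fibre_product_morphism[OF ext_morphism_sym[OF M N U U1] ext_morphism_sym[OF M N V V1]] UVW]) auto
    then have "ext_morphism S (direct_sum N N) (\<lambda>(a, b). a \<oplus>\<^bsub>N\<^esub> b) id (ext_fibre_product U1 V1) Y"
      by (rule ext_morphism_comp[OF UV1 _ Y(2)]) auto
    then show "Y \<in> baer_sum S M N (ext_class S M N U) (ext_class S M N V)"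
      using Y U1 V1 by (auto simp: baer_sum_def ext_class_def)
  qed
qed

section \<open>Tensor products by generators and relations\<close>

text \<open>Generators and relations define a tensor product as soon as the operations are closed. With closure alone as the
hypothesis, the set \<open>Ext\<^sup>1\<close> with Baer sums can be taken as a factor directly.\<close>

locale tensor_factors =
  fixes K :: "('k, 'x) ring_scheme" and M :: "('k, 'm) module" and N :: "('k, 'n) module"
  assumes M_add: "\<And>x y. x \<in> carrier M \<Longrightarrow> y \<in> carrier M \<Longrightarrow> x \<oplus>\<^bsub>M\<^esub> y \<in> carrier M"
    and M_smult: "\<And>a x. a \<in> carrier K \<Longrightarrow> x \<in> carrier M \<Longrightarrow> a \<odot>\<^bsub>M\<^esub> x \<in> carrier M"
    and N_add: "\<And>x y. x \<in> carrier N \<Longrightarrow> y \<in> carrier N \<Longrightarrow> x \<oplus>\<^bsub>N\<^esub> y \<in> carrier N"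
    and N_smult: "\<And>a x. a \<in> carrier K \<Longrightarrow> x \<in> carrier N \<Longrightarrow> a \<odot>\<^bsub>N\<^esub> x \<in> carrier N"
begin

abbreviation "F \<equiv> free_Abelian_group (carrier M \<times> carrier N)"
abbreviation "T \<equiv> tensor_group K M N"
abbreviation "te \<equiv> tensor_elem K M N"

lemma F_comm_group: "comm_group F"
  by (rule abelian_free_Abelian_group)

lemma keys_frag_diff:
  assumes "Poly_Mapping.keys c \<subseteq> S" "Poly_Mapping.keys d \<subseteq> S"
  shows "Poly_Mapping.keys (c - d :: 'z \<Rightarrow>\<^sub>0 int) \<subseteq> S"
  using keys_diff[of c d] assms by blast

lemma relations_closed: "tensor_relations K M N \<subseteq> carrier F"
proof
  fix c assume "c \<in> tensor_relations K M N"
  then show "c \<in> carrier F"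
    unfolding tensor_relations_def carrier_free_Abelian_group_iff
    by (elim UnE CollectE exE conjE; hypsubst; intro keys_frag_diff; simp add: M_add M_smult N_add N_smult)
qed

lemma kernel_subgroup: "subgroup (tensor_kernel K M N) F"
  unfolding tensor_kernel_def
  by (rule group.generate_is_subgroup[OF group_free_Abelian_group relations_closed])

lemma kernel_normal: "tensor_kernel K M N \<lhd> F"
  by (rule comm_group.subgroup_imp_normal[OF F_comm_group kernel_subgroup])

lemma tensor_comm_group: "comm_group T"
  unfolding tensor_group_def
  by (rule comm_group.abelian_FactGroup[OF F_comm_group kernel_subgroup])

lemma proj_hom: "(\<lambda>c. tensor_kernel K M N #>\<^bsub>F\<^esub> c) \<in> hom F T"
  unfolding tensor_group_def by (rule normal.r_coset_hom_Mod[OF kernel_normal])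

lemma proj_closed: "c \<in> carrier F \<Longrightarrow> tensor_kernel K M N #>\<^bsub>F\<^esub> c \<in> carrier T"
  using proj_hom by (auto simp: hom_def simp del: carrier_free_Abelian_group_iff)

lemma proj_add:
  "c \<in> carrier F \<Longrightarrow> d \<in> carrier F \<Longrightarrow>
    tensor_kernel K M N #>\<^bsub>F\<^esub> (c + d) = (tensor_kernel K M N #>\<^bsub>F\<^esub> c) \<otimes>\<^bsub>T\<^esub> (tensor_kernel K M N #>\<^bsub>F\<^esub> d)"
  using hom_mult[OF proj_hom, of c d] by simp

lemma proj_eqI:
  assumes "c \<in> carrier F" "d \<in> carrier F" "c - d \<in> tensor_kernel K M N"
  shows "tensor_kernel K M N #>\<^bsub>F\<^esub> c = tensor_kernel K M N #>\<^bsub>F\<^esub> d"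
proof -
  have "c \<in> tensor_kernel K M N #>\<^bsub>F\<^esub> d"
    using assms by (auto simp: r_coset_def intro!: bexI[of _ "c - d"])
  then show ?thesis
    using group.repr_independence[OF group_free_Abelian_group _ assms(2) kernel_subgroup, of c] by simp
qed

lemma relation_in_kernel: "c \<in> tensor_relations K M N \<Longrightarrow> c \<in> tensor_kernel K M N"
  unfolding tensor_kernel_def by (rule generate.incl)

lemma tensor_elem_closed [simp]: "x \<in> carrier M \<Longrightarrow> y \<in> carrier N \<Longrightarrow> te x y \<in> carrier T"
  unfolding tensor_elem_def by (rule proj_closed) simp

lemma tensor_elem_add_left:
  assumes "x \<in> carrier M" "x' \<in> carrier M" "y \<in> carrier N"
  shows "te (x \<oplus>\<^bsub>M\<^esub> x') y = te x y \<otimes>\<^bsub>T\<^esub> te x' y"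
proof -
  have "frag_of (x \<oplus>\<^bsub>M\<^esub> x', y) - frag_of (x, y) - frag_of (x', y) \<in> tensor_relations K M N"
    unfolding tensor_relations_def using assms by blast
  then have "frag_of (x \<oplus>\<^bsub>M\<^esub> x', y) - (frag_of (x, y) + frag_of (x', y)) \<in> tensor_kernel K M N"
    by (intro relation_in_kernel) (simp add: diff_diff_eq)
  moreover have "frag_of (x, y) + frag_of (x', y) \<in> carrier F"
    using assms by (auto dest!: subsetD[OF keys_add])
  ultimately have "te (x \<oplus>\<^bsub>M\<^esub> x') y = tensor_kernel K M N #>\<^bsub>F\<^esub> (frag_of (x, y) + frag_of (x', y))"
    unfolding tensor_elem_def using assms M_add by (intro proj_eqI) auto
  then show ?thesis
    unfolding tensor_elem_def using assms by (subst (asm) proj_add) auto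
qed

lemma tensor_elem_add_right:
  assumes "x \<in> carrier M" "y \<in> carrier N" "y' \<in> carrier N"
  shows "te x (y \<oplus>\<^bsub>N\<^esub> y') = te x y \<otimes>\<^bsub>T\<^esub> te x y'"
proof -
  have "frag_of (x, y \<oplus>\<^bsub>N\<^esub> y') - frag_of (x, y) - frag_of (x, y') \<in> tensor_relations K M N"
    unfolding tensor_relations_def using assms by blast
  then have "frag_of (x, y \<oplus>\<^bsub>N\<^esub> y') - (frag_of (x, y) + frag_of (x, y')) \<in> tensor_kernel K M N"
    by (intro relation_in_kernel) (simp add: diff_diff_eq)
  moreover have "frag_of (x, y) + frag_of (x, y') \<in> carrier F"
    using assms by (auto dest!: subsetD[OF keys_add])
  ultimately have "te x (y \<oplus>\<^bsub>N\<^esub> y') = tensor_kernel K M N #>\<^bsub>F\<^esub> (frag_of (x, y) + frag_of (x, y'))"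
    unfolding tensor_elem_def using assms N_add by (intro proj_eqI) auto
  then show ?thesis
    unfolding tensor_elem_def using assms by (subst (asm) proj_add) auto
qed

lemma tensor_elem_balanced:
  assumes "a \<in> carrier K" "x \<in> carrier M" "y \<in> carrier N"
  shows "te (a \<odot>\<^bsub>M\<^esub> x) y = te x (a \<odot>\<^bsub>N\<^esub> y)"
proof -
  have "frag_of (a \<odot>\<^bsub>M\<^esub> x, y) - frag_of (x, a \<odot>\<^bsub>N\<^esub> y) \<in> tensor_relations K M N"
    unfolding tensor_relations_def using assms by blast
  then show ?thesis
    unfolding tensor_elem_def using assms M_smult N_smult by (intro proj_eqI relation_in_kernel) auto
qed

lemma tensor_carrierE:
  assumes "z \<in> carrier T"
  obtains c where "c \<in> carrier F" "z = tensor_kernel K M N #>\<^bsub>F\<^esub> c"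
  using assms unfolding tensor_group_def FactGroup_def RCOSETS_def by auto

lemma tensor_induct [consumes 1, case_names one elem diff]:
  assumes "z \<in> carrier T" and one: "Q \<one>\<^bsub>T\<^esub>"
    and elem: "\<And>x y. x \<in> carrier M \<Longrightarrow> y \<in> carrier N \<Longrightarrow> Q (te x y)"
    and diff: "\<And>z w. z \<in> carrier T \<Longrightarrow> w \<in> carrier T \<Longrightarrow> Q z \<Longrightarrow> Q w \<Longrightarrow> Q (z \<otimes>\<^bsub>T\<^esub> inv\<^bsub>T\<^esub> w)"
  shows "Q z"
proof -
  interpret T: comm_group T by (rule tensor_comm_group)
  interpret p: group_hom F T "\<lambda>c. tensor_kernel K M N #>\<^bsub>F\<^esub> c"
    using proj_hom by (simp add: group_hom_def group_hom_axioms_def T.is_group)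
  obtain c where c: "c \<in> carrier F" "z = tensor_kernel K M N #>\<^bsub>F\<^esub> c"
    using assms(1) by (rule tensor_carrierE)
  have "Q (tensor_kernel K M N #>\<^bsub>F\<^esub> c)"
  proof (rule free_Abelian_group_induct[of c "carrier M \<times> carrier N"])
    show "Poly_Mapping.keys c \<subseteq> carrier M \<times> carrier N" using c by simp
    show "Q (tensor_kernel K M N #>\<^bsub>F\<^esub> 0)" using one p.hom_one by simp
    fix x y assume xy: "Poly_Mapping.keys x \<subseteq> carrier M \<times> carrier N" "Poly_Mapping.keys y \<subseteq> carrier M \<times> carrier N"
      "Q (tensor_kernel K M N #>\<^bsub>F\<^esub> x)" "Q (tensor_kernel K M N #>\<^bsub>F\<^esub> y)"
    have "tensor_kernel K M N #>\<^bsub>F\<^esub> (x - y) = (tensor_kernel K M N #>\<^bsub>F\<^esub> x) \<otimes>\<^bsub>T\<^esub> inv\<^bsub>T\<^esub> (tensor_kernel K M N #>\<^bsub>F\<^esub> y)"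
      using xy proj_add[of x "- y"] p.hom_inv[of y] by simp
    then show "Q (tensor_kernel K M N #>\<^bsub>F\<^esub> (x - y))"
      using diff xy proj_closed by simp
  next
    fix a assume "a \<in> carrier M \<times> carrier N"
    then show "Q (tensor_kernel K M N #>\<^bsub>F\<^esub> frag_of a)"
      using elem by (auto simp: tensor_elem_def)
  qed
  with c show ?thesis by simp
qed

lemma tensor_hom_eqI:
  assumes "group G" "f \<in> hom T G" "h \<in> hom T G" "z \<in> carrier T"
    and "\<And>x y. x \<in> carrier M \<Longrightarrow> y \<in> carrier N \<Longrightarrow> f (te x y) = h (te x y)"
  shows "f z = h z"
proof -
  interpret T: comm_group T by (rule tensor_comm_group)
  interpret f: group_hom T G f using assms by (simp add: group_hom_def group_hom_axioms_def T.is_group)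
  interpret h: group_hom T G h using assms by (simp add: group_hom_def group_hom_axioms_def T.is_group)
  show ?thesis
    using assms(4) by (induction z rule: tensor_induct) (simp_all add: assms(5))
qed

context
  fixes G :: "('g, 'y) monoid_scheme" and b :: "'m \<times> 'n \<Rightarrow> 'g"
  assumes G: "comm_group G"
    and b_closed: "\<And>x y. x \<in> carrier M \<Longrightarrow> y \<in> carrier N \<Longrightarrow> b (x, y) \<in> carrier G"
    and b_left: "\<And>x x' y. x \<in> carrier M \<Longrightarrow> x' \<in> carrier M \<Longrightarrow> y \<in> carrier N \<Longrightarrow>
      b (x \<oplus>\<^bsub>M\<^esub> x', y) = b (x, y) \<otimes>\<^bsub>G\<^esub> b (x', y)"
    and b_right: "\<And>x y y'. x \<in> carrier M \<Longrightarrow> y \<in> carrier N \<Longrightarrow> y' \<in> carrier N \<Longrightarrow>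
      b (x, y \<oplus>\<^bsub>N\<^esub> y') = b (x, y) \<otimes>\<^bsub>G\<^esub> b (x, y')"
    and b_balanced: "\<And>a x y. a \<in> carrier K \<Longrightarrow> x \<in> carrier M \<Longrightarrow> y \<in> carrier N \<Longrightarrow>
      b (a \<odot>\<^bsub>M\<^esub> x, y) = b (x, a \<odot>\<^bsub>N\<^esub> y)"
begin

interpretation G: comm_group G by (rule G)

definition free_lift :: "('m \<times> 'n \<Rightarrow>\<^sub>0 int) \<Rightarrow> 'g" where
  "free_lift c = finprod G (\<lambda>u. b u [^]\<^bsub>G\<^esub> Poly_Mapping.lookup c u) (Poly_Mapping.keys c)"

lemma free_lift_superset:
  assumes "Poly_Mapping.keys c \<subseteq> A" "A \<subseteq> carrier M \<times> carrier N" "finite A"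
  shows "free_lift c = finprod G (\<lambda>u. b u [^]\<^bsub>G\<^esub> Poly_Mapping.lookup c u) A"
  unfolding free_lift_def using assms b_closed
  by (intro G.finprod_mono_neutral_cong_left) (auto simp: in_keys_iff subset_iff)

lemma free_lift_hom: "free_lift \<in> hom F G"
proof (rule homI)
  fix c assume "c \<in> carrier F"
  then show "free_lift c \<in> carrier G"
    unfolding free_lift_def using b_closed by (intro G.finprod_closed) (auto simp: subset_iff)
next
  fix c d assume cd: "c \<in> carrier F" "d \<in> carrier F"
  let ?A = "Poly_Mapping.keys c \<union> Poly_Mapping.keys d"
  have A: "?A \<subseteq> carrier M \<times> carrier N" using cd by simp
  have b: "b u \<in> carrier G" if "u \<in> ?A" for u
    using subsetD[OF A that] b_closed by auto
  have "free_lift (c + d) = finprod G (\<lambda>u. b u [^]\<^bsub>G\<^esub> Poly_Mapping.lookup (c + d) u) ?A"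
    using A keys_add[of c d] by (intro free_lift_superset) auto
  also have "\<dots> = finprod G (\<lambda>u. b u [^]\<^bsub>G\<^esub> Poly_Mapping.lookup c u \<otimes>\<^bsub>G\<^esub> b u [^]\<^bsub>G\<^esub> Poly_Mapping.lookup d u) ?A"
    using b by (intro G.finprod_cong') (auto simp: lookup_add G.int_pow_mult)
  also have "\<dots> = free_lift c \<otimes>\<^bsub>G\<^esub> free_lift d"
    using b A by (subst G.finprod_multf) (auto simp: free_lift_superset[of _ ?A])
  finally show "free_lift (c \<otimes>\<^bsub>F\<^esub> d) = free_lift c \<otimes>\<^bsub>G\<^esub> free_lift d" by simp
qed

interpretation fl: group_hom F G free_lift
  using free_lift_hom by (simp add: group_hom_def group_hom_axioms_def G.is_group)

lemma free_lift_frag_of: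
  assumes "x \<in> carrier M" "y \<in> carrier N"
  shows "free_lift (frag_of (x, y)) = b (x, y)"
  using b_closed[OF assms] by (simp add: free_lift_def)

lemma free_lift_diff:
  assumes "c \<in> carrier F" "d \<in> carrier F"
  shows "free_lift (c - d) = free_lift c \<otimes>\<^bsub>G\<^esub> inv\<^bsub>G\<^esub> free_lift d"
  using fl.hom_mult[of c "- d"] fl.hom_inv[of d] assms by simp

lemma free_lift_kernel:
  assumes "c \<in> tensor_kernel K M N"
  shows "free_lift c = \<one>\<^bsub>G\<^esub>"
proof -
  have cancel: "g \<otimes>\<^bsub>G\<^esub> h \<otimes>\<^bsub>G\<^esub> inv\<^bsub>G\<^esub> g \<otimes>\<^bsub>G\<^esub> inv\<^bsub>G\<^esub> h = \<one>\<^bsub>G\<^esub>"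
    if "g \<in> carrier G" "h \<in> carrier G" for g h
    using that by (simp add: G.m_comm[of g h] G.m_assoc)
  have "tensor_relations K M N \<subseteq> kernel F G free_lift"
  proof
    fix c assume c: "c \<in> tensor_relations K M N"
    then have cF: "c \<in> carrier F" using relations_closed by blast
    from c have "free_lift c = \<one>\<^bsub>G\<^esub>"
      unfolding tensor_relations_def
      by (auto simp: free_lift_diff free_lift_frag_of keys_frag_diff M_add M_smult N_add N_smult
          b_left b_right b_balanced b_closed cancel)
    then show "c \<in> kernel F G free_lift" using cF by (simp add: kernel_def)
  qed
  then have "tensor_kernel K M N \<subseteq> kernel F G free_lift"
    unfolding tensor_kernel_def
    by (rule group.generate_subgroup_incl[OF group_free_Abelian_group _ fl.subgroup_kernel])
  with assms show ?thesis by (auto simp: kernel_def)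
qed

lemma tensor_lift_proj:
  assumes "c \<in> carrier F"
  shows "tensor_lift G b (tensor_kernel K M N #>\<^bsub>F\<^esub> c) = free_lift c"
proof -
  have "free_lift (k + c) = free_lift c" if "k \<in> tensor_kernel K M N" for k
  proof -
    have "k \<in> carrier F" using that kernel_subgroup subgroup.subset by blast
    then show ?thesis
      using fl.hom_mult[of k c] assms free_lift_kernel[OF that] fl.hom_closed[OF assms] by simp
  qed
  moreover have "0 \<in> tensor_kernel K M N"
    using subgroup.one_closed[OF kernel_subgroup] by simp
  ultimately have "free_lift ` (tensor_kernel K M N #>\<^bsub>F\<^esub> c) = {free_lift c}"
    by (auto simp: r_coset_def image_iff)
  then show ?thesis
    unfolding tensor_lift_def free_lift_def[abs_def] by simp
qed

lemma tensor_lift_hom: "tensor_lift G b \<in> hom T G"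
proof (rule homI)
  fix z assume "z \<in> carrier T"
  then obtain c where "c \<in> carrier F" "z = tensor_kernel K M N #>\<^bsub>F\<^esub> c" by (rule tensor_carrierE)
  then show "tensor_lift G b z \<in> carrier G" using tensor_lift_proj fl.hom_closed by simp
next
  fix z w assume "z \<in> carrier T" "w \<in> carrier T"
  then obtain c d where c: "c \<in> carrier F" "z = tensor_kernel K M N #>\<^bsub>F\<^esub> c"
    and d: "d \<in> carrier F" "w = tensor_kernel K M N #>\<^bsub>F\<^esub> d" by (metis tensor_carrierE)
  have "c + d \<in> carrier F" using c d keys_add[of c d] by auto
  then show "tensor_lift G b (z \<otimes>\<^bsub>T\<^esub> w) = tensor_lift G b z \<otimes>\<^bsub>G\<^esub> tensor_lift G b w"
    unfolding c(2) d(2) using proj_add[OF c(1) d(1)] tensor_lift_proj[of "c + d"]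
      tensor_lift_proj[OF c(1)] tensor_lift_proj[OF d(1)] fl.hom_mult[OF c(1) d(1)] by simp
qed

text \<open>With \<open>tensor_lift_hom\<close>, the universal property: \<open>b\<close> extended to the free abelian group kills the relations.\<close>

lemma tensor_lift_elem:
  assumes "x \<in> carrier M" "y \<in> carrier N"
  shows "tensor_lift G b (te x y) = b (x, y)"
  unfolding tensor_elem_def using assms by (simp add: tensor_lift_proj free_lift_frag_of)

end

lemma tensor_map_bilinear:
  assumes "\<And>x. x \<in> carrier M \<Longrightarrow> f x \<in> carrier M"
    "\<And>x y. x \<in> carrier M \<Longrightarrow> y \<in> carrier M \<Longrightarrow> f (x \<oplus>\<^bsub>M\<^esub> y) = f x \<oplus>\<^bsub>M\<^esub> f y"
    "\<And>a x. a \<in> carrier K \<Longrightarrow> x \<in> carrier M \<Longrightarrow> f (a \<odot>\<^bsub>M\<^esub> x) = a \<odot>\<^bsub>M\<^esub> f x"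
  shows "tensor_map K M N f id \<in> hom T T"
    and "x \<in> carrier M \<Longrightarrow> y \<in> carrier N \<Longrightarrow> tensor_map K M N f id (te x y) = te (f x) y"
proof -
  show "tensor_map K M N f id \<in> hom T T"
    unfolding tensor_map_def
    by (rule tensor_lift_hom[OF tensor_comm_group])
      (simp_all add: assms tensor_elem_add_left tensor_elem_add_right tensor_elem_balanced)
  assume xy: "x \<in> carrier M" "y \<in> carrier N"
  have "tensor_map K M N f id (te x y) = (\<lambda>(x, y). te (f x) (id y)) (x, y)"
    unfolding tensor_map_def
    by (rule tensor_lift_elem[OF tensor_comm_group _ _ _ _ xy])
      (simp_all add: assms tensor_elem_add_left tensor_elem_add_right tensor_elem_balanced)
  then show "tensor_map K M N f id (te x y) = te (f x) y" by simp
qed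

end

section \<open>Modules over Euclidean domains\<close>

locale euclidean_module = euclidean_domain D \<phi> + module D M
  for D :: "('a, 'b) ring_scheme" (structure) and \<phi> :: "'a \<Rightarrow> nat" and M :: "('a, 'm) module"
begin

definition span_of :: "'i set \<Rightarrow> ('i \<Rightarrow> 'm) \<Rightarrow> 'm set" where
  "span_of I u = lincomb M I u ` (I \<rightarrow>\<^sub>E carrier D)"

lemma lincomb_cong':
  assumes "\<And>i. i \<in> I \<Longrightarrow> u i = u' i" "\<And>i. i \<in> I \<Longrightarrow> v i = v' i"
    "\<And>i. i \<in> I \<Longrightarrow> u' i \<in> carrier M" "\<And>i. i \<in> I \<Longrightarrow> v' i \<in> carrier D"
  shows "lincomb M I u v = lincomb M I u' v'"
  unfolding lincomb_def using assms by (intro M.finsum_cong') auto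

lemma lincomb_insert:
  assumes "finite I" "i \<notin> I" "\<And>j. j \<in> insert i I \<Longrightarrow> u j \<in> carrier M" "\<And>j. j \<in> insert i I \<Longrightarrow> v j \<in> carrier D"
  shows "lincomb M (insert i I) u v = v i \<odot>\<^bsub>M\<^esub> u i \<oplus>\<^bsub>M\<^esub> lincomb M I u v"
  unfolding lincomb_def using assms by (intro M.finsum_insert) auto

lemma span_ofI:
  assumes "\<And>i. i \<in> I \<Longrightarrow> u i \<in> carrier M" "\<And>i. i \<in> I \<Longrightarrow> v i \<in> carrier D"
  shows "lincomb M I u v \<in> span_of I u"
  unfolding span_of_def
proof (rule image_eqI[of _ _ "restrict v I"])
  show "lincomb M I u v = lincomb M I u (restrict v I)"
    using assms by (intro lincomb_cong') auto
qed (use assms in auto)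

context
  fixes I :: "'i set" and u :: "'i \<Rightarrow> 'm"
  assumes I: "finite I" and u: "\<And>i. i \<in> I \<Longrightarrow> u i \<in> carrier M"
begin

lemma span_closed: "x \<in> span_of I u \<Longrightarrow> x \<in> carrier M"
  using mod_hom_closed[OF lincomb_hom[OF module_axioms u I]] unfolding span_of_def by auto

lemma span_add: "x \<in> span_of I u \<Longrightarrow> y \<in> span_of I u \<Longrightarrow> x \<oplus>\<^bsub>M\<^esub> y \<in> span_of I u"
proof -
  interpret F: module D "free_on D I" by (rule free_on_module)
  assume "x \<in> span_of I u" "y \<in> span_of I u"
  then obtain a b where ab: "a \<in> carrier (free_on D I)" "b \<in> carrier (free_on D I)" "x = lincomb M I u a" "y = lincomb M I u b"
    by (auto simp: span_of_def)
  have "x \<oplus>\<^bsub>M\<^esub> y = lincomb M I u (a \<oplus>\<^bsub>free_on D I\<^esub> b)"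
    unfolding ab(3,4) by (rule mod_hom_add[OF lincomb_hom[OF module_axioms u I] ab(1,2), symmetric])
  then show ?thesis
    unfolding span_of_def using F.M.a_closed[OF ab(1,2)] by (intro image_eqI) (simp_all only: free_on_simps(1))
qed

lemma span_smult: "x \<in> span_of I u \<Longrightarrow> c \<in> carrier D \<Longrightarrow> c \<odot>\<^bsub>M\<^esub> x \<in> span_of I u"
proof -
  interpret F: module D "free_on D I" by (rule free_on_module)
  assume "x \<in> span_of I u" and c: "c \<in> carrier D"
  then obtain a where ab: "a \<in> carrier (free_on D I)" "x = lincomb M I u a"
    by (auto simp: span_of_def)
  have "c \<odot>\<^bsub>M\<^esub> x = lincomb M I u (c \<odot>\<^bsub>free_on D I\<^esub> a)"
    unfolding ab(2) by (rule mod_hom_smult[OF lincomb_hom[OF module_axioms u I] c ab(1), symmetric])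
  then show ?thesis
    unfolding span_of_def using F.smult_closed[OF c ab(1)] by (intro image_eqI) (simp_all only: free_on_simps(1))
qed

lemma span_insert:
  assumes i: "i \<notin> I" and ui: "u i \<in> carrier M"
  shows "span_of (insert i I) u = {a \<odot>\<^bsub>M\<^esub> u i \<oplus>\<^bsub>M\<^esub> y | a y. a \<in> carrier D \<and> y \<in> span_of I u}"
proof (intro Set.set_eqI iffI)
  fix x assume "x \<in> span_of (insert i I) u"
  then obtain v where v: "v \<in> insert i I \<rightarrow>\<^sub>E carrier D" "x = lincomb M (insert i I) u v"
    by (auto simp: span_of_def)
  note vc = PiE_app[OF v(1)]
  have "x = v i \<odot>\<^bsub>M\<^esub> u i \<oplus>\<^bsub>M\<^esub> lincomb M I u v"
    unfolding v(2) using i ui u vc by (intro lincomb_insert I) auto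
  moreover have "lincomb M I u v \<in> span_of I u" using u vc by (intro span_ofI) auto
  ultimately show "x \<in> {a \<odot>\<^bsub>M\<^esub> u i \<oplus>\<^bsub>M\<^esub> y | a y. a \<in> carrier D \<and> y \<in> span_of I u}"
    using vc by blast
next
  fix x assume "x \<in> {a \<odot>\<^bsub>M\<^esub> u i \<oplus>\<^bsub>M\<^esub> y | a y. a \<in> carrier D \<and> y \<in> span_of I u}"
  then obtain a v where a: "a \<in> carrier D" and v: "v \<in> I \<rightarrow>\<^sub>E carrier D" and x: "x = a \<odot>\<^bsub>M\<^esub> u i \<oplus>\<^bsub>M\<^esub> lincomb M I u v"
    by (auto simp: span_of_def)
  note vc = PiE_app[OF v]
  have "lincomb M (insert i I) u (v(i := a)) = (v(i := a)) i \<odot>\<^bsub>M\<^esub> u i \<oplus>\<^bsub>M\<^esub> lincomb M I u (v(i := a))"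
    using i ui u vc a by (intro lincomb_insert I) auto
  also have "lincomb M I u (v(i := a)) = lincomb M I u v"
    using i u vc by (intro lincomb_cong') auto
  finally have "x = lincomb M (insert i I) u (v(i := a))" unfolding x fun_upd_same by (rule sym)
  then show "x \<in> span_of (insert i I) u"
    using ui u vc a by (simp only:) (rule span_ofI, auto)
qed

end

lemma span_cong:
  assumes "\<And>i. i \<in> I \<Longrightarrow> u i = u' i" "\<And>i. i \<in> I \<Longrightarrow> u' i \<in> carrier M"
  shows "span_of I u = span_of I u'"
  unfolding span_of_def by (rule image_cong[OF refl], rule lincomb_cong') (simp_all add: assms PiE_app)

text \<open>An elementary operation on generators.\<close>

lemma span_shift:
  assumes J: "finite J" "i \<notin> J" and u: "\<And>j. j \<in> insert i J \<Longrightarrow> u j \<in> carrier M" and z: "z \<in> span_of J u"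
  shows "span_of (insert i J) (u(i := u i \<oplus>\<^bsub>M\<^esub> z)) = span_of (insert i J) u"
proof -
  let ?u = "u(i := u i \<oplus>\<^bsub>M\<^esub> z)"
  have uJ: "\<And>j. j \<in> J \<Longrightarrow> u j \<in> carrier M" and ui: "u i \<in> carrier M" using u by auto
  note cl = span_closed[of J u, OF J(1) uJ]
  have zc: "z \<in> carrier M" using z cl by blast
  have J': "span_of J ?u = span_of J u" using J u by (intro span_cong) auto
  have l: "a \<odot>\<^bsub>M\<^esub> (u i \<oplus>\<^bsub>M\<^esub> z) \<oplus>\<^bsub>M\<^esub> y = a \<odot>\<^bsub>M\<^esub> u i \<oplus>\<^bsub>M\<^esub> (a \<odot>\<^bsub>M\<^esub> z \<oplus>\<^bsub>M\<^esub> y)"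
    if "a \<in> carrier D" "y \<in> carrier M" for a y
    using that ui zc by (simp add: smult_r_distr M.a_assoc)
  have r: "a \<odot>\<^bsub>M\<^esub> (u i \<oplus>\<^bsub>M\<^esub> z) \<oplus>\<^bsub>M\<^esub> ((\<ominus> a) \<odot>\<^bsub>M\<^esub> z \<oplus>\<^bsub>M\<^esub> y) = a \<odot>\<^bsub>M\<^esub> u i \<oplus>\<^bsub>M\<^esub> y"
    if "a \<in> carrier D" "y \<in> carrier M" for a y
    using that ui zc by (simp add: smult_r_distr M.a_assoc smult_l_minus M.r_neg1 M.r_neg2)
  have "span_of (insert i J) ?u = {a \<odot>\<^bsub>M\<^esub> (u i \<oplus>\<^bsub>M\<^esub> z) \<oplus>\<^bsub>M\<^esub> y | a y. a \<in> carrier D \<and> y \<in> span_of J u}"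
    using span_insert[of J ?u i] J uJ ui zc by (auto simp: J')
  also have "\<dots> = {a \<odot>\<^bsub>M\<^esub> u i \<oplus>\<^bsub>M\<^esub> y | a y. a \<in> carrier D \<and> y \<in> span_of J u}"
  proof (intro Set.set_eqI iffI)
    fix x assume "x \<in> {a \<odot>\<^bsub>M\<^esub> (u i \<oplus>\<^bsub>M\<^esub> z) \<oplus>\<^bsub>M\<^esub> y | a y. a \<in> carrier D \<and> y \<in> span_of J u}"
    then obtain a y where ay: "a \<in> carrier D" "y \<in> span_of J u" "x = a \<odot>\<^bsub>M\<^esub> (u i \<oplus>\<^bsub>M\<^esub> z) \<oplus>\<^bsub>M\<^esub> y" by blast
    have "x = a \<odot>\<^bsub>M\<^esub> u i \<oplus>\<^bsub>M\<^esub> (a \<odot>\<^bsub>M\<^esub> z \<oplus>\<^bsub>M\<^esub> y)" using ay l cl by simp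
    moreover have "a \<odot>\<^bsub>M\<^esub> z \<oplus>\<^bsub>M\<^esub> y \<in> span_of J u"
      using ay z by (intro span_add span_smult J uJ)
    ultimately show "x \<in> {a \<odot>\<^bsub>M\<^esub> u i \<oplus>\<^bsub>M\<^esub> y | a y. a \<in> carrier D \<and> y \<in> span_of J u}" using ay by blast
  next
    fix x assume "x \<in> {a \<odot>\<^bsub>M\<^esub> u i \<oplus>\<^bsub>M\<^esub> y | a y. a \<in> carrier D \<and> y \<in> span_of J u}"
    then obtain a y where ay: "a \<in> carrier D" "y \<in> span_of J u" "x = a \<odot>\<^bsub>M\<^esub> u i \<oplus>\<^bsub>M\<^esub> y" by blast
    have "x = a \<odot>\<^bsub>M\<^esub> (u i \<oplus>\<^bsub>M\<^esub> z) \<oplus>\<^bsub>M\<^esub> ((\<ominus> a) \<odot>\<^bsub>M\<^esub> z \<oplus>\<^bsub>M\<^esub> y)" using ay r cl by simp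
    moreover have "(\<ominus> a) \<odot>\<^bsub>M\<^esub> z \<oplus>\<^bsub>M\<^esub> y \<in> span_of J u"
      using ay z by (intro span_add span_smult J uJ) auto
    ultimately show "x \<in> {a \<odot>\<^bsub>M\<^esub> (u i \<oplus>\<^bsub>M\<^esub> z) \<oplus>\<^bsub>M\<^esub> y | a y. a \<in> carrier D \<and> y \<in> span_of J u}" using ay by blast
  qed
  also have "\<dots> = span_of (insert i J) u"
    using span_insert[of J u i] J uJ ui by simp
  finally show ?thesis .
qed

definition relation :: "'i set \<Rightarrow> ('i \<Rightarrow> 'm) \<Rightarrow> ('i \<Rightarrow> 'a) \<Rightarrow> bool" where
  "relation I u b \<longleftrightarrow> (\<forall>i\<in>I. b i \<in> carrier D) \<and> lincomb M I u b = \<zero>\<^bsub>M\<^esub>"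

lemma divides_zero: "a \<in> carrier D \<Longrightarrow> a divides \<zero>"
  unfolding factor_def by (rule bexI[of _ "\<zero>"]) auto

definition generates_same :: "'i set \<Rightarrow> ('i \<Rightarrow> 'm) \<Rightarrow> ('i \<Rightarrow> 'm) \<Rightarrow> bool" where
  "generates_same I w u \<longleftrightarrow> (\<forall>i\<in>I. u i \<in> carrier M) \<and> span_of I u = span_of I w"

text \<open>Division with remainder: if the remainder of \<open>b j\<close> by \<open>f\<close> were not zero, it would be a coefficient of a relation
between other generators of the same module, smaller than the minimal coefficient \<open>f\<close>.\<close>

lemma minimal_coefficient_divides:
  assumes J: "finite J" "i \<notin> J" and P: "generates_same (insert i J) w u"
    and min: "\<And>u' b k. generates_same (insert i J) w u' \<Longrightarrow> relation (insert i J) u' b \<Longrightarrow>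
      k \<in> insert i J \<Longrightarrow> b k \<noteq> \<zero> \<Longrightarrow> \<phi> f \<le> \<phi> (b k)"
    and f: "f \<noteq> \<zero>" "b i = f" and b: "relation (insert i J) u b" and j: "j \<in> J"
  shows "f divides b j"
proof (cases "b j = \<zero>")
  case True
  then show ?thesis using divides_zero b f by (auto simp: relation_def)
next
  case False
  have u [simp]: "k = i \<or> k \<in> J \<Longrightarrow> u k \<in> carrier M" for k using P by (auto simp: generates_same_def)
  have bc: "k = i \<or> k \<in> J \<Longrightarrow> b k \<in> carrier D" for k using b by (auto simp: relation_def)
  have fD: "f \<in> carrier D" using bc[of i] f by auto
  obtain q r where qr: "q \<in> carrier D" "r \<in> carrier D" "b j = f \<otimes> q \<oplus> r" "r = \<zero> \<or> \<phi> r < \<phi> f"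
    using euclidean_function[of "b j" f] False f fD bc[of j] j by auto
  have "r = \<zero>"
  proof (rule ccontr)
    assume r: "r \<noteq> \<zero>"
    \<comment> \<open>\<open>f u\<^sub>i + (f q + r) u\<^sub>j = f (u\<^sub>i + q u\<^sub>j) + r u\<^sub>j\<close>\<close>
    let ?u = "u(i := u i \<oplus>\<^bsub>M\<^esub> q \<odot>\<^bsub>M\<^esub> u j)" and ?b = "b(j := r)"
    let ?L = "J - {j}"
    have ij: "i \<noteq> j" "insert j ?L = J" using j J by auto
    have uj: "u j \<in> span_of J u"
    proof -
      have "lincomb M J u (unit_vec D J j) = u j"
        using j J by (intro lincomb_unit_vec[OF module_axioms]) auto
      moreover have "lincomb M J u (unit_vec D J j) \<in> span_of J u" by (intro span_ofI) auto
      ultimately show ?thesis by simp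
    qed
    have "q \<odot>\<^bsub>M\<^esub> u j \<in> span_of J u" using uj qr(1) J by (intro span_smult) auto
    then have "span_of (insert i J) ?u = span_of (insert i J) u"
      using J by (intro span_shift) auto
    then have P': "generates_same (insert i J) w ?u"
      using P qr j by (auto simp: generates_same_def)
    have tail: "lincomb M J u' b' = b' j \<odot>\<^bsub>M\<^esub> u' j \<oplus>\<^bsub>M\<^esub> lincomb M ?L u' b'"
      if "\<And>k. k \<in> J \<Longrightarrow> u' k \<in> carrier M" "\<And>k. k \<in> J \<Longrightarrow> b' k \<in> carrier D" for u' b'
      using lincomb_insert[of ?L j u' b'] that J j unfolding ij by auto
    have L: "lincomb M ?L ?u ?b = lincomb M ?L u b"
      using J bc by (intro lincomb_cong') auto
    have Lc: "lincomb M ?L u b \<in> carrier M" using bc by (intro lincomb_closed[OF module_axioms]) auto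
    have "lincomb M (insert i J) ?u ?b = ?b i \<odot>\<^bsub>M\<^esub> ?u i \<oplus>\<^bsub>M\<^esub> lincomb M J ?u ?b"
      using J bc qr j by (intro lincomb_insert) auto
    also have "lincomb M J ?u ?b = ?b j \<odot>\<^bsub>M\<^esub> ?u j \<oplus>\<^bsub>M\<^esub> lincomb M ?L ?u ?b"
      using J bc qr j by (intro tail) auto
    also have "?b i \<odot>\<^bsub>M\<^esub> ?u i \<oplus>\<^bsub>M\<^esub> (?b j \<odot>\<^bsub>M\<^esub> ?u j \<oplus>\<^bsub>M\<^esub> lincomb M ?L ?u ?b)
        = f \<odot>\<^bsub>M\<^esub> u i \<oplus>\<^bsub>M\<^esub> (b j \<odot>\<^bsub>M\<^esub> u j \<oplus>\<^bsub>M\<^esub> lincomb M ?L u b)"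
      unfolding L qr(3) using ij f fD qr j Lc
      by (simp add: smult_r_distr smult_l_distr smult_assoc1 M.a_assoc)
    also have "\<dots> = lincomb M (insert i J) u b"
      using J bc f by (subst lincomb_insert) (auto simp: tail)
    also have "\<dots> = \<zero>\<^bsub>M\<^esub>" using b by (simp add: relation_def)
    finally have "lincomb M (insert i J) ?u ?b = \<zero>\<^bsub>M\<^esub>" .
    moreover have "\<forall>k\<in>insert i J. ?b k \<in> carrier D" using bc qr by auto
    ultimately have "relation (insert i J) ?u ?b"
      unfolding relation_def by (intro conjI)
    from min[OF P' this, of j] j r qr show False by auto
  qed
  then show ?thesis using qr fD unfolding factor_def by auto
qed

text \<open>The structure theorem: the cyclic modules generated by the \<open>u i\<close> are independent, and \<open>f i\<close> generates the annihilator of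
\<open>u i\<close>. The number of generators is kept, so some \<open>f i\<close> may be units. The proof splits off one generator,
killed by a minimal nonzero coefficient of a relation, and proceeds by induction on the number of generators.\<close>

lemma invariant_factors:
  assumes "finite I" and "\<And>i. i \<in> I \<Longrightarrow> w i \<in> carrier M"
  shows "\<exists>u f is. generates_same I w u \<and> (\<forall>i\<in>I. f i \<in> carrier D \<and> f i \<odot>\<^bsub>M\<^esub> u i = \<zero>\<^bsub>M\<^esub>) \<and>
    (\<forall>b. relation I u b \<longrightarrow> (\<forall>i\<in>I. f i divides b i)) \<and>
    distinct is \<and> set is = I \<and> sorted_wrt (\<lambda>i j. f i divides f j) is"
  using assms
proof (induction "card I" arbitrary: I w)
  case 0
  then have "I = {}" by simp
  then show ?case by (auto simp: generates_same_def)
next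
  case (Suc n)
  show ?case
  proof (cases "\<exists>u b i. generates_same I w u \<and> relation I u b \<and> i \<in> I \<and> b i \<noteq> \<zero>")
    \<comment> \<open>Every relation is trivial, and all \<open>f i\<close> are zero.\<close>
    case False
    obtain "is" where "is": "distinct is" "set is = I" using finite_distinct_list[OF Suc(3)] by blast
    have "sorted_wrt (\<lambda>i j. \<zero> divides \<zero>) is"
      using divides_zero[of \<zero>] by (simp add: sorted_wrt_iff_nth_less)
    moreover have "generates_same I w w" using Suc(4) by (simp add: generates_same_def)
    moreover have "\<zero> divides b i" if "relation I w b" "i \<in> I" for b i
    proof -
      have "b i = \<zero>" using False that \<open>generates_same I w w\<close> by blast
      then show ?thesis by (simp add: divides_zero)
    qed
    ultimately show ?thesis
      using "is" Suc(4) by (intro exI[of _ w] exI[of _ "\<lambda>_. \<zero>"] exI[of _ "is"]) simp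
  next
    case True
    \<comment> \<open>The smallest value of the Euclidean function on nonzero coefficients of relations, over all systems of
      \<open>card I\<close> generators.\<close>
    define m where "m = (LEAST m. \<exists>u b i. generates_same I w u \<and> relation I u b \<and> i \<in> I \<and> b i \<noteq> \<zero> \<and> \<phi> (b i) = m)"
    have "\<exists>u b i. generates_same I w u \<and> relation I u b \<and> i \<in> I \<and> b i \<noteq> \<zero> \<and> \<phi> (b i) = m"
      unfolding m_def by (rule LeastI_ex) (use True in blast)
    then obtain u0 b0 i where u0: "generates_same I w u0" "relation I u0 b0" "i \<in> I" "b0 i \<noteq> \<zero>" "\<phi> (b0 i) = m"
      by blast
    define f where "f = b0 i"
    define J where "J = I - {i}"
    have IJ: "I = insert i J" "i \<notin> J" "finite J" using u0(3) Suc(3) by (auto simp: J_def)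
    have fD [simp]: "f \<in> carrier D" and f0: "f \<noteq> \<zero>" using u0 by (auto simp: f_def relation_def)
    have min: "\<phi> f \<le> \<phi> (b k)" if "generates_same (insert i J) w u'" "relation (insert i J) u' b" "k \<in> insert i J" "b k \<noteq> \<zero>" for u' b k
      unfolding f_def u0(5) m_def by (rule Least_le) (use that IJ in blast)
    have first: "f divides b j"
      if "generates_same I w u" "relation I u b" "b i = f" "j \<in> J" for u b j
    proof (rule minimal_coefficient_divides[where w = w and u = u and i = i and J = J])
      fix u' b k assume "generates_same (insert i J) w u'" "relation (insert i J) u' b" "k \<in> insert i J" "b k \<noteq> \<zero>"
      then show "\<phi> f \<le> \<phi> (b k)" by (rule min)
    qed (use that IJ f0 in auto)
    have div: "\<exists>c\<in>carrier D. b0 j = f \<otimes> c" if "j \<in> J" for j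
      using first[OF u0(1,2) f_def[symmetric] that] by (auto simp: factor_def)
    define c where "c j = (SOME c. c \<in> carrier D \<and> b0 j = f \<otimes> c)" for j
    have c: "c j \<in> carrier D" "b0 j = f \<otimes> c j" if "j \<in> J" for j
      using someI_ex[of "\<lambda>c. c \<in> carrier D \<and> b0 j = f \<otimes> c"] div[OF that] unfolding c_def by blast+
    have b0c: "k = i \<or> k \<in> J \<Longrightarrow> b0 k \<in> carrier D" for k using u0(2) IJ by (auto simp: relation_def)
    have u0c: "k = i \<or> k \<in> J \<Longrightarrow> u0 k \<in> carrier M" for k using u0(1) IJ by (auto simp: generates_same_def)
    \<comment> \<open>All coefficients of the minimal relation are multiples of \<open>f\<close>, so \<open>f\<close> kills \<open>u0 i + (\<Sum>j\<in>J. c j u0 j)\<close>.\<close>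
    define z where "z = lincomb M J u0 c"
    define u1 where "u1 = u0(i := u0 i \<oplus>\<^bsub>M\<^esub> z)"
    have zspan: "z \<in> span_of J u0" unfolding z_def using u0c c by (intro span_ofI) auto
    have z: "z \<in> carrier M" unfolding z_def using u0c c by (intro lincomb_closed[OF module_axioms]) auto
    have u1c: "k = i \<or> k \<in> J \<Longrightarrow> u1 k \<in> carrier M" for k using u0c z by (auto simp: u1_def)
    have "span_of (insert i J) u1 = span_of (insert i J) u0"
      unfolding u1_def using IJ u0c zspan by (intro span_shift) auto
    then have P1: "generates_same I w u1"
      using u0(1) u1c IJ by (auto simp: generates_same_def)
    have "f \<odot>\<^bsub>M\<^esub> z = lincomb M J u0 b0"
      unfolding z_def lincomb_def using IJ c u0c
      by (subst finsum_smult_ldistr) (auto simp: smult_assoc1 intro!: M.finsum_cong')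
    then have fu1: "f \<odot>\<^bsub>M\<^esub> u1 i = \<zero>\<^bsub>M\<^esub>"
      using u0(2) lincomb_insert[OF IJ(3,2), of u0 b0] u0c b0c z unfolding IJ(1)
      by (auto simp: u1_def smult_r_distr relation_def f_def)
    \<comment> \<open>Coefficients at \<open>i\<close> may be changed by multiples of \<open>f\<close> without changing the sum. So any relation can be given
      the coefficient \<open>f\<close> at \<open>i\<close>, and then minimality applies to the other coefficients.\<close>
    have all: "f divides b k" if P: "generates_same I w u" and ui: "u i = u1 i" and b: "relation I u b" and k: "k \<in> I" for u b k
    proof -
      have uc: "k = i \<or> k \<in> J \<Longrightarrow> u k \<in> carrier M" for k using P IJ by (auto simp: generates_same_def)
      have bc: "k = i \<or> k \<in> J \<Longrightarrow> b k \<in> carrier D" for k using b IJ by (auto simp: relation_def)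
      have rel: "relation I u (b(i := r))" if r: "r \<in> carrier D" "r \<odot>\<^bsub>M\<^esub> u i = b i \<odot>\<^bsub>M\<^esub> u i" for r
      proof -
        have "lincomb M J u (b(i := r)) = lincomb M J u b" using IJ uc bc by (intro lincomb_cong') auto
        then have "lincomb M I u (b(i := r)) = lincomb M I u b"
          unfolding IJ(1) using IJ uc bc r by (subst (1 2) lincomb_insert) auto
        then show ?thesis using b r by (auto simp: relation_def)
      qed
      have fi: "f divides b i"
      proof (cases "b i = \<zero>")
        case True then show ?thesis by (simp add: divides_zero)
      next
        case False
        obtain q r where qr: "q \<in> carrier D" "r \<in> carrier D" "b i = f \<otimes> q \<oplus> r" "r = \<zero> \<or> \<phi> r < \<phi> f"
          using euclidean_function[of "b i" f] False f0 bc[of i] by auto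
        have "(f \<otimes> q) \<odot>\<^bsub>M\<^esub> u i = \<zero>\<^bsub>M\<^esub>"
          using qr fu1 uc[of i] ui m_comm[of f q] by (simp add: smult_assoc1)
        then have "r \<odot>\<^bsub>M\<^esub> u i = b i \<odot>\<^bsub>M\<^esub> u i"
          unfolding qr(3) using qr uc[of i] by (simp add: smult_l_distr)
        then have "relation (insert i J) u (b(i := r))" using rel[OF qr(2)] IJ(1) by simp
        from min[OF P[unfolded IJ(1)] this, of i] have "r \<noteq> \<zero> \<Longrightarrow> \<phi> f \<le> \<phi> r" by simp
        then have "r = \<zero>" using qr(4) by (metis not_less)
        then show ?thesis using qr by (auto simp: factor_def)
      qed
      then obtain d where d: "d \<in> carrier D" "b i = f \<otimes> d" by (auto simp: factor_def)
      have bu: "f \<odot>\<^bsub>M\<^esub> u i = b i \<odot>\<^bsub>M\<^esub> u i"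
        unfolding d using d fu1 ui uc[of i] m_comm[of f d] by (simp add: smult_assoc1)
      show ?thesis
      proof (cases "k = i")
        case True with fi show ?thesis by simp
      next
        case False
        then have "k \<in> J" using k IJ by auto
        from first[OF P rel[OF fD bu] _ this] show ?thesis using False by simp
      qed
    qed
    have cJ: "n = card J" using Suc(2) IJ by simp
    obtain u2 f2 is2 where ih: "generates_same J u1 u2"
      "\<And>j. j \<in> J \<Longrightarrow> f2 j \<in> carrier D" "\<And>j. j \<in> J \<Longrightarrow> f2 j \<odot>\<^bsub>M\<^esub> u2 j = \<zero>\<^bsub>M\<^esub>"
      "\<And>b j. relation J u2 b \<Longrightarrow> j \<in> J \<Longrightarrow> f2 j divides b j"
      "distinct is2" "set is2 = J" "sorted_wrt (\<lambda>i j. f2 i divides f2 j) is2"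
      using Suc(1)[OF cJ IJ(3), of u1] u1c by blast
    define u3 where "u3 = u2(i := u1 i)"
    define f3 where "f3 = f2(i := f)"
    have u2c: "j \<in> J \<Longrightarrow> u2 j \<in> carrier M" for j using ih(1) by (auto simp: generates_same_def)
    have u3c: "j = i \<or> j \<in> J \<Longrightarrow> u3 j \<in> carrier M" for j using u2c u1c by (auto simp: u3_def)
    have s32: "span_of J u3 = span_of J u2" using u2c IJ by (intro span_cong) (auto simp: u3_def)
    have "span_of (insert i J) u3 = span_of (insert i J) u1"
      using span_insert[of J u3 i] span_insert[of J u1 i] IJ u3c u1c ih(1) s32
      by (simp add: generates_same_def u3_def)
    then have P3: "generates_same I w u3"
      using P1 u3c unfolding IJ(1) by (auto simp: generates_same_def)
    have u3i: "u3 i = u1 i" by (simp add: u3_def)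
    have rel3: "f3 k divides b k" if b: "relation I u3 b" and k: "k \<in> I" for b k
    proof (cases "k = i")
      case True then show ?thesis using all[OF P3 u3i b k] by (simp add: f3_def)
    next
      case False
      have bc: "k = i \<or> k \<in> J \<Longrightarrow> b k \<in> carrier D" for k using b IJ by (auto simp: relation_def)
      obtain d where d: "d \<in> carrier D" "b i = f \<otimes> d" using all[OF P3 u3i b u0(3)] by (auto simp: factor_def)
      have "b i \<odot>\<^bsub>M\<^esub> u3 i = \<zero>\<^bsub>M\<^esub>"
        unfolding d u3i using d fu1 u1c[of i] m_comm[of f d] by (simp add: smult_assoc1)
      moreover have "lincomb M J u3 b = lincomb M J u2 b"
        using IJ u2c bc by (intro lincomb_cong') (auto simp: u3_def)
      moreover have "lincomb M J u2 b \<in> carrier M" using u2c bc by (intro lincomb_closed[OF module_axioms]) auto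
      ultimately have "lincomb M J u2 b = \<zero>\<^bsub>M\<^esub>"
        using b lincomb_insert[OF IJ(3,2), of u3 b] u3c bc unfolding IJ(1) by (auto simp: relation_def)
      then have "relation J u2 b" using bc by (auto simp: relation_def)
      then show ?thesis using ih(4)[of b k] k False IJ by (auto simp: f3_def)
    qed
    \<comment> \<open>\<open>f2 j\<close> alone is a coefficient of the relation \<open>f2 j u\<^sub>j = 0\<close>.\<close>
    have f_div: "f divides f2 j" if j: "j \<in> J" for j
    proof -
      let ?b = "\<lambda>k. if k = j then f2 j else \<zero>"
      have "lincomb M I u3 ?b = (\<Oplus>\<^bsub>M\<^esub>k\<in>I. if j = k then f2 j \<odot>\<^bsub>M\<^esub> u3 k else \<zero>\<^bsub>M\<^esub>)"
        unfolding lincomb_def using u3c ih(2)[OF j] IJ by (intro M.finsum_cong') auto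
      also have "\<dots> = f2 j \<odot>\<^bsub>M\<^esub> u3 j"
        using u3c ih(2)[OF j] IJ j by (intro M.finsum_singleton) auto
      also have "\<dots> = \<zero>\<^bsub>M\<^esub>" using ih(3)[OF j] j IJ by (auto simp: u3_def)
      finally have "relation I u3 ?b" using ih(2)[OF j] by (auto simp: relation_def)
      from all[OF P3 u3i this, of j] j IJ show ?thesis by auto
    qed
    have "sorted_wrt (\<lambda>i j. f3 i divides f3 j) (i # is2)"
    proof -
      have "sorted_wrt (\<lambda>i j. f3 i divides f3 j) is2"
        by (rule sorted_wrt_mono_rel[OF _ ih(7)]) (use ih(6) IJ in \<open>auto simp: f3_def\<close>)
      moreover have "f3 i divides f3 j" if "j \<in> set is2" for j
        using f_div[of j] that ih(6) IJ by (auto simp: f3_def)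
      ultimately show ?thesis by simp
    qed
    moreover have "distinct (i # is2)" "set (i # is2) = I" using ih(5,6) IJ by auto
    moreover have "f3 k \<in> carrier D \<and> f3 k \<odot>\<^bsub>M\<^esub> u3 k = \<zero>\<^bsub>M\<^esub>" if "k \<in> I" for k
      using that IJ ih(2,3) fu1 by (auto simp: f3_def u3_def)
    ultimately show ?thesis
      using P3 rel3 by (intro exI[of _ u3] exI[of _ f3] exI[of _ "i # is2"]) blast
  qed
qed

end

section \<open>Reduction modulo an ideal of square zero\<close>

locale residue_setup = cring R for R (structure) +
  fixes P :: "'a set"
  assumes max: "maximalideal P R" and sq: "P \<cdot>\<^bsub>R\<^esub> P = {\<zero>\<^bsub>R\<^esub>}"
begin

abbreviation "K \<equiv> R Quot P"

definition res :: "'a \<Rightarrow> 'a set" where "res x = P +>\<^bsub>R\<^esub> x"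

sublocale K: field "R Quot P"
  by (rule maximalideal.quotient_is_field[OF max is_cring])

lemma P_ideal: "ideal P R" using max by (rule maximalideal.axioms)

lemma P_carrier: "p \<in> P \<Longrightarrow> p \<in> carrier R"
  using ideal.Icarr[OF P_ideal] .

lemma P_mult: "p \<in> P \<Longrightarrow> q \<in> P \<Longrightarrow> p \<otimes> q = \<zero>"
  using ideal_prod.prod[of p P q P R] sq by simp

lemma res_hom: "res \<in> ring_hom R K"
  unfolding res_def[abs_def] by (rule ideal.rcos_ring_hom[OF P_ideal])

lemma res_simps [simp]:
  "x \<in> carrier R \<Longrightarrow> res x \<in> carrier K"
  "x \<in> carrier R \<Longrightarrow> y \<in> carrier R \<Longrightarrow> res (x \<oplus> y) = res x \<oplus>\<^bsub>K\<^esub> res y"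
  "x \<in> carrier R \<Longrightarrow> y \<in> carrier R \<Longrightarrow> res (x \<otimes> y) = res x \<otimes>\<^bsub>K\<^esub> res y"
  "res \<one> = \<one>\<^bsub>K\<^esub>"
  using ring_hom_closed[OF res_hom] ring_hom_add[OF res_hom] ring_hom_mult[OF res_hom] ring_hom_one[OF res_hom]
  by simp_all

lemma res_eq_zero_iff: "x \<in> carrier R \<Longrightarrow> res x = \<zero>\<^bsub>K\<^esub> \<longleftrightarrow> x \<in> P"
proof -
  interpret P: ideal P R by (rule P_ideal)
  assume x: "x \<in> carrier R"
  show ?thesis
    unfolding res_def FactRing_def using x P.a_rcos_const[of x] P.a_rcos_self[of x] by auto
qed

lemma res_zero [simp]: "res \<zero> = \<zero>\<^bsub>K\<^esub>"
  using res_eq_zero_iff[of \<zero>] additive_subgroup.zero_closed[OF ideal.axioms(1)[OF P_ideal]] by simp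

lemma res_surj: "a \<in> carrier K \<Longrightarrow> \<exists>x\<in>carrier R. res x = a"
  unfolding FactRing_def A_RCOSETS_def RCOSETS_def res_def a_r_coset_def by auto

definition lift_elem :: "'a set \<Rightarrow> 'a" where "lift_elem a = (SOME x. x \<in> carrier R \<and> res x = a)"

lemma lift_elem: "a \<in> carrier K \<Longrightarrow> lift_elem a \<in> carrier R" "a \<in> carrier K \<Longrightarrow> res (lift_elem a) = a"
  using someI_ex[of "\<lambda>x. x \<in> carrier R \<and> res x = a"] res_surj[of a] unfolding lift_elem_def by blast+

lemma res_finsum: "f \<in> A \<rightarrow> carrier R \<Longrightarrow> res (finsum R f A) = (\<Oplus>\<^bsub>K\<^esub>a\<in>A. res (f a))"
  by (rule additive_finsum) (auto intro: abelian_group_axioms K.abelian_group_axioms)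

lemma P_space_smult:
  assumes r: "r \<in> carrier R" and p: "p \<in> P"
  shows "res r \<odot>\<^bsub>ideal_space R P\<^esub> p = r \<otimes> p"
proof -
  interpret P: ideal P R by (rule P_ideal)
  have "(\<lambda>r. r \<otimes> p) ` (res r) = {r \<otimes> p}"
  proof (intro Set.set_eqI iffI)
    fix x assume "x \<in> (\<lambda>r. r \<otimes> p) ` (res r)"
    then obtain q where q: "q \<in> P" "x = (q \<oplus> r) \<otimes> p"
      unfolding res_def a_r_coset_def' by auto
    then show "x \<in> {r \<otimes> p}" using r p by (simp add: l_distr P_carrier P_mult)
  next
    fix x assume "x \<in> {r \<otimes> p}"
    then show "x \<in> (\<lambda>r. r \<otimes> p) ` (res r)"
      using P.a_rcos_self[OF r] unfolding res_def by auto
  qed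
  then show ?thesis by (simp add: ideal_space_def)
qed

lemma P_space_simps [simp]:
  "carrier (ideal_space R P) = P"
  "\<zero>\<^bsub>ideal_space R P\<^esub> = \<zero>"
  "x \<oplus>\<^bsub>ideal_space R P\<^esub> y = x \<oplus> y"
  by (simp_all add: ideal_space_def)

lemma P_closed:
  "\<zero> \<in> P" "p \<in> P \<Longrightarrow> q \<in> P \<Longrightarrow> p \<oplus> q \<in> P" "p \<in> P \<Longrightarrow> \<ominus> p \<in> P"
  "r \<in> carrier R \<Longrightarrow> p \<in> P \<Longrightarrow> r \<otimes> p \<in> P" "r \<in> carrier R \<Longrightarrow> p \<in> P \<Longrightarrow> p \<otimes> r \<in> P"
proof -
  interpret P: ideal P R by (rule P_ideal)
  show "\<zero> \<in> P" "p \<in> P \<Longrightarrow> q \<in> P \<Longrightarrow> p \<oplus> q \<in> P" "p \<in> P \<Longrightarrow> \<ominus> p \<in> P"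
    "r \<in> carrier R \<Longrightarrow> p \<in> P \<Longrightarrow> r \<otimes> p \<in> P" "r \<in> carrier R \<Longrightarrow> p \<in> P \<Longrightarrow> p \<otimes> r \<in> P"
    by (auto intro: P.I_l_closed P.I_r_closed)
qed

lemma P_space_smult_closed: "a \<in> carrier K \<Longrightarrow> p \<in> P \<Longrightarrow> a \<odot>\<^bsub>ideal_space R P\<^esub> p \<in> P"
  using P_space_smult[of "lift_elem a" p] lift_elem[of a] P_closed(4)[of "lift_elem a" p] by simp

definition redv :: "'i set \<Rightarrow> ('i \<Rightarrow> 'a) \<Rightarrow> 'i \<Rightarrow> 'a set" where
  "redv I x = (\<lambda>i\<in>I. res (x i))"

abbreviation residue_space :: "'i set \<Rightarrow> ('a, 'i \<Rightarrow> 'a set) module" where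
  "residue_space I \<equiv> restrict_scalars res (free_on K I)"

lemma residue_space_module: "module R (residue_space I)"
  by (rule restrict_scalars_module[OF is_cring K.free_on_module res_hom])

lemma redv_closed: "x \<in> I \<rightarrow>\<^sub>E carrier R \<Longrightarrow> redv I x \<in> I \<rightarrow>\<^sub>E carrier K"
  unfolding redv_def by (auto dest: PiE_app)

lemma redv_hom: "redv I \<in> mod_hom R (free_on R I) (residue_space I)"
proof (rule mod_homI)
  fix x y assume xy: "x \<in> carrier (free_on R I)" "y \<in> carrier (free_on R I)"
  note [simp] = PiE_app[OF xy(1)[unfolded free_on_simps(1)]] PiE_app[OF xy(2)[unfolded free_on_simps(1)]]
  show "redv I (x \<oplus>\<^bsub>free_on R I\<^esub> y) = redv I x \<oplus>\<^bsub>residue_space I\<^esub> redv I y"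
    by (auto simp: redv_def intro!: restrict_ext)
next
  fix a x assume a: "a \<in> carrier R" and x: "x \<in> carrier (free_on R I)"
  note [simp] = PiE_app[OF x[unfolded free_on_simps(1)]]
  show "redv I (a \<odot>\<^bsub>free_on R I\<^esub> x) = a \<odot>\<^bsub>residue_space I\<^esub> redv I x"
    using a by (auto simp: redv_def intro!: restrict_ext)
qed (use redv_closed in simp)

lemma redv_surj:
  assumes "v \<in> I \<rightarrow>\<^sub>E carrier K"
  shows "\<exists>x\<in>I \<rightarrow>\<^sub>E carrier R. redv I x = v"
proof (rule bexI[of _ "\<lambda>i\<in>I. lift_elem (v i)"])
  show "redv I (\<lambda>i\<in>I. lift_elem (v i)) = v"
    unfolding redv_def using PiE_app[OF assms] by (intro restrict_eqI[OF assms]) (simp add: lift_elem)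
  show "(\<lambda>i\<in>I. lift_elem (v i)) \<in> I \<rightarrow>\<^sub>E carrier R"
    using PiE_app[OF assms] lift_elem(1) by (simp add: restrict_PiE_iff)
qed

lemma redv_kernel:
  assumes "x \<in> I \<rightarrow>\<^sub>E carrier R"
  shows "redv I x = \<zero>\<^bsub>free_on K I\<^esub> \<longleftrightarrow> x \<in> I \<rightarrow>\<^sub>E P"
proof -
  have "redv I x = \<zero>\<^bsub>free_on K I\<^esub> \<longleftrightarrow> (\<forall>i\<in>I. res (x i) = \<zero>\<^bsub>K\<^esub>)"
  proof
    assume eq: "redv I x = \<zero>\<^bsub>free_on K I\<^esub>"
    show "\<forall>i\<in>I. res (x i) = \<zero>\<^bsub>K\<^esub>"
    proof
      fix i assume "i \<in> I"
      with fun_cong[OF eq, of i] show "res (x i) = \<zero>\<^bsub>K\<^esub>" by (simp add: redv_def)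
    qed
  qed (simp add: redv_def cong: restrict_cong)
  also have "\<dots> \<longleftrightarrow> (\<forall>i\<in>I. x i \<in> P)" using PiE_app[OF assms] res_eq_zero_iff by auto
  also have "\<dots> \<longleftrightarrow> x \<in> I \<rightarrow>\<^sub>E P" using assms by (simp add: PiE_iff)
  finally show ?thesis .
qed

lemma hom_kills_P:
  assumes E: "module R E" and f: "f \<in> mod_hom R (free_on R I) E" and I: "finite I"
    and x: "x \<in> I \<rightarrow>\<^sub>E P" and Q: "\<And>p i. p \<in> P \<Longrightarrow> i \<in> I \<Longrightarrow> p \<odot>\<^bsub>E\<^esub> f (unit_vec R I i) = \<zero>\<^bsub>E\<^esub>"
  shows "f x = \<zero>\<^bsub>E\<^esub>"
proof -
  interpret E: module R E by fact
  have xR: "x \<in> I \<rightarrow>\<^sub>E carrier R" using x P_carrier by (auto simp: PiE_iff)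
  show ?thesis
    unfolding hom_eq_lincomb[OF E f I xR] lincomb_def
    using PiE_app[OF x] Q by (intro E.M.add.finprod_one_eqI) simp
qed

lemma P_smult_P_vec:
  assumes "p \<in> P" "x \<in> I \<rightarrow>\<^sub>E P"
  shows "p \<odot>\<^bsub>free_on R I\<^esub> x = \<zero>\<^bsub>free_on R I\<^esub>"
  using PiE_app[OF assms(2)] assms(1) by (auto simp: P_mult intro!: restrict_ext)

text \<open>An endomorphism \<open>1 + \<nu>\<close> with \<open>\<nu>\<close> zero modulo \<open>P\<close> has the inverse \<open>1 - \<nu>\<close>, as \<open>\<nu>\<close> also kills
the vectors over \<open>P\<close>.\<close>

lemma congruent_one_bij:
  assumes I: "finite I" and f: "f \<in> mod_hom R (free_on R I) (free_on R I)"
    and cong: "\<And>x. x \<in> I \<rightarrow>\<^sub>E carrier R \<Longrightarrow> redv I (f x) = redv I x"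
  shows "bij_betw f (I \<rightarrow>\<^sub>E carrier R) (I \<rightarrow>\<^sub>E carrier R)"
proof -
  let ?E = "free_on R I"
  interpret E: module R ?E by (rule free_on_module)
  have fc: "f x \<in> carrier ?E" if "x \<in> carrier ?E" for x using mod_hom_closed[OF f that] .
  define \<nu> where "\<nu> x = f x \<ominus>\<^bsub>?E\<^esub> x" for x
  have \<nu>c: "\<nu> x \<in> carrier ?E" if "x \<in> carrier ?E" for x
    unfolding \<nu>_def by (rule E.M.minus_closed[OF fc[OF that] that])
  have \<nu>P: "\<nu> x \<in> I \<rightarrow>\<^sub>E P" if x: "x \<in> carrier ?E" for x
  proof -
    interpret W: module R "residue_space I" by (rule residue_space_module)
    have "redv I (\<nu> x) = redv I (f x) \<ominus>\<^bsub>residue_space I\<^esub> redv I x"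
      unfolding \<nu>_def by (rule mod_hom_diff[OF E.module_axioms W.module_axioms redv_hom fc[OF x] x])
    also have "\<dots> = \<zero>\<^bsub>residue_space I\<^esub>"
      using cong[of x] x mod_hom_closed[OF redv_hom x] unfolding a_minus_def free_on_simps(1)
      by (simp only: W.M.r_neg)
    finally show ?thesis
      using redv_kernel[of "\<nu> x" I] \<nu>c[OF x] by simp
  qed
  have \<nu>_hom: "\<nu> \<in> mod_hom R ?E ?E"
  proof (rule mod_homI)
    show "\<nu> x \<in> carrier ?E" if "x \<in> carrier ?E" for x by (rule \<nu>c[OF that])
    show "\<nu> (x \<oplus>\<^bsub>?E\<^esub> y) = \<nu> x \<oplus>\<^bsub>?E\<^esub> \<nu> y" if "x \<in> carrier ?E" "y \<in> carrier ?E" for x y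
      unfolding \<nu>_def a_minus_def using that fc
      by (simp add: mod_hom_add[OF f] E.M.minus_add E.M.a_ac del: free_on_simps)
    show "\<nu> (a \<odot>\<^bsub>?E\<^esub> x) = a \<odot>\<^bsub>?E\<^esub> \<nu> x" if "a \<in> carrier R" "x \<in> carrier ?E" for a x
      unfolding \<nu>_def a_minus_def using that fc
      by (simp add: mod_hom_smult[OF f] E.smult_r_distr E.smult_r_minus del: free_on_simps)
  qed
  have \<nu>0: "\<nu> x = \<zero>\<^bsub>?E\<^esub>" if "x \<in> I \<rightarrow>\<^sub>E P" for x
    using \<nu>P[of "unit_vec R I i" for i]
    by (intro hom_kills_P[OF E.module_axioms \<nu>_hom I that] P_smult_P_vec) simp_all
  have fx: "f x = x \<oplus>\<^bsub>?E\<^esub> \<nu> x" if "x \<in> carrier ?E" for x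
    unfolding \<nu>_def a_minus_def using that fc
    by (simp add: E.M.a_lcomm[of x "f x"] E.M.r_neg del: free_on_simps)
  have inj: "x = y" if xy: "x \<in> carrier ?E" "y \<in> carrier ?E" "f x = f y" for x y
  proof -
    define d where "d = x \<ominus>\<^bsub>?E\<^esub> y"
    have d: "d \<in> carrier ?E" unfolding d_def by (rule E.M.minus_closed[OF xy(1,2)])
    have "f d = f x \<ominus>\<^bsub>?E\<^esub> f y"
      unfolding d_def by (rule mod_hom_diff[OF E.module_axioms E.module_axioms f xy(1,2)])
    also have "\<dots> = \<zero>\<^bsub>?E\<^esub>" unfolding xy(3) a_minus_def by (rule E.M.r_neg[OF fc[OF xy(2)]])
    finally have 0: "d \<oplus>\<^bsub>?E\<^esub> \<nu> d = \<zero>\<^bsub>?E\<^esub>" unfolding fx[OF d] .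
    have "\<nu> d = \<nu> d \<oplus>\<^bsub>?E\<^esub> \<nu> (\<nu> d)"
      unfolding \<nu>0[OF \<nu>P[OF d]] by (rule E.M.r_zero[OF \<nu>c[OF d], symmetric])
    also have "\<dots> = \<nu> (d \<oplus>\<^bsub>?E\<^esub> \<nu> d)" by (rule mod_hom_add[OF \<nu>_hom d \<nu>c[OF d], symmetric])
    also have "\<dots> = \<zero>\<^bsub>?E\<^esub>"
      unfolding 0 by (rule mod_hom_zero[OF E.module_axioms E.module_axioms \<nu>_hom])
    finally have "d = \<zero>\<^bsub>?E\<^esub>" using 0 E.M.r_zero[OF d] by (simp del: free_on_simps)
    moreover have "x = d \<oplus>\<^bsub>?E\<^esub> y"
      unfolding d_def a_minus_def using xy(1,2) by (simp add: E.M.a_assoc E.M.l_neg del: free_on_simps)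
    ultimately show ?thesis using E.M.l_zero[OF xy(2)] by simp
  qed
  \<comment> \<open>\<open>f (y - \<nu> y) = y\<close>\<close>
  have surj: "\<exists>x\<in>carrier ?E. f x = y" if y: "y \<in> carrier ?E" for y
  proof (rule bexI[of _ "y \<ominus>\<^bsub>?E\<^esub> \<nu> y"])
    have "f (y \<ominus>\<^bsub>?E\<^esub> \<nu> y) = f y \<ominus>\<^bsub>?E\<^esub> f (\<nu> y)"
      by (rule mod_hom_diff[OF E.module_axioms E.module_axioms f y \<nu>c[OF y]])
    also have "f (\<nu> y) = \<nu> y"
      using fx[OF \<nu>c[OF y]] \<nu>0[OF \<nu>P[OF y]] E.M.r_zero[OF \<nu>c[OF y]] by simp
    also have "f y \<ominus>\<^bsub>?E\<^esub> \<nu> y = y"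
      unfolding fx[OF y] a_minus_def using y \<nu>c[OF y]
      by (simp add: E.M.a_assoc E.M.r_neg del: free_on_simps)
    finally show "f (y \<ominus>\<^bsub>?E\<^esub> \<nu> y) = y" .
    show "y \<ominus>\<^bsub>?E\<^esub> \<nu> y \<in> carrier ?E" by (rule E.M.minus_closed[OF y \<nu>c[OF y]])
  qed
  show ?thesis
    unfolding bij_betw_def
  proof
    show "inj_on f (I \<rightarrow>\<^sub>E carrier R)" using inj by (auto simp: inj_on_def)
    show "f ` (I \<rightarrow>\<^sub>E carrier R) = I \<rightarrow>\<^sub>E carrier R"
      using surj fc unfolding free_on_simps(1) by (auto simp: image_iff)
  qed
qed

end

section \<open>Monic polynomials and their lifts\<close>

definition monic_of_degree :: "('s, 'x) ring_scheme \<Rightarrow> nat \<Rightarrow> (nat \<Rightarrow> 's) \<Rightarrow> bool" where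
  "monic_of_degree S d p \<longleftrightarrow> p \<in> carrier (UP S) \<and> up_ring.coeff (UP S) p d = \<one>\<^bsub>S\<^esub> \<and>
    (\<forall>i>d. up_ring.coeff (UP S) p i = \<zero>\<^bsub>S\<^esub>)"

lemma (in cring) top_coeff_mult:
  assumes p: "p \<in> carrier (UP R)" "\<And>i. i > d \<Longrightarrow> up_ring.coeff (UP R) p i = \<zero>"
    and q: "q \<in> carrier (UP R)" "\<And>i. i > e \<Longrightarrow> up_ring.coeff (UP R) q i = \<zero>"
  shows "up_ring.coeff (UP R) (p \<otimes>\<^bsub>UP R\<^esub> q) (d + e) = up_ring.coeff (UP R) p d \<otimes> up_ring.coeff (UP R) q e"
    and "k > d + e \<Longrightarrow> up_ring.coeff (UP R) (p \<otimes>\<^bsub>UP R\<^esub> q) k = \<zero>"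
proof -
  interpret U: UP_cring R "UP R" by (rule UP_cring.intro) (rule is_cring)
  have z: "up_ring.coeff (UP R) p i \<otimes> up_ring.coeff (UP R) q (k - i) = \<zero>" if "k \<ge> d + e" "i \<le> k" "i \<noteq> d \<or> k > d + e" for i k
  proof (cases "i > d")
    case True then show ?thesis using p q by simp
  next
    case False
    then have "k - i > e" using that by auto
    then show ?thesis using p q by simp
  qed
  have "up_ring.coeff (UP R) (p \<otimes>\<^bsub>UP R\<^esub> q) (d + e)
      = (\<Oplus>i\<in>{..d + e}. if d = i then up_ring.coeff (UP R) p i \<otimes> up_ring.coeff (UP R) q (d + e - i) else \<zero>)"
    unfolding U.coeff_mult[OF p(1) q(1)] using p(1) q(1) z[of "d + e"] by (intro finsum_cong') auto
  also have "\<dots> = up_ring.coeff (UP R) p d \<otimes> up_ring.coeff (UP R) q (d + e - d)"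
    using p(1) q(1) by (intro finsum_singleton) auto
  finally show "up_ring.coeff (UP R) (p \<otimes>\<^bsub>UP R\<^esub> q) (d + e) = up_ring.coeff (UP R) p d \<otimes> up_ring.coeff (UP R) q e"
    by simp
  assume k: "k > d + e"
  show "up_ring.coeff (UP R) (p \<otimes>\<^bsub>UP R\<^esub> q) k = \<zero>"
    unfolding U.coeff_mult[OF p(1) q(1)] using z[of k] k by (intro add.finprod_one_eqI) auto
qed

lemma (in cring) monic_mult:
  assumes "monic_of_degree R d p" "monic_of_degree R e q"
  shows "monic_of_degree R (d + e) (p \<otimes>\<^bsub>UP R\<^esub> q)"
proof -
  interpret U: UP_cring R "UP R" by (rule UP_cring.intro) (rule is_cring)
  show ?thesis
    using assms top_coeff_mult[of p d q e] unfolding monic_of_degree_def by simp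
qed

lemma (in domain) monic_factor:
  assumes f: "monic_of_degree R d f" and fg: "monic_of_degree R m (f \<otimes>\<^bsub>UP R\<^esub> g)" and g: "g \<in> carrier (UP R)"
  shows "\<exists>e. monic_of_degree R e g"
proof -
  interpret U: UP_domain R "UP R" by (rule UP_domain.intro) (rule domain_axioms)
  have g0: "g \<noteq> \<zero>\<^bsub>UP R\<^esub>"
    using fg f by (auto simp: monic_of_degree_def)
  let ?e = "deg R g"
  have ge: "\<And>i. i > ?e \<Longrightarrow> up_ring.coeff (UP R) g i = \<zero>" using U.deg_aboveD[OF _ g] by auto
  have top: "up_ring.coeff (UP R) (f \<otimes>\<^bsub>UP R\<^esub> g) (d + ?e) = up_ring.coeff (UP R) g ?e"
    "\<And>k. k > d + ?e \<Longrightarrow> up_ring.coeff (UP R) (f \<otimes>\<^bsub>UP R\<^esub> g) k = \<zero>"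
    using top_coeff_mult[of f d g ?e] f g ge unfolding monic_of_degree_def by auto
  have nz: "up_ring.coeff (UP R) g ?e \<noteq> \<zero>" using U.lcoeff_nonzero[OF g0 g] .
  have "m = d + ?e"
  proof (rule ccontr)
    assume "m \<noteq> d + ?e"
    then consider "m < d + ?e" | "m > d + ?e" by linarith
    then show False
      using fg top nz one_not_zero by cases (auto simp: monic_of_degree_def)
  qed
  then have "up_ring.coeff (UP R) g ?e = \<one>" using top fg by (simp add: monic_of_degree_def)
  then show ?thesis using g ge by (auto simp: monic_of_degree_def)
qed

lemma (in field) monic_associate:
  assumes f: "f \<in> carrier (UP R)" "f \<noteq> \<zero>\<^bsub>UP R\<^esub>"
  shows "\<exists>g c c'. monic_of_degree R (deg R f) g \<and> c \<in> carrier (UP R) \<and> c' \<in> carrier (UP R) \<and>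
    g = c \<otimes>\<^bsub>UP R\<^esub> f \<and> f = c' \<otimes>\<^bsub>UP R\<^esub> g"
proof -
  interpret U: UP_domain R "UP R" by (rule UP_domain.intro) (rule domain_axioms)
  let ?l = "up_ring.coeff (UP R) f (deg R f)"
  have l: "?l \<in> carrier R - {\<zero>}" using U.lcoeff_nonzero[OF f(2,1)] f by simp
  then have i: "inv ?l \<in> carrier R" "inv ?l \<otimes> ?l = \<one>" "?l \<otimes> inv ?l = \<one>" using field_Units by auto
  let ?c = "up_ring.monom (UP R) (inv ?l) 0" and ?c' = "up_ring.monom (UP R) ?l 0"
  have g: "?c \<otimes>\<^bsub>UP R\<^esub> f = inv ?l \<odot>\<^bsub>UP R\<^esub> f" using i f by (intro U.monom_mult_is_smult) auto
  have "monic_of_degree R (deg R f) (inv ?l \<odot>\<^bsub>UP R\<^esub> f)"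
    unfolding monic_of_degree_def using i f U.deg_aboveD[OF _ f(1)] by auto
  moreover have "f = ?c' \<otimes>\<^bsub>UP R\<^esub> (inv ?l \<odot>\<^bsub>UP R\<^esub> f)"
    using i f l by (subst U.monom_mult_is_smult) (simp_all flip: U.UP_smult_assoc1)
  ultimately show ?thesis
    using i l f g by (intro exI[of _ "inv ?l \<odot>\<^bsub>UP R\<^esub> f"] exI[of _ ?c] exI[of _ ?c']) simp
qed

text \<open>Over a field the leading coefficient of the divisor is a unit, so pseudo-division becomes division.\<close>

lemma (in field) UP_euclidean: "euclidean_domain (UP R) (deg R)"
proof -
  interpret U: UP_domain R "UP R" by (rule UP_domain.intro) (rule domain_axioms)
  show ?thesis
  proof (rule domain.euclidean_domainI[OF U.UP_domain])
    fix a b assume "a \<in> carrier (UP R) - {\<zero>\<^bsub>UP R\<^esub>}" "b \<in> carrier (UP R) - {\<zero>\<^bsub>UP R\<^esub>}"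
    then have a: "a \<in> carrier (UP R)" and b: "b \<in> carrier (UP R)" "b \<noteq> \<zero>\<^bsub>UP R\<^esub>" by auto
    let ?l = "up_ring.coeff (UP R) b (deg R b)"
    obtain q r and k :: nat where qr: "q \<in> carrier (UP R)" "r \<in> carrier (UP R)"
      "?l [^] k \<odot>\<^bsub>UP R\<^esub> a = b \<otimes>\<^bsub>UP R\<^esub> q \<oplus>\<^bsub>UP R\<^esub> r" "r = \<zero>\<^bsub>UP R\<^esub> \<or> deg R r < deg R b"
      using U.long_div_theorem[OF b(1) a b(2)] by blast
    have "?l \<in> Units R" using U.lcoeff_nonzero[OF b(2,1)] b field_Units by simp
    then have lk: "?l [^] k \<in> Units R" by (rule Units_pow_closed)
    let ?i = "inv (?l [^] k)"
    have i: "?i \<in> carrier R" "?i \<otimes> ?l [^] k = \<one>" "?l [^] k \<in> carrier R" using lk by auto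
    have "a = ?i \<odot>\<^bsub>UP R\<^esub> (?l [^] k \<odot>\<^bsub>UP R\<^esub> a)"
      using i a by (simp flip: U.UP_smult_assoc1)
    also have "\<dots> = b \<otimes>\<^bsub>UP R\<^esub> (?i \<odot>\<^bsub>UP R\<^esub> q) \<oplus>\<^bsub>UP R\<^esub> ?i \<odot>\<^bsub>UP R\<^esub> r"
      unfolding qr(3) using i b qr by (simp add: U.UP_smult_r_distr U.UP_smult_assoc2 U.m_comm[of b])
    finally have "a = b \<otimes>\<^bsub>UP R\<^esub> (?i \<odot>\<^bsub>UP R\<^esub> q) \<oplus>\<^bsub>UP R\<^esub> ?i \<odot>\<^bsub>UP R\<^esub> r" .
    moreover have "?i \<odot>\<^bsub>UP R\<^esub> r = \<zero>\<^bsub>UP R\<^esub> \<or> deg R (?i \<odot>\<^bsub>UP R\<^esub> r) < deg R b"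
      using qr i U.deg_smult_decr[of ?i r] by auto
    ultimately show "\<exists>q r. q \<in> carrier (UP R) \<and> r \<in> carrier (UP R) \<and> a = b \<otimes>\<^bsub>UP R\<^esub> q \<oplus>\<^bsub>UP R\<^esub> r \<and>
      (r = \<zero>\<^bsub>UP R\<^esub> \<or> deg R r < deg R b)"
      using i qr U.UP_smult_closed by blast
  qed
qed

text \<open>Gaussian elimination: a variable with a nonzero coefficient in the last equation is eliminated.\<close>

lemma (in field) homogeneous_system:
  assumes "finite J" "card J > n" "\<And>j i. j \<in> J \<Longrightarrow> i < n \<Longrightarrow> a j i \<in> carrier R"
  shows "\<exists>c. (\<forall>j\<in>J. c j \<in> carrier R) \<and> (\<exists>j\<in>J. c j \<noteq> \<zero>) \<and> (\<forall>i<n. (\<Oplus>j\<in>J. c j \<otimes> a j i) = \<zero>)"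
  using assms
proof (induction n arbitrary: J a)
  case 0
  then have "J \<noteq> {}" by auto
  then show ?case by (intro exI[of _ "\<lambda>_. \<one>"]) auto
next
  case (Suc n)
  show ?case
  proof (cases "\<forall>j\<in>J. a j n = \<zero>")
    case True
    obtain c where c: "\<forall>j\<in>J. c j \<in> carrier R" "\<exists>j\<in>J. c j \<noteq> \<zero>" "\<forall>i<n. (\<Oplus>j\<in>J. c j \<otimes> a j i) = \<zero>"
      using Suc.IH[of J a] Suc.prems by auto
    have "(\<Oplus>j\<in>J. c j \<otimes> a j n) = \<zero>" using True c by (intro add.finprod_one_eqI) auto
    with c show ?thesis by (intro exI[of _ c]) (auto simp: less_Suc_eq)
  next
    case False
    then obtain j0 where j0: "j0 \<in> J" "a j0 n \<noteq> \<zero>" by auto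
    define J' where "J' = J - {j0}"
    have J: "J = insert j0 J'" "j0 \<notin> J'" "finite J'" "card J' > n" using j0 Suc.prems by (auto simp: J'_def)
    have ac [simp]: "a j i \<in> carrier R" if "j = j0 \<or> j \<in> J'" "i < Suc n" for j i using Suc.prems(3) that J by auto
    have u: "inv a j0 n \<in> carrier R" "inv a j0 n \<otimes> a j0 n = \<one>" using field_Units j0 ac[of j0 n] by auto
    define l where "l j = a j n \<otimes> inv a j0 n" for j
    have l [simp]: "l j \<in> carrier R" if "j \<in> J'" for j using u that by (simp add: l_def)
    define a' where "a' j i = a j i \<ominus> l j \<otimes> a j0 i" for j i
    obtain c where c: "\<forall>j\<in>J'. c j \<in> carrier R" "\<exists>j\<in>J'. c j \<noteq> \<zero>" "\<forall>i<n. (\<Oplus>j\<in>J'. c j \<otimes> a' j i) = \<zero>"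
      using Suc.IH[of J' a'] J by (auto simp: a'_def)
    define s where "s = (\<Oplus>j\<in>J'. c j \<otimes> l j)"
    have s: "s \<in> carrier R" using c by (auto simp: s_def intro!: finsum_closed)
    define c' where "c' = c(j0 := \<ominus> s)"
    have eq: "(\<Oplus>j\<in>J. c' j \<otimes> a j i) = (\<Oplus>j\<in>J'. c j \<otimes> a' j i)" if i: "i < Suc n" for i
    proof -
      have "(\<Oplus>j\<in>J. c' j \<otimes> a j i) = c' j0 \<otimes> a j0 i \<oplus> (\<Oplus>j\<in>J'. c' j \<otimes> a j i)"
        unfolding J(1) using J c s i by (intro finsum_insert) (auto simp: c'_def)
      also have "(\<Oplus>j\<in>J'. c' j \<otimes> a j i) = (\<Oplus>j\<in>J'. c j \<otimes> a' j i \<oplus> (c j \<otimes> l j) \<otimes> a j0 i)"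
        using J c i by (intro finsum_cong') (auto simp: c'_def a'_def a_minus_def r_distr m_assoc r_minus a_assoc l_neg)
      also have "\<dots> = (\<Oplus>j\<in>J'. c j \<otimes> a' j i) \<oplus> (\<Oplus>j\<in>J'. (c j \<otimes> l j) \<otimes> a j0 i)"
        using J c i by (intro finsum_addf) (auto simp: a'_def)
      also have "(\<Oplus>j\<in>J'. (c j \<otimes> l j) \<otimes> a j0 i) = s \<otimes> a j0 i"
        unfolding s_def using J c i by (intro finsum_ldistr[symmetric]) auto
      also have "c' j0 \<otimes> a j0 i \<oplus> ((\<Oplus>j\<in>J'. c j \<otimes> a' j i) \<oplus> s \<otimes> a j0 i) = (\<Oplus>j\<in>J'. c j \<otimes> a' j i)"
      proof -
        have "(\<Oplus>j\<in>J'. c j \<otimes> a' j i) \<in> carrier R" using c i by (auto simp: a'_def intro!: finsum_closed)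
        moreover have "s \<otimes> a j0 i \<in> carrier R" using s i by simp
        moreover have "\<ominus> t \<oplus> (S \<oplus> t) = S" if "S \<in> carrier R" "t \<in> carrier R" for S t
          using that by (simp add: a_comm[of S t] r_neg1)
        ultimately show ?thesis using s i by (simp add: c'_def l_minus)
      qed
      finally show ?thesis .
    qed
    have "(\<Oplus>j\<in>J'. c j \<otimes> a' j n) = \<zero>"
    proof (rule add.finprod_one_eqI)
      fix j assume j: "j \<in> J'"
      then have "l j \<otimes> a j0 n = a j n" using u by (simp add: l_def m_assoc)
      then show "c j \<otimes> a' j n = \<zero>" using j c by (simp add: a'_def a_minus_def r_neg)
    qed
    then have "\<forall>i<Suc n. (\<Oplus>j\<in>J. c' j \<otimes> a j i) = \<zero>" using eq c(3) by (simp add: less_Suc_eq)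
    moreover have "\<forall>j\<in>J. c' j \<in> carrier R" using c s J by (auto simp: c'_def)
    moreover have "\<exists>j\<in>J. c' j \<noteq> \<zero>" using c(2) J by (auto simp: c'_def)
    ultimately show ?thesis by blast
  qed
qed

lemma up_mem_UP: "f \<in> up S \<Longrightarrow> f \<in> carrier (UP S)" "f \<in> up S \<Longrightarrow> up_ring.coeff (UP S) f = f"
  by (simp_all add: UP_def)

context residue_setup begin

lemma poly_residue_coeff:
  assumes p: "p \<in> carrier (UP R)"
  shows "poly_residue R P p \<in> carrier (UP K)"
    and "up_ring.coeff (UP K) (poly_residue R P p) i = res (up_ring.coeff (UP R) p i)"
proof -
  interpret U: UP_cring R "UP R" by (rule UP_cring.intro) (rule is_cring)
  have eq: "poly_residue R P p = (\<lambda>i. res (up_ring.coeff (UP R) p i))"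
    by (simp add: poly_residue_def res_def fun_eq_iff)
  have "(\<lambda>i. res (up_ring.coeff (UP R) p i)) \<in> up K"
  proof (rule mem_upI)
    have "bound \<zero>\<^bsub>K\<^esub> (deg R p) (\<lambda>i. res (up_ring.coeff (UP R) p i))"
      by (rule bound.intro) (simp add: U.deg_aboveD[OF _ p])
    then show "\<exists>n. bound \<zero>\<^bsub>K\<^esub> n (\<lambda>i. res (up_ring.coeff (UP R) p i))" by blast
  qed (use p in simp)
  then show "poly_residue R P p \<in> carrier (UP K)"
    "up_ring.coeff (UP K) (poly_residue R P p) i = res (up_ring.coeff (UP R) p i)"
    unfolding eq by (simp_all add: UP_def)
qed

lemma poly_residue_hom: "poly_residue R P \<in> ring_hom (UP R) (UP K)"
proof -
  interpret U: UP_cring R "UP R" by (rule UP_cring.intro) (rule is_cring)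
  interpret W: UP_cring K "UP K" by (rule UP_cring.intro) (rule K.cring_axioms)
  show ?thesis
  proof (rule ring_hom_memI)
    fix p q assume pq: "p \<in> carrier (UP R)" "q \<in> carrier (UP R)"
    show "poly_residue R P (p \<otimes>\<^bsub>UP R\<^esub> q) = poly_residue R P p \<otimes>\<^bsub>UP K\<^esub> poly_residue R P q"
    proof (rule W.up_eqI)
      fix k
      have "up_ring.coeff (UP K) (poly_residue R P (p \<otimes>\<^bsub>UP R\<^esub> q)) k
          = (\<Oplus>\<^bsub>K\<^esub>i\<in>{..k}. res (up_ring.coeff (UP R) p i \<otimes> up_ring.coeff (UP R) q (k - i)))"
        using pq by (simp add: poly_residue_coeff res_finsum Pi_def)
      also have "\<dots> = up_ring.coeff (UP K) (poly_residue R P p \<otimes>\<^bsub>UP K\<^esub> poly_residue R P q) k"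
        using pq by (simp add: poly_residue_coeff)
      finally show "up_ring.coeff (UP K) (poly_residue R P (p \<otimes>\<^bsub>UP R\<^esub> q)) k
          = up_ring.coeff (UP K) (poly_residue R P p \<otimes>\<^bsub>UP K\<^esub> poly_residue R P q) k" .
    qed (use pq poly_residue_coeff in simp_all)
    show "poly_residue R P (p \<oplus>\<^bsub>UP R\<^esub> q) = poly_residue R P p \<oplus>\<^bsub>UP K\<^esub> poly_residue R P q"
      by (rule W.up_eqI) (use pq in \<open>simp_all add: poly_residue_coeff\<close>)
  next
    show "poly_residue R P \<one>\<^bsub>UP R\<^esub> = \<one>\<^bsub>UP K\<^esub>"
      by (rule W.up_eqI) (simp_all add: poly_residue_coeff)
  qed (rule poly_residue_coeff)
qed

lemma poly_residue_const: "a \<in> carrier R \<Longrightarrow> poly_residue R P (const_poly R a) = const_poly K (res a)"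
proof -
  interpret U: UP_cring R "UP R" by (rule UP_cring.intro) (rule is_cring)
  interpret W: UP_cring K "UP K" by (rule UP_cring.intro) (rule K.cring_axioms)
  assume "a \<in> carrier R"
  then show ?thesis
    unfolding const_poly_def by (intro W.up_eqI) (simp_all add: poly_residue_coeff)
qed

lemma poly_residue_var: "poly_residue R P (poly_var R) = poly_var K"
proof -
  interpret U: UP_cring R "UP R" by (rule UP_cring.intro) (rule is_cring)
  interpret W: UP_cring K "UP K" by (rule UP_cring.intro) (rule K.cring_axioms)
  show ?thesis
    unfolding poly_var_def by (intro W.up_eqI) (simp_all add: poly_residue_coeff)
qed

text \<open>Coefficients \<open>0\<close> and \<open>1\<close> are lifted to \<open>0\<close> and \<open>1\<close>, which makes lifts of monic polynomials monic of the
same degree.\<close>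

lemma poly_residue_lift:
  assumes q: "q \<in> carrier (UP K)"
  obtains Q where "Q \<in> carrier (UP R)" "poly_residue R P Q = q"
    "\<And>i. up_ring.coeff (UP K) q i = \<zero>\<^bsub>K\<^esub> \<Longrightarrow> up_ring.coeff (UP R) Q i = \<zero>"
    "\<And>i. up_ring.coeff (UP K) q i = \<one>\<^bsub>K\<^esub> \<Longrightarrow> up_ring.coeff (UP R) Q i = \<one>"
proof -
  interpret U: UP_cring R "UP R" by (rule UP_cring.intro) (rule is_cring)
  interpret W: UP_cring K "UP K" by (rule UP_cring.intro) (rule K.cring_axioms)
  let ?c = "up_ring.coeff (UP K) q"
  define Q where "Q i = (if ?c i = \<zero>\<^bsub>K\<^esub> then \<zero> else if ?c i = \<one>\<^bsub>K\<^esub> then \<one> else lift_elem (?c i))" for i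
  have "Q \<in> up R"
  proof (rule mem_upI)
    have "bound \<zero> (deg K q) Q"
      by (rule bound.intro) (simp add: Q_def W.deg_aboveD[OF _ q])
    then show "\<exists>n. bound \<zero> n Q" by blast
  qed (use q lift_elem in \<open>simp add: Q_def\<close>)
  note Qc = up_mem_UP(1)[OF this] and Qi = fun_cong[OF up_mem_UP(2)[OF this]]
  have r: "poly_residue R P Q = q"
    proof (rule W.up_eqI)
    fix i
    show "up_ring.coeff (UP K) (poly_residue R P Q) i = ?c i"
      unfolding poly_residue_coeff(2)[OF Qc] Qi Q_def using q by (simp add: lift_elem)
  qed (use q Qc poly_residue_coeff in auto)
  show ?thesis
    by (rule that[OF Qc r]) (simp_all only: Qi, simp_all add: Q_def)
qed

lemma monic_lift:
  assumes "monic_of_degree K d q"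
  obtains Q where "monic_of_degree R d Q" "poly_residue R P Q = q"
proof -
  have q: "q \<in> carrier (UP K)" using assms by (simp add: monic_of_degree_def)
  obtain Q where "Q \<in> carrier (UP R)" "poly_residue R P Q = q"
    "\<And>i. up_ring.coeff (UP K) q i = \<zero>\<^bsub>K\<^esub> \<Longrightarrow> up_ring.coeff (UP R) Q i = \<zero>"
    "\<And>i. up_ring.coeff (UP K) q i = \<one>\<^bsub>K\<^esub> \<Longrightarrow> up_ring.coeff (UP R) Q i = \<one>"
    using poly_residue_lift[OF q] by blast
  with assms show ?thesis by (intro that[of Q]) (auto simp: monic_of_degree_def)
qed

text \<open>Each \<open>f i\<close> is a multiple of its predecessor. It is lifted as the chosen lift of the predecessor times a monic lift of the
quotient.\<close>

lemma chain_lift_from: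
  assumes "distinct is" "sorted_wrt (\<lambda>i j. f i divides\<^bsub>UP K\<^esub> f j) is" "\<And>i. i \<in> set is \<Longrightarrow> monic_of_degree K (d i) (f i)"
    and "monic_of_degree R d0 F0" "\<And>i. i \<in> set is \<Longrightarrow> poly_residue R P F0 divides\<^bsub>UP K\<^esub> f i"
  shows "\<exists>F. (\<forall>i\<in>set is. monic_of_degree R (d i) (F i) \<and> poly_residue R P (F i) = f i \<and> F0 divides\<^bsub>UP R\<^esub> F i) \<and>
    sorted_wrt (\<lambda>i j. F i divides\<^bsub>UP R\<^esub> F j) is"
  using assms
proof (induction "is" arbitrary: d0 F0)
  case Nil
  then show ?case by simp
next
  case (Cons i "is")
  interpret U: UP_cring R "UP R" by (rule UP_cring.intro) (rule is_cring)
  interpret W: UP_domain K "UP K" by (rule UP_domain.intro) (rule K.domain_axioms)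
  have F0c: "F0 \<in> carrier (UP R)" using Cons.prems by (simp add: monic_of_degree_def)
  have one_nz: "\<one>\<^bsub>K\<^esub> \<noteq> \<zero>\<^bsub>K\<^esub>" by simp
  have f0: "monic_of_degree K d0 (poly_residue R P F0)"
    using Cons.prems(4) by (simp add: monic_of_degree_def poly_residue_coeff)
  obtain g where g: "g \<in> carrier (UP K)" "f i = poly_residue R P F0 \<otimes>\<^bsub>UP K\<^esub> g"
    using Cons.prems(5)[of i] by (auto simp: factor_def)
  have fi: "monic_of_degree K (d i) (f i)" using Cons.prems(3) by simp
  obtain e where e: "monic_of_degree K e g"
    using K.monic_factor[OF f0 fi[unfolded g(2)] g(1)] by blast
  obtain G where G: "monic_of_degree R e G" "poly_residue R P G = g" using monic_lift[OF e] by blast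
  have Gc: "G \<in> carrier (UP R)" using G by (simp add: monic_of_degree_def)
  define Fi where "Fi = F0 \<otimes>\<^bsub>UP R\<^esub> G"
  have rFi: "poly_residue R P Fi = f i"
    unfolding Fi_def g(2) using ring_hom_mult[OF poly_residue_hom F0c Gc] G by simp
  have mFi: "monic_of_degree R (d0 + e) Fi" unfolding Fi_def by (rule monic_mult[OF Cons.prems(4) G(1)])
  have Fic: "Fi \<in> carrier (UP R)" using mFi by (simp add: monic_of_degree_def)
  have "d i = d0 + e"
  proof -
    have m: "monic_of_degree K (d0 + e) (f i)"
      unfolding rFi[symmetric] using mFi by (simp add: monic_of_degree_def poly_residue_coeff)
    show ?thesis
    proof (rule ccontr)
      assume "d i \<noteq> d0 + e"
      then consider "d i < d0 + e" | "d i > d0 + e" by linarith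
      then show False using m fi one_nz by cases (auto simp: monic_of_degree_def)
    qed
  qed
  with mFi have mFi': "monic_of_degree R (d i) Fi" by simp
  obtain F where F: "\<forall>j\<in>set is. monic_of_degree R (d j) (F j) \<and> poly_residue R P (F j) = f j \<and> Fi divides\<^bsub>UP R\<^esub> F j"
    "sorted_wrt (\<lambda>i j. F i divides\<^bsub>UP R\<^esub> F j) is"
    using Cons.IH[of "d i" Fi] Cons.prems mFi' rFi by auto
  have dFi: "F0 divides\<^bsub>UP R\<^esub> Fi" unfolding factor_def Fi_def using Gc by blast
  have dF: "F0 divides\<^bsub>UP R\<^esub> F j" if "j \<in> set is" for j
    using U.P.divides_trans[OF dFi _ F0c] F(1) that by blast
  define F' where "F' = F(i := Fi)"
  have F'i: "F' i = Fi" by (simp add: F'_def)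
  have F'j: "F' j = F j" if "j \<in> set is" for j using that Cons.prems(1) by (auto simp: F'_def)
  have "sorted_wrt (\<lambda>i j. F' i divides\<^bsub>UP R\<^esub> F' j) is"
    by (rule sorted_wrt_mono_rel[OF _ F(2)]) (simp add: F'j)
  moreover have "\<forall>j\<in>set is. F' i divides\<^bsub>UP R\<^esub> F' j" using F(1) by (simp add: F'i F'j)
  ultimately have "sorted_wrt (\<lambda>i j. F' i divides\<^bsub>UP R\<^esub> F' j) (i # is)" by simp
  moreover have "monic_of_degree R (d j) (F' j) \<and> poly_residue R P (F' j) = f j \<and> F0 divides\<^bsub>UP R\<^esub> F' j"
    if "j \<in> set (i # is)" for j
  proof (cases "j = i")
    case True
    then show ?thesis using dFi mFi' rFi by (simp add: F'i)
  next
    case False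
    then have "j \<in> set is" using that by simp
    then show ?thesis using F(1) dF by (simp add: F'j)
  qed
  ultimately show ?case by blast
qed

lemma chain_lift:
  assumes "distinct is" "sorted_wrt (\<lambda>i j. f i divides\<^bsub>UP K\<^esub> f j) is" "\<And>i. i \<in> set is \<Longrightarrow> monic_of_degree K (d i) (f i)"
  shows "\<exists>F. (\<forall>i\<in>set is. monic_of_degree R (d i) (F i) \<and> poly_residue R P (F i) = f i) \<and>
    sorted_wrt (\<lambda>i j. F i divides\<^bsub>UP R\<^esub> F j) is"
proof -
  interpret U: UP_cring R "UP R" by (rule UP_cring.intro) (rule is_cring)
  interpret W: UP_cring K "UP K" by (rule UP_cring.intro) (rule K.cring_axioms)
  have "monic_of_degree R 0 \<one>\<^bsub>UP R\<^esub>" by (simp add: monic_of_degree_def)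
  moreover have "poly_residue R P \<one>\<^bsub>UP R\<^esub> divides\<^bsub>UP K\<^esub> f i" if "i \<in> set is" for i
    unfolding factor_def ring_hom_one[OF poly_residue_hom] using assms(3)[OF that]
    by (intro bexI[of _ "f i"]) (simp_all add: monic_of_degree_def)
  ultimately have "\<exists>F. (\<forall>i\<in>set is. monic_of_degree R (d i) (F i) \<and> poly_residue R P (F i) = f i \<and> \<one>\<^bsub>UP R\<^esub> divides\<^bsub>UP R\<^esub> F i) \<and>
    sorted_wrt (\<lambda>i j. F i divides\<^bsub>UP R\<^esub> F j) is"
    by (intro chain_lift_from[OF assms(1,2)]) (rule assms(3))
  then show ?thesis by blast
qed

end

section \<open>Lifting a matrix together with its centralizer\<close>

lemma (in abelian_monoid) finsum_Sigma:
  assumes I: "finite I" and B: "\<And>i. i \<in> I \<Longrightarrow> finite (B i)"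
    and g: "\<And>i j. i \<in> I \<Longrightarrow> j \<in> B i \<Longrightarrow> g (i, j) \<in> carrier G"
  shows "(\<Oplus>u\<in>Sigma I B. g u) = (\<Oplus>i\<in>I. \<Oplus>j\<in>B i. g (i, j))"
proof -
  have S: "Sigma I B = (\<Union>i\<in>I. Pair i ` B i)" by auto
  have "(\<Oplus>u\<in>Sigma I B. g u) = (\<Oplus>i\<in>I. finsum G g (Pair i ` B i))"
    unfolding S using assms by (intro add.finprod_UN_disjoint) (auto simp: pairwise_def disjnt_def)
  also have "\<dots> = (\<Oplus>i\<in>I. \<Oplus>j\<in>B i. g (i, j))"
    using g by (intro finsum_cong' finsum_reindex) (auto simp: inj_on_def intro!: finsum_closed)
  finally show ?thesis .
qed

lemma finsum_poly_module: "finsum (poly_module S E T) f I = finsum E f I"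
  by (simp add: finsum_def finprod_def poly_module_def)

lemma poly_smult_bound:
  assumes "module S E" "T \<in> mod_hom S E E" "p \<in> carrier (UP S)" "v \<in> carrier E"
    and z: "\<And>i. i \<ge> d \<Longrightarrow> up_ring.coeff (UP S) p i = \<zero>\<^bsub>S\<^esub>"
  shows "p \<odot>\<^bsub>poly_module S E T\<^esub> v = (\<Oplus>\<^bsub>E\<^esub>i\<in>{..<d}. up_ring.coeff (UP S) p i \<odot>\<^bsub>E\<^esub> (T ^^ i) v)"
proof -
  interpret E: module S E by fact
  interpret U: UP_cring S "UP S" by (rule UP_cring.intro) (rule E.R.cring_axioms)
  have T: "(T ^^ i) v \<in> carrier E" for i
    using mod_hom_closed[OF mod_hom_funpow[OF assms(2)] assms(4)] .
  have "p \<odot>\<^bsub>poly_module S E T\<^esub> v = (\<Oplus>\<^bsub>E\<^esub>i\<in>{..deg S p + d}. up_ring.coeff (UP S) p i \<odot>\<^bsub>E\<^esub> (T ^^ i) v)"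
    by (rule poly_smult_le[OF assms(1-4)]) simp
  also have "\<dots> = (\<Oplus>\<^bsub>E\<^esub>i\<in>{..<d}. up_ring.coeff (UP S) p i \<odot>\<^bsub>E\<^esub> (T ^^ i) v)"
    using assms T by (intro E.M.add.finprod_mono_neutral_cong_left[symmetric]) auto
  finally show ?thesis .
qed

lemma monic_smult:
  assumes "module S E" "T \<in> mod_hom S E E" "v \<in> carrier E" and p: "monic_of_degree S d p"
  shows "p \<odot>\<^bsub>poly_module S E T\<^esub> v
    = (T ^^ d) v \<oplus>\<^bsub>E\<^esub> (\<Oplus>\<^bsub>E\<^esub>i\<in>{..<d}. up_ring.coeff (UP S) p i \<odot>\<^bsub>E\<^esub> (T ^^ i) v)"
proof -
  interpret E: module S E by fact
  interpret U: UP_cring S "UP S" by (rule UP_cring.intro) (rule E.R.cring_axioms)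
  have T: "(T ^^ i) v \<in> carrier E" for i
    using mod_hom_closed[OF mod_hom_funpow[OF assms(2)] assms(3)] .
  have p': "p \<in> carrier (UP S)" using p by (simp add: monic_of_degree_def)
  have "p \<odot>\<^bsub>poly_module S E T\<^esub> v = (\<Oplus>\<^bsub>E\<^esub>i\<in>{..<Suc d}. up_ring.coeff (UP S) p i \<odot>\<^bsub>E\<^esub> (T ^^ i) v)"
    using p by (intro poly_smult_bound[OF assms(1,2) p' assms(3)]) (simp add: monic_of_degree_def)
  also have "\<dots> = up_ring.coeff (UP S) p d \<odot>\<^bsub>E\<^esub> (T ^^ d) v \<oplus>\<^bsub>E\<^esub> (\<Oplus>\<^bsub>E\<^esub>i\<in>{..<d}. up_ring.coeff (UP S) p i \<odot>\<^bsub>E\<^esub> (T ^^ i) v)"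
    unfolding lessThan_Suc using T p' by (intro E.M.finsum_insert) auto
  finally show ?thesis using p T by (simp add: monic_of_degree_def)
qed

text \<open>The vectors \<open>v, Av, \<dots>, A\<^sup>nv\<close> are linearly dependent, so \<open>M\<^sup>A\<close> is a torsion module, its invariant
factors are nonzero, and they can be taken monic.\<close>

lemma (in field) matrix_invariant_factors:
  assumes A: "A \<in> matrices R n"
  obtains u d f xs where
    "\<And>i. i < n \<Longrightarrow> u i \<in> vectors R n" "\<And>i. i < n \<Longrightarrow> monic_of_degree R (d i) (f i)"
    "\<And>i. i < n \<Longrightarrow> f i \<odot>\<^bsub>matrix_module R n A\<^esub> u i = \<zero>\<^bsub>free_on R {..<n}\<^esub>"
    "\<And>b i. (\<And>i. i < n \<Longrightarrow> b i \<in> carrier (UP R)) \<Longrightarrow>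
      lincomb (matrix_module R n A) {..<n} u b = \<zero>\<^bsub>free_on R {..<n}\<^esub> \<Longrightarrow> i < n \<Longrightarrow> f i divides\<^bsub>UP R\<^esub> b i"
    "\<And>v. v \<in> vectors R n \<Longrightarrow>
      \<exists>b. (\<forall>i<n. b i \<in> carrier (UP R)) \<and> v = lincomb (matrix_module R n A) {..<n} u b"
    "distinct xs" "set xs = {..<n}" "sorted_wrt (\<lambda>i j. f i divides\<^bsub>UP R\<^esub> f j) xs"
proof -
  let ?V = "free_on R {..<n}" and ?A = "mat_vec R n A"
  define M where "M = matrix_module R n A"
  have M: "M = poly_module R ?V ?A" by (simp add: M_def matrix_module_eq)
  note V = free_on_module[of "{..<n}"] and hA = mat_vec_hom[OF A]
  interpret V: module R ?V by (rule V)
  interpret U: UP_domain R "UP R" by (rule UP_domain.intro) (rule domain_axioms)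
  have Mm: "module (UP R) M" unfolding M by (rule poly_module_module[OF V hA])
  interpret EM: euclidean_module "UP R" "deg R" M
    by (rule euclidean_module.intro[OF UP_euclidean Mm])
  have Mc: "carrier M = (vectors R n)" "\<zero>\<^bsub>M\<^esub> = \<zero>\<^bsub>?V\<^esub>" by (simp_all add: M)
  have "unit_vec R {..<n} i \<in> carrier M" for i by (simp add: Mc)
  from EM.invariant_factors[of "{..<n}" "unit_vec R {..<n}", OF finite_lessThan this]
  obtain u f0 xs where u': "EM.generates_same {..<n} (unit_vec R {..<n}) u"
    "\<forall>i\<in>{..<n}. f0 i \<in> carrier (UP R) \<and> f0 i \<odot>\<^bsub>M\<^esub> u i = \<zero>\<^bsub>M\<^esub>"
    "\<forall>b. EM.relation {..<n} u b \<longrightarrow> (\<forall>i\<in>{..<n}. f0 i divides\<^bsub>UP R\<^esub> b i)"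
    "distinct xs" "set xs = {..<n}" "sorted_wrt (\<lambda>i j. f0 i divides\<^bsub>UP R\<^esub> f0 j) xs"
    by (elim exE conjE)
  have u: "EM.generates_same {..<n} (unit_vec R {..<n}) u"
    "\<And>i. i < n \<Longrightarrow> f0 i \<in> carrier (UP R)" "\<And>i. i < n \<Longrightarrow> f0 i \<odot>\<^bsub>M\<^esub> u i = \<zero>\<^bsub>M\<^esub>"
    "\<And>b i. EM.relation {..<n} u b \<Longrightarrow> i < n \<Longrightarrow> f0 i divides\<^bsub>UP R\<^esub> b i"
    "distinct xs" "set xs = {..<n}" "sorted_wrt (\<lambda>i j. f0 i divides\<^bsub>UP R\<^esub> f0 j) xs"
    using u' by blast+
  have uc: "u i \<in> vectors R n" if "i < n" for i
    using u(1) that Mc by (auto simp: EM.generates_same_def simp del: PiE_iff)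
  have nz: "f0 i \<noteq> \<zero>\<^bsub>UP R\<^esub>" if i: "i < n" for i
  proof
    assume f0: "f0 i = \<zero>\<^bsub>UP R\<^esub>"
    have pc: "(?A ^^ j) (u i) \<in> vectors R n" for j
      using mod_hom_closed[OF mod_hom_funpow[OF hA], of "u i" j] uc[OF i] by simp
    obtain c where c: "\<forall>j\<in>{..n}. c j \<in> carrier R" "\<exists>j\<in>{..n}. c j \<noteq> \<zero>"
      "\<forall>k<n. (\<Oplus>j\<in>{..n}. c j \<otimes> (?A ^^ j) (u i) k) = \<zero>"
      using homogeneous_system[of "{..n}" n "\<lambda>j. (?A ^^ j) (u i)"] PiE_app[OF pc] by auto
    define p where "p j = (if j \<le> n then c j else \<zero>)" for j
    have "p \<in> up R"
    proof (rule mem_upI)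
      have "bound \<zero> n p" by (rule bound.intro) (simp add: p_def)
      then show "\<exists>n. bound \<zero> n p" by blast
    qed (use c in \<open>simp add: p_def\<close>)
    note pU = up_mem_UP(1)[OF this] and pi = fun_cong[OF up_mem_UP(2)[OF this]]
    have "p \<odot>\<^bsub>M\<^esub> u i = (\<Oplus>\<^bsub>?V\<^esub>j\<in>{..<Suc n}. up_ring.coeff (UP R) p j \<odot>\<^bsub>?V\<^esub> (?A ^^ j) (u i))"
      unfolding M using uc[OF i] by (intro poly_smult_bound[OF V hA pU]) (simp_all add: pi, simp add: p_def)
    also have "\<dots> = (\<lambda>k\<in>{..<n}. \<Oplus>j\<in>{..<Suc n}. (up_ring.coeff (UP R) p j \<odot>\<^bsub>?V\<^esub> (?A ^^ j) (u i)) k)"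
    proof (rule finsum_free_on)
      show "(\<lambda>j. up_ring.coeff (UP R) p j \<odot>\<^bsub>?V\<^esub> (?A ^^ j) (u i)) \<in> {..<Suc n} \<rightarrow> vectors R n"
        using V.smult_closed[of "up_ring.coeff (UP R) p j" "(?A ^^ j) (u i)" for j] pc pU U.coeff_closed
        by (simp only: free_on_simps(1)) blast
    qed simp
    also have "\<dots> = (\<lambda>k\<in>{..<n}. \<Oplus>j\<in>{..n}. c j \<otimes> (?A ^^ j) (u i) k)"
      using PiE_app[OF pc] c unfolding pi lessThan_Suc_atMost
      by (intro restrict_ext finsum_cong') (auto simp: p_def)
    also have "\<dots> = \<zero>\<^bsub>M\<^esub>" unfolding Mc free_on_simps using c(3) by (intro restrict_ext) simp
    finally have pu: "p \<odot>\<^bsub>M\<^esub> u i = \<zero>\<^bsub>M\<^esub>" .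
    let ?b = "\<lambda>k. if k = i then p else \<zero>\<^bsub>UP R\<^esub>"
    have "lincomb M {..<n} u ?b = (\<Oplus>\<^bsub>M\<^esub>k\<in>{..<n}. \<zero>\<^bsub>M\<^esub>)"
      unfolding lincomb_def using uc pu Mc(1) EM.M.zero_closed by (intro EM.M.finsum_cong') simp_all
    then have "EM.relation {..<n} u ?b" using pU by (simp add: EM.relation_def EM.M.finsum_zero)
    from u(4)[OF this i] f0 have p0: "p = \<zero>\<^bsub>UP R\<^esub>" by (auto simp: factor_def)
    have "up_ring.coeff (UP R) p j = \<zero>" for j unfolding p0 by (rule U.coeff_zero)
    then have "p j = \<zero>" for j unfolding pi .
    then have "c j = \<zero>" if "j \<le> n" for j using that by (metis p_def)
    with c(2) show False by auto
  qed
  have "\<forall>i. \<exists>g. i < n \<longrightarrow> monic_of_degree R (deg R (f0 i)) g \<and> (\<exists>c c'. c \<in> carrier (UP R) \<and> c' \<in> carrier (UP R) \<and>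
      g = c \<otimes>\<^bsub>UP R\<^esub> f0 i \<and> f0 i = c' \<otimes>\<^bsub>UP R\<^esub> g)"
    using monic_associate[OF u(2) nz] by blast
  from choice[OF this] obtain f where f: "\<And>i. i < n \<Longrightarrow> monic_of_degree R (deg R (f0 i)) (f i)"
    "\<And>i. i < n \<Longrightarrow> \<exists>c c'. c \<in> carrier (UP R) \<and> c' \<in> carrier (UP R) \<and> f i = c \<otimes>\<^bsub>UP R\<^esub> f0 i \<and> f0 i = c' \<otimes>\<^bsub>UP R\<^esub> f i"
    by blast
  have fc: "f i \<in> carrier (UP R)" if "i < n" for i using f(1)[OF that] by (simp add: monic_of_degree_def)
  have ff0: "f i divides\<^bsub>UP R\<^esub> f0 i" "f0 i divides\<^bsub>UP R\<^esub> f i" if "i < n" for i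
    using f(2)[OF that] u(2)[OF that] fc[OF that] unfolding factor_def by (auto simp: U.P.m_comm)
  show thesis
  proof (rule that[of u "\<lambda>i. deg R (f0 i)" f xs])
    fix i assume i: "i < n"
    show "u i \<in> vectors R n" by (rule uc[OF i])
    show "monic_of_degree R (deg R (f0 i)) (f i)" by (rule f(1)[OF i])
    obtain c where "c \<in> carrier (UP R)" "f i = c \<otimes>\<^bsub>UP R\<^esub> f0 i" using f(2)[OF i] by blast
    then show "f i \<odot>\<^bsub>matrix_module R n A\<^esub> u i = \<zero>\<^bsub>?V\<^esub>"
      using u(2,3)[OF i] uc[OF i] Mc EM.smult_assoc1[of c "f0 i" "u i"] EM.smult_r_null[of c] by (simp add: M_def[symmetric] del: free_on_simps)
  next
    fix b i assume b: "\<And>i. i < n \<Longrightarrow> b i \<in> carrier (UP R)"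
      "lincomb (matrix_module R n A) {..<n} u b = \<zero>\<^bsub>?V\<^esub>" and i: "i < n"
    have "EM.relation {..<n} u b" using b Mc unfolding EM.relation_def M_def[symmetric] by simp
    from U.P.divides_trans[OF ff0(1)[OF i] u(4)[OF this i] fc[OF i]]
    show "f i divides\<^bsub>UP R\<^esub> b i" .
  next
    fix v assume v: "v \<in> vectors R n"
    note vc = PiE_app[OF v]
    have "lincomb M {..<n} (unit_vec R {..<n}) (\<lambda>i. const_poly R (v i)) = lincomb ?V {..<n} (unit_vec R {..<n}) v"
      unfolding lincomb_def M finsum_poly_module using vc V.smult_closed[of "v i" "unit_vec R {..<n} i" for i]
      by (intro V.M.finsum_cong') (simp_all add: poly_module_const[OF V hA] del: free_on_simps(4))
    also have "\<dots> = v" using v by (intro lincomb_unit_vecs) simp_all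
    finally have "v \<in> EM.span_of {..<n} (unit_vec R {..<n})"
      using EM.span_ofI[of "{..<n}" "unit_vec R {..<n}" "\<lambda>i. const_poly R (v i)"] vc Mc is_cring by simp
    then have "v \<in> EM.span_of {..<n} u" using u(1) by (simp add: EM.generates_same_def)
    then obtain b where b: "b \<in> {..<n} \<rightarrow>\<^sub>E carrier (UP R)" "v = lincomb M {..<n} u b" by (auto simp: EM.span_of_def)
    then show "\<exists>b. (\<forall>i<n. b i \<in> carrier (UP R)) \<and> v = lincomb (matrix_module R n A) {..<n} u b"
      using PiE_app[OF b(1)] by (auto simp: M_def)
  next
    have "sorted_wrt (\<lambda>i j. f i divides\<^bsub>UP R\<^esub> f j) xs"
    proof (rule sorted_wrt_mono_rel[OF _ u(7)])
      fix i j assume ij: "i \<in> set xs" "j \<in> set xs" "f0 i divides\<^bsub>UP R\<^esub> f0 j"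
      then have i: "i < n" "j < n" using u(6) by auto
      show "f i divides\<^bsub>UP R\<^esub> f j"
        using U.P.divides_trans[OF U.P.divides_trans[OF ff0(1)[OF i(1)] ij(3) fc[OF i(1)]] ff0(2)[OF i(2)] fc[OF i(1)]] .
    qed
    then show "sorted_wrt (\<lambda>i j. f i divides\<^bsub>UP R\<^esub> f j) xs" .
  qed (use u in auto)
qed

context residue_setup begin

abbreviation "redm n \<equiv> redv ({..<n} \<times> {..<n})"

lemma redv_mat_vec:
  assumes B: "B \<in> matrices R n" and x: "x \<in> vectors R n"
  shows "redv {..<n} (mat_vec R n B x) = mat_vec K n (redm n B) (redv {..<n} x)"
proof -
  note [simp] = PiE_app[OF B] PiE_app[OF x]
  have "res (\<Oplus>j\<in>{..<n}. B (i, j) \<otimes> x j) = (\<Oplus>\<^bsub>K\<^esub>j\<in>{..<n}. redm n B (i, j) \<otimes>\<^bsub>K\<^esub> redv {..<n} x j)"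
    if "i < n" for i
  proof -
    have "res (\<Oplus>j\<in>{..<n}. B (i, j) \<otimes> x j) = (\<Oplus>\<^bsub>K\<^esub>j\<in>{..<n}. res (B (i, j) \<otimes> x j))"
      using that by (intro res_finsum) simp
    also have "\<dots> = (\<Oplus>\<^bsub>K\<^esub>j\<in>{..<n}. redm n B (i, j) \<otimes>\<^bsub>K\<^esub> redv {..<n} x j)"
      using that by (intro K.finsum_cong') (simp_all add: redv_def)
    finally show ?thesis .
  qed
  then show ?thesis
    unfolding mat_vec_def redv_def[of "{..<n}" "restrict _ _"] by (intro restrict_ext) simp
qed

lemma redm_eqI:
  assumes B: "B \<in> matrices R n" and A: "A \<in> matrices K n"
    and eq: "\<And>x. x \<in> vectors R n \<Longrightarrow> redv {..<n} (mat_vec R n B x) = mat_vec K n A (redv {..<n} x)"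
  shows "redm n B = A"
proof (rule K.matrix_eqI[OF redv_closed[OF B] A])
  fix v assume "v \<in> vectors K n"
  then obtain x where "x \<in> vectors R n" "redv {..<n} x = v" using redv_surj by blast
  then show "mat_vec K n (redm n B) v = mat_vec K n A v"
    using redv_mat_vec[OF B] eq by metis
qed

lemma mat_vec_residue_hom:
  assumes A: "A \<in> matrices K n"
  shows "mat_vec K n A \<in> mod_hom R (residue_space {..<n}) (residue_space {..<n})"
  using K.mat_vec_hom[OF A] by (auto simp: mod_hom_def simp del: free_on_simps)

lemma poly_smult_residue:
  assumes A: "A \<in> matrices K n" and p: "p \<in> carrier (UP R)" and v: "v \<in> vectors K n"
  shows "p \<odot>\<^bsub>poly_module R (residue_space {..<n}) (mat_vec K n A)\<^esub> v = poly_residue R P p \<odot>\<^bsub>matrix_module K n A\<^esub> v"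
proof -
  let ?W = "residue_space {..<n}" and ?V = "free_on K {..<n}" and ?A = "mat_vec K n A"
  note hW = mat_vec_residue_hom[OF A] and hV = K.mat_vec_hom[OF A]
  note mV = poly_module_module[OF K.free_on_module hV] and mW = poly_module_module[OF residue_space_module hW]
  have mU: "cring (UP R)" by (rule UP_cring.UP_cring) (rule UP_cring.intro, rule is_cring)
  have "(\<lambda>v. v) \<in> mod_hom (UP R) (poly_module R ?W ?A) (restrict_scalars (poly_residue R P) (poly_module K ?V ?A))"
    using res_simps(1)
    by (intro UP_mod_homI mW restrict_scalars_module[OF mU mV poly_residue_hom] is_cring)
      (simp_all add: poly_module_const[OF residue_space_module hW] poly_module_var[OF residue_space_module hW]
        poly_residue_const poly_residue_var poly_module_const[OF K.free_on_module hV] poly_module_var[OF K.free_on_module hV]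
        del: free_on_simps(3,4))
  from mod_hom_smult[OF this p, of v] v show ?thesis by (simp add: matrix_module_eq)
qed

end

context residue_setup begin

lemma hom_lift_through_surjection:
  assumes I: "finite I" and h: "h \<in> mod_hom R (free_on R I) W" and W: "module R W" and E: "module R E"
    and p: "p \<in> mod_hom R E W" and surj: "p ` carrier E = carrier W"
  obtains f where "f \<in> mod_hom R (free_on R I) E" "\<And>x. x \<in> I \<rightarrow>\<^sub>E carrier R \<Longrightarrow> p (f x) = h x"
proof -
  have "\<exists>y\<in>carrier E. p y = h (unit_vec R I i)" for i
  proof -
    have "h (unit_vec R I i) \<in> carrier W" by (rule mod_hom_closed[OF h]) simp
    then show ?thesis unfolding surj[symmetric] by auto
  qed
  then have "\<forall>i. \<exists>y. y \<in> carrier E \<and> p y = h (unit_vec R I i)" by blast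
  from choice[OF this] obtain g where g: "\<And>i. g i \<in> carrier E" "\<And>i. p (g i) = h (unit_vec R I i)" by blast
  note lg = lincomb_hom[OF E g(1) I]
  show thesis
  proof (rule that[OF lg])
    fix x assume x: "x \<in> I \<rightarrow>\<^sub>E carrier R"
    show "p (lincomb E I g x) = h x"
      by (rule hom_eqI_unit_vec[OF W mod_hom_comp[OF lg p] h I x])
        (simp add: lincomb_unit_vec[OF E g(1) I] g(2))
  qed
qed

text \<open>Two free modules whose quotients modulo \<open>P\<close> are identified with the same module are isomorphic over it. Lift the
two surjections through each other; the composites are the identity modulo \<open>P\<close>, hence bijective by \<open>congruent_one_bij\<close>.\<close>

lemma iso_of_projective_covers:
  assumes I: "finite I" and J: "finite J" and W: "module R W"
    and p: "p \<in> mod_hom R (free_on R I) W" "p ` (I \<rightarrow>\<^sub>E carrier R) = carrier W"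
    and q: "q \<in> mod_hom R (free_on R J) W" "q ` (J \<rightarrow>\<^sub>E carrier R) = carrier W"
    and pker: "\<And>x. x \<in> I \<rightarrow>\<^sub>E carrier R \<Longrightarrow> p x = \<zero>\<^bsub>W\<^esub> \<Longrightarrow> x \<in> I \<rightarrow>\<^sub>E P"
    and qker: "\<And>x. x \<in> J \<rightarrow>\<^sub>E carrier R \<Longrightarrow> q x = \<zero>\<^bsub>W\<^esub> \<Longrightarrow> x \<in> J \<rightarrow>\<^sub>E P"
  obtains f g where "f \<in> mod_hom R (free_on R I) (free_on R J)" "g \<in> mod_hom R (free_on R J) (free_on R I)"
    "\<And>x. x \<in> I \<rightarrow>\<^sub>E carrier R \<Longrightarrow> q (f x) = p x" "\<And>y. y \<in> J \<rightarrow>\<^sub>E carrier R \<Longrightarrow> p (g y) = q y"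
    "\<And>x. x \<in> I \<rightarrow>\<^sub>E carrier R \<Longrightarrow> g (f x) = x" "\<And>y. y \<in> J \<rightarrow>\<^sub>E carrier R \<Longrightarrow> f (g y) = y"
proof -
  interpret W: module R W by fact
  obtain f where f: "f \<in> mod_hom R (free_on R I) (free_on R J)" "\<And>x. x \<in> I \<rightarrow>\<^sub>E carrier R \<Longrightarrow> q (f x) = p x"
    using hom_lift_through_surjection[OF I p(1) W free_on_module q(1)] q(2) by (metis free_on_simps(1))
  obtain h where h: "h \<in> mod_hom R (free_on R J) (free_on R I)" "\<And>y. y \<in> J \<rightarrow>\<^sub>E carrier R \<Longrightarrow> p (h y) = q y"
    using hom_lift_through_surjection[OF J q(1) W free_on_module p(1)] p(2) by (metis free_on_simps(1))
  note fc = mod_hom_closed[OF f(1), unfolded free_on_simps(1)] and hc = mod_hom_closed[OF h(1), unfolded free_on_simps(1)]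
  have cong: "redv L (k x) = redv L x"
    if r: "r \<in> mod_hom R (free_on R L) W" "\<And>x. x \<in> L \<rightarrow>\<^sub>E carrier R \<Longrightarrow> r x = \<zero>\<^bsub>W\<^esub> \<Longrightarrow> x \<in> L \<rightarrow>\<^sub>E P"
      and k: "k x \<in> L \<rightarrow>\<^sub>E carrier R" "r (k x) = r x" and x: "x \<in> L \<rightarrow>\<^sub>E carrier R" for L :: "'z set" and r k x
  proof -
    interpret E: module R "free_on R L" by (rule free_on_module)
    interpret Q: module R "residue_space L" by (rule residue_space_module)
    have c: "k x \<in> carrier (free_on R L)" "x \<in> carrier (free_on R L)" using k x by simp_all
    have "r (k x \<ominus>\<^bsub>free_on R L\<^esub> x) = r (k x) \<ominus>\<^bsub>W\<^esub> r x"
      by (rule mod_hom_diff[OF E.module_axioms W r(1) c])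
    also have "\<dots> = \<zero>\<^bsub>W\<^esub>" unfolding k(2) a_minus_def by (rule W.M.r_neg[OF mod_hom_closed[OF r(1) c(2)]])
    finally have "k x \<ominus>\<^bsub>free_on R L\<^esub> x \<in> L \<rightarrow>\<^sub>E P"
      using r(2) E.M.minus_closed[OF c] by simp
    then have "redv L (k x \<ominus>\<^bsub>free_on R L\<^esub> x) = \<zero>\<^bsub>free_on K L\<^esub>"
      using redv_kernel[of "k x \<ominus>\<^bsub>free_on R L\<^esub> x" L] E.M.minus_closed[OF c] by simp
    then have 0: "redv L (k x) \<ominus>\<^bsub>residue_space L\<^esub> redv L x = \<zero>\<^bsub>residue_space L\<^esub>"
      using mod_hom_diff[OF E.module_axioms Q.module_axioms redv_hom c] by simp
    have cc: "redv L (k x) \<in> carrier (residue_space L)" "redv L x \<in> carrier (residue_space L)"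
      using mod_hom_closed[OF redv_hom] c by blast+
    have "redv L (k x) = (redv L (k x) \<ominus>\<^bsub>residue_space L\<^esub> redv L x) \<oplus>\<^bsub>residue_space L\<^esub> redv L x"
      unfolding a_minus_def using cc by (simp add: Q.M.a_assoc Q.M.l_neg del: restrict_scalars_simps free_on_simps)
    also have "\<dots> = redv L x" unfolding 0 by (rule Q.M.l_zero[OF cc(2)])
    finally show ?thesis .
  qed
  have b1: "bij_betw (\<lambda>x. h (f x)) (I \<rightarrow>\<^sub>E carrier R) (I \<rightarrow>\<^sub>E carrier R)"
  proof (rule congruent_one_bij[OF I mod_hom_comp[OF f(1) h(1)]])
    fix x assume x: "x \<in> I \<rightarrow>\<^sub>E carrier R"
    show "redv I (h (f x)) = redv I x"
      by (rule cong[of p I "\<lambda>x. h (f x)"]) (simp_all add: p(1) pker x fc hc f(2) h(2))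
  qed
  have b2: "bij_betw (\<lambda>y. f (h y)) (J \<rightarrow>\<^sub>E carrier R) (J \<rightarrow>\<^sub>E carrier R)"
  proof (rule congruent_one_bij[OF J mod_hom_comp[OF h(1) f(1)]])
    fix x assume x: "x \<in> J \<rightarrow>\<^sub>E carrier R"
    show "redv J (f (h x)) = redv J x"
      by (rule cong[of q J "\<lambda>x. f (h x)"]) (simp_all add: q(1) qker x fc hc f(2) h(2))
  qed
  have inj: "inj_on f (I \<rightarrow>\<^sub>E carrier R)"
    using b1 by (auto simp: bij_betw_def inj_on_def)
  have surj: "f ` (I \<rightarrow>\<^sub>E carrier R) = J \<rightarrow>\<^sub>E carrier R"
  proof (intro Set.set_eqI iffI)
    fix y assume "y \<in> J \<rightarrow>\<^sub>E carrier R"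
    then have "y \<in> (\<lambda>y. f (h y)) ` (J \<rightarrow>\<^sub>E carrier R)" using b2 by (simp add: bij_betw_def)
    then show "y \<in> f ` (I \<rightarrow>\<^sub>E carrier R)" using hc by blast
  qed (use fc in blast)
  define g where "g = inv_into (I \<rightarrow>\<^sub>E carrier R) f"
  have gc: "g y \<in> I \<rightarrow>\<^sub>E carrier R" and fg: "f (g y) = y" if "y \<in> J \<rightarrow>\<^sub>E carrier R" for y
    using that surj unfolding g_def by (metis inv_into_into, metis f_inv_into_f)
  have gf: "g (f x) = x" if "x \<in> I \<rightarrow>\<^sub>E carrier R" for x
    unfolding g_def by (rule inv_into_f_f[OF inj that])
  interpret EI: module R "free_on R I" by (rule free_on_module)
  have g: "g \<in> mod_hom R (free_on R J) (free_on R I)"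
  proof (rule mod_homI)
    fix x y assume "x \<in> carrier (free_on R J)" "y \<in> carrier (free_on R J)"
    then have xy: "x \<in> J \<rightarrow>\<^sub>E carrier R" "y \<in> J \<rightarrow>\<^sub>E carrier R" by simp_all
    have c: "g x \<in> carrier (free_on R I)" "g y \<in> carrier (free_on R I)" using gc xy by simp_all
    have "x \<oplus>\<^bsub>free_on R J\<^esub> y = f (g x \<oplus>\<^bsub>free_on R I\<^esub> g y)"
      using mod_hom_add[OF f(1) c] fg xy by (simp del: free_on_simps)
    then show "g (x \<oplus>\<^bsub>free_on R J\<^esub> y) = g x \<oplus>\<^bsub>free_on R I\<^esub> g y"
      using gf[of "g x \<oplus>\<^bsub>free_on R I\<^esub> g y"] EI.M.a_closed[OF c] by (simp only: free_on_simps(1))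
  next
    fix a x assume a: "a \<in> carrier R" and "x \<in> carrier (free_on R J)"
    then have x: "x \<in> J \<rightarrow>\<^sub>E carrier R" by simp
    have c: "g x \<in> carrier (free_on R I)" using gc x by simp
    have "a \<odot>\<^bsub>free_on R J\<^esub> x = f (a \<odot>\<^bsub>free_on R I\<^esub> g x)"
      using mod_hom_smult[OF f(1) a c] fg x by (simp del: free_on_simps)
    then show "g (a \<odot>\<^bsub>free_on R J\<^esub> x) = a \<odot>\<^bsub>free_on R I\<^esub> g x"
      using gf[of "a \<odot>\<^bsub>free_on R I\<^esub> g x"] EI.smult_closed[OF a c] by (simp only: free_on_simps(1))
  qed (use gc in simp)
  have pg: "p (g y) = q y" if "y \<in> J \<rightarrow>\<^sub>E carrier R" for y
    using f(2)[OF gc[OF that]] fg[OF that] by simp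
  show thesis
    by (rule that[OF f(1) g f(2) pg gf fg], assumption+)
qed

lemma poly_residue_surj:
  assumes "q \<in> carrier (UP K)"
  shows "\<exists>Q. Q \<in> carrier (UP R) \<and> poly_residue R P Q = q"
  by (rule poly_residue_lift[OF assms]) (intro exI conjI, assumption+)

text \<open>If \<open>F\<^sub>j\<close> divides \<open>F\<^sub>i\<close>, any lift of \<open>q\<close> serves. If \<open>F\<^sub>j = F\<^sub>iC\<close>, then the reduction of \<open>C\<close> divides
\<open>q\<close>, because the nonzero reduction of \<open>F\<^sub>i\<close> cancels, and the quotient is lifted.\<close>

lemma divisibility_lift:
  assumes F: "Fi \<in> carrier (UP R)" "Fj \<in> carrier (UP R)" "Fi divides\<^bsub>UP R\<^esub> Fj \<or> Fj divides\<^bsub>UP R\<^esub> Fi"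
    and nz: "poly_residue R P Fi \<noteq> \<zero>\<^bsub>UP K\<^esub>"
    and q: "q \<in> carrier (UP K)" "poly_residue R P Fj divides\<^bsub>UP K\<^esub> (poly_residue R P Fi \<otimes>\<^bsub>UP K\<^esub> q)"
  shows "\<exists>Q\<in>carrier (UP R). poly_residue R P Q = q \<and> Fj divides\<^bsub>UP R\<^esub> (Fi \<otimes>\<^bsub>UP R\<^esub> Q)"
proof -
  interpret U: UP_cring R "UP R" by (rule UP_cring.intro) (rule is_cring)
  interpret W: UP_domain K "UP K" by (rule UP_domain.intro) (rule K.domain_axioms)
  note rc = poly_residue_coeff(1) and rm = ring_hom_mult[OF poly_residue_hom]
  show ?thesis
  proof (cases "Fj divides\<^bsub>UP R\<^esub> Fi")
    case True
    obtain Q where Q: "Q \<in> carrier (UP R)" "poly_residue R P Q = q" using poly_residue_surj[OF q(1)] by blast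
    obtain c where c: "c \<in> carrier (UP R)" "Fi = Fj \<otimes>\<^bsub>UP R\<^esub> c" using True by (auto simp: factor_def)
    have "Fi \<otimes>\<^bsub>UP R\<^esub> Q = Fj \<otimes>\<^bsub>UP R\<^esub> (c \<otimes>\<^bsub>UP R\<^esub> Q)" unfolding c(2) by (rule U.P.m_assoc[OF F(2) c(1) Q(1)])
    then have "Fj divides\<^bsub>UP R\<^esub> (Fi \<otimes>\<^bsub>UP R\<^esub> Q)" using U.UP_mult_closed[OF c(1) Q(1)] unfolding factor_def by (rule bexI)
    with Q show ?thesis by (intro bexI[of _ Q] conjI)
  next
    case False
    then obtain G where G: "G \<in> carrier (UP R)" "Fj = Fi \<otimes>\<^bsub>UP R\<^esub> G" using F(3) by (auto simp: factor_def)
    obtain h where h: "h \<in> carrier (UP K)"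
      "poly_residue R P Fi \<otimes>\<^bsub>UP K\<^esub> q = poly_residue R P Fj \<otimes>\<^bsub>UP K\<^esub> h"
      using q(2) by (auto simp: factor_def)
    have "poly_residue R P Fi \<otimes>\<^bsub>UP K\<^esub> q = poly_residue R P Fi \<otimes>\<^bsub>UP K\<^esub> (poly_residue R P G \<otimes>\<^bsub>UP K\<^esub> h)"
      unfolding h(2) G(2) using rm[OF F(1) G(1)] rc F G h by (simp add: W.P.m_assoc)
    then have qh: "q = poly_residue R P G \<otimes>\<^bsub>UP K\<^esub> h"
      using domain.m_lcancel[OF W.UP_domain nz rc[OF F(1)] q(1) W.UP_mult_closed[OF rc[OF G(1)] h(1)]] by simp
    obtain H where H: "H \<in> carrier (UP R)" "poly_residue R P H = h" using poly_residue_surj[OF h(1)] by blast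
    have "poly_residue R P (G \<otimes>\<^bsub>UP R\<^esub> H) = q" using rm[OF G(1) H(1)] H qh by simp
    moreover have "Fi \<otimes>\<^bsub>UP R\<^esub> (G \<otimes>\<^bsub>UP R\<^esub> H) = Fj \<otimes>\<^bsub>UP R\<^esub> H"
      unfolding G(2) using F G H by (simp add: U.P.m_assoc)
    ultimately show ?thesis
      using G H by (intro bexI[of _ "G \<otimes>\<^bsub>UP R\<^esub> H"]) (auto simp: factor_def)
  qed
qed

lemma chain_comparable:
  assumes "sorted_wrt (\<lambda>i j. Q (F i) (F j)) xs" "i \<in> set xs" "j \<in> set xs" "Q (F i) (F i)"
  shows "Q (F i) (F j) \<or> Q (F j) (F i)"
proof -
  obtain a b where "i = xs ! a" "a < length xs" "j = xs ! b" "b < length xs"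
    using assms by (auto simp: in_set_conv_nth)
  then show ?thesis
    using assms sorted_wrt_nth_less[OF assms(1)] by (metis linorder_less_linear)
qed

text \<open>The matrix \<open>B\<close> describes multiplication by \<open>t\<close> on the direct sum of the \<open>R[t]/(F\<^sub>i)\<close>, where the \<open>F\<^sub>i\<close> are
compatible monic lifts of the invariant factors of \<open>A\<close>. In that module an element killed by \<open>F\<^sub>i\<close> can be prescribed
as the image of the \<open>i\<close>-th generator, so endomorphisms of \<open>M\<^sup>A\<close> lift.\<close>

lemma centralizer_lift:
  assumes A: "A \<in> matrices K n"
  obtains B where "B \<in> matrices R n" "redm n B = A"
    "\<And>g. g \<in> matrices K n \<Longrightarrow> g \<otimes>\<^bsub>mat_ring K n\<^esub> A = A \<otimes>\<^bsub>mat_ring K n\<^esub> g \<Longrightarrow>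
      \<exists>\<gamma>. \<gamma> \<in> matrices R n \<and> redm n \<gamma> = g \<and> \<gamma> \<otimes>\<^bsub>mat_ring R n\<^esub> B = B \<otimes>\<^bsub>mat_ring R n\<^esub> \<gamma>"
proof -
  let ?V = "free_on K {..<n}" and ?A = "mat_vec K n A" and ?W = "residue_space {..<n}" and ?Rn = "free_on R {..<n}"
  define M where "M = matrix_module K n A"
  define MW where "MW = poly_module R ?W ?A"
  interpret U: UP_cring R "UP R" by (rule UP_cring.intro) (rule is_cring)
  interpret UK: UP_domain K "UP K" by (rule UP_domain.intro) (rule K.domain_axioms)
  note W = residue_space_module[of "{..<n}"] and hW = mat_vec_residue_hom[OF A] and hV = K.mat_vec_hom[OF A]
  interpret W: module R ?W by (rule W)
  interpret V: module K ?V by (rule K.free_on_module)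
  have M_eq: "M = poly_module K ?V ?A" by (simp add: M_def matrix_module_eq)
  have Mm: "module (UP K) M" unfolding M_eq by (rule poly_module_module[OF K.free_on_module hV])
  have MWm: "module (UP R) MW" unfolding MW_def by (rule poly_module_module[OF W hW])
  interpret M: module "UP K" M by (rule Mm)
  interpret MW: module "UP R" MW by (rule MWm)
  have MW_smult: "p \<odot>\<^bsub>MW\<^esub> v = poly_residue R P p \<odot>\<^bsub>M\<^esub> v" if "p \<in> carrier (UP R)" "v \<in> vectors K n" for p v
    unfolding MW_def M_def by (rule poly_smult_residue[OF A that])
  have Mc: "carrier M = (vectors K n)" "\<zero>\<^bsub>M\<^esub> = \<zero>\<^bsub>?V\<^esub>" by (simp_all add: M_eq)
  have Wc: "carrier ?W = (vectors K n)" by simp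
  have MWc: "carrier MW = (vectors K n)" "\<zero>\<^bsub>MW\<^esub> = \<zero>\<^bsub>?V\<^esub>" by (simp_all add: MW_def)
  have sum_eq: "finsum MW f I = finsum M f I" for f and I :: "'z set"
    unfolding MW_def M_eq finsum_poly_module by (simp add: finsum_def finprod_def restrict_scalars_def)
  obtain u d f xs where u: "\<And>i. i < n \<Longrightarrow> u i \<in> vectors K n" "\<And>i. i < n \<Longrightarrow> monic_of_degree K (d i) (f i)"
    "\<And>i. i < n \<Longrightarrow> f i \<odot>\<^bsub>M\<^esub> u i = \<zero>\<^bsub>?V\<^esub>"
    "\<And>b i. (\<And>i. i < n \<Longrightarrow> b i \<in> carrier (UP K)) \<Longrightarrow> lincomb M {..<n} u b = \<zero>\<^bsub>?V\<^esub> \<Longrightarrow> i < n \<Longrightarrow> f i divides\<^bsub>UP K\<^esub> b i"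
    "\<And>v. v \<in> vectors K n \<Longrightarrow> \<exists>b. (\<forall>i<n. b i \<in> carrier (UP K)) \<and> v = lincomb M {..<n} u b"
    "distinct xs" "set xs = {..<n}" "sorted_wrt (\<lambda>i j. f i divides\<^bsub>UP K\<^esub> f j) xs"
    unfolding M_def using K.matrix_invariant_factors[OF A] by blast
  have "\<exists>F. (\<forall>i\<in>set xs. monic_of_degree R (d i) (F i) \<and> poly_residue R P (F i) = f i) \<and>
    sorted_wrt (\<lambda>i j. F i divides\<^bsub>UP R\<^esub> F j) xs"
    by (rule chain_lift[OF u(6,8)]) (use u(2,7) in simp)
  then obtain F where F: "\<And>i. i < n \<Longrightarrow> monic_of_degree R (d i) (F i)" "\<And>i. i < n \<Longrightarrow> poly_residue R P (F i) = f i"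
    "sorted_wrt (\<lambda>i j. F i divides\<^bsub>UP R\<^esub> F j) xs"
    unfolding u(7) by blast
  have Fc: "F i \<in> carrier (UP R)" if "i < n" for i using F(1)[OF that] by (simp add: monic_of_degree_def)
  have fc: "f i \<in> carrier (UP K)" if "i < n" for i using u(2)[OF that] by (simp add: monic_of_degree_def)
  have f_nz: "f i \<noteq> \<zero>\<^bsub>UP K\<^esub>" if "i < n" for i
    using u(2)[OF that] K.one_not_zero by (auto simp: monic_of_degree_def)
  have comparable: "F i divides\<^bsub>UP R\<^esub> F j \<or> F j divides\<^bsub>UP R\<^esub> F i" if "i < n" "j < n" for i j
    using chain_comparable[OF F(3), of i j] that u(7) Fc[of i] U.P.divides_refl by simp
  \<comment> \<open>\<open>?E\<close> is the direct sum of the \<open>R[t]/(F i)\<close>: the basis vector \<open>(i, j)\<close> is \<open>t\<^sup>j\<close> in the \<open>i\<close>-th summand,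
    and \<open>T\<close> is multiplication by \<open>t\<close>. The map \<open>\<pi>\<close> to \<open>k\<^sup>n\<close> sends it to \<open>A\<^sup>j u\<^sub>i\<close>.\<close>
  define I where "I = Sigma {..<n} (\<lambda>i. {..<d i})"
  have I: "finite I" by (simp add: I_def)
  let ?E = "free_on R I" and ?e = "unit_vec R I"
  note E = free_on_module[of I]
  interpret E: module R ?E by (rule E)
  have ec: "?e l \<in> carrier ?E" for l by simp
  define y where "y = (\<lambda>(i, j). (?A ^^ j) (u i))"
  have yc: "y l \<in> carrier ?W" if l: "l \<in> I" for l
  proof -
    obtain i j where ij: "l = (i, j)" "i < n" using l by (auto simp: I_def)
    show ?thesis using mod_hom_closed[OF mod_hom_funpow[OF hW], of "u i" j] u(1)[OF ij(2)] by (simp add: y_def ij(1))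
  qed
  define tail where "tail i = (\<Oplus>\<^bsub>?E\<^esub>l\<in>{..<d i}. up_ring.coeff (UP R) (F i) l \<odot>\<^bsub>?E\<^esub> ?e (i, l))" for i
  have tailc: "tail i \<in> carrier ?E" if "i < n" for i
    unfolding tail_def using Fc[OF that] ec E.smult_closed U.coeff_closed by (intro E.M.finsum_closed) blast
  define \<tau> where "\<tau> = (\<lambda>(i, j). if Suc j < d i then ?e (i, Suc j) else \<ominus>\<^bsub>?E\<^esub> tail i)"
  have \<tau>c: "\<tau> l \<in> carrier ?E" if "l \<in> I" for l
    using that ec E.M.a_inv_closed[OF tailc] unfolding I_def \<tau>_def by (auto simp del: free_on_simps)
  define T where "T = lincomb ?E I \<tau>"
  have T: "T \<in> mod_hom R ?E ?E" unfolding T_def by (rule lincomb_hom[OF E \<tau>c I])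
  have Te: "T (?e l) = \<tau> l" if "l \<in> I" for l unfolding T_def by (rule lincomb_unit_vec[OF E \<tau>c I that])
  define \<pi> where "\<pi> = lincomb ?W I y"
  have \<pi>: "\<pi> \<in> mod_hom R ?E ?W" unfolding \<pi>_def by (rule lincomb_hom[OF W yc I])
  have \<pi>e: "\<pi> (?e l) = y l" if "l \<in> I" for l unfolding \<pi>_def by (rule lincomb_unit_vec[OF W yc I that])
  define XE where "XE = poly_module R ?E T"
  have XEm: "module (UP R) XE" unfolding XE_def by (rule poly_module_module[OF E T])
  interpret XE: module "UP R" XE by (rule XEm)
  have XEc: "carrier XE = carrier ?E" "\<zero>\<^bsub>XE\<^esub> = \<zero>\<^bsub>?E\<^esub>" by (simp_all add: XE_def)
  \<comment> \<open>The element \<open>1\<close> of the \<open>i\<close>-th summand; this summand is zero if \<open>d i = 0\<close>.\<close>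
  define \<upsilon> where "\<upsilon> i = (if 0 < d i then ?e (i, 0) else \<zero>\<^bsub>?E\<^esub>)" for i
  have \<upsilon>c: "\<upsilon> i \<in> carrier ?E" for i unfolding \<upsilon>_def using ec E.M.zero_closed by (simp del: free_on_simps)
  have T\<upsilon>: "(T ^^ j) (\<upsilon> i) = ?e (i, j)" if "i < n" "j < d i" for i j
    using that
  proof (induction j)
    case 0
    then show ?case by (simp add: \<upsilon>_def)
  next
    case (Suc j)
    then show ?case using Te[of "(i, j)"] by (simp add: I_def \<tau>_def)
  qed
  have tail_alt: "tail i = (\<Oplus>\<^bsub>?E\<^esub>l\<in>{..<d i}. up_ring.coeff (UP R) (F i) l \<odot>\<^bsub>?E\<^esub> (T ^^ l) (\<upsilon> i))" if "i < n" for i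
    unfolding tail_def using T\<upsilon>[OF that] Fc[OF that] ec E.smult_closed U.coeff_closed
    by (intro E.M.finsum_cong') (simp_all del: free_on_simps)
  have T_top: "T (?e (i, j)) = \<ominus>\<^bsub>?E\<^esub> tail i" if "i < n" "d i = Suc j" for i j
    using Te[of "(i, j)"] that by (simp add: I_def \<tau>_def)
  have F\<upsilon>: "F i \<odot>\<^bsub>XE\<^esub> \<upsilon> i = \<zero>\<^bsub>?E\<^esub>" if i: "i < n" for i
  proof (cases "d i")
    case 0
    then show ?thesis using XE.smult_r_null[OF Fc[OF i]] XEc by (simp add: \<upsilon>_def del: free_on_simps)
  next
    case (Suc j)
    have "F i \<odot>\<^bsub>XE\<^esub> \<upsilon> i = (T ^^ d i) (\<upsilon> i) \<oplus>\<^bsub>?E\<^esub> tail i"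
      unfolding XE_def tail_alt[OF i] by (rule monic_smult[OF E T \<upsilon>c F(1)[OF i]])
    also have "(T ^^ d i) (\<upsilon> i) = \<ominus>\<^bsub>?E\<^esub> tail i"
      unfolding Suc using T\<upsilon>[OF i, of j] T_top[OF i Suc] Suc by simp
    also have "\<ominus>\<^bsub>?E\<^esub> tail i \<oplus>\<^bsub>?E\<^esub> tail i = \<zero>\<^bsub>?E\<^esub>" by (rule E.M.l_neg[OF tailc[OF i]])
    finally show ?thesis .
  qed
  have uW: "u i \<in> carrier ?W" if "i < n" for i using u(1)[OF that] by simp
  \<comment> \<open>As \<open>F i\<close> is monic, an element it kills satisfies a recursion of order \<open>d i\<close>.\<close>
  have top_gen: "(S ^^ d i) z = \<ominus>\<^bsub>Y\<^esub> (\<Oplus>\<^bsub>Y\<^esub>l\<in>{..<d i}. up_ring.coeff (UP R) (F i) l \<odot>\<^bsub>Y\<^esub> (S ^^ l) z)"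
    if i: "i < n" and Y: "module R Y" "S \<in> mod_hom R Y Y" "z \<in> carrier Y" "F i \<odot>\<^bsub>poly_module R Y S\<^esub> z = \<zero>\<^bsub>Y\<^esub>"
    for i and Y :: "('a, 'y) module" and S z
  proof -
    interpret Y: module R Y by (rule Y(1))
    have Sc: "(S ^^ l) z \<in> carrier Y" for l by (rule mod_hom_closed[OF mod_hom_funpow[OF Y(2)] Y(3)])
    have c: "(\<Oplus>\<^bsub>Y\<^esub>l\<in>{..<d i}. up_ring.coeff (UP R) (F i) l \<odot>\<^bsub>Y\<^esub> (S ^^ l) z) \<in> carrier Y"
      using Sc Fc[OF i] by (intro Y.M.finsum_closed) simp
    show ?thesis
      using monic_smult[OF Y(1-3) F(1)[OF i]] Y(4) Y.M.minus_equality[OF _ c Sc] by simp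
  qed
  \<comment> \<open>The universal property of the sum: elements killed by the \<open>F i\<close> are the images of the generators under a
    \<open>t\<close>-linear map. Only the top basis vector of each summand is in question.\<close>
  have intertwines: "h (T x) = S (h x)"
    if Y: "module R Y" "S \<in> mod_hom R Y Y" and h: "h \<in> mod_hom R ?E Y"
      and z: "\<And>i. i < n \<Longrightarrow> z i \<in> carrier Y" "\<And>i. i < n \<Longrightarrow> F i \<odot>\<^bsub>poly_module R Y S\<^esub> z i = \<zero>\<^bsub>Y\<^esub>"
      and he: "\<And>i j. (i, j) \<in> I \<Longrightarrow> h (?e (i, j)) = (S ^^ j) (z i)" and x: "x \<in> I \<rightarrow>\<^sub>E carrier R"
    for Y :: "('a, 'y) module" and S h z x
  proof (rule hom_eqI_unit_vec[OF Y(1) mod_hom_comp[OF T h] mod_hom_comp[OF h Y(2)] I x])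
    interpret Y: module R Y by (rule Y(1))
    fix l assume l: "l \<in> I"
    then obtain i j where ij: "l = (i, j)" "i < n" "j < d i" by (auto simp: I_def)
    have Sz: "(S ^^ k) (z i) \<in> carrier Y" for k by (rule mod_hom_closed[OF mod_hom_funpow[OF Y(2)] z(1)[OF ij(2)]])
    show "h (T (?e l)) = S (h (?e l))"
    proof (cases "Suc j < d i")
      case True
      then have "(i, Suc j) \<in> I" using ij by (simp add: I_def)
      then show ?thesis using True l ij by (simp add: Te he \<tau>_def)
    next
      case False
      then have dj: "d i = Suc j" using ij by simp
      have "h (T (?e l)) = \<ominus>\<^bsub>Y\<^esub> h (tail i)"
        unfolding ij(1) T_top[OF ij(2) dj] by (rule mod_hom_minus[OF E Y(1) h tailc[OF ij(2)]])
      also have "h (tail i) = (\<Oplus>\<^bsub>Y\<^esub>l\<in>{..<d i}. h (up_ring.coeff (UP R) (F i) l \<odot>\<^bsub>?E\<^esub> ?e (i, l)))"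
        unfolding tail_def using Fc[OF ij(2)] ec E.smult_closed U.coeff_closed
        by (intro mod_hom_finsum[OF E Y(1) h]) blast
      also have "\<dots> = (\<Oplus>\<^bsub>Y\<^esub>l\<in>{..<d i}. up_ring.coeff (UP R) (F i) l \<odot>\<^bsub>Y\<^esub> (S ^^ l) (z i))"
      proof (rule Y.M.finsum_cong'[OF refl])
        show "(\<lambda>l. up_ring.coeff (UP R) (F i) l \<odot>\<^bsub>Y\<^esub> (S ^^ l) (z i)) \<in> {..<d i} \<rightarrow> carrier Y"
          using Y.smult_closed[OF U.coeff_closed[OF Fc[OF ij(2)]] Sz] by blast
        fix k assume "k \<in> {..<d i}"
        then have "(i, k) \<in> I" using ij by (simp add: I_def)
        then show "h (up_ring.coeff (UP R) (F i) k \<odot>\<^bsub>?E\<^esub> ?e (i, k)) = up_ring.coeff (UP R) (F i) k \<odot>\<^bsub>Y\<^esub> (S ^^ k) (z i)"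
          using mod_hom_smult[OF h U.coeff_closed[OF Fc[OF ij(2)]] ec] he[of i k] by (simp del: free_on_simps)
      qed
      also have "\<ominus>\<^bsub>Y\<^esub> \<dots> = (S ^^ d i) (z i)"
        by (rule top_gen[OF ij(2) Y z(1)[OF ij(2)] z(2)[OF ij(2)], symmetric])
      also have "\<dots> = S (h (?e l))" unfolding dj using he[of i j] l ij by simp
      finally show ?thesis .
    qed
  qed
  have u_torsion: "F i \<odot>\<^bsub>poly_module R ?W ?A\<^esub> u i = \<zero>\<^bsub>?W\<^esub>" if "i < n" for i
    using MW_smult[OF Fc[OF that] u(1)[OF that]] u(3)[OF that] F(2)[OF that] by (simp add: MW_def)
  have \<pi>T: "\<pi> (T x) = ?A (\<pi> x)" if "x \<in> I \<rightarrow>\<^sub>E carrier R" for x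
    by (rule intertwines[of ?W ?A \<pi> u, OF W hW \<pi> uW u_torsion _ that], assumption+) (simp only: \<pi>e y_def case_prod_conv)
  have \<pi>X: "\<pi> \<in> mod_hom (UP R) XE MW"
    unfolding XE_def MW_def by (rule poly_module_hom[OF E W T hW \<pi>]) (unfold free_on_simps(1), rule \<pi>T)
  have \<pi>\<upsilon>: "\<pi> (\<upsilon> i) = u i" if i: "i < n" for i
  proof (cases "d i")
    case 0
    have "(?A ^^ d i) (u i) = \<ominus>\<^bsub>?W\<^esub> (\<Oplus>\<^bsub>?W\<^esub>l\<in>{..<d i}. up_ring.coeff (UP R) (F i) l \<odot>\<^bsub>?W\<^esub> (?A ^^ l) (u i))"
      using MW_smult[OF Fc[OF i] u(1)[OF i]] u(3)[OF i] F(2)[OF i]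
      by (intro top_gen[OF i W hW uW[OF i]]) (simp add: MW_def)
    then have "u i = \<zero>\<^bsub>?W\<^esub>" unfolding 0 by (simp del: restrict_scalars_simps free_on_simps)
    moreover have "\<pi> (\<upsilon> i) = \<zero>\<^bsub>?W\<^esub>"
      unfolding \<upsilon>_def 0 using mod_hom_zero[OF E W \<pi>] by (simp del: restrict_scalars_simps free_on_simps)
    ultimately show ?thesis by simp
  next
    case (Suc j)
    then have "(i, 0) \<in> I" using i by (simp add: I_def)
    then show ?thesis using Suc \<pi>e[of "(i, 0)"] by (simp add: \<upsilon>_def y_def)
  qed
  have \<pi>_comb: "\<pi> (lincomb XE {..<n} \<upsilon> Q) = lincomb M {..<n} u (\<lambda>i. poly_residue R P (Q i))"
    if Q: "\<And>i. i < n \<Longrightarrow> Q i \<in> carrier (UP R)" for Q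
  proof -
    have "\<pi> (lincomb XE {..<n} \<upsilon> Q) = (\<Oplus>\<^bsub>MW\<^esub>i\<in>{..<n}. \<pi> (Q i \<odot>\<^bsub>XE\<^esub> \<upsilon> i))"
      unfolding lincomb_def using Q \<upsilon>c XE.smult_closed XEc
      by (intro mod_hom_finsum[OF XEm MWm \<pi>X]) (simp add: Pi_iff del: free_on_simps)
    also have "\<dots> = (\<Oplus>\<^bsub>MW\<^esub>i\<in>{..<n}. poly_residue R P (Q i) \<odot>\<^bsub>M\<^esub> u i)"
    proof (rule MW.M.finsum_cong'[OF refl])
      show "(\<lambda>i. poly_residue R P (Q i) \<odot>\<^bsub>M\<^esub> u i) \<in> {..<n} \<rightarrow> carrier MW"
        using M.smult_closed poly_residue_coeff(1) Q u(1) Mc MWc by (simp add: Pi_iff)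
      fix i assume "i \<in> {..<n}"
      then show "\<pi> (Q i \<odot>\<^bsub>XE\<^esub> \<upsilon> i) = poly_residue R P (Q i) \<odot>\<^bsub>M\<^esub> u i"
        using mod_hom_smult[OF \<pi>X, of "Q i" "\<upsilon> i"] Q \<upsilon>c \<pi>\<upsilon> MW_smult u(1) XEc by simp
    qed
    finally show ?thesis unfolding sum_eq lincomb_def .
  qed
  have \<pi>_surj: "\<pi> ` (I \<rightarrow>\<^sub>E carrier R) = carrier ?W"
  proof (intro Set.set_eqI iffI)
    fix v assume "v \<in> carrier ?W"
    then obtain b where b: "\<And>i. i < n \<Longrightarrow> b i \<in> carrier (UP K)" "v = lincomb M {..<n} u b" using u(5)[of v] by auto
    have "\<forall>i. \<exists>Q. i < n \<longrightarrow> Q \<in> carrier (UP R) \<and> poly_residue R P Q = b i"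
      using poly_residue_surj[OF b(1)] by blast
    from choice[OF this] obtain Q where Q: "\<And>i. i < n \<Longrightarrow> Q i \<in> carrier (UP R)" "\<And>i. i < n \<Longrightarrow> poly_residue R P (Q i) = b i" by blast
    have "lincomb M {..<n} u (\<lambda>i. poly_residue R P (Q i)) = lincomb M {..<n} u b"
      unfolding lincomb_def using Q b u(1) Mc M.smult_closed by (intro M.M.finsum_cong') (simp_all add: Pi_iff)
    then have "\<pi> (lincomb XE {..<n} \<upsilon> Q) = v" using \<pi>_comb[OF Q(1)] b by simp
    moreover have "lincomb XE {..<n} \<upsilon> Q \<in> carrier XE" using Q \<upsilon>c XEc by (intro lincomb_closed[OF XEm]) (simp_all del: free_on_simps)
    ultimately show "v \<in> \<pi> ` (I \<rightarrow>\<^sub>E carrier R)" using XEc by auto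
  next
    fix v assume "v \<in> \<pi> ` (I \<rightarrow>\<^sub>E carrier R)"
    then show "v \<in> carrier ?W" using mod_hom_closed[OF \<pi>] by auto
  qed
  \<comment> \<open>In a relation between the \<open>u i\<close>, the \<open>i\<close>-th coefficient is a multiple of \<open>f i\<close>. A polynomial of degree less
    than \<open>d i\<close> is such a multiple only if it is zero.\<close>
  have \<pi>_ker: "x \<in> I \<rightarrow>\<^sub>E P" if x: "x \<in> I \<rightarrow>\<^sub>E carrier R" and \<pi>x: "\<pi> x = \<zero>\<^bsub>?W\<^esub>" for x
  proof -
    define q where "q i = (\<lambda>j. if j < d i \<and> i < n then x (i, j) else \<zero>)" for i
    have "q i \<in> up R" for i
    proof (rule mem_upI)
      have "bound \<zero> (d i) (q i)" by (rule bound.intro) (simp add: q_def)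
      then show "\<exists>n. bound \<zero> n (q i)" by blast
    qed (use PiE_app[OF x] in \<open>simp add: q_def I_def\<close>)
    note qU = up_mem_UP(1)[OF this] and qi = fun_cong[OF up_mem_UP(2)[OF this]]
    have q\<upsilon>: "q i \<odot>\<^bsub>XE\<^esub> \<upsilon> i = (\<Oplus>\<^bsub>?E\<^esub>j\<in>{..<d i}. x (i, j) \<odot>\<^bsub>?E\<^esub> ?e (i, j))" if "i < n" for i
    proof -
      have "q i \<odot>\<^bsub>XE\<^esub> \<upsilon> i = (\<Oplus>\<^bsub>?E\<^esub>j\<in>{..<d i}. up_ring.coeff (UP R) (q i) j \<odot>\<^bsub>?E\<^esub> (T ^^ j) (\<upsilon> i))"
        unfolding XE_def by (rule poly_smult_bound[OF E T qU \<upsilon>c]) (simp only: qi, simp add: q_def)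
      also have "\<dots> = (\<Oplus>\<^bsub>?E\<^esub>j\<in>{..<d i}. x (i, j) \<odot>\<^bsub>?E\<^esub> ?e (i, j))"
      proof (rule E.M.finsum_cong'[OF refl])
        show "(\<lambda>j. x (i, j) \<odot>\<^bsub>?E\<^esub> ?e (i, j)) \<in> {..<d i} \<rightarrow> carrier ?E"
          using PiE_app[OF x] that ec E.smult_closed by (simp add: I_def del: free_on_simps)
      qed (use T\<upsilon>[OF that] that in \<open>simp add: qi, simp add: q_def\<close>)
      finally show ?thesis .
    qed
    have "x = lincomb ?E I ?e x" using x I by (simp add: lincomb_unit_vecs)
    also have "\<dots> = (\<Oplus>\<^bsub>?E\<^esub>i\<in>{..<n}. \<Oplus>\<^bsub>?E\<^esub>j\<in>{..<d i}. x (i, j) \<odot>\<^bsub>?E\<^esub> ?e (i, j))"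
    proof -
      have "x (i, j) \<odot>\<^bsub>?E\<^esub> ?e (i, j) \<in> carrier ?E" if "i \<in> {..<n}" "j \<in> {..<d i}" for i j
        using PiE_app[OF x, of "(i, j)"] that by (intro E.smult_closed ec) (simp add: I_def)
      then have "(\<Oplus>\<^bsub>?E\<^esub>l\<in>Sigma {..<n} (\<lambda>i. {..<d i}). x l \<odot>\<^bsub>?E\<^esub> ?e l)
          = (\<Oplus>\<^bsub>?E\<^esub>i\<in>{..<n}. \<Oplus>\<^bsub>?E\<^esub>j\<in>{..<d i}. x (i, j) \<odot>\<^bsub>?E\<^esub> ?e (i, j))"
        by (intro E.M.finsum_Sigma) simp_all
      then show ?thesis unfolding lincomb_def by (simp only: I_def[symmetric])
    qed
    also have "\<dots> = (\<Oplus>\<^bsub>?E\<^esub>i\<in>{..<n}. q i \<odot>\<^bsub>XE\<^esub> \<upsilon> i)"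
    proof (rule E.M.finsum_cong'[OF refl])
      show "(\<lambda>i. q i \<odot>\<^bsub>XE\<^esub> \<upsilon> i) \<in> {..<n} \<rightarrow> carrier ?E"
        using XE.smult_closed[OF qU] \<upsilon>c XEc by (simp add: Pi_iff del: free_on_simps)
    qed (use q\<upsilon> in \<open>simp del: free_on_simps\<close>)
    also have "\<dots> = lincomb XE {..<n} \<upsilon> q" unfolding lincomb_def by (simp add: XE_def finsum_poly_module)
    finally have "\<pi> x = lincomb M {..<n} u (\<lambda>i. poly_residue R P (q i))" using \<pi>_comb[OF qU] by simp
    with \<pi>x have rel: "lincomb M {..<n} u (\<lambda>i. poly_residue R P (q i)) = \<zero>\<^bsub>?V\<^esub>" by simp
    show ?thesis
    proof -
      have "x (i, j) \<in> P" if ij: "i < n" "j < d i" for i j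
      proof -
        obtain h where h: "h \<in> carrier (UP K)" "poly_residue R P (q i) = f i \<otimes>\<^bsub>UP K\<^esub> h"
          using u(4)[OF poly_residue_coeff(1)[OF qU] rel ij(1)] by (auto simp: factor_def)
        have "h = \<zero>\<^bsub>UP K\<^esub>"
        proof (rule ccontr)
          assume h0: "h \<noteq> \<zero>\<^bsub>UP K\<^esub>"
          have "up_ring.coeff (UP K) (f i \<otimes>\<^bsub>UP K\<^esub> h) (d i + deg K h) = up_ring.coeff (UP K) h (deg K h)"
            using K.top_coeff_mult(1)[of "f i" "d i" h "deg K h"] u(2)[OF ij(1)] h UK.deg_aboveD[OF _ h(1)]
            by (auto simp: monic_of_degree_def)
          moreover have "up_ring.coeff (UP K) (poly_residue R P (q i)) (d i + deg K h) = \<zero>\<^bsub>K\<^esub>"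
            unfolding poly_residue_coeff(2)[OF qU] qi by (simp add: q_def)
          ultimately show False using UK.lcoeff_nonzero[OF h0 h(1)] h(2) by simp
        qed
        then have "up_ring.coeff (UP K) (poly_residue R P (q i)) j = \<zero>\<^bsub>K\<^esub>" using h(2) fc[OF ij(1)] by simp
        then have "res (q i j) = \<zero>\<^bsub>K\<^esub>" unfolding poly_residue_coeff(2)[OF qU] qi .
        then show ?thesis using ij res_eq_zero_iff[of "x (i, j)"] PiE_app[OF x] by (simp add: q_def I_def)
      qed
      then show ?thesis using x by (auto simp: PiE_iff I_def)
    qed
  qed
  have redv_surj': "redv {..<n} ` (vectors R n) = carrier ?W"
    unfolding Wc
  proof (intro equalityI image_subsetI subsetI)
    fix v assume "v \<in> vectors K n"
    from redv_surj[OF this] show "v \<in> redv {..<n} ` (vectors R n)" by blast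
  qed (rule redv_closed)
  have redv_ker: "x \<in> {..<n} \<rightarrow>\<^sub>E P" if "x \<in> vectors R n" "redv {..<n} x = \<zero>\<^bsub>?W\<^esub>" for x
    using redv_kernel[OF that(1)] that(2) by simp
  \<comment> \<open>\<open>?E\<close> and \<open>R\<^sup>n\<close> both reduce to \<open>k\<^sup>n\<close>.\<close>
  obtain \<psi> \<theta> where \<psi>: "\<psi> \<in> mod_hom R ?E ?Rn" and \<theta>: "\<theta> \<in> mod_hom R ?Rn ?E"
    and \<psi>\<pi>: "\<And>x. x \<in> I \<rightarrow>\<^sub>E carrier R \<Longrightarrow> redv {..<n} (\<psi> x) = \<pi> x"
    and \<theta>\<pi>: "\<And>x. x \<in> vectors R n \<Longrightarrow> \<pi> (\<theta> x) = redv {..<n} x"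
    and \<theta>\<psi>: "\<And>x. x \<in> I \<rightarrow>\<^sub>E carrier R \<Longrightarrow> \<theta> (\<psi> x) = x"
    and \<psi>\<theta>: "\<And>x. x \<in> vectors R n \<Longrightarrow> \<psi> (\<theta> x) = x"
    by (rule iso_of_projective_covers[OF I finite_lessThan W \<pi> \<pi>_surj redv_hom redv_surj' \<pi>_ker redv_ker],
      assumption+, rule that, assumption+)
  note \<theta>c = mod_hom_closed[OF \<theta>, unfolded free_on_simps(1)] and \<psi>c = mod_hom_closed[OF \<psi>, unfolded free_on_simps(1)]
  \<comment> \<open>Endomorphisms of \<open>?E\<close> become matrices over \<open>R\<close>, compatibly with reduction.\<close>
  have transfer: "\<exists>B. B \<in> matrices R n \<and> redm n B = C \<and> (\<forall>x\<in>vectors R n. mat_vec R n B x = \<psi> (S (\<theta> x)))"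
    if S: "S \<in> mod_hom R ?E ?E" and C: "C \<in> matrices K n"
      and SC: "\<And>x. x \<in> I \<rightarrow>\<^sub>E carrier R \<Longrightarrow> \<pi> (S x) = mat_vec K n C (\<pi> x)" for S C
  proof -
    obtain B where B: "B \<in> matrices R n" "\<And>x. x \<in> vectors R n \<Longrightarrow> \<psi> (S (\<theta> x)) = mat_vec R n B x"
      using matrix_of_hom[OF mod_hom_comp[OF \<theta> mod_hom_comp[OF S \<psi>]]] by blast
    have "redm n B = C"
    proof (rule redm_eqI[OF B(1) C])
      fix x assume x: "x \<in> vectors R n"
      have "S (\<theta> x) \<in> I \<rightarrow>\<^sub>E carrier R" using mod_hom_closed[OF S] \<theta>c[OF x] by simp
      then show "redv {..<n} (mat_vec R n B x) = mat_vec K n C (redv {..<n} x)"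
        unfolding B(2)[OF x, symmetric] using \<psi>\<pi> SC \<theta>c[OF x] \<theta>\<pi>[OF x] by simp
    qed
    with B show ?thesis by auto
  qed
  obtain B where B: "B \<in> matrices R n" "redm n B = A"
    "\<And>x. x \<in> vectors R n \<Longrightarrow> mat_vec R n B x = \<psi> (T (\<theta> x))"
    using transfer[OF T A \<pi>T] by auto
  show thesis
  proof (rule that[OF B(1,2)])
    fix g assume g: "g \<in> matrices K n" and comm: "g \<otimes>\<^bsub>mat_ring K n\<^esub> A = A \<otimes>\<^bsub>mat_ring K n\<^esub> g"
    let ?g = "mat_vec K n g"
    note hgV = K.mat_vec_hom[OF g] and hg = mat_vec_residue_hom[OF g]
    have gA: "?g (?A v) = ?A (?g v)" if "v \<in> vectors K n" for v
      using K.mat_vec_mult[OF g A that] K.mat_vec_mult[OF A g that] comm by simp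
    have gM: "?g \<in> mod_hom (UP K) M M"
      unfolding M_eq using gA by (intro poly_module_hom[OF K.free_on_module K.free_on_module hV hV hgV]) simp
    have gAk: "?g ((?A ^^ k) v) = (?A ^^ k) (?g v)" if "v \<in> vectors K n" for v k
    proof (induction k)
      case (Suc k)
      have "(?A ^^ k) v \<in> vectors K n"
        using mod_hom_closed[OF mod_hom_funpow[OF hV], of v k] that by simp
      then show ?case using gA Suc by simp
    qed simp
    have guc: "?g (u i) \<in> vectors K n" if "i < n" for i using K.mat_vec_closed[OF g u(1)[OF that]] .
    \<comment> \<open>The image of the \<open>i\<close>-th generator under a lift of \<open>g\<close>: if \<open>g u\<^sub>i = (\<Sum>j. q\<^sub>j u\<^sub>j)\<close>, then \<open>f j\<close> divides
      \<open>f i q\<^sub>j\<close>, since \<open>f i\<close> kills \<open>g u\<^sub>i\<close>; the \<open>q\<^sub>j\<close> are lifted accordingly.\<close>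
    have zex: "\<exists>z\<in>carrier ?E. \<pi> z = ?g (u i) \<and> F i \<odot>\<^bsub>XE\<^esub> z = \<zero>\<^bsub>?E\<^esub>" if i: "i < n" for i
    proof -
      obtain q where q: "\<And>j. j < n \<Longrightarrow> q j \<in> carrier (UP K)" "?g (u i) = lincomb M {..<n} u q"
        using u(5)[OF guc[OF i]] by blast
      have "lincomb M {..<n} u (\<lambda>j. f i \<otimes>\<^bsub>UP K\<^esub> q j) = f i \<odot>\<^bsub>M\<^esub> lincomb M {..<n} u q"
      proof -
        have "f i \<odot>\<^bsub>M\<^esub> lincomb M {..<n} u q = (\<Oplus>\<^bsub>M\<^esub>j\<in>{..<n}. f i \<odot>\<^bsub>M\<^esub> (q j \<odot>\<^bsub>M\<^esub> u j))"
          unfolding lincomb_def using q(1) u(1) fc[OF i] Mc M.smult_closed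
          by (intro M.finsum_smult_ldistr) (simp_all add: Pi_iff)
        also have "\<dots> = lincomb M {..<n} u (\<lambda>j. f i \<otimes>\<^bsub>UP K\<^esub> q j)"
          unfolding lincomb_def using q(1) u(1) fc[OF i] Mc M.smult_closed
          by (intro M.M.finsum_cong') (simp_all add: Pi_iff M.smult_assoc1)
        finally show ?thesis by simp
      qed
      also have "\<dots> = ?g (f i \<odot>\<^bsub>M\<^esub> u i)"
        unfolding q(2)[symmetric] using mod_hom_smult[OF gM fc[OF i], of "u i"] u(1)[OF i] Mc by simp
      also have "\<dots> = \<zero>\<^bsub>?V\<^esub>"
        unfolding u(3)[OF i] by (rule mod_hom_zero[OF K.free_on_module K.free_on_module hgV])
      finally have "f j divides\<^bsub>UP K\<^esub> (f i \<otimes>\<^bsub>UP K\<^esub> q j)" if "j < n" for j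
        using u(4)[of "\<lambda>j. f i \<otimes>\<^bsub>UP K\<^esub> q j" j] q(1) fc[OF i] that by simp
      then have "\<exists>Q\<in>carrier (UP R). poly_residue R P Q = q j \<and> F j divides\<^bsub>UP R\<^esub> (F i \<otimes>\<^bsub>UP R\<^esub> Q)" if "j < n" for j
        using divisibility_lift[OF Fc[OF i] Fc[OF that] comparable[OF i that], of "q j"] that F(2) i f_nz[OF i] q(1) by simp
      then have "\<forall>j. \<exists>Q. j < n \<longrightarrow> Q \<in> carrier (UP R) \<and> poly_residue R P Q = q j \<and> F j divides\<^bsub>UP R\<^esub> (F i \<otimes>\<^bsub>UP R\<^esub> Q)" by blast
      from choice[OF this] obtain Q where Q: "\<And>j. j < n \<Longrightarrow> Q j \<in> carrier (UP R)" "\<And>j. j < n \<Longrightarrow> poly_residue R P (Q j) = q j"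
        "\<And>j. j < n \<Longrightarrow> F j divides\<^bsub>UP R\<^esub> (F i \<otimes>\<^bsub>UP R\<^esub> Q j)" by blast
      let ?z = "lincomb XE {..<n} \<upsilon> Q"
      have "?z \<in> carrier ?E" using Q(1) \<upsilon>c XEc lincomb_closed[OF XEm, of "{..<n}" \<upsilon> Q] by (simp del: free_on_simps)
      moreover have "\<pi> ?z = ?g (u i)"
      proof -
        have "lincomb M {..<n} u (\<lambda>j. poly_residue R P (Q j)) = lincomb M {..<n} u q"
          unfolding lincomb_def using Q(2) q(1) u(1) Mc M.smult_closed by (intro M.M.finsum_cong') (simp_all add: Pi_iff)
        then show ?thesis using \<pi>_comb[OF Q(1)] q(2) by simp
      qed
      moreover have "F i \<odot>\<^bsub>XE\<^esub> ?z = \<zero>\<^bsub>?E\<^esub>"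
      proof -
        have "F i \<odot>\<^bsub>XE\<^esub> ?z = (\<Oplus>\<^bsub>XE\<^esub>j\<in>{..<n}. F i \<odot>\<^bsub>XE\<^esub> (Q j \<odot>\<^bsub>XE\<^esub> \<upsilon> j))"
          unfolding lincomb_def using Q(1) \<upsilon>c XEc XE.smult_closed Fc[OF i] by (intro XE.finsum_smult_ldistr) (simp_all add: Pi_iff del: free_on_simps)
        also have "\<dots> = (\<Oplus>\<^bsub>XE\<^esub>j\<in>{..<n}. \<zero>\<^bsub>XE\<^esub>)"
        proof (rule XE.M.finsum_cong'[OF refl])
          fix j assume "j \<in> {..<n}"
          then have j: "j < n" by simp
          obtain H where H: "H \<in> carrier (UP R)" "F i \<otimes>\<^bsub>UP R\<^esub> Q j = F j \<otimes>\<^bsub>UP R\<^esub> H" using Q(3)[OF j] by (auto simp: factor_def)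
          have "F i \<odot>\<^bsub>XE\<^esub> (Q j \<odot>\<^bsub>XE\<^esub> \<upsilon> j) = (H \<otimes>\<^bsub>UP R\<^esub> F j) \<odot>\<^bsub>XE\<^esub> \<upsilon> j"
            using H Fc Q(1) i j \<upsilon>c XEc XE.smult_assoc1[of "F i" "Q j" "\<upsilon> j"] U.P.m_comm[of H "F j"] by (simp del: free_on_simps)
          also have "\<dots> = \<zero>\<^bsub>XE\<^esub>"
            using H Fc j \<upsilon>c XEc XE.smult_assoc1[of H "F j" "\<upsilon> j"] F\<upsilon>[OF j] XE.smult_r_null[OF H(1)] by (simp del: free_on_simps)
          finally show "F i \<odot>\<^bsub>XE\<^esub> (Q j \<odot>\<^bsub>XE\<^esub> \<upsilon> j) = \<zero>\<^bsub>XE\<^esub>" .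
        qed simp
        also have "\<dots> = \<zero>\<^bsub>?E\<^esub>" unfolding XE.M.finsum_zero by (rule XEc(2))
        finally show ?thesis .
      qed
      ultimately show ?thesis by blast
    qed
    have "\<forall>i. \<exists>z. i < n \<longrightarrow> z \<in> carrier ?E \<and> \<pi> z = ?g (u i) \<and> F i \<odot>\<^bsub>XE\<^esub> z = \<zero>\<^bsub>?E\<^esub>" using zex by blast
    from choice[OF this] obtain z where z: "\<And>i. i < n \<Longrightarrow> z i \<in> carrier ?E" "\<And>i. i < n \<Longrightarrow> \<pi> (z i) = ?g (u i)"
      "\<And>i. i < n \<Longrightarrow> F i \<odot>\<^bsub>XE\<^esub> z i = \<zero>\<^bsub>?E\<^esub>" by blast
    define \<zeta> where "\<zeta> = (\<lambda>(i, j). (T ^^ j) (z i))"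
    have Tz: "(T ^^ j) (z i) \<in> carrier ?E" if "i < n" for i j by (rule mod_hom_closed[OF mod_hom_funpow[OF T] z(1)[OF that]])
    have \<zeta>c: "\<zeta> l \<in> carrier ?E" if "l \<in> I" for l
      using that Tz unfolding I_def \<zeta>_def by (auto simp del: free_on_simps)
    define G where "G = lincomb ?E I \<zeta>"
    have G: "G \<in> mod_hom R ?E ?E" unfolding G_def by (rule lincomb_hom[OF E \<zeta>c I])
    have Ge: "G (?e l) = \<zeta> l" if "l \<in> I" for l unfolding G_def by (rule lincomb_unit_vec[OF E \<zeta>c I that])
    have GT: "G (T x) = T (G x)" if "x \<in> I \<rightarrow>\<^sub>E carrier R" for x
      by (rule intertwines[of ?E T G z, OF E T G z(1) z(3)[unfolded XE_def] _ that], assumption+) (simp only: Ge \<zeta>_def case_prod_conv)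
    have \<pi>Tk: "\<pi> ((T ^^ k) x) = (?A ^^ k) (\<pi> x)" if "x \<in> carrier ?E" for x k
      by (induction k) (simp_all add: \<pi>T[OF mod_hom_closed[OF mod_hom_funpow[OF T] that, unfolded free_on_simps(1)]] del: free_on_simps)
    have \<pi>G: "\<pi> (G x) = ?g (\<pi> x)" if x: "x \<in> I \<rightarrow>\<^sub>E carrier R" for x
    proof (rule hom_eqI_unit_vec[OF W mod_hom_comp[OF G \<pi>] mod_hom_comp[OF \<pi> hg] I x])
      fix l assume l: "l \<in> I"
      then obtain i j where ij: "l = (i, j)" "i < n" "j < d i" by (auto simp: I_def)
      then show "\<pi> (G (?e l)) = ?g (\<pi> (?e l))"
        using l \<pi>Tk[OF z(1)[OF ij(2)], of j] z(2)[OF ij(2)] gAk[OF u(1)[OF ij(2)], of j]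
        by (simp add: Ge \<pi>e \<zeta>_def y_def)
    qed
    obtain \<gamma> where \<gamma>: "\<gamma> \<in> matrices R n" "redm n \<gamma> = g"
      "\<And>x. x \<in> vectors R n \<Longrightarrow> mat_vec R n \<gamma> x = \<psi> (G (\<theta> x))"
      using transfer[OF G g \<pi>G] by auto
    have "\<gamma> \<otimes>\<^bsub>mat_ring R n\<^esub> B = B \<otimes>\<^bsub>mat_ring R n\<^esub> \<gamma>"
    proof (rule matrix_eqI[OF matrix_mult_closed[OF \<gamma>(1) B(1)] matrix_mult_closed[OF B(1) \<gamma>(1)]])
      fix v assume v: "v \<in> vectors R n"
      have c: "T (\<theta> v) \<in> I \<rightarrow>\<^sub>E carrier R" "G (\<theta> v) \<in> I \<rightarrow>\<^sub>E carrier R"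
        using mod_hom_closed[OF T] mod_hom_closed[OF G] \<theta>c[OF v] by simp_all
      show "mat_vec R n (\<gamma> \<otimes>\<^bsub>mat_ring R n\<^esub> B) v = mat_vec R n (B \<otimes>\<^bsub>mat_ring R n\<^esub> \<gamma>) v"
        unfolding mat_vec_mult[OF \<gamma>(1) B(1) v] mat_vec_mult[OF B(1) \<gamma>(1) v]
        using \<gamma>(3) B(3) v \<psi>c c \<theta>\<psi> GT[OF \<theta>c[OF v]] by simp
    qed
    with \<gamma> show "\<exists>\<gamma>. \<gamma> \<in> matrices R n \<and> redm n \<gamma> = g \<and> \<gamma> \<otimes>\<^bsub>mat_ring R n\<^esub> B = B \<otimes>\<^bsub>mat_ring R n\<^esub> \<gamma>"
      by blast
  qed
qed

end

section \<open>Extensions of a matrix module by itself\<close>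

text \<open>The block matrix with \<open>A\<close> twice on the diagonal and \<open>c\<close> in the upper right corner.\<close>

definition coupled_operator ::
  "('s, 'x) ring_scheme \<Rightarrow> nat \<Rightarrow> (nat \<times> nat \<Rightarrow> 's) \<Rightarrow> (nat \<times> nat \<Rightarrow> 's)
    \<Rightarrow> (nat \<Rightarrow> 's) \<times> (nat \<Rightarrow> 's) \<Rightarrow> (nat \<Rightarrow> 's) \<times> (nat \<Rightarrow> 's)" where
  "coupled_operator S n A c =
    (\<lambda>(x, y). (mat_vec S n A x \<oplus>\<^bsub>free_on S {..<n}\<^esub> mat_vec S n c y, mat_vec S n A y))"

definition coupled_extension ::
  "('s, 'x) ring_scheme \<Rightarrow> nat \<Rightarrow> (nat \<times> nat \<Rightarrow> 's) \<Rightarrow> (nat \<times> nat \<Rightarrow> 's)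
    \<Rightarrow> (nat \<Rightarrow> 's, nat \<Rightarrow> 's, nat \<Rightarrow> 's) ext" where
  "coupled_extension S n A c =
    \<lparr>ext_mid = poly_module S (direct_sum (free_on S {..<n}) (free_on S {..<n})) (coupled_operator S n A c),
     ext_in = (\<lambda>x. (x, \<zero>\<^bsub>free_on S {..<n}\<^esub>)), ext_out = snd\<rparr>"

definition coupled_class ::
  "('s, 'x) ring_scheme \<Rightarrow> nat \<Rightarrow> (nat \<times> nat \<Rightarrow> 's) \<Rightarrow> (nat \<times> nat \<Rightarrow> 's)
    \<Rightarrow> (nat \<Rightarrow> 's, nat \<Rightarrow> 's, nat \<Rightarrow> 's) ext set" where
  "coupled_class S n A c =
    ext_class (UP S) (matrix_module S n A) (matrix_module S n A) (coupled_extension S n A c)"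

lemma coupled_extension_simps [simp]:
  "ext_mid (coupled_extension S n A c)
    = poly_module S (direct_sum (free_on S {..<n}) (free_on S {..<n})) (coupled_operator S n A c)"
  "ext_in (coupled_extension S n A c) = (\<lambda>x. (x, \<zero>\<^bsub>free_on S {..<n}\<^esub>))"
  "ext_out (coupled_extension S n A c) = snd"
  by (simp_all add: coupled_extension_def)

lemma (in cring) mat_vec_smult:
  assumes C: "C \<in> matrices R n" and a: "a \<in> carrier R" and v: "v \<in> vectors R n"
  shows "mat_vec R n (a \<odot>\<^bsub>free_on R ({..<n} \<times> {..<n})\<^esub> C) v = a \<odot>\<^bsub>free_on R {..<n}\<^esub> mat_vec R n C v"
proof -
  note [simp] = PiE_app[OF C] PiE_app[OF v]
  have "(\<Oplus>j\<in>{..<n}. (a \<odot>\<^bsub>free_on R ({..<n} \<times> {..<n})\<^esub> C) (i, j) \<otimes> v j) = a \<otimes> (\<Oplus>j\<in>{..<n}. C (i, j) \<otimes> v j)"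
    if "i < n" for i
  proof -
    have "(\<Oplus>j\<in>{..<n}. (a \<odot>\<^bsub>free_on R ({..<n} \<times> {..<n})\<^esub> C) (i, j) \<otimes> v j) = (\<Oplus>j\<in>{..<n}. a \<otimes> (C (i, j) \<otimes> v j))"
      using that a by (intro finsum_cong') (simp_all add: m_assoc Pi_iff)
    also have "\<dots> = a \<otimes> (\<Oplus>j\<in>{..<n}. C (i, j) \<otimes> v j)"
      using that a by (intro finsum_rdistr[symmetric]) (simp_all add: Pi_iff)
    finally show ?thesis .
  qed
  then show ?thesis
    unfolding mat_vec_def free_on_simps(4)[of R "{..<n}" a] by (intro restrict_ext) (simp del: free_on_simps)
qed

context cring begin

context
  fixes n :: nat and A :: "nat \<times> nat \<Rightarrow> 'a"
  assumes A: "A \<in> matrices R n"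
begin

abbreviation "Vn \<equiv> free_on R {..<n}"
abbreviation "Mn \<equiv> matrices R n"

lemma Vn_module: "module R Vn" by (rule free_on_module)

lemma VV_module: "module R (direct_sum Vn Vn)" by (rule direct_sum_module[OF Vn_module Vn_module])

lemma matrix_module_module: "module (UP R) (matrix_module R n A)"
  unfolding matrix_module_eq by (rule poly_module_module[OF Vn_module mat_vec_hom[OF A]])

lemma coupled_operator_hom:
  assumes c: "c \<in> Mn"
  shows "coupled_operator R n A c \<in> mod_hom R (direct_sum Vn Vn) (direct_sum Vn Vn)"
proof -
  interpret V: module R Vn by (rule Vn_module)
  note hA = mat_vec_hom[OF A] and hc = mat_vec_hom[OF c]
  note cl = mod_hom_closed[OF hA] mod_hom_closed[OF hc] mod_hom_add[OF hA] mod_hom_add[OF hc]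
    mod_hom_smult[OF hA] mod_hom_smult[OF hc]
  show ?thesis
    by (rule mod_homI)
      (auto simp: coupled_operator_def cl V.M.a_ac V.smult_r_distr simp del: free_on_simps)
qed

lemma coupled_extension_is_extension:
  assumes c: "c \<in> Mn"
  shows "is_extension (UP R) (matrix_module R n A) (matrix_module R n A) (coupled_extension R n A c)"
proof -
  interpret V: module R Vn by (rule Vn_module)
  note hA = mat_vec_hom[OF A] and hc = mat_vec_hom[OF c] and hop = coupled_operator_hom[OF c]
  have "(\<lambda>x. (x, \<zero>\<^bsub>Vn\<^esub>)) \<in> mod_hom R Vn (direct_sum Vn Vn)"
    by (rule mod_homI) (auto simp del: free_on_simps)
  then have "(\<lambda>x. (x, \<zero>\<^bsub>Vn\<^esub>)) \<in> mod_hom (UP R) (poly_module R Vn (mat_vec R n A)) (poly_module R (direct_sum Vn Vn) (coupled_operator R n A c))"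
    using mod_hom_zero[OF Vn_module Vn_module hc] mod_hom_zero[OF Vn_module Vn_module hA] mod_hom_closed[OF hA]
    by (intro poly_module_hom[OF Vn_module VV_module hA hop]) (simp_all add: coupled_operator_def del: free_on_simps)
  moreover have "snd \<in> mod_hom R (direct_sum Vn Vn) Vn"
    by (rule mod_homI) (auto simp del: free_on_simps)
  then have "snd \<in> mod_hom (UP R) (poly_module R (direct_sum Vn Vn) (coupled_operator R n A c)) (poly_module R Vn (mat_vec R n A))"
    by (intro poly_module_hom[OF VV_module Vn_module hop hA]) (simp_all add: coupled_operator_def split_beta del: free_on_simps)
  moreover have "snd ` (carrier Vn \<times> carrier Vn) = carrier Vn"
    using V.M.zero_closed unfolding snd_image_times by (simp split: if_splits del: free_on_simps)
  moreover have "(\<lambda>x. (x, \<zero>\<^bsub>Vn\<^esub>)) ` carrier Vn = {e \<in> carrier Vn \<times> carrier Vn. snd e = \<zero>\<^bsub>Vn\<^esub>}"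
    using V.M.zero_closed by force
  ultimately show ?thesis
    unfolding is_extension_def coupled_extension_simps matrix_module_eq poly_module_simps direct_sum_simps
    using poly_module_module[OF VV_module hop] by (simp add: inj_on_def del: free_on_simps)
qed

text \<open>The map \<open>(x, y) \<mapsto> (\<alpha>x + hy, \<beta>y)\<close> is compatible with \<open>t\<close> exactly when the last equation holds.\<close>

lemma coupled_morphism:
  assumes c: "c \<in> Mn" "c' \<in> Mn" and h: "h \<in> mod_hom R Vn Vn"
    and \<alpha>: "\<alpha> \<in> mod_hom R Vn Vn" "\<And>x. x \<in> carrier Vn \<Longrightarrow> \<alpha> (mat_vec R n A x) = mat_vec R n A (\<alpha> x)"
    and \<beta>: "\<beta> \<in> mod_hom R Vn Vn" "\<And>x. x \<in> carrier Vn \<Longrightarrow> \<beta> (mat_vec R n A x) = mat_vec R n A (\<beta> x)"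
    and eq: "\<And>y. y \<in> carrier Vn \<Longrightarrow> \<alpha> (mat_vec R n c y) \<oplus>\<^bsub>Vn\<^esub> h (mat_vec R n A y)
      = mat_vec R n A (h y) \<oplus>\<^bsub>Vn\<^esub> mat_vec R n c' (\<beta> y)"
  shows "ext_morphism (UP R) (matrix_module R n A) \<alpha> \<beta> (coupled_extension R n A c) (coupled_extension R n A c')"
proof -
  interpret V: module R Vn by (rule Vn_module)
  note hA = mat_vec_hom[OF A] and hc = mat_vec_hom[OF c(1)] and hc' = mat_vec_hom[OF c(2)]
  note cl = mod_hom_closed[OF hA] mod_hom_closed[OF hc] mod_hom_closed[OF hc'] mod_hom_closed[OF h]
    mod_hom_closed[OF \<alpha>(1)] mod_hom_closed[OF \<beta>(1)] mod_hom_add[OF hA]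
    mod_hom_add[OF h] mod_hom_add[OF \<alpha>(1)] mod_hom_add[OF \<beta>(1)]
    mod_hom_smult[OF h] mod_hom_smult[OF \<alpha>(1)] mod_hom_smult[OF \<beta>(1)]
  define \<phi> where "\<phi> = (\<lambda>(x, y). (\<alpha> x \<oplus>\<^bsub>Vn\<^esub> h y, \<beta> y))"
  have \<phi>: "\<phi> \<in> mod_hom R (direct_sum Vn Vn) (direct_sum Vn Vn)"
    by (rule mod_homI) (auto simp: \<phi>_def cl V.M.a_ac V.smult_r_distr simp del: free_on_simps)
  have comm: "\<phi> (coupled_operator R n A c e) = coupled_operator R n A c' (\<phi> e)" if eVV: "e \<in> carrier (direct_sum Vn Vn)" for e
  proof -
    obtain x y where e: "e = (x, y)" "x \<in> carrier Vn" "y \<in> carrier Vn" using eVV by (auto simp del: free_on_simps)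
    have "\<alpha> (mat_vec R n A x) \<oplus>\<^bsub>Vn\<^esub> \<alpha> (mat_vec R n c y) \<oplus>\<^bsub>Vn\<^esub> h (mat_vec R n A y)
        = mat_vec R n A (\<alpha> x) \<oplus>\<^bsub>Vn\<^esub> mat_vec R n A (h y) \<oplus>\<^bsub>Vn\<^esub> mat_vec R n c' (\<beta> y)"
      using e eq[OF e(3)] by (simp add: V.M.a_assoc cl \<alpha>(2) del: free_on_simps)
    then show ?thesis
      using e by (simp add: coupled_operator_def \<phi>_def cl \<beta>(2) del: free_on_simps)
  qed
  show ?thesis
  proof (rule ext_morphismI[of \<phi>])
    show "\<phi> \<in> mod_hom (UP R) (ext_mid (coupled_extension R n A c)) (ext_mid (coupled_extension R n A c'))"
      unfolding coupled_extension_simps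
      by (rule poly_module_hom[OF VV_module VV_module coupled_operator_hom[OF c(1)] coupled_operator_hom[OF c(2)] \<phi>]) (rule comm)
    show "\<phi> (ext_in (coupled_extension R n A c) x) = ext_in (coupled_extension R n A c') (\<alpha> x)"
      if "x \<in> carrier (matrix_module R n A)" for x
      using that mod_hom_zero[OF Vn_module Vn_module h] mod_hom_zero[OF Vn_module Vn_module \<beta>(1)] cl
      by (simp add: \<phi>_def matrix_module_eq del: free_on_simps)
  qed (simp add: \<phi>_def split_beta del: free_on_simps)
qed

text \<open>A morphism over the identities is \<open>(x, y) \<mapsto> (x + hy, y)\<close> for some matrix \<open>h\<close>.\<close>

lemma coupled_morphismD:
  assumes c: "c \<in> Mn" "c' \<in> Mn"
    and m: "ext_morphism (UP R) (matrix_module R n A) id id (coupled_extension R n A c) (coupled_extension R n A c')"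
  obtains h where "h \<in> Mn" "\<And>y. y \<in> carrier Vn \<Longrightarrow>
    mat_vec R n c y \<oplus>\<^bsub>Vn\<^esub> mat_vec R n h (mat_vec R n A y) = mat_vec R n A (mat_vec R n h y) \<oplus>\<^bsub>Vn\<^esub> mat_vec R n c' y"
proof -
  interpret V: module R Vn by (rule Vn_module)
  note hA = mat_vec_hom[OF A] and hc = mat_vec_hom[OF c(1)] and hc' = mat_vec_hom[OF c(2)]
  obtain \<phi> where \<phi>X: "\<phi> \<in> mod_hom (UP R) (ext_mid (coupled_extension R n A c)) (ext_mid (coupled_extension R n A c'))"
    "\<And>x. x \<in> carrier (matrix_module R n A) \<Longrightarrow> \<phi> (ext_in (coupled_extension R n A c) x) = ext_in (coupled_extension R n A c') (id x)"
    "\<And>e. e \<in> carrier (ext_mid (coupled_extension R n A c)) \<Longrightarrow>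
      ext_out (coupled_extension R n A c') (\<phi> e) = id (ext_out (coupled_extension R n A c) e)"
    using m by (rule ext_morphismE) blast
  have \<phi>_in: "\<phi> (x, \<zero>\<^bsub>Vn\<^esub>) = (x, \<zero>\<^bsub>Vn\<^esub>)" if "x \<in> carrier Vn" for x
    using \<phi>X(2)[of x] that by (simp add: matrix_module_eq del: free_on_simps)
  have \<phi>_out: "snd (\<phi> (x, y)) = y" if "x \<in> carrier Vn" "y \<in> carrier Vn" for x y
    using \<phi>X(3)[of "(x, y)"] that by (simp del: free_on_simps)
  note D = poly_module_homD[OF VV_module VV_module coupled_operator_hom[OF c(1)] coupled_operator_hom[OF c(2)]
      \<phi>X(1)[unfolded coupled_extension_simps]]
  define h where "h y = fst (\<phi> (\<zero>\<^bsub>Vn\<^esub>, y))" for y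
  have \<phi>0: "\<phi> (\<zero>\<^bsub>Vn\<^esub>, y) = (h y, y)" if "y \<in> carrier Vn" for y
    unfolding h_def using \<phi>_out[OF V.M.zero_closed that] by (metis prod.collapse)
  have hcl: "h y \<in> carrier Vn" if "y \<in> carrier Vn" for y
    using mod_hom_closed[OF D(1), of "(\<zero>\<^bsub>Vn\<^esub>, y)"] \<phi>0[OF that] that by (simp del: free_on_simps)
  have h: "h \<in> mod_hom R Vn Vn"
  proof (rule mod_homI[OF hcl])
    fix x y assume xy: "x \<in> carrier Vn" "y \<in> carrier Vn"
    have "\<phi> ((\<zero>\<^bsub>Vn\<^esub>, x) \<oplus>\<^bsub>direct_sum Vn Vn\<^esub> (\<zero>\<^bsub>Vn\<^esub>, y)) = \<phi> (\<zero>\<^bsub>Vn\<^esub>, x) \<oplus>\<^bsub>direct_sum Vn Vn\<^esub> \<phi> (\<zero>\<^bsub>Vn\<^esub>, y)"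
      using xy by (intro mod_hom_add[OF D(1)]) (simp_all del: free_on_simps)
    then show "h (x \<oplus>\<^bsub>Vn\<^esub> y) = h x \<oplus>\<^bsub>Vn\<^esub> h y"
      using xy \<phi>0 by (simp del: free_on_simps)
  next
    fix a x assume ax: "a \<in> carrier R" "x \<in> carrier Vn"
    have "\<phi> (a \<odot>\<^bsub>direct_sum Vn Vn\<^esub> (\<zero>\<^bsub>Vn\<^esub>, x)) = a \<odot>\<^bsub>direct_sum Vn Vn\<^esub> \<phi> (\<zero>\<^bsub>Vn\<^esub>, x)"
      using ax by (intro mod_hom_smult[OF D(1)]) (simp_all del: free_on_simps)
    then show "h (a \<odot>\<^bsub>Vn\<^esub> x) = a \<odot>\<^bsub>Vn\<^esub> h x"
      using ax \<phi>0 by (simp del: free_on_simps)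
  qed
  obtain H where H: "H \<in> Mn" "\<And>v. v \<in> vectors R n \<Longrightarrow> h v = mat_vec R n H v"
    using matrix_of_hom[OF h] by blast
  show thesis
  proof (rule that[OF H(1)])
    fix y assume y: "y \<in> carrier Vn"
    note cl = mod_hom_closed[OF hA y] mod_hom_closed[OF hc y] mod_hom_closed[OF hc' y] hcl[OF y]
    have "\<phi> (coupled_operator R n A c (\<zero>\<^bsub>Vn\<^esub>, y)) = \<phi> ((mat_vec R n c y, \<zero>\<^bsub>Vn\<^esub>) \<oplus>\<^bsub>direct_sum Vn Vn\<^esub> (\<zero>\<^bsub>Vn\<^esub>, mat_vec R n A y))"
      using y cl by (simp add: coupled_operator_def mod_hom_zero[OF Vn_module Vn_module hA] del: free_on_simps)
    also have "\<dots> = \<phi> (mat_vec R n c y, \<zero>\<^bsub>Vn\<^esub>) \<oplus>\<^bsub>direct_sum Vn Vn\<^esub> \<phi> (\<zero>\<^bsub>Vn\<^esub>, mat_vec R n A y)"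
      using cl by (intro mod_hom_add[OF D(1)]) (simp_all del: free_on_simps)
    also have "\<dots> = (mat_vec R n c y \<oplus>\<^bsub>Vn\<^esub> h (mat_vec R n A y), mat_vec R n A y)"
      using cl \<phi>_in \<phi>0 by (simp del: free_on_simps)
    finally have "(mat_vec R n c y \<oplus>\<^bsub>Vn\<^esub> h (mat_vec R n A y), mat_vec R n A y) = coupled_operator R n A c' (h y, y)"
      using D(2)[of "(\<zero>\<^bsub>Vn\<^esub>, y)"] y \<phi>0[OF y] by (simp del: free_on_simps)
    then have "mat_vec R n c y \<oplus>\<^bsub>Vn\<^esub> h (mat_vec R n A y) = mat_vec R n A (h y) \<oplus>\<^bsub>Vn\<^esub> mat_vec R n c' y"
      by (simp add: coupled_operator_def del: free_on_simps)
    then show "mat_vec R n c y \<oplus>\<^bsub>Vn\<^esub> mat_vec R n H (mat_vec R n A y) = mat_vec R n A (mat_vec R n H y) \<oplus>\<^bsub>Vn\<^esub> mat_vec R n c' y"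
      using H(2)[of y] H(2)[of "mat_vec R n A y"] y cl unfolding free_on_simps(1) by simp
  qed
qed

text \<open>Since \<open>R\<^sup>n\<close> is free, the extension has an \<open>R\<close>-linear section \<open>\<sigma>\<close>. The failure \<open>t\<sigma> - \<sigma>A\<close> of \<open>\<sigma>\<close> to commute
with \<open>t\<close> takes values in the submodule, where it is the matrix \<open>c\<close>.\<close>

lemma coupled_extension_exhausts:
  assumes U: "is_extension (UP R) (matrix_module R n A) (matrix_module R n A) U"
  shows "\<exists>c\<in>Mn. ext_morphism (UP R) (matrix_module R n A) id id (coupled_extension R n A c) U"
proof -
  interpret V: module R Vn by (rule Vn_module)
  note hA = mat_vec_hom[OF A]
  define Y where "Y = ext_mid U"
  define i where "i = ext_in U"
  define s where "s = ext_out U"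
  note u = is_extensionD[OF U, folded Y_def i_def s_def]
  interpret Y: module "UP R" Y by (rule u(1))
  have Mm: "module (UP R) (poly_module R Vn (mat_vec R n A))" by (rule poly_module_module[OF Vn_module hA])
  note i = u(2)[unfolded matrix_module_eq] and s = u(3)[unfolded matrix_module_eq]
  note ic = mod_hom_closed[OF i, unfolded poly_module_simps] and sc = mod_hom_closed[OF s, unfolded poly_module_simps]
    and ia = mod_hom_add[OF i, unfolded poly_module_simps] and sa = mod_hom_add[OF s, unfolded poly_module_simps]
  have cp: "const_poly R a \<in> carrier (UP R)" if "a \<in> carrier R" for a using const_poly_closed[OF is_cring that] .
  have pv: "poly_var R \<in> carrier (UP R)" using poly_var_closed[OF is_cring] .
  have i_const: "i (a \<odot>\<^bsub>Vn\<^esub> x) = const_poly R a \<odot>\<^bsub>Y\<^esub> i x" if "a \<in> carrier R" "x \<in> carrier Vn" for a x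
    using mod_hom_smult[OF i cp[OF that(1)], of x] that(2) poly_module_const[OF Vn_module hA that] by simp
  have s_const: "s (const_poly R a \<odot>\<^bsub>Y\<^esub> e) = a \<odot>\<^bsub>Vn\<^esub> s e" if "a \<in> carrier R" "e \<in> carrier Y" for a e
    using mod_hom_smult[OF s cp[OF that(1)] that(2)] poly_module_const[OF Vn_module hA that(1) sc[OF that(2)]] by simp
  have i_var: "i (mat_vec R n A x) = poly_var R \<odot>\<^bsub>Y\<^esub> i x" if "x \<in> carrier Vn" for x
    using mod_hom_smult[OF i pv, of x] that poly_module_var[OF Vn_module hA that] by simp
  have s_var: "s (poly_var R \<odot>\<^bsub>Y\<^esub> e) = mat_vec R n A (s e)" if "e \<in> carrier Y" for e
    using mod_hom_smult[OF s pv that] poly_module_var[OF Vn_module hA sc[OF that]] by simp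
  define Y0 where "Y0 = restrict_scalars (const_poly R) Y"
  have Y0: "module R Y0" unfolding Y0_def by (rule restrict_scalars_module[OF is_cring Y.module_axioms const_poly_hom[OF is_cring]])
  interpret Y0: module R Y0 by (rule Y0)
  have Y0s: "carrier Y0 = carrier Y" "\<And>x y. x \<oplus>\<^bsub>Y0\<^esub> y = x \<oplus>\<^bsub>Y\<^esub> y" "\<And>a x. a \<odot>\<^bsub>Y0\<^esub> x = const_poly R a \<odot>\<^bsub>Y\<^esub> x"
    by (simp_all add: Y0_def)
  have sY0: "s \<in> mod_hom R Y0 Vn"
    by (rule mod_homI) (simp_all add: Y0s sc sa s_const del: free_on_simps)
  have surj: "s ` carrier Y0 = carrier Vn" using u(5) by (simp add: Y0s matrix_module_eq del: free_on_simps)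
  have "\<exists>\<sigma>. \<sigma> \<in> mod_hom R Vn Y0 \<and> (\<forall>x\<in>carrier Vn. s (\<sigma> x) = x)"
  proof -
    have "\<exists>y. y \<in> carrier Y0 \<and> s y = unit_vec R {..<n} j" for j
    proof -
      have "unit_vec R {..<n} j \<in> s ` carrier Y0" unfolding surj by simp
      then show ?thesis by auto
    qed
    then have "\<forall>j. \<exists>y. y \<in> carrier Y0 \<and> s y = unit_vec R {..<n} j" by blast
    from choice[OF this] obtain g where g: "\<And>j. g j \<in> carrier Y0" "\<And>j. s (g j) = unit_vec R {..<n} j" by blast
    note lg = lincomb_hom[where I = "{..<n}", OF Y0 g(1) finite_lessThan]
    have "s (lincomb Y0 {..<n} g x) = x" if "x \<in> carrier Vn" for x
      by (rule hom_eqI_unit_vec[OF Vn_module mod_hom_comp[OF lg sY0] mod_hom_id finite_lessThan])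
        (use that in \<open>simp_all add: lincomb_unit_vec[OF Y0 g(1) finite_lessThan] g(2)\<close>)
    with lg show ?thesis by (intro exI[of _ "lincomb Y0 {..<n} g"] conjI ballI)
  qed
  then obtain \<sigma> where \<sigma>: "\<sigma> \<in> mod_hom R Vn Y0" "\<And>x. x \<in> carrier Vn \<Longrightarrow> s (\<sigma> x) = x" by blast
  note \<sigma>c = mod_hom_closed[OF \<sigma>(1), unfolded Y0s] and \<sigma>a = mod_hom_add[OF \<sigma>(1), unfolded Y0s] and \<sigma>s = mod_hom_smult[OF \<sigma>(1), unfolded Y0s]
  have Ac: "mat_vec R n A y \<in> carrier Vn" if "y \<in> carrier Vn" for y by (rule mod_hom_closed[OF hA that])
  \<comment> \<open>The failure of \<open>\<sigma>\<close> to commute with \<open>t\<close>; it is killed by \<open>s\<close>.\<close>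
  define \<kappa> where "\<kappa> y = poly_var R \<odot>\<^bsub>Y\<^esub> \<sigma> y \<ominus>\<^bsub>Y\<^esub> \<sigma> (mat_vec R n A y)" for y
  have \<kappa>c: "\<kappa> y \<in> carrier Y" if "y \<in> carrier Vn" for y
    unfolding \<kappa>_def using Y.smult_closed[OF pv \<sigma>c[OF that]] \<sigma>c[OF Ac[OF that]] by (rule Y.M.minus_closed)
  have "\<exists>x. x \<in> carrier Vn \<and> \<kappa> y = i x" if y: "y \<in> carrier Vn" for y
  proof -
    have t: "poly_var R \<odot>\<^bsub>Y\<^esub> \<sigma> y \<in> carrier Y" by (rule Y.smult_closed[OF pv \<sigma>c[OF y]])
    have "s (\<kappa> y) = s (poly_var R \<odot>\<^bsub>Y\<^esub> \<sigma> y) \<ominus>\<^bsub>poly_module R Vn (mat_vec R n A)\<^esub> s (\<sigma> (mat_vec R n A y))"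
      unfolding \<kappa>_def by (rule mod_hom_diff[OF u(1) Mm s t \<sigma>c[OF Ac[OF y]]])
    also have "\<dots> = mat_vec R n A y \<ominus>\<^bsub>poly_module R Vn (mat_vec R n A)\<^esub> mat_vec R n A y"
      by (simp only: s_var[OF \<sigma>c[OF y]] \<sigma>(2)[OF y] \<sigma>(2)[OF Ac[OF y]])
    also have "\<dots> = \<zero>\<^bsub>poly_module R Vn (mat_vec R n A)\<^esub>"
      using Ac[OF y] module.axioms(2)[OF Mm] by (simp add: a_minus_def abelian_group.r_neg del: free_on_simps poly_module_simps(2,3))
    finally show ?thesis using u(6)[OF \<kappa>c[OF y]] by (auto simp: matrix_module_eq simp del: free_on_simps)
  qed
  then have "\<forall>y. \<exists>x. y \<in> carrier Vn \<longrightarrow> x \<in> carrier Vn \<and> \<kappa> y = i x" by blast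
  from choice[OF this] obtain k where k: "\<And>y. y \<in> carrier Vn \<Longrightarrow> k y \<in> carrier Vn" "\<And>y. y \<in> carrier Vn \<Longrightarrow> \<kappa> y = i (k y)" by blast
  have i_inj: "x = y" if "x \<in> carrier Vn" "y \<in> carrier Vn" "i x = i y" for x y
    using u(4) that by (auto simp: inj_on_def matrix_module_eq simp del: free_on_simps)
  have t\<sigma>: "poly_var R \<odot>\<^bsub>Y\<^esub> \<sigma> y = i (k y) \<oplus>\<^bsub>Y\<^esub> \<sigma> (mat_vec R n A y)" if "y \<in> carrier Vn" for y
    unfolding k(2)[OF that, symmetric] \<kappa>_def a_minus_def
    using Y.smult_closed[OF pv \<sigma>c[OF that]] \<sigma>c[OF Ac[OF that]] by (simp add: Y.M.a_assoc Y.M.l_neg)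
  have \<kappa>add: "\<kappa> (x \<oplus>\<^bsub>Vn\<^esub> y) = \<kappa> x \<oplus>\<^bsub>Y\<^esub> \<kappa> y" if "x \<in> carrier Vn" "y \<in> carrier Vn" for x y
    unfolding \<kappa>_def a_minus_def using that \<sigma>c Ac pv
    by (simp add: \<sigma>a mod_hom_add[OF hA] Y.smult_r_distr Y.M.minus_add Y.M.a_ac del: free_on_simps)
  have \<kappa>smult: "\<kappa> (a \<odot>\<^bsub>Vn\<^esub> x) = const_poly R a \<odot>\<^bsub>Y\<^esub> \<kappa> x" if "a \<in> carrier R" "x \<in> carrier Vn" for a x
  proof -
    interpret U: UP_cring R "UP R" by (rule UP_cring.intro) (rule is_cring)
    have "poly_var R \<odot>\<^bsub>Y\<^esub> (const_poly R a \<odot>\<^bsub>Y\<^esub> \<sigma> x) = const_poly R a \<odot>\<^bsub>Y\<^esub> (poly_var R \<odot>\<^bsub>Y\<^esub> \<sigma> x)"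
      using Y.smult_assoc1[OF pv cp[OF that(1)] \<sigma>c[OF that(2)]] Y.smult_assoc1[OF cp[OF that(1)] pv \<sigma>c[OF that(2)]]
        comm_monoid.m_comm[OF cring.axioms(2)[OF U.UP_cring] pv cp[OF that(1)]] by simp
    then show ?thesis
      unfolding \<kappa>_def a_minus_def using that \<sigma>c Ac pv cp
      by (simp add: \<sigma>s mod_hom_smult[OF hA] Y.smult_r_distr Y.smult_r_minus del: free_on_simps)
  qed
  have kh: "k \<in> mod_hom R Vn Vn"
  proof (rule mod_homI[OF k(1)])
    fix x y assume xy: "x \<in> carrier Vn" "y \<in> carrier Vn"
    show "k (x \<oplus>\<^bsub>Vn\<^esub> y) = k x \<oplus>\<^bsub>Vn\<^esub> k y"
      using xy k \<kappa>add[OF xy] ia[of "k x" "k y"] V.M.a_closed[OF xy] by (intro i_inj) (simp_all del: free_on_simps)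
  next
    fix a x assume ax: "a \<in> carrier R" "x \<in> carrier Vn"
    show "k (a \<odot>\<^bsub>Vn\<^esub> x) = a \<odot>\<^bsub>Vn\<^esub> k x"
      using ax k \<kappa>smult[OF ax] i_const[of a "k x"] V.smult_closed[OF ax] by (intro i_inj) (simp_all del: free_on_simps)
  qed
  obtain c where c: "c \<in> Mn" "\<And>v. v \<in> carrier Vn \<Longrightarrow> k v = mat_vec R n c v"
    using matrix_of_hom[OF kh] unfolding free_on_simps(1) by blast
  note hop = coupled_operator_hom[OF c(1)]
  define \<phi> where "\<phi> = (\<lambda>(x, y). i x \<oplus>\<^bsub>Y\<^esub> \<sigma> y)"
  have "ext_morphism (UP R) (matrix_module R n A) id id (coupled_extension R n A c) U"
  proof (rule ext_morphismI[of \<phi>], fold Y_def i_def s_def, unfold coupled_extension_simps)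
    show "\<phi> \<in> mod_hom (UP R) (poly_module R (direct_sum Vn Vn) (coupled_operator R n A c)) Y"
    proof (rule UP_mod_homI[OF poly_module_module[OF VV_module hop] u(1) is_cring], unfold poly_module_simps)
      fix e assume "e \<in> carrier (direct_sum Vn Vn)"
      then obtain x y where e: "e = (x, y)" "x \<in> carrier Vn" "y \<in> carrier Vn" by (auto simp del: free_on_simps)
      show "\<phi> e \<in> carrier Y" using e ic \<sigma>c by (simp add: \<phi>_def)
      show "\<phi> (poly_var R \<odot>\<^bsub>poly_module R (direct_sum Vn Vn) (coupled_operator R n A c)\<^esub> e) = poly_var R \<odot>\<^bsub>Y\<^esub> \<phi> e"
      proof -
        have "poly_var R \<odot>\<^bsub>poly_module R (direct_sum Vn Vn) (coupled_operator R n A c)\<^esub> e = coupled_operator R n A c e"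
          using e by (intro poly_module_var[OF VV_module hop]) (simp del: free_on_simps)
        also have "\<phi> \<dots> = i (mat_vec R n A x \<oplus>\<^bsub>Vn\<^esub> k y) \<oplus>\<^bsub>Y\<^esub> \<sigma> (mat_vec R n A y)"
          using e c by (simp add: \<phi>_def coupled_operator_def del: free_on_simps)
        also have "\<dots> = poly_var R \<odot>\<^bsub>Y\<^esub> i x \<oplus>\<^bsub>Y\<^esub> (i (k y) \<oplus>\<^bsub>Y\<^esub> \<sigma> (mat_vec R n A y))"
          using e k(1) Ac ic \<sigma>c pv by (simp add: ia i_var Y.M.a_assoc del: free_on_simps)
        also have "\<dots> = poly_var R \<odot>\<^bsub>Y\<^esub> \<phi> e"
          unfolding t\<sigma>[OF e(3), symmetric] using e ic \<sigma>c pv by (simp add: \<phi>_def Y.smult_r_distr)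
        finally show ?thesis .
      qed
      fix a assume a: "a \<in> carrier R"
      have "const_poly R a \<odot>\<^bsub>poly_module R (direct_sum Vn Vn) (coupled_operator R n A c)\<^esub> e = a \<odot>\<^bsub>direct_sum Vn Vn\<^esub> e"
        using e by (intro poly_module_const[OF VV_module hop a]) (simp del: free_on_simps)
      then show "\<phi> (const_poly R a \<odot>\<^bsub>poly_module R (direct_sum Vn Vn) (coupled_operator R n A c)\<^esub> e) = const_poly R a \<odot>\<^bsub>Y\<^esub> \<phi> e"
        using e a ic \<sigma>c cp by (simp add: \<phi>_def i_const \<sigma>s Y.smult_r_distr del: free_on_simps)
    next
      fix e e' assume "e \<in> carrier (direct_sum Vn Vn)" "e' \<in> carrier (direct_sum Vn Vn)"
      then obtain x y x' y' where e: "e = (x, y)" "x \<in> carrier Vn" "y \<in> carrier Vn" "e' = (x', y')" "x' \<in> carrier Vn" "y' \<in> carrier Vn"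
        by (auto simp del: free_on_simps)
      then show "\<phi> (e \<oplus>\<^bsub>direct_sum Vn Vn\<^esub> e') = \<phi> e \<oplus>\<^bsub>Y\<^esub> \<phi> e'"
        using ic \<sigma>c by (simp add: \<phi>_def ia \<sigma>a Y.M.a_ac del: free_on_simps)
    qed
    have \<sigma>0: "\<sigma> \<zero>\<^bsub>Vn\<^esub> = \<zero>\<^bsub>Y\<^esub>" using mod_hom_zero[OF Vn_module Y0 \<sigma>(1)] by (simp add: Y0_def del: free_on_simps)
    show "\<phi> (x, \<zero>\<^bsub>Vn\<^esub>) = i (id x)" if "x \<in> carrier (matrix_module R n A)" for x
      using that ic \<sigma>0 by (simp add: \<phi>_def matrix_module_eq del: free_on_simps)
    show "s (\<phi> e) = id (snd e)" if eVV: "e \<in> carrier (poly_module R (direct_sum Vn Vn) (coupled_operator R n A c))" for e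
    proof -
      obtain x y where e: "e = (x, y)" "x \<in> carrier Vn" "y \<in> carrier Vn" using eVV by (auto simp del: free_on_simps)
      have "s (i x) = \<zero>\<^bsub>Vn\<^esub>" using u(7)[of x] e by (simp add: matrix_module_eq del: free_on_simps)
      then show ?thesis using e ic \<sigma>c \<sigma>(2) by (simp add: \<phi>_def sa del: free_on_simps)
    qed
  qed
  with c show ?thesis by blast
qed

lemma Ext1_matrix_module:
  "Ext1 (UP R) (matrix_module R n A) (matrix_module R n A) = coupled_class R n A ` Mn"
proof (intro equalityI subsetI)
  fix \<xi> assume "\<xi> \<in> Ext1 (UP R) (matrix_module R n A) (matrix_module R n A)"
  then obtain U :: "(nat \<Rightarrow> 'a, nat \<Rightarrow> 'a, nat \<Rightarrow> 'a) ext" where U: "is_extension (UP R) (matrix_module R n A) (matrix_module R n A) U"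
    "\<xi> = ext_class (UP R) (matrix_module R n A) (matrix_module R n A) U"
    by (auto simp: Ext1_def)
  obtain c where c: "c \<in> Mn" "ext_morphism (UP R) (matrix_module R n A) id id (coupled_extension R n A c) U"
    using coupled_extension_exhausts[OF U(1)] by blast
  then have "coupled_class R n A c = \<xi>"
    unfolding coupled_class_def U(2)
    using ext_class_eq_iff[OF matrix_module_module matrix_module_module coupled_extension_is_extension[OF c(1)] U(1)] by simp
  with c show "\<xi> \<in> coupled_class R n A ` Mn" by blast
next
  fix \<xi> assume "\<xi> \<in> coupled_class R n A ` Mn"
  then show "\<xi> \<in> Ext1 (UP R) (matrix_module R n A) (matrix_module R n A)"
    using ext_class_in_Ext1[OF matrix_module_module matrix_module_module coupled_extension_is_extension]
    by (auto simp: coupled_class_def)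
qed

lemma coupled_class_eq_iff:
  assumes c: "c \<in> Mn" "c' \<in> Mn"
  shows "coupled_class R n A c = coupled_class R n A c' \<longleftrightarrow>
    (\<exists>h\<in>Mn. c \<oplus>\<^bsub>mat_ring R n\<^esub> h \<otimes>\<^bsub>mat_ring R n\<^esub> A = A \<otimes>\<^bsub>mat_ring R n\<^esub> h \<oplus>\<^bsub>mat_ring R n\<^esub> c')"
proof -
  interpret MR: ring "mat_ring R n" by (rule mat_ring_ring)
  have carr: "carrier (mat_ring R n) = Mn" by simp
  have "coupled_class R n A c = coupled_class R n A c' \<longleftrightarrow>
      ext_morphism (UP R) (matrix_module R n A) id id (coupled_extension R n A c) (coupled_extension R n A c')"
    unfolding coupled_class_def
    by (rule ext_class_eq_iff[OF matrix_module_module matrix_module_module coupled_extension_is_extension[OF c(1)] coupled_extension_is_extension[OF c(2)]])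
  also have "\<dots> \<longleftrightarrow> (\<exists>h\<in>Mn. \<forall>y\<in>carrier Vn. mat_vec R n c y \<oplus>\<^bsub>Vn\<^esub> mat_vec R n h (mat_vec R n A y)
      = mat_vec R n A (mat_vec R n h y) \<oplus>\<^bsub>Vn\<^esub> mat_vec R n c' y)"
  proof
    assume "ext_morphism (UP R) (matrix_module R n A) id id (coupled_extension R n A c) (coupled_extension R n A c')"
    then show "\<exists>h\<in>Mn. \<forall>y\<in>carrier Vn. mat_vec R n c y \<oplus>\<^bsub>Vn\<^esub> mat_vec R n h (mat_vec R n A y)
      = mat_vec R n A (mat_vec R n h y) \<oplus>\<^bsub>Vn\<^esub> mat_vec R n c' y"
      by (rule coupled_morphismD[OF c]) blast
  next
    assume "\<exists>h\<in>Mn. \<forall>y\<in>carrier Vn. mat_vec R n c y \<oplus>\<^bsub>Vn\<^esub> mat_vec R n h (mat_vec R n A y)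
      = mat_vec R n A (mat_vec R n h y) \<oplus>\<^bsub>Vn\<^esub> mat_vec R n c' y"
    then obtain h where h: "h \<in> Mn" "\<And>y. y \<in> carrier Vn \<Longrightarrow> mat_vec R n c y \<oplus>\<^bsub>Vn\<^esub> mat_vec R n h (mat_vec R n A y)
      = mat_vec R n A (mat_vec R n h y) \<oplus>\<^bsub>Vn\<^esub> mat_vec R n c' y" by blast
    show "ext_morphism (UP R) (matrix_module R n A) id id (coupled_extension R n A c) (coupled_extension R n A c')"
      using h(2) mod_hom_id[of R Vn] by (intro coupled_morphism[OF c mat_vec_hom[OF h(1)]]) (simp_all add: id_def del: free_on_simps)
  qed
  also have "\<dots> \<longleftrightarrow> (\<exists>h\<in>Mn. c \<oplus>\<^bsub>mat_ring R n\<^esub> h \<otimes>\<^bsub>mat_ring R n\<^esub> A = A \<otimes>\<^bsub>mat_ring R n\<^esub> h \<oplus>\<^bsub>mat_ring R n\<^esub> c')"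
  proof (rule bex_cong[OF refl])
    fix h assume h: "h \<in> Mn"
    note mm = matrix_mult_closed[OF h A] matrix_mult_closed[OF A h]
    have l: "c \<oplus>\<^bsub>mat_ring R n\<^esub> h \<otimes>\<^bsub>mat_ring R n\<^esub> A \<in> Mn" "A \<otimes>\<^bsub>mat_ring R n\<^esub> h \<oplus>\<^bsub>mat_ring R n\<^esub> c' \<in> Mn"
      using MR.a_closed[unfolded carr] mm c by blast+
    have e: "mat_vec R n (c \<oplus>\<^bsub>mat_ring R n\<^esub> h \<otimes>\<^bsub>mat_ring R n\<^esub> A) y = mat_vec R n c y \<oplus>\<^bsub>Vn\<^esub> mat_vec R n h (mat_vec R n A y)"
      "mat_vec R n (A \<otimes>\<^bsub>mat_ring R n\<^esub> h \<oplus>\<^bsub>mat_ring R n\<^esub> c') y = mat_vec R n A (mat_vec R n h y) \<oplus>\<^bsub>Vn\<^esub> mat_vec R n c' y"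
      if "y \<in> vectors R n" for y
      unfolding mat_vec_add[OF c(1) mm(1) that] mat_vec_add[OF mm(2) c(2) that] mat_vec_mult[OF h A that] mat_vec_mult[OF A h that]
      by (rule refl)+
    show "(\<forall>y\<in>carrier Vn. mat_vec R n c y \<oplus>\<^bsub>Vn\<^esub> mat_vec R n h (mat_vec R n A y) = mat_vec R n A (mat_vec R n h y) \<oplus>\<^bsub>Vn\<^esub> mat_vec R n c' y)
      \<longleftrightarrow> c \<oplus>\<^bsub>mat_ring R n\<^esub> h \<otimes>\<^bsub>mat_ring R n\<^esub> A = A \<otimes>\<^bsub>mat_ring R n\<^esub> h \<oplus>\<^bsub>mat_ring R n\<^esub> c'"
      unfolding free_on_simps(1) using e matrix_eqI[OF l] by metis
  qed
  finally show ?thesis .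
qed

lemma baer_sum_coupled_class:
  assumes c: "c \<in> Mn" "c' \<in> Mn"
  shows "baer_sum (UP R) (matrix_module R n A) (matrix_module R n A) (coupled_class R n A c) (coupled_class R n A c')
    = coupled_class R n A (c \<oplus>\<^bsub>mat_ring R n\<^esub> c')"
proof -
  interpret V: module R Vn by (rule Vn_module)
  interpret MR: ring "mat_ring R n" by (rule mat_ring_ring)
  have carr: "carrier (mat_ring R n) = Mn" by simp
  have cc: "c \<oplus>\<^bsub>mat_ring R n\<^esub> c' \<in> Mn" using MR.a_closed[unfolded carr] c by blast
  note hA = mat_vec_hom[OF A] and hc = mat_vec_hom[OF c(1)] and hc' = mat_vec_hom[OF c(2)]
  note op = coupled_operator_hom[OF c(1)] coupled_operator_hom[OF c(2)] coupled_operator_hom[OF cc]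
  note ext = coupled_extension_is_extension[OF c(1)] coupled_extension_is_extension[OF c(2)] coupled_extension_is_extension[OF cc]
  let ?W = "ext_fibre_product (coupled_extension R n A c) (coupled_extension R n A c')"
  note fib = is_extensionD(1)[OF ext_fibre_product_extension[OF matrix_module_module matrix_module_module ext(1,2)]]
  let ?M1 = "poly_module R (direct_sum Vn Vn) (coupled_operator R n A c)"
  let ?M2 = "poly_module R (direct_sum Vn Vn) (coupled_operator R n A c')"
  let ?M3 = "poly_module R (direct_sum Vn Vn) (coupled_operator R n A (c \<oplus>\<^bsub>mat_ring R n\<^esub> c'))"
  have W: "carrier (ext_mid ?W) = {((x, y), (x', y')). x \<in> carrier Vn \<and> y \<in> carrier Vn \<and> x' \<in> carrier Vn \<and> y' = y}"
    by (auto simp: ext_fibre_product_def simp del: free_on_simps)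
  have Wop: "\<And>e f e' f'. (e, f) \<oplus>\<^bsub>ext_mid ?W\<^esub> (e', f') = (e \<oplus>\<^bsub>direct_sum Vn Vn\<^esub> e', f \<oplus>\<^bsub>direct_sum Vn Vn\<^esub> f')"
    "\<And>p e f. p \<odot>\<^bsub>ext_mid ?W\<^esub> (e, f) = (p \<odot>\<^bsub>?M1\<^esub> e, p \<odot>\<^bsub>?M2\<^esub> f)"
    by (simp_all add: ext_fibre_product_def direct_sum_def)
  define \<phi> :: "((nat \<Rightarrow> 'a) \<times> (nat \<Rightarrow> 'a)) \<times> ((nat \<Rightarrow> 'a) \<times> (nat \<Rightarrow> 'a)) \<Rightarrow> (nat \<Rightarrow> 'a) \<times> (nat \<Rightarrow> 'a)"
    where "\<phi> = (\<lambda>((x, y), (x', y')). (x \<oplus>\<^bsub>Vn\<^esub> x', y))"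
  have "ext_morphism (UP R) (direct_sum (matrix_module R n A) (matrix_module R n A)) (\<lambda>(a, b). a \<oplus>\<^bsub>matrix_module R n A\<^esub> b) id
      ?W (coupled_extension R n A (c \<oplus>\<^bsub>mat_ring R n\<^esub> c'))"
  proof (rule ext_morphismI[of \<phi>])
    show "\<phi> \<in> mod_hom (UP R) (ext_mid ?W) (ext_mid (coupled_extension R n A (c \<oplus>\<^bsub>mat_ring R n\<^esub> c')))"
      unfolding coupled_extension_simps
    proof (rule UP_mod_homI[OF fib poly_module_module[OF VV_module op(3)] is_cring])
      fix e assume "e \<in> carrier (ext_mid ?W)"
      then obtain x y x' where e: "e = ((x, y), (x', y))" "x \<in> carrier Vn" "y \<in> carrier Vn" "x' \<in> carrier Vn"
        unfolding W by blast
      have m: "(x, y) \<in> carrier (direct_sum Vn Vn)" "(x', y) \<in> carrier (direct_sum Vn Vn)" "\<phi> e \<in> carrier (direct_sum Vn Vn)"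
        using e by (simp_all add: \<phi>_def del: free_on_simps)
      then show "\<phi> e \<in> carrier ?M3" by simp
      have "\<phi> (poly_var R \<odot>\<^bsub>ext_mid ?W\<^esub> e) = \<phi> (coupled_operator R n A c (x, y), coupled_operator R n A c' (x', y))"
        unfolding e(1) Wop poly_module_var[OF VV_module op(1) m(1)] poly_module_var[OF VV_module op(2) m(2)] ..
      also have "\<dots> = coupled_operator R n A (c \<oplus>\<^bsub>mat_ring R n\<^esub> c') (\<phi> e)"
        using e mod_hom_closed[OF hA] mod_hom_closed[OF hc] mod_hom_closed[OF hc'] mat_vec_add[OF c e(3)[unfolded free_on_simps(1)]]
        by (simp add: \<phi>_def coupled_operator_def mod_hom_add[OF hA] V.M.a_ac del: free_on_simps mat_ring_simps)
      also have "\<dots> = poly_var R \<odot>\<^bsub>?M3\<^esub> \<phi> e" by (rule poly_module_var[OF VV_module op(3) m(3), symmetric])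
      finally show "\<phi> (poly_var R \<odot>\<^bsub>ext_mid ?W\<^esub> e) = poly_var R \<odot>\<^bsub>?M3\<^esub> \<phi> e" .
      fix a assume a: "a \<in> carrier R"
      have "\<phi> (const_poly R a \<odot>\<^bsub>ext_mid ?W\<^esub> e) = \<phi> (a \<odot>\<^bsub>direct_sum Vn Vn\<^esub> (x, y), a \<odot>\<^bsub>direct_sum Vn Vn\<^esub> (x', y))"
        unfolding e(1) Wop poly_module_const[OF VV_module op(1) a m(1)] poly_module_const[OF VV_module op(2) a m(2)] ..
      also have "\<dots> = a \<odot>\<^bsub>direct_sum Vn Vn\<^esub> \<phi> e"
        using e a by (simp add: \<phi>_def V.smult_r_distr del: free_on_simps)
      also have "\<dots> = const_poly R a \<odot>\<^bsub>?M3\<^esub> \<phi> e" by (rule poly_module_const[OF VV_module op(3) a m(3), symmetric])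
      finally show "\<phi> (const_poly R a \<odot>\<^bsub>ext_mid ?W\<^esub> e) = const_poly R a \<odot>\<^bsub>?M3\<^esub> \<phi> e" .
    next
      fix e f assume "e \<in> carrier (ext_mid ?W)" "f \<in> carrier (ext_mid ?W)"
      then obtain x y x' u v u' where e: "e = ((x, y), (x', y))" "x \<in> carrier Vn" "y \<in> carrier Vn" "x' \<in> carrier Vn"
        and f: "f = ((u, v), (u', v))" "u \<in> carrier Vn" "v \<in> carrier Vn" "u' \<in> carrier Vn"
        unfolding W by blast
      then show "\<phi> (e \<oplus>\<^bsub>ext_mid ?W\<^esub> f) = \<phi> e \<oplus>\<^bsub>?M3\<^esub> \<phi> f"
        by (simp add: Wop \<phi>_def V.M.a_ac del: free_on_simps)
    qed
  qed (simp_all add: \<phi>_def ext_fibre_product_def matrix_module_eq split_beta del: free_on_simps)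
  then show ?thesis
    unfolding coupled_class_def by (rule baer_sum_class[OF matrix_module_module matrix_module_module ext])
qed

lemma ext_transport_coupled_class:
  assumes c: "c \<in> Mn" "c' \<in> Mn"
    and \<alpha>: "\<alpha> \<in> mod_hom R Vn Vn" "\<And>x. x \<in> carrier Vn \<Longrightarrow> \<alpha> (mat_vec R n A x) = mat_vec R n A (\<alpha> x)"
    and \<beta>: "\<beta> \<in> mod_hom R Vn Vn" "\<And>x. x \<in> carrier Vn \<Longrightarrow> \<beta> (mat_vec R n A x) = mat_vec R n A (\<beta> x)"
      "bij_betw \<beta> (carrier Vn) (carrier Vn)"
    and eq: "\<And>y. y \<in> carrier Vn \<Longrightarrow> \<alpha> (mat_vec R n c y) = mat_vec R n c' (\<beta> y)"
  shows "ext_transport (UP R) (matrix_module R n A) (matrix_module R n A) \<alpha> \<beta> (coupled_class R n A c) = coupled_class R n A c'"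
proof -
  interpret V: module R Vn by (rule Vn_module)
  note hA = mat_vec_hom[OF A]
  have z: "(\<lambda>_. \<zero>\<^bsub>Vn\<^esub>) \<in> mod_hom R Vn Vn"
    by (rule mod_homI) (simp_all del: free_on_simps)
  have "ext_morphism (UP R) (matrix_module R n A) \<alpha> \<beta> (coupled_extension R n A c) (coupled_extension R n A c')"
    using mod_hom_closed[OF mat_vec_hom[OF c(1)]] mod_hom_closed[OF mat_vec_hom[OF c(2)]] mod_hom_closed[OF \<alpha>(1)] mod_hom_closed[OF \<beta>(1)]
    by (intro coupled_morphism[OF c z \<alpha> \<beta>(1,2)]) (simp_all add: eq mod_hom_zero[OF Vn_module Vn_module hA] del: free_on_simps)
  then show ?thesis
    unfolding coupled_class_def using mod_hom_closed[OF \<alpha>(1)] \<beta>(3)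
    by (intro ext_transport_class matrix_module_module coupled_extension_is_extension c) (simp_all add: matrix_module_eq del: free_on_simps)
qed

lemma smult_coupled_class:
  assumes c: "c \<in> Mn" and a: "a \<in> carrier R"
  shows "ext_transport (UP R) (matrix_module R n A) (matrix_module R n A) (\<lambda>x. const_poly R a \<odot>\<^bsub>matrix_module R n A\<^esub> x) id (coupled_class R n A c)
    = coupled_class R n A (a \<odot>\<^bsub>free_on R ({..<n} \<times> {..<n})\<^esub> c)"
proof -
  interpret V: module R Vn by (rule Vn_module)
  interpret Q: module R "free_on R ({..<n} \<times> {..<n})" by (rule free_on_module)
  note hA = mat_vec_hom[OF A]
  have ac: "a \<odot>\<^bsub>free_on R ({..<n} \<times> {..<n})\<^esub> c \<in> Mn" using Q.smult_closed[OF a] c by simp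
  have act: "const_poly R a \<odot>\<^bsub>matrix_module R n A\<^esub> x = a \<odot>\<^bsub>Vn\<^esub> x" if "x \<in> carrier Vn" for x
    unfolding matrix_module_eq by (rule poly_module_const[OF Vn_module hA a that])
  have h: "(\<lambda>x. const_poly R a \<odot>\<^bsub>matrix_module R n A\<^esub> x) \<in> mod_hom R Vn Vn"
    using a by (intro mod_homI) (simp_all add: act V.smult_r_distr V.smult_assoc1[symmetric] m_comm del: free_on_simps)
  have e: "mat_vec R n (a \<odot>\<^bsub>free_on R ({..<n} \<times> {..<n})\<^esub> c) y = a \<odot>\<^bsub>Vn\<^esub> mat_vec R n c y" if "y \<in> carrier Vn" for y
    using that by (intro mat_vec_smult[OF c a]) simp
  show ?thesis
    using mod_hom_closed[OF hA] mod_hom_closed[OF mat_vec_hom[OF c]] mod_hom_id[of R Vn]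
    by (intro ext_transport_coupled_class[OF c ac h])
      (simp_all add: act a mod_hom_smult[OF hA] e id_def bij_betw_def del: free_on_simps)
qed

end

end

section \<open>Extensions lying over the standard one\<close>

text \<open>\<open>M\<^sup>A \<otimes> P\<close> will obtain its module structure from an injection into \<open>R\<^sup>n\<close>.\<close>

lemma module_embedding:
  assumes Y: "module S Y" and N: "abelian_group N"
    and closed: "\<And>a z. a \<in> carrier S \<Longrightarrow> z \<in> carrier N \<Longrightarrow> a \<odot>\<^bsub>N\<^esub> z \<in> carrier N"
    and f: "f \<in> mod_hom S N Y" and inj: "inj_on f (carrier N)"
  shows "module S N"
proof -
  interpret Y: module S Y by fact
  interpret N: abelian_group N by fact
  note fc = mod_hom_closed[OF f] and fa = mod_hom_add[OF f] and fs = mod_hom_smult[OF f]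
  have eqI: "z = w" if "z \<in> carrier N" "w \<in> carrier N" "f z = f w" for z w
    using inj that by (auto simp: inj_on_def)
  show ?thesis
    by (rule moduleI)
      (auto intro!: eqI simp: Y.R.cring_axioms N.abelian_group_axioms closed fc fa fs
        Y.smult_l_distr Y.smult_r_distr Y.smult_assoc1)
qed

lemma ext_morphism_restrict:
  assumes \<phi>: "\<phi> \<in> ring_hom S S'" and m: "ext_morphism S' N \<alpha> \<beta> U V"
  shows "ext_morphism S (restrict_scalars \<phi> N) \<alpha> \<beta> (ext_restrict_scalars \<phi> U) (ext_restrict_scalars \<phi> V)"
proof -
  obtain \<psi> where \<psi>: "\<psi> \<in> mod_hom S' (ext_mid U) (ext_mid V)"
    "\<And>x. x \<in> carrier N \<Longrightarrow> \<psi> (ext_in U x) = ext_in V (\<alpha> x)"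
    "\<And>e. e \<in> carrier (ext_mid U) \<Longrightarrow> ext_out V (\<psi> e) = \<beta> (ext_out U e)"
    using m by (rule ext_morphismE) blast
  show ?thesis
    using \<psi> ring_hom_closed[OF \<phi>]
    by (intro ext_morphismI[of \<psi>]) (auto simp: ext_restrict_scalars_def mod_hom_def)
qed

lemma is_extension_restrict:
  assumes S: "cring S" and \<phi>: "\<phi> \<in> ring_hom S S'" and U: "is_extension S' M N U"
  shows "is_extension S (restrict_scalars \<phi> M) (restrict_scalars \<phi> N) (ext_restrict_scalars \<phi> U)"
  using U restrict_scalars_module[OF S _ \<phi>, of "ext_mid U"] ring_hom_closed[OF \<phi>]
  by (auto simp: is_extension_def ext_restrict_scalars_def mod_hom_def)

text \<open>The five lemma.\<close>

lemma ext_morphism_bij: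
  assumes M: "module S M" and N: "module S N" and U: "is_extension S M N U" and V: "is_extension S M N V"
    and \<phi>: "\<phi> \<in> mod_hom S (ext_mid U) (ext_mid V)"
      "\<And>x. x \<in> carrier N \<Longrightarrow> \<phi> (ext_in U x) = ext_in V x"
      "\<And>e. e \<in> carrier (ext_mid U) \<Longrightarrow> ext_out V (\<phi> e) = ext_out U e"
  shows "bij_betw \<phi> (carrier (ext_mid U)) (carrier (ext_mid V))"
proof -
  note u = is_extensionD[OF U] and v = is_extensionD[OF V]
  interpret M: module S M by (rule M)
  interpret N: module S N by (rule N)
  interpret E: module S "ext_mid U" by (rule u(1))
  interpret F: module S "ext_mid V" by (rule v(1))
  note \<phi>c = mod_hom_closed[OF \<phi>(1)]
  have "e = e'" if e: "e \<in> carrier (ext_mid U)" "e' \<in> carrier (ext_mid U)" "\<phi> e = \<phi> e'" for e e'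
  proof -
    have d: "e \<ominus>\<^bsub>ext_mid U\<^esub> e' \<in> carrier (ext_mid U)" using e by simp
    have 0: "\<phi> (e \<ominus>\<^bsub>ext_mid U\<^esub> e') = \<zero>\<^bsub>ext_mid V\<^esub>"
      unfolding mod_hom_diff[OF u(1) v(1) \<phi>(1) e(1,2)] e(3) using \<phi>c[OF e(2)] by (simp add: a_minus_def F.M.r_neg)
    then have "ext_out U (e \<ominus>\<^bsub>ext_mid U\<^esub> e') = \<zero>\<^bsub>M\<^esub>"
      using \<phi>(3)[OF d] mod_hom_zero[OF v(1) M v(3)] by simp
    then obtain x where x: "x \<in> carrier N" "e \<ominus>\<^bsub>ext_mid U\<^esub> e' = ext_in U x" using u(6)[OF d] by blast
    then have "ext_in V x = ext_in V \<zero>\<^bsub>N\<^esub>" using 0 \<phi>(2)[OF x(1)] mod_hom_zero[OF N v(1) v(2)] by simp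
    then have "x = \<zero>\<^bsub>N\<^esub>" using v(4) x(1) by (auto simp: inj_on_def)
    then have "e \<ominus>\<^bsub>ext_mid U\<^esub> e' = \<zero>\<^bsub>ext_mid U\<^esub>" using x(2) mod_hom_zero[OF N u(1) u(2)] by simp
    then have "(e \<ominus>\<^bsub>ext_mid U\<^esub> e') \<oplus>\<^bsub>ext_mid U\<^esub> e' = e'" using e by simp
    then show ?thesis using e by (simp add: a_minus_def E.M.a_assoc E.M.l_neg)
  qed
  moreover have "\<exists>e\<in>carrier (ext_mid U). \<phi> e = f" if f: "f \<in> carrier (ext_mid V)" for f
  proof -
    have "ext_out V f \<in> ext_out U ` carrier (ext_mid U)" unfolding u(5) by (rule mod_hom_closed[OF v(3) f])
    then obtain e where e: "e \<in> carrier (ext_mid U)" "ext_out U e = ext_out V f" by auto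
    have d: "f \<ominus>\<^bsub>ext_mid V\<^esub> \<phi> e \<in> carrier (ext_mid V)" using f \<phi>c[OF e(1)] by simp
    have "ext_out V (f \<ominus>\<^bsub>ext_mid V\<^esub> \<phi> e) = \<zero>\<^bsub>M\<^esub>"
      unfolding mod_hom_diff[OF v(1) M v(3) f \<phi>c[OF e(1)]] \<phi>(3)[OF e(1)] e(2)
      using mod_hom_closed[OF v(3) f] by (simp add: a_minus_def M.M.r_neg)
    then obtain x where x: "x \<in> carrier N" "f \<ominus>\<^bsub>ext_mid V\<^esub> \<phi> e = ext_in V x" using v(6)[OF d] by blast
    have xu: "ext_in U x \<in> carrier (ext_mid U)" by (rule mod_hom_closed[OF u(2) x(1)])
    have "\<phi> (ext_in U x \<oplus>\<^bsub>ext_mid U\<^esub> e) = (f \<ominus>\<^bsub>ext_mid V\<^esub> \<phi> e) \<oplus>\<^bsub>ext_mid V\<^esub> \<phi> e"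
      unfolding mod_hom_add[OF \<phi>(1) xu e(1)] \<phi>(2)[OF x(1)] x(2) ..
    also have "\<dots> = f" using f \<phi>c[OF e(1)] by (simp add: a_minus_def F.M.a_assoc F.M.l_neg)
    finally show ?thesis using xu e(1) by (intro bexI[of _ "ext_in U x \<oplus>\<^bsub>ext_mid U\<^esub> e"]) auto
  qed
  ultimately show ?thesis
    using \<phi>c unfolding bij_betw_def inj_on_def by (auto simp: image_iff) metis
qed

lemma hom_finprod_comm:
  assumes G: "comm_group G" and H: "comm_group H" and h: "h \<in> hom G H" and f: "f \<in> A \<rightarrow> carrier G"
  shows "h (finprod G f A) = finprod H (\<lambda>a. h (f a)) A"
proof -
  interpret G: comm_group G by fact
  interpret H: comm_group H by fact
  interpret h: group_hom G H h using h by (simp add: group_hom_def group_hom_axioms_def G.is_group H.is_group)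
  show ?thesis
    using f
  proof (induction A rule: infinite_finite_induct)
    case (insert x F)
    then show ?case by (simp add: Pi_iff)
  qed simp_all
qed

context residue_setup begin

lemma tensor_factors_free: "tensor_factors K (free_on K {..<n}) (ideal_space R P)"
proof -
  interpret V: module K "free_on K {..<n}" by (rule K.free_on_module)
  show ?thesis
    using P_closed P_space_smult_closed V.M.a_closed V.smult_closed by unfold_locales (simp_all del: free_on_simps)
qed

end

locale residue_matrix = residue_setup +
  fixes n :: nat and A :: "nat \<times> nat \<Rightarrow> 'a set"
  assumes A: "A \<in> {..<n} \<times> {..<n} \<rightarrow>\<^sub>E carrier (R Quot P)"
begin

abbreviation "VK \<equiv> free_on K {..<n}"
abbreviation "Rn \<equiv> free_on R {..<n}"
abbreviation "TP \<equiv> tensor_group K VK (ideal_space R P)"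
abbreviation "te \<equiv> tensor_elem K VK (ideal_space R P)"
abbreviation "NP \<equiv> MA_tensor_P R P n A"
abbreviation "MAR \<equiv> MA R P n A"

sublocale TF: tensor_factors K "free_on K {..<n}" "ideal_space R P" by (rule tensor_factors_free)

text \<open>The identification of \<open>k\<^sup>n \<otimes> P\<close> with \<open>P\<^sup>n\<close>, as a subset of \<open>R\<^sup>n\<close>.\<close>

definition embed :: "((nat \<Rightarrow> 'a set) \<times> 'a \<Rightarrow>\<^sub>0 int) set \<Rightarrow> nat \<Rightarrow> 'a" where
  "embed = ext_in (xi0_extension R P n)"

lemma embed_bilinear:
  shows embed_hom: "embed \<in> hom TP (add_monoid Rn)"
    and embed_elem: "x \<in> vectors R n \<Longrightarrow> p \<in> P \<Longrightarrow> embed (te (redv {..<n} x) p) = p \<odot>\<^bsub>Rn\<^esub> x"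
proof -
  interpret Rn: module R Rn by (rule free_on_module)
  interpret W: module R "residue_space {..<n}" by (rule residue_space_module)
  define b where "b = (\<lambda>(v, p). \<lambda>i\<in>{..<n}. v i \<odot>\<^bsub>ideal_space R P\<^esub> p)"
  have e: "embed = tensor_lift (add_monoid Rn) b"
    by (simp add: embed_def xi0_extension_def b_def free_module_eq)
  have b: "b (redv {..<n} x, p) = p \<odot>\<^bsub>Rn\<^esub> x" if "x \<in> vectors R n" "p \<in> P" for x p
    using PiE_app[OF that(1)] that(2) P_carrier[OF that(2)]
    by (auto simp: b_def redv_def P_space_smult m_comm intro!: restrict_ext)
  have lift: "\<exists>x. x \<in> carrier Rn \<and> v = redv {..<n} x" if "v \<in> carrier VK" for v
    using redv_surj[of v "{..<n}"] that by auto
  have G: "comm_group (add_monoid Rn)" by (rule Rn.M.a_comm_group)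
  have b1: "b (v, p) \<in> carrier (add_monoid Rn)" if v: "v \<in> carrier VK" and p: "p \<in> carrier (ideal_space R P)" for v p
  proof -
    obtain x where x: "x \<in> carrier Rn" "v = redv {..<n} x" using lift[OF v] by blast
    then show ?thesis using b[of x p] p Rn.smult_closed[OF P_carrier x(1)] by (simp del: free_on_simps(2-))
  qed
  have b2: "b (v \<oplus>\<^bsub>VK\<^esub> v', p) = b (v, p) \<otimes>\<^bsub>add_monoid Rn\<^esub> b (v', p)"
    if v: "v \<in> carrier VK" "v' \<in> carrier VK" and p: "p \<in> carrier (ideal_space R P)" for v v' p
  proof -
    obtain x x' where x: "x \<in> carrier Rn" "v = redv {..<n} x" "x' \<in> carrier Rn" "v' = redv {..<n} x'" using lift[OF v(1)] lift[OF v(2)] by blast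
    have s: "v \<oplus>\<^bsub>VK\<^esub> v' = redv {..<n} (x \<oplus>\<^bsub>Rn\<^esub> x')" using mod_hom_add[OF redv_hom x(1,3)] x by simp
    have "b (v \<oplus>\<^bsub>VK\<^esub> v', p) = p \<odot>\<^bsub>Rn\<^esub> (x \<oplus>\<^bsub>Rn\<^esub> x')"
      unfolding s using b[of "x \<oplus>\<^bsub>Rn\<^esub> x'" p] Rn.M.a_closed[OF x(1,3)] p by simp
    also have "\<dots> = p \<odot>\<^bsub>Rn\<^esub> x \<oplus>\<^bsub>Rn\<^esub> p \<odot>\<^bsub>Rn\<^esub> x'" using p P_carrier x by (intro Rn.smult_r_distr) simp_all
    also have "\<dots> = b (v, p) \<otimes>\<^bsub>add_monoid Rn\<^esub> b (v', p)" using b[of x p] b[of x' p] x p by simp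
    finally show ?thesis .
  qed
  have b3: "b (v, p \<oplus>\<^bsub>ideal_space R P\<^esub> p') = b (v, p) \<otimes>\<^bsub>add_monoid Rn\<^esub> b (v, p')"
    if v: "v \<in> carrier VK" and p: "p \<in> carrier (ideal_space R P)" "p' \<in> carrier (ideal_space R P)" for v p p'
  proof -
    obtain x where x: "x \<in> carrier Rn" "v = redv {..<n} x" using lift[OF v] by blast
    have "b (v, p \<oplus>\<^bsub>ideal_space R P\<^esub> p') = (p \<oplus> p') \<odot>\<^bsub>Rn\<^esub> x"
      unfolding x(2) using b[of x "p \<oplus> p'"] x p P_closed(2) by simp
    also have "\<dots> = p \<odot>\<^bsub>Rn\<^esub> x \<oplus>\<^bsub>Rn\<^esub> p' \<odot>\<^bsub>Rn\<^esub> x" using p P_carrier x by (intro Rn.smult_l_distr) simp_all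
    also have "\<dots> = b (v, p) \<otimes>\<^bsub>add_monoid Rn\<^esub> b (v, p')" using b[of x p] b[of x p'] x p by simp
    finally show ?thesis .
  qed
  have b4: "b (a \<odot>\<^bsub>VK\<^esub> v, p) = b (v, a \<odot>\<^bsub>ideal_space R P\<^esub> p)"
    if a: "a \<in> carrier K" and v: "v \<in> carrier VK" and p: "p \<in> carrier (ideal_space R P)" for a v p
  proof -
    obtain x where x: "x \<in> carrier Rn" "v = redv {..<n} x" using lift[OF v] by blast
    obtain r where r: "r \<in> carrier R" "a = res r" using res_surj[OF a] by blast
    have s: "a \<odot>\<^bsub>VK\<^esub> v = redv {..<n} (r \<odot>\<^bsub>Rn\<^esub> x)" using mod_hom_smult[OF redv_hom r(1) x(1)] x r by simp
    have "b (a \<odot>\<^bsub>VK\<^esub> v, p) = p \<odot>\<^bsub>Rn\<^esub> (r \<odot>\<^bsub>Rn\<^esub> x)"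
      unfolding s using b[of "r \<odot>\<^bsub>Rn\<^esub> x" p] Rn.smult_closed[OF r(1) x(1)] p by simp
    also have "\<dots> = (r \<otimes> p) \<odot>\<^bsub>Rn\<^esub> x"
      using p r P_carrier[of p] x Rn.smult_assoc1[of p r x] m_comm[of p r] by (simp del: free_on_simps)
    also have "\<dots> = b (v, a \<odot>\<^bsub>ideal_space R P\<^esub> p)"
      using b[of x "r \<otimes> p"] x p r P_closed(4)[of r p] P_space_smult[of r p] by simp
    finally show ?thesis .
  qed
  note tl = TF.tensor_lift_hom[where b = b, OF G b1 b2 b3 b4] and te = TF.tensor_lift_elem[where b = b, OF G b1 b2 b3 b4]
  show "embed \<in> hom TP (add_monoid Rn)" unfolding e by (rule tl)
  assume x: "x \<in> vectors R n" and p: "p \<in> P"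
  show "embed (te (redv {..<n} x) p) = p \<odot>\<^bsub>Rn\<^esub> x"
    unfolding e b[OF x p, symmetric] using redv_closed[OF x] p by (intro te) simp_all
qed

lemma TP_comm_group: "comm_group TP" by (rule TF.tensor_comm_group)

lemma tensor_elem_lincomb:
  assumes p: "p \<in> P" and w: "\<And>j. j \<in> J \<Longrightarrow> w j \<in> carrier VK"
  shows "te (finsum VK w J) p = finprod TP (\<lambda>j. te (w j) p) J"
proof -
  interpret V: module K VK by (rule K.free_on_module)
  have pc: "p \<in> carrier (ideal_space R P)" using p by simp
  have h: "(\<lambda>v. te v p) \<in> hom (add_monoid VK) TP"
    by (rule homI) (simp_all add: TF.tensor_elem_closed TF.tensor_elem_add_left pc del: free_on_simps P_space_simps)
  show ?thesis
    unfolding finsum_def by (rule hom_finprod_comm[OF V.M.a_comm_group TP_comm_group h]) (simp add: w Pi_iff del: free_on_simps)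
qed

text \<open>The inverse sends \<open>y\<close> to \<open>\<Sum>\<^sub>j e\<^sub>j \<otimes> y\<^sub>j\<close>.\<close>

lemma embed_props:
  shows embed_inj: "inj_on embed (carrier TP)" and embed_image: "embed ` carrier TP = {..<n} \<rightarrow>\<^sub>E P"
proof -
  interpret TG: comm_group TP by (rule TP_comm_group)
  interpret V: module K VK by (rule K.free_on_module)
  interpret Rn: module R Rn by (rule free_on_module)
  interpret h: group_hom TP "add_monoid Rn" embed
    using embed_hom Rn.M.a_group TG.is_group by (simp add: group_hom_def group_hom_axioms_def)
  let ?e = "unit_vec K {..<n}"
  have ec: "?e j \<in> carrier VK" for j by simp
  have tc: "te (?e j) q \<in> carrier TP" if "q \<in> P" for j q
    by (rule TF.tensor_elem_closed[OF ec]) (simp add: that)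
  \<comment> \<open>The inverse map.\<close>
  define J where "J y = finprod TP (\<lambda>j. te (?e j) (y j)) {..<n}" for y
  have Jc: "J y \<in> carrier TP" if "\<And>j. j < n \<Longrightarrow> y j \<in> P" for y
    unfolding J_def using tc[OF that] by (intro TG.finprod_closed) (simp add: Pi_iff)
  have e_eq: "?e j = redv {..<n} (unit_vec R {..<n} j)" for j
    by (auto simp: unit_vec_def redv_def intro!: restrict_ext)
  have eJ: "embed (J y) = y" if y: "y \<in> {..<n} \<rightarrow>\<^sub>E P" for y
  proof -
    have yR: "y \<in> vectors R n" using y P_carrier by (auto simp: PiE_iff)
    have "embed (J y) = finprod (add_monoid Rn) (\<lambda>j. embed (te (?e j) (y j))) {..<n}"
      unfolding J_def by (rule hom_finprod_comm[OF TP_comm_group Rn.M.a_comm_group embed_hom])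
        (use ec PiE_app[OF y] TF.tensor_elem_closed in \<open>simp_all add: Pi_iff del: free_on_simps\<close>)
    also have "\<dots> = (\<Oplus>\<^bsub>Rn\<^esub>j\<in>{..<n}. y j \<odot>\<^bsub>Rn\<^esub> unit_vec R {..<n} j)"
      unfolding finsum_def
    proof (rule comm_monoid.finprod_cong'[OF Rn.M.a_comm_monoid refl])
      show "(\<lambda>j. y j \<odot>\<^bsub>Rn\<^esub> unit_vec R {..<n} j) \<in> {..<n} \<rightarrow> carrier (add_monoid Rn)"
        using PiE_app[OF yR] Rn.smult_closed[of "y j" "unit_vec R {..<n} j" for j] by (simp add: Pi_iff del: free_on_simps(2-))
      show "embed (te (?e j) (y j)) = y j \<odot>\<^bsub>Rn\<^esub> unit_vec R {..<n} j" if "j \<in> {..<n}" for j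
        unfolding e_eq using PiE_app[OF y that] by (intro embed_elem) simp_all
    qed
    also have "\<dots> = y" using lincomb_unit_vecs[OF finite_lessThan yR] by (simp only: lincomb_def)
    finally show ?thesis .
  qed
  have val: "embed z \<in> {..<n} \<rightarrow>\<^sub>E P \<and> J (embed z) = z" if "z \<in> carrier TP" for z
    using that
  proof (induction z rule: TF.tensor_induct)
    case one
    have "te (?e j) \<zero> = \<one>\<^bsub>TP\<^esub>" for j
      using TF.tensor_elem_add_right[of "?e j" "\<zero>" "\<zero>"] TF.tensor_elem_closed[of "?e j" "\<zero>"] ec P_closed(1)
      by (simp del: free_on_simps add: TG.l_cancel_one')
    then have "J \<zero>\<^bsub>Rn\<^esub> = \<one>\<^bsub>TP\<^esub>" unfolding J_def by (intro TG.finprod_one_eqI) simp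
    moreover have e1: "embed \<one>\<^bsub>TP\<^esub> = \<zero>\<^bsub>Rn\<^esub>" using h.hom_one by (simp del: free_on_simps)
    moreover have "\<zero>\<^bsub>Rn\<^esub> \<in> {..<n} \<rightarrow>\<^sub>E P" using P_closed(1) by simp
    ultimately show ?case unfolding e1 by (intro conjI)
  next
    case (elem v p)
    obtain x where x: "x \<in> vectors R n" "redv {..<n} x = v" using redv_surj[of v "{..<n}"] elem by auto
    have p: "p \<in> P" using elem by simp
    have em: "embed (te v p) = p \<odot>\<^bsub>Rn\<^esub> x" using embed_elem[OF x(1) p] x(2) by simp
    have v: "v \<in> vectors K n" using elem by simp
    have xp: "(p \<odot>\<^bsub>Rn\<^esub> x) j = v j \<odot>\<^bsub>ideal_space R P\<^esub> p" if "j < n" for j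
    proof -
      have xj: "x j \<in> carrier R" using PiE_app[OF x(1), of j] that by simp
      have "v j = res (x j)" using that unfolding x(2)[symmetric] redv_def by simp
      then have "v j \<odot>\<^bsub>ideal_space R P\<^esub> p = p \<otimes> x j"
        using P_space_smult[OF xj p] m_comm[OF xj P_carrier[OF p]] by simp
      then show ?thesis using that by simp
    qed
    have P1: "p \<odot>\<^bsub>Rn\<^esub> x \<in> {..<n} \<rightarrow>\<^sub>E P" using P_closed(5)[OF PiE_app[OF x(1)] p] PiE_app[OF x(1)] P_carrier[OF p] p
      by (simp add: restrict_PiE_iff m_comm)
    have "J (p \<odot>\<^bsub>Rn\<^esub> x) = finprod TP (\<lambda>j. te (v j \<odot>\<^bsub>VK\<^esub> ?e j) p) {..<n}"
      unfolding J_def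
    proof (rule TG.finprod_cong'[OF refl])
      show "(\<lambda>j. te (v j \<odot>\<^bsub>VK\<^esub> ?e j) p) \<in> {..<n} \<rightarrow> carrier TP"
        using TF.tensor_elem_closed[OF V.smult_closed[OF PiE_app[OF v] ec] elem(2)] by blast
      show "te (?e j) ((p \<odot>\<^bsub>Rn\<^esub> x) j) = te (v j \<odot>\<^bsub>VK\<^esub> ?e j) p" if "j \<in> {..<n}" for j
        unfolding xp[OF that[unfolded lessThan_iff]] by (rule TF.tensor_elem_balanced[symmetric, OF PiE_app[OF v that] ec elem(2)])
    qed
    also have "\<dots> = te (\<Oplus>\<^bsub>VK\<^esub>j\<in>{..<n}. v j \<odot>\<^bsub>VK\<^esub> ?e j) p"
      using V.smult_closed[OF PiE_app[OF v] ec] by (intro tensor_elem_lincomb[OF p, symmetric])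
    also have "(\<Oplus>\<^bsub>VK\<^esub>j\<in>{..<n}. v j \<odot>\<^bsub>VK\<^esub> ?e j) = v"
      using K.lincomb_unit_vecs[OF finite_lessThan v] by (simp only: lincomb_def)
    finally have Jx: "J (p \<odot>\<^bsub>Rn\<^esub> x) = te v p" .
    show ?case unfolding em using P1 Jx by (intro conjI)
  next
    case (diff z w)
    let ?i = "\<ominus>\<^bsub>Rn\<^esub> embed w"
    have zw: "embed z \<in> carrier Rn" "embed w \<in> carrier Rn" using diff(3,4) P_carrier by (auto simp: PiE_iff)
    have em: "embed (z \<otimes>\<^bsub>TP\<^esub> inv\<^bsub>TP\<^esub> w) = embed z \<ominus>\<^bsub>Rn\<^esub> embed w"
      using diff(1,2) by (simp add: a_minus_def a_inv_def)
    have mi: "(embed z \<ominus>\<^bsub>Rn\<^esub> embed w) \<in> {..<n} \<rightarrow>\<^sub>E P"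
    proof -
      have "redv {..<n} (embed z \<ominus>\<^bsub>Rn\<^esub> embed w) = redv {..<n} (embed z) \<ominus>\<^bsub>residue_space {..<n}\<^esub> redv {..<n} (embed w)"
        by (rule mod_hom_diff[OF Rn.module_axioms residue_space_module redv_hom zw])
      also have "\<dots> = \<zero>\<^bsub>VK\<^esub>"
      proof -
        interpret W: module R "residue_space {..<n}" by (rule residue_space_module)
        have "redv {..<n} (embed z) = \<zero>\<^bsub>residue_space {..<n}\<^esub>" "redv {..<n} (embed w) = \<zero>\<^bsub>residue_space {..<n}\<^esub>"
          unfolding restrict_scalars_simps
          by (rule redv_kernel[THEN iffD2, OF zw(1)[unfolded free_on_simps(1)] conjunct1[OF diff(3)]],
            rule redv_kernel[THEN iffD2, OF zw(2)[unfolded free_on_simps(1)] conjunct1[OF diff(4)]])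
        then show ?thesis
          using W.M.r_neg[OF W.M.zero_closed] by (simp only: a_minus_def restrict_scalars_simps)
      qed
      finally show ?thesis using redv_kernel[of "embed z \<ominus>\<^bsub>Rn\<^esub> embed w" "{..<n}"] Rn.M.minus_closed[OF zw] by simp
    qed
    have Jadd: "J (x \<oplus>\<^bsub>Rn\<^esub> y) = J x \<otimes>\<^bsub>TP\<^esub> J y" if "x \<in> {..<n} \<rightarrow>\<^sub>E P" "y \<in> {..<n} \<rightarrow>\<^sub>E P" for x y
    proof -
      have "J (x \<oplus>\<^bsub>Rn\<^esub> y) = finprod TP (\<lambda>j. te (?e j) (x j) \<otimes>\<^bsub>TP\<^esub> te (?e j) (y j)) {..<n}"
        unfolding J_def
      proof (rule TG.finprod_cong'[OF refl])
        show "(\<lambda>j. te (?e j) (x j) \<otimes>\<^bsub>TP\<^esub> te (?e j) (y j)) \<in> {..<n} \<rightarrow> carrier TP"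
          using TG.m_closed[OF tc[OF PiE_app[OF that(1)]] tc[OF PiE_app[OF that(2)]]] by blast
        show "te (?e j) ((x \<oplus>\<^bsub>Rn\<^esub> y) j) = te (?e j) (x j) \<otimes>\<^bsub>TP\<^esub> te (?e j) (y j)" if "j \<in> {..<n}" for j
          using TF.tensor_elem_add_right[OF ec, of "x j" "y j" j] PiE_app[OF \<open>x \<in> _\<close> that] PiE_app[OF \<open>y \<in> _\<close> that] that
          by (simp only: P_space_simps free_on_simps(3) restrict_apply if_True)
      qed
      also have "\<dots> = J x \<otimes>\<^bsub>TP\<^esub> J y"
        unfolding J_def using tc[OF PiE_app[OF that(1)]] tc[OF PiE_app[OF that(2)]] by (intro TG.finprod_multf) blast+
      finally show ?thesis .
    qed
    have "embed z = (embed z \<ominus>\<^bsub>Rn\<^esub> embed w) \<oplus>\<^bsub>Rn\<^esub> embed w"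
      using zw by (simp add: a_minus_def Rn.M.a_assoc Rn.M.l_neg del: free_on_simps)
    then have "J (embed z) = J ((embed z \<ominus>\<^bsub>Rn\<^esub> embed w) \<oplus>\<^bsub>Rn\<^esub> embed w)" by (rule arg_cong[where f = J])
    also have "\<dots> = J (embed z \<ominus>\<^bsub>Rn\<^esub> embed w) \<otimes>\<^bsub>TP\<^esub> J (embed w)"
      by (rule Jadd[OF mi conjunct1[OF diff(4)]])
    finally have "J (embed z) = J (embed z \<ominus>\<^bsub>Rn\<^esub> embed w) \<otimes>\<^bsub>TP\<^esub> J (embed w)" .
    then have "z = J (embed z \<ominus>\<^bsub>Rn\<^esub> embed w) \<otimes>\<^bsub>TP\<^esub> w" using diff(3,4) by simp
    moreover have "J (embed z \<ominus>\<^bsub>Rn\<^esub> embed w) \<in> carrier TP" using Jc PiE_app[OF mi] by simp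
    ultimately have "J (embed z \<ominus>\<^bsub>Rn\<^esub> embed w) = z \<otimes>\<^bsub>TP\<^esub> inv\<^bsub>TP\<^esub> w"
      using diff(1,2) TG.inv_solve_right by metis
    then show ?case unfolding em using mi by simp
  qed
  show "inj_on embed (carrier TP)" using val by (metis inj_onI)
  show "embed ` carrier TP = {..<n} \<rightarrow>\<^sub>E P"
  proof (intro equalityI subsetI)
    fix y assume y: "y \<in> {..<n} \<rightarrow>\<^sub>E P"
    then show "y \<in> embed ` carrier TP" using eJ[OF y] Jc[of y] PiE_app[OF y] by (intro image_eqI[of _ _ "J y"]) simp_all
  qed (use val in blast)
qed

end

lemma poly_smult_hom:
  assumes E: "module S E" and T: "T \<in> mod_hom S E E" and p: "p \<in> carrier (UP S)"
  shows "smult (poly_module S E T) p \<in> mod_hom S E E"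
proof -
  interpret E: module S E by fact
  interpret M: module "UP S" "poly_module S E T" by (rule poly_module_module[OF E T])
  show ?thesis
  proof (rule mod_homI)
    fix x assume "x \<in> carrier E"
    then show "p \<odot>\<^bsub>poly_module S E T\<^esub> x \<in> carrier E" using M.smult_closed[OF p] by simp
  next
    fix x y assume "x \<in> carrier E" "y \<in> carrier E"
    then show "p \<odot>\<^bsub>poly_module S E T\<^esub> (x \<oplus>\<^bsub>E\<^esub> y) = p \<odot>\<^bsub>poly_module S E T\<^esub> x \<oplus>\<^bsub>E\<^esub> p \<odot>\<^bsub>poly_module S E T\<^esub> y"
      using M.smult_r_distr[OF p, of x y] by simp
  next
    fix a x assume a: "a \<in> carrier S" and x: "x \<in> carrier E"
    have px: "p \<odot>\<^bsub>poly_module S E T\<^esub> x \<in> carrier E" using M.smult_closed[OF p] x by simp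
    note ac = const_poly_closed[OF E.R.cring_axioms a]
    have "p \<odot>\<^bsub>poly_module S E T\<^esub> (const_poly S a \<odot>\<^bsub>poly_module S E T\<^esub> x)
        = const_poly S a \<odot>\<^bsub>poly_module S E T\<^esub> (p \<odot>\<^bsub>poly_module S E T\<^esub> x)"
      using M.smult_assoc1[OF p ac, of x] M.smult_assoc1[OF ac p, of x] M.R.m_comm[OF p ac] x by simp
    then show "p \<odot>\<^bsub>poly_module S E T\<^esub> (a \<odot>\<^bsub>E\<^esub> x) = a \<odot>\<^bsub>E\<^esub> (p \<odot>\<^bsub>poly_module S E T\<^esub> x)"
      unfolding poly_module_const[OF E T a x] poly_module_const[OF E T a px] .
  qed
qed

context residue_matrix begin

lemma UP_R_cring: "cring (UP R)" by (rule UP_cring.UP_cring) (rule UP_cring.intro, rule is_cring)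

lemma const_hom: "const_poly R \<in> ring_hom R (UP R)" by (rule const_poly_hom[OF is_cring])

abbreviation "VM \<equiv> matrix_module K n A"
abbreviation "tensor_one f \<equiv> tensor_map K VK (ideal_space R P) f id"

lemma MA_simps [simp]:
  "carrier MAR = carrier VK" "\<zero>\<^bsub>MAR\<^esub> = \<zero>\<^bsub>VK\<^esub>" "x \<oplus>\<^bsub>MAR\<^esub> y = x \<oplus>\<^bsub>VK\<^esub> y"
  "p \<odot>\<^bsub>MAR\<^esub> x = poly_residue R P p \<odot>\<^bsub>VM\<^esub> x"
  by (simp_all only: MA_def restrict_scalars_simps matrix_module_eq poly_module_simps)

lemma MA_tensor_P_simps [simp]:
  "carrier NP = carrier TP" "\<zero>\<^bsub>NP\<^esub> = \<one>\<^bsub>TP\<^esub>" "x \<oplus>\<^bsub>NP\<^esub> y = x \<otimes>\<^bsub>TP\<^esub> y"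
  "p \<odot>\<^bsub>NP\<^esub> x = tensor_one (smult MAR p) x"
  by (simp_all add: MA_tensor_P_def tensor_module_def free_module_eq)

lemma MA_module: "module (UP R) MAR"
  unfolding MA_def by (rule restrict_scalars_module[OF UP_R_cring K.matrix_module_module[OF A] poly_residue_hom])

lemma MA_smult_hom:
  assumes p: "p \<in> carrier (UP R)"
  shows "smult MAR p \<in> mod_hom K VK VK"
proof -
  have "smult MAR p = smult (poly_module K VK (mat_vec K n A)) (poly_residue R P p)"
    by (rule ext) (simp only: MA_simps matrix_module_eq)
  then show ?thesis
    using poly_smult_hom[OF K.free_on_module K.mat_vec_hom[OF A] ring_hom_closed[OF poly_residue_hom p]] by simp
qed

lemma tensor_one_hom: "f \<in> mod_hom K VK VK \<Longrightarrow> tensor_one f \<in> hom TP TP"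
  by (rule TF.tensor_map_bilinear(1)[where f = f]) (simp_all only: mod_hom_closed mod_hom_add mod_hom_smult)

lemma tensor_one_elem:
  "f \<in> mod_hom K VK VK \<Longrightarrow> v \<in> carrier VK \<Longrightarrow> p \<in> P \<Longrightarrow> tensor_one f (te v p) = te (f v) p"
  by (rule TF.tensor_map_bilinear(2)[where f = f]) (simp_all only: mod_hom_closed mod_hom_add mod_hom_smult P_space_simps)

lemma embed_closed: "z \<in> carrier TP \<Longrightarrow> embed z \<in> carrier Rn"
  using embed_hom by (auto simp: hom_def Pi_iff simp del: free_on_simps)

text \<open>Under the embedding into \<open>R\<^sup>n\<close>, any lift \<open>h\<close> of \<open>f\<close> restricts to \<open>f \<otimes> 1\<close>: on \<open>v \<otimes> p\<close> both give
\<open>p\<close> times a lift of \<open>f v\<close>.\<close>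

lemma embed_tensor_one:
  assumes f: "f \<in> mod_hom K VK VK" and h: "h \<in> mod_hom R Rn Rn"
    and fh: "\<And>x. x \<in> carrier Rn \<Longrightarrow> f (redv {..<n} x) = redv {..<n} (h x)" and z: "z \<in> carrier TP"
  shows "embed (tensor_one f z) = h (embed z)"
proof -
  interpret Rn: module R Rn by (rule free_on_module)
  have h_hom: "h \<in> hom (add_monoid Rn) (add_monoid Rn)"
    by (rule homI) (simp_all add: mod_hom_closed[OF h] mod_hom_add[OF h] del: free_on_simps)
  have "(embed \<circ> tensor_one f) z = (h \<circ> embed) z"
  proof (rule TF.tensor_hom_eqI[OF Rn.M.a_group _ _ z])
    show "embed \<circ> tensor_one f \<in> hom TP (add_monoid Rn)" by (rule Group.hom_compose[OF tensor_one_hom[OF f] embed_hom])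
    show "h \<circ> embed \<in> hom TP (add_monoid Rn)" by (rule Group.hom_compose[OF embed_hom h_hom])
    fix v p assume v: "v \<in> carrier VK" and p: "p \<in> carrier (ideal_space R P)"
    obtain x where x: "x \<in> carrier Rn" "redv {..<n} x = v" using redv_surj[of v "{..<n}"] v unfolding free_on_simps(1) by blast
    note x' = x(1)[unfolded free_on_simps(1)] and p' = p[unfolded P_space_simps(1)]
    note hx = mod_hom_closed[OF h x(1), unfolded free_on_simps(1)]
    have "embed (tensor_one f (te v p)) = embed (te (redv {..<n} (h x)) p)"
      unfolding tensor_one_elem[OF f v p'] fh[OF x(1), unfolded x(2)] ..
    also have "\<dots> = p \<odot>\<^bsub>Rn\<^esub> h x" by (rule embed_elem[OF hx p'])
    also have "\<dots> = h (p \<odot>\<^bsub>Rn\<^esub> x)" by (rule mod_hom_smult[OF h P_carrier[OF p'] x(1), symmetric])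
    also have "p \<odot>\<^bsub>Rn\<^esub> x = embed (te v p)" unfolding x(2)[symmetric] by (rule embed_elem[OF x' p', symmetric])
    finally show "(embed \<circ> tensor_one f) (te v p) = (h \<circ> embed) (te v p)" by (simp only: o_apply)
  qed
  then show ?thesis by (simp only: o_apply)
qed

abbreviation "lifted_module B \<equiv> poly_module R Rn (mat_vec R n B)"

definition lifted_extension :: "(nat \<times> nat \<Rightarrow> 'a)
    \<Rightarrow> (nat \<Rightarrow> 'a, ((nat \<Rightarrow> 'a set) \<times> 'a \<Rightarrow>\<^sub>0 int) set, nat \<Rightarrow> 'a, nat \<Rightarrow> 'a set) extension" where
  "lifted_extension B = \<lparr>ext_mid = lifted_module B, ext_in = embed, ext_out = redv {..<n}\<rparr>"

lemma lifted_extension_simps [simp]: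
  "ext_mid (lifted_extension B) = lifted_module B" "ext_in (lifted_extension B) = embed"
  "ext_out (lifted_extension B) = redv {..<n}"
  by (simp_all add: lifted_extension_def)

abbreviation "lifts \<equiv> {B \<in> matrices R n. redm n B = A}"

lemma liftsD: "B \<in> lifts \<Longrightarrow> B \<in> matrices R n" "B \<in> lifts \<Longrightarrow> redm n B = A"
  by simp_all

lemma lifted_module_module: "B \<in> lifts \<Longrightarrow> module (UP R) (lifted_module B)"
  by (rule poly_module_module[OF free_on_module mat_vec_hom[OF liftsD(1)]])

lemma redv_poly_hom:
  assumes B: "B \<in> lifts"
  shows "redv {..<n} \<in> mod_hom (UP R) (lifted_module B) MAR"
proof -
  note hB = mat_vec_hom[OF liftsD(1)[OF B]]
  have h: "redv {..<n} \<in> mod_hom (UP R) (lifted_module B) (poly_module R (residue_space {..<n}) (mat_vec K n A))"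
    by (rule poly_module_hom[OF free_on_module residue_space_module hB mat_vec_residue_hom[OF A] redv_hom])
      (unfold free_on_simps(1), simp only: redv_mat_vec[OF liftsD(1)[OF B]] liftsD(2)[OF B])
  show ?thesis
  proof (rule mod_homI)
    fix x assume "x \<in> carrier (lifted_module B)"
    then show "redv {..<n} x \<in> carrier MAR" using mod_hom_closed[OF h] by simp
  next
    fix x y assume "x \<in> carrier (lifted_module B)" "y \<in> carrier (lifted_module B)"
    from mod_hom_add[OF h this] show "redv {..<n} (x \<oplus>\<^bsub>lifted_module B\<^esub> y) = redv {..<n} x \<oplus>\<^bsub>MAR\<^esub> redv {..<n} y"
      by (simp only: MA_simps poly_module_simps restrict_scalars_simps)
  next
    fix p x assume p: "p \<in> carrier (UP R)" and x: "x \<in> carrier (lifted_module B)"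
    have "redv {..<n} x \<in> vectors K n" using x by (intro redv_closed) simp
    from mod_hom_smult[OF h p x] poly_smult_residue[OF A p this]
    show "redv {..<n} (p \<odot>\<^bsub>lifted_module B\<^esub> x) = p \<odot>\<^bsub>MAR\<^esub> redv {..<n} x" by (simp only: MA_simps)
  qed
qed

lemma embed_poly_hom:
  assumes B: "B \<in> lifts"
  shows "embed \<in> mod_hom (UP R) NP (lifted_module B)"
proof (rule mod_homI)
  show "embed z \<in> carrier (lifted_module B)" if "z \<in> carrier NP" for z
    using embed_closed[of z] that by (simp del: free_on_simps)
  show "embed (z \<oplus>\<^bsub>NP\<^esub> w) = embed z \<oplus>\<^bsub>lifted_module B\<^esub> embed w" if "z \<in> carrier NP" "w \<in> carrier NP" for z w
    using hom_mult[OF embed_hom, of z w] that by (simp del: free_on_simps)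
  fix p z assume p: "p \<in> carrier (UP R)" and z: "z \<in> carrier NP"
  have "embed (tensor_one (smult MAR p) z) = p \<odot>\<^bsub>lifted_module B\<^esub> embed z"
  proof (rule embed_tensor_one[OF MA_smult_hom[OF p] poly_smult_hom[OF free_on_module mat_vec_hom[OF liftsD(1)[OF B]] p]])
    show "p \<odot>\<^bsub>MAR\<^esub> redv {..<n} x = redv {..<n} (p \<odot>\<^bsub>lifted_module B\<^esub> x)" if "x \<in> carrier Rn" for x
      using mod_hom_smult[OF redv_poly_hom[OF B] p, of x] that by (simp only: poly_module_simps)
  qed (use z in \<open>simp only: MA_tensor_P_simps\<close>)
  then show "embed (p \<odot>\<^bsub>NP\<^esub> z) = p \<odot>\<^bsub>lifted_module B\<^esub> embed z" by (simp only: MA_tensor_P_simps(4))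
qed

lemma lifts_nonempty: "\<exists>B. B \<in> lifts"
  using redv_surj[OF A] by blast

lemma tensor_one_closed: "f \<in> mod_hom K VK VK \<Longrightarrow> z \<in> carrier TP \<Longrightarrow> tensor_one f z \<in> carrier TP"
  using tensor_one_hom by (auto simp: hom_def Pi_iff)

lemma MA_tensor_P_module: "module (UP R) NP"
proof -
  obtain B where B: "B \<in> lifts" using lifts_nonempty by blast
  interpret TG: comm_group TP by (rule TP_comm_group)
  have ab: "abelian_group NP"
  proof (rule abelian_groupI, unfold MA_tensor_P_simps)
    fix z assume "z \<in> carrier TP"
    then show "\<exists>w\<in>carrier TP. w \<otimes>\<^bsub>TP\<^esub> z = \<one>\<^bsub>TP\<^esub>" by (intro bexI[of _ "inv\<^bsub>TP\<^esub> z"] TG.l_inv TG.inv_closed)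
  qed (simp_all only: TG.m_closed TG.one_closed TG.m_ac TG.l_one TG.r_one)
  show ?thesis
  proof (rule module_embedding[OF lifted_module_module[OF B] ab _ embed_poly_hom[OF B]])
    show "p \<odot>\<^bsub>NP\<^esub> z \<in> carrier NP" if "p \<in> carrier (UP R)" "z \<in> carrier NP" for p z
      using tensor_one_closed[OF MA_smult_hom[OF that(1)], of z] that(2) by (simp only: MA_tensor_P_simps)
    show "inj_on embed (carrier NP)" using embed_inj by (simp only: MA_tensor_P_simps)
  qed
qed

lemma embed_kernel: "embed ` carrier TP = {x \<in> carrier Rn. redv {..<n} x = \<zero>\<^bsub>VK\<^esub>}"
proof (intro Set.set_eqI iffI CollectI conjI)
  fix x
  assume x: "x \<in> embed ` carrier TP"
  then have xP: "x \<in> {..<n} \<rightarrow>\<^sub>E P" unfolding embed_image .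
  then show xR: "x \<in> carrier Rn" using P_carrier by (auto simp: PiE_iff)
  show "redv {..<n} x = \<zero>\<^bsub>VK\<^esub>" using redv_kernel[OF xR[unfolded free_on_simps(1)]] xP by (rule iffD2)
next
  fix x assume x: "x \<in> {x \<in> carrier Rn. redv {..<n} x = \<zero>\<^bsub>VK\<^esub>}"
  then have xR: "x \<in> vectors R n" by (simp only: mem_Collect_eq free_on_simps(1))
  show "x \<in> embed ` carrier TP" unfolding embed_image using redv_kernel[OF xR] x by blast
qed

lemma redv_image: "redv {..<n} ` carrier Rn = carrier VK"
  unfolding free_on_simps(1)
proof (intro equalityI image_subsetI subsetI)
  fix v assume "v \<in> vectors K n"
  from redv_surj[OF this] obtain x where x: "x \<in> vectors R n" "redv {..<n} x = v" by (rule bexE)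
  show "v \<in> redv {..<n} ` (vectors R n)" unfolding x(2)[symmetric] by (rule imageI[OF x(1)])
qed (rule redv_closed)

lemma lifted_extension_is_extension:
  assumes B: "B \<in> lifts"
  shows "is_extension (UP R) MAR NP (lifted_extension B)"
  unfolding is_extension_def lifted_extension_simps
proof (intro conjI)
  show "redv {..<n} ` carrier (lifted_module B) = carrier MAR"
    unfolding poly_module_simps MA_simps by (rule redv_image)
  show "inj_on embed (carrier NP)" unfolding MA_tensor_P_simps by (rule embed_inj)
  show "embed ` carrier NP = {x \<in> carrier (lifted_module B). redv {..<n} x = \<zero>\<^bsub>MAR\<^esub>}"
    unfolding poly_module_simps MA_simps MA_tensor_P_simps by (rule embed_kernel)
qed (rule lifted_module_module[OF B] embed_poly_hom[OF B] redv_poly_hom[OF B])+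

abbreviation "MAB \<equiv> MA_base R P n A"
abbreviation "NPB \<equiv> MA_tensor_P_base R P n A"

lemma MA_base_module: "module R MAB"
  unfolding MA_base_def by (rule restrict_scalars_module[OF is_cring MA_module const_hom])

lemma MA_tensor_P_base_module: "module R NPB"
  unfolding MA_tensor_P_base_def by (rule restrict_scalars_module[OF is_cring MA_tensor_P_module const_hom])

lemma lifted_restrict_morphism:
  assumes B: "B \<in> lifts"
  shows "ext_morphism R NPB id id (xi0_extension R P n) (ext_restrict_scalars (const_poly R) (lifted_extension B))"
proof (rule ext_morphismI[of "\<lambda>x. x"])
  note hB = mat_vec_hom[OF liftsD(1)[OF B]]
  show "(\<lambda>x. x) \<in> mod_hom R (ext_mid (xi0_extension R P n)) (ext_mid (ext_restrict_scalars (const_poly R) (lifted_extension B)))"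
    by (rule mod_homI)
      (simp_all only: xi0_extension_def extension.simps free_module_eq ext_restrict_scalars_def lifted_extension_simps
        restrict_scalars_simps poly_module_simps poly_module_const[OF free_on_module hB])
qed (simp_all add: xi0_extension_def ext_restrict_scalars_def embed_def redv_def res_def del: free_on_simps)

lemma xi0_extension_simps:
  shows "ext_mid (xi0_extension R P n) = Rn" "ext_in (xi0_extension R P n) = embed"
    "ext_out (xi0_extension R P n) = redv {..<n}"
proof -
  show "ext_mid (xi0_extension R P n) = Rn" by (simp add: xi0_extension_def free_module_eq)
  show "ext_in (xi0_extension R P n) = embed" by (simp add: embed_def)
  show "ext_out (xi0_extension R P n) = redv {..<n}"
    by (rule ext) (simp add: xi0_extension_def redv_def res_def)
qed

lemma xi0_extension_is_extension: "is_extension R MAB NPB (xi0_extension R P n)"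
proof -
  obtain B where B: "B \<in> lifts" using lifts_nonempty by blast
  note hB = mat_vec_hom[OF liftsD(1)[OF B]]
  have m: "(\<lambda>x. x) \<in> mod_hom R Rn (restrict_scalars (const_poly R) (lifted_module B))" "(\<lambda>x. x) \<in> mod_hom R (restrict_scalars (const_poly R) (lifted_module B)) Rn"
    by (rule mod_homI; simp_all only: restrict_scalars_simps poly_module_simps poly_module_const[OF free_on_module hB])+
  have U: "is_extension R MAB NPB (ext_restrict_scalars (const_poly R) (lifted_extension B))"
    unfolding MA_base_def MA_tensor_P_base_def
    by (rule is_extension_restrict[OF is_cring const_hom lifted_extension_is_extension[OF B]])
  note u = is_extensionD(2,3)[OF U, unfolded ext_restrict_scalars_def extension.simps lifted_extension_simps]
  have "embed \<in> mod_hom R NPB Rn" "redv {..<n} \<in> mod_hom R Rn MAB"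
    using mod_hom_comp[OF u(1) m(2)] mod_hom_comp[OF m(1) u(2)] by simp_all
  moreover have "carrier MAB = carrier VK" "carrier NPB = carrier TP" "\<zero>\<^bsub>MAB\<^esub> = \<zero>\<^bsub>VK\<^esub>"
    by (simp_all only: MA_base_def MA_tensor_P_base_def restrict_scalars_simps MA_simps MA_tensor_P_simps)
  ultimately show ?thesis
    unfolding is_extension_def xi0_extension_simps by (intro conjI) (simp_all only: embed_inj redv_image embed_kernel free_on_module)
qed

end

section \<open>The fibre of the forgetful map\<close>

lemma ext_morphism_cong:
  assumes U: "is_extension S M N U" and m: "ext_morphism S N \<alpha> \<beta> U V"
    and "\<And>x. x \<in> carrier N \<Longrightarrow> \<alpha> x = \<alpha>' x" "\<And>y. y \<in> carrier M \<Longrightarrow> \<beta> y = \<beta>' y"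
  shows "ext_morphism S N \<alpha>' \<beta>' U V"
proof -
  obtain \<phi> where \<phi>: "\<phi> \<in> mod_hom S (ext_mid U) (ext_mid V)"
    "\<And>x. x \<in> carrier N \<Longrightarrow> \<phi> (ext_in U x) = ext_in V (\<alpha> x)"
    "\<And>e. e \<in> carrier (ext_mid U) \<Longrightarrow> ext_out V (\<phi> e) = \<beta> (ext_out U e)"
    using m by (rule ext_morphismE) blast
  show ?thesis
    by (rule ext_morphismI[OF \<phi>(1)]) (simp_all add: \<phi> assms(3,4) mod_hom_closed[OF is_extensionD(3)[OF U]])
qed

lemma (in cring) mat_vec_bij:
  assumes g: "g \<in> matrices R n" "h \<in> matrices R n"
    and gh: "g \<otimes>\<^bsub>mat_ring R n\<^esub> h = \<one>\<^bsub>mat_ring R n\<^esub>" "h \<otimes>\<^bsub>mat_ring R n\<^esub> g = \<one>\<^bsub>mat_ring R n\<^esub>"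
  shows "bij_betw (mat_vec R n g) (carrier (free_on R {..<n})) (carrier (free_on R {..<n}))"
proof (rule bij_betwI[where g = "mat_vec R n h"])
  show "mat_vec R n h (mat_vec R n g x) = x" if "x \<in> carrier (free_on R {..<n})" for x
    using mat_vec_mult[OF g(2,1), of x] mat_vec_one[of x] gh that unfolding free_on_simps(1) by simp
  show "mat_vec R n g (mat_vec R n h x) = x" if "x \<in> carrier (free_on R {..<n})" for x
    using mat_vec_mult[OF g, of x] mat_vec_one[of x] gh that unfolding free_on_simps(1) by simp
qed (unfold free_on_simps(1), rule Pi_I, erule mat_vec_closed[OF g(1)], rule Pi_I, erule mat_vec_closed[OF g(2)])

context residue_matrix begin

lemma tensor_one_ident:
  assumes f: "f \<in> mod_hom K VK VK" and id: "\<And>v. v \<in> carrier VK \<Longrightarrow> f v = v" and z: "z \<in> carrier TP"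
  shows "tensor_one f z = z"
proof -
  interpret TG: comm_group TP by (rule TP_comm_group)
  have i: "(\<lambda>z. z) \<in> hom TP TP" by (rule homI) simp_all
  show ?thesis
    by (rule TF.tensor_hom_eqI[OF TG.is_group tensor_one_hom[OF f] i z])
      (simp only: tensor_one_elem[OF f] id P_space_simps)
qed

definition lifted_class :: "(nat \<times> nat \<Rightarrow> 'a)
    \<Rightarrow> (nat \<Rightarrow> 'a, ((nat \<Rightarrow> 'a set) \<times> 'a \<Rightarrow>\<^sub>0 int) set, nat \<Rightarrow> 'a set) ext set" where
  "lifted_class B = ext_class (UP R) MAR NP (lifted_extension B)"

text \<open>The union in the definition of \<open>omega\<close> is over equal sets, as an isomorphism of extensions over \<open>R[t]\<close> is one over \<open>R\<close>.\<close>

lemma omega_class: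
  fixes U :: "(nat \<Rightarrow> 'a, ((nat \<Rightarrow> 'a set) \<times> 'a \<Rightarrow>\<^sub>0 int) set, 'e, nat \<Rightarrow> 'a set) extension"
  assumes U: "is_extension (UP R) MAR NP U"
  shows "omega R P n A (ext_class (UP R) MAR NP U) = ext_class R MAB NPB (ext_restrict_scalars (const_poly R) U)"
proof -
  note rU = is_extension_restrict[OF is_cring const_hom U, folded MA_base_def MA_tensor_P_base_def]
  have "ext_class R MAB NPB (ext_restrict_scalars (const_poly R) V) = ext_class R MAB NPB (ext_restrict_scalars (const_poly R) U)"
    if V: "V \<in> ext_class (UP R) MAR NP U" for V
  proof -
    have V': "is_extension (UP R) MAR NP V" "ext_morphism (UP R) NP id id U V"
      using V unfolding ext_class_def by blast+
    note rV = is_extension_restrict[OF is_cring const_hom V'(1), folded MA_base_def MA_tensor_P_base_def]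
    show ?thesis
      using ext_class_eq_iff[OF MA_base_module MA_tensor_P_base_module rU rV]
        ext_morphism_restrict[OF const_hom V'(2), folded MA_tensor_P_base_def] by simp
  qed
  then show ?thesis
    unfolding omega_def using ext_class_nonempty[OF MA_module MA_tensor_P_module U] by blast
qed

lemma lifted_class_in_fibre:
  assumes B: "B \<in> lifts"
  shows "lifted_class B \<in> omega_fibre R P n A"
proof -
  note L = lifted_extension_is_extension[OF B]
  note rL = is_extension_restrict[OF is_cring const_hom L, folded MA_base_def MA_tensor_P_base_def]
  have "xi0 R P n A = omega R P n A (lifted_class B)"
    unfolding lifted_class_def omega_class[OF L] xi0_def
    using ext_class_eq_iff[OF MA_base_module MA_tensor_P_base_module xi0_extension_is_extension rL]
      lifted_restrict_morphism[OF B] by simp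
  then show ?thesis
    unfolding omega_fibre_def using ext_class_in_Ext1[OF MA_module MA_tensor_P_module L] by (simp add: lifted_class_def)
qed

text \<open>An isomorphism over \<open>R\<close> from \<open>R\<^sup>n\<close> to the middle term transports the action of \<open>t\<close> to an endomorphism of \<open>R\<^sup>n\<close>,
hence to a matrix. It lifts \<open>A\<close> because \<open>t\<close> acts on the quotient by \<open>A\<close>.\<close>

lemma lift_of_fibre_extension:
  fixes U :: "(nat \<Rightarrow> 'a, ((nat \<Rightarrow> 'a set) \<times> 'a \<Rightarrow>\<^sub>0 int) set, 'e, nat \<Rightarrow> 'a set) extension"
  assumes U: "is_extension (UP R) MAR NP U"
    and m: "ext_morphism R NPB id id (xi0_extension R P n) (ext_restrict_scalars (const_poly R) U)"
  shows "\<exists>B\<in>lifts. ext_morphism (UP R) NP id id (lifted_extension B) U"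
proof -
  note u = is_extensionD[OF U]
  note rU = is_extension_restrict[OF is_cring const_hom U, folded MA_base_def MA_tensor_P_base_def]
  define Y where "Y = ext_mid U"
  interpret Y: module "UP R" Y unfolding Y_def by (rule u(1))
  interpret Rn: module R Rn by (rule free_on_module)
  have rY: "ext_mid (ext_restrict_scalars (const_poly R) U) = restrict_scalars (const_poly R) Y"
    "ext_in (ext_restrict_scalars (const_poly R) U) = ext_in U" "ext_out (ext_restrict_scalars (const_poly R) U) = ext_out U"
    by (simp_all add: ext_restrict_scalars_def Y_def)
  have NPBc: "carrier NPB = carrier TP" by (simp only: MA_tensor_P_base_def restrict_scalars_simps MA_tensor_P_simps)
  obtain \<phi> where \<phi>0: "\<phi> \<in> mod_hom R (ext_mid (xi0_extension R P n)) (ext_mid (ext_restrict_scalars (const_poly R) U))"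
    "\<And>x. x \<in> carrier NPB \<Longrightarrow> \<phi> (ext_in (xi0_extension R P n) x) = ext_in (ext_restrict_scalars (const_poly R) U) (id x)"
    "\<And>e. e \<in> carrier (ext_mid (xi0_extension R P n)) \<Longrightarrow>
      ext_out (ext_restrict_scalars (const_poly R) U) (\<phi> e) = id (ext_out (xi0_extension R P n) e)"
    using m by (rule ext_morphismE) blast
  have bij: "bij_betw \<phi> (carrier Rn) (carrier Y)"
    using ext_morphism_bij[OF MA_base_module MA_tensor_P_base_module xi0_extension_is_extension rU \<phi>0[unfolded id_apply]]
    unfolding rY xi0_extension_simps restrict_scalars_simps .
  note \<phi> = \<phi>0[unfolded rY xi0_extension_simps NPBc id_apply]
  have \<phi>c: "\<phi> x \<in> carrier Y" if "x \<in> carrier Rn" for x using mod_hom_closed[OF \<phi>(1) that] by (simp only: restrict_scalars_simps)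
  have \<phi>a: "\<phi> (x \<oplus>\<^bsub>Rn\<^esub> y) = \<phi> x \<oplus>\<^bsub>Y\<^esub> \<phi> y" if "x \<in> carrier Rn" "y \<in> carrier Rn" for x y
    using mod_hom_add[OF \<phi>(1) that] by (simp only: restrict_scalars_simps)
  have \<phi>s: "\<phi> (a \<odot>\<^bsub>Rn\<^esub> x) = const_poly R a \<odot>\<^bsub>Y\<^esub> \<phi> x" if "a \<in> carrier R" "x \<in> carrier Rn" for a x
    using mod_hom_smult[OF \<phi>(1) that] by (simp only: restrict_scalars_simps)
  have inj: "x = y" if "x \<in> carrier Rn" "y \<in> carrier Rn" "\<phi> x = \<phi> y" for x y
    using inj_onD[OF bij_betw_imp_inj_on[OF bij] that(3,1,2)] .
  have X: "poly_var R \<in> carrier (UP R)" by (rule poly_var_closed[OF is_cring])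
  \<comment> \<open>The action of \<open>t\<close>, transported along \<open>\<phi>\<close>.\<close>
  define T where "T x = inv_into (carrier Rn) \<phi> (poly_var R \<odot>\<^bsub>Y\<^esub> \<phi> x)" for x
  have T: "T x \<in> carrier Rn" "\<phi> (T x) = poly_var R \<odot>\<^bsub>Y\<^esub> \<phi> x" if "x \<in> carrier Rn" for x
  proof -
    have "poly_var R \<odot>\<^bsub>Y\<^esub> \<phi> x \<in> \<phi> ` carrier Rn"
      unfolding bij_betw_imp_surj_on[OF bij] by (rule Y.smult_closed[OF X \<phi>c[OF that]])
    then show "T x \<in> carrier Rn" "\<phi> (T x) = poly_var R \<odot>\<^bsub>Y\<^esub> \<phi> x"
      unfolding T_def by (rule inv_into_into, rule f_inv_into_f)
  qed
  have T_hom: "T \<in> mod_hom R Rn Rn"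
  proof (rule mod_homI)
    show "T x \<in> carrier Rn" if "x \<in> carrier Rn" for x by (rule T(1)[OF that])
    show "T (x \<oplus>\<^bsub>Rn\<^esub> y) = T x \<oplus>\<^bsub>Rn\<^esub> T y" if xy: "x \<in> carrier Rn" "y \<in> carrier Rn" for x y
    proof (rule inj[OF T(1)[OF Rn.M.a_closed[OF xy]] Rn.M.a_closed[OF T(1)[OF xy(1)] T(1)[OF xy(2)]]])
      show "\<phi> (T (x \<oplus>\<^bsub>Rn\<^esub> y)) = \<phi> (T x \<oplus>\<^bsub>Rn\<^esub> T y)"
        unfolding T(2)[OF Rn.M.a_closed[OF xy]] \<phi>a[OF xy] \<phi>a[OF T(1)[OF xy(1)] T(1)[OF xy(2)]] T(2)[OF xy(1)] T(2)[OF xy(2)]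
        by (rule Y.smult_r_distr[OF X \<phi>c[OF xy(1)] \<phi>c[OF xy(2)]])
    qed
    show "T (a \<odot>\<^bsub>Rn\<^esub> x) = a \<odot>\<^bsub>Rn\<^esub> T x" if a: "a \<in> carrier R" and x: "x \<in> carrier Rn" for a x
    proof (rule inj[OF T(1)[OF Rn.smult_closed[OF a x]] Rn.smult_closed[OF a T(1)[OF x]]])
      note ac = const_poly_closed[OF is_cring a]
      show "\<phi> (T (a \<odot>\<^bsub>Rn\<^esub> x)) = \<phi> (a \<odot>\<^bsub>Rn\<^esub> T x)"
        unfolding T(2)[OF Rn.smult_closed[OF a x]] \<phi>s[OF a x] \<phi>s[OF a T(1)[OF x]] T(2)[OF x]
        using Y.smult_assoc1[OF X ac \<phi>c[OF x]] Y.smult_assoc1[OF ac X \<phi>c[OF x]] Y.R.m_comm[OF X ac] by simp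
    qed
  qed
  obtain B where B: "B \<in> matrices R n" "\<And>x. x \<in> vectors R n \<Longrightarrow> T x = mat_vec R n B x"
    using matrix_of_hom[OF T_hom] by blast
  have "redm n B = A"
  proof (rule redm_eqI[OF B(1) A])
    fix x assume x: "x \<in> vectors R n"
    then have x': "x \<in> carrier Rn" unfolding free_on_simps(1) .
    have "redv {..<n} (mat_vec R n B x) = ext_out U (\<phi> (T x))"
      unfolding B(2)[OF x, symmetric] by (rule \<phi>(3)[OF T(1)[OF x'], symmetric])
    also have "\<dots> = poly_var R \<odot>\<^bsub>MAR\<^esub> ext_out U (\<phi> x)"
      unfolding T(2)[OF x'] using mod_hom_smult[OF u(3) X, of "\<phi> x"] \<phi>c[OF x'] by (simp only: Y_def)
    also have "ext_out U (\<phi> x) = redv {..<n} x" by (rule \<phi>(3)[OF x'])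
    also have "poly_var R \<odot>\<^bsub>MAR\<^esub> redv {..<n} x = mat_vec K n A (redv {..<n} x)"
      unfolding MA_simps poly_residue_var matrix_module_eq
      by (rule poly_module_var[OF K.free_on_module K.mat_vec_hom[OF A]]) (unfold free_on_simps(1), rule redv_closed[OF x])
    finally show "redv {..<n} (mat_vec R n B x) = mat_vec K n A (redv {..<n} x)" .
  qed
  with B(1) have BL: "B \<in> lifts" by blast
  note hB = mat_vec_hom[OF B(1)]
  have "\<phi> \<in> mod_hom (UP R) (lifted_module B) Y"
  proof (rule UP_mod_homI[OF lifted_module_module[OF BL] Y.module_axioms is_cring]; unfold poly_module_simps)
    show "\<phi> (const_poly R a \<odot>\<^bsub>lifted_module B\<^esub> x) = const_poly R a \<odot>\<^bsub>Y\<^esub> \<phi> x" if "a \<in> carrier R" "x \<in> carrier Rn" for a x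
      unfolding poly_module_const[OF free_on_module hB that] by (rule \<phi>s[OF that])
    show "\<phi> (poly_var R \<odot>\<^bsub>lifted_module B\<^esub> x) = poly_var R \<odot>\<^bsub>Y\<^esub> \<phi> x" if x: "x \<in> carrier Rn" for x
      unfolding poly_module_var[OF free_on_module hB x] B(2)[OF x[unfolded free_on_simps(1)], symmetric] by (rule T(2)[OF x])
  qed (rule \<phi>c \<phi>a, assumption+)+
  then have "ext_morphism (UP R) NP id id (lifted_extension B) U"
    by (intro ext_morphismI[of \<phi>]) (simp_all only: lifted_extension_simps poly_module_simps MA_tensor_P_simps \<phi>(2,3) id_apply Y_def)
  with BL show ?thesis by blast
qed

lemma omega_fibre_eq: "omega_fibre R P n A = lifted_class ` lifts"
proof (intro equalityI subsetI)
  fix \<xi> assume "\<xi> \<in> omega_fibre R P n A"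
  then have \<xi>: "\<xi> \<in> Ext1 (UP R) MAR NP" "omega R P n A \<xi> = xi0 R P n A" by (simp_all add: omega_fibre_def)
  obtain U :: "(nat \<Rightarrow> 'a, ((nat \<Rightarrow> 'a set) \<times> 'a \<Rightarrow>\<^sub>0 int) set, nat \<Rightarrow> 'a set) ext"
    where U: "is_extension (UP R) MAR NP U" "\<xi> = ext_class (UP R) MAR NP U"
    using \<xi>(1) unfolding Ext1_def by blast
  note rU = is_extension_restrict[OF is_cring const_hom U(1), folded MA_base_def MA_tensor_P_base_def]
  have "ext_morphism R NPB id id (xi0_extension R P n) (ext_restrict_scalars (const_poly R) U)"
    using \<xi>(2) ext_class_eq_iff[OF MA_base_module MA_tensor_P_base_module xi0_extension_is_extension rU]
    unfolding U(2) omega_class[OF U(1)] xi0_def by simp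
  from lift_of_fibre_extension[OF U(1) this] obtain B where B: "B \<in> lifts" "ext_morphism (UP R) NP id id (lifted_extension B) U"
    by blast
  have "lifted_class B = \<xi>"
    unfolding lifted_class_def U(2)
    using ext_class_eq_iff[OF MA_module MA_tensor_P_module lifted_extension_is_extension[OF B(1)] U(1)] B(2) by simp
  with B(1) show "\<xi> \<in> lifted_class ` lifts" by blast
qed (use lifted_class_in_fibre in blast)

text \<open>The morphism is \<open>\<gamma>\<close> itself, and its restriction to \<open>M\<^sup>A \<otimes> P\<close> is given by \<open>embed_tensor_one\<close>.\<close>

lemma lifted_morphism:
  assumes B: "B \<in> lifts" "B' \<in> lifts" and \<gamma>: "\<gamma> \<in> matrices R n"
    and comm: "\<gamma> \<otimes>\<^bsub>mat_ring R n\<^esub> B = B' \<otimes>\<^bsub>mat_ring R n\<^esub> \<gamma>"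
  shows "ext_morphism (UP R) NP (tensor_one (mat_vec K n (redm n \<gamma>))) (mat_vec K n (redm n \<gamma>))
    (lifted_extension B) (lifted_extension B')"
proof (rule ext_morphismI[of "mat_vec R n \<gamma>"]; unfold lifted_extension_simps poly_module_simps MA_tensor_P_simps)
  note B1 = liftsD(1)[OF B(1)] and B2 = liftsD(1)[OF B(2)]
  show "mat_vec R n \<gamma> \<in> mod_hom (UP R) (lifted_module B) (lifted_module B')"
  proof (rule poly_module_hom[OF free_on_module free_on_module mat_vec_hom[OF B1] mat_vec_hom[OF B2] mat_vec_hom[OF \<gamma>]])
    fix x assume "x \<in> carrier Rn"
    then have x: "x \<in> vectors R n" unfolding free_on_simps(1) .
    show "mat_vec R n \<gamma> (mat_vec R n B x) = mat_vec R n B' (mat_vec R n \<gamma> x)"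
      unfolding mat_vec_mult[OF \<gamma> B1 x, symmetric] mat_vec_mult[OF B2 \<gamma> x, symmetric] comm ..
  qed
  have g: "redm n \<gamma> \<in> matrices K n" by (rule redv_closed[OF \<gamma>])
  show "mat_vec R n \<gamma> (embed z) = embed (tensor_one (mat_vec K n (redm n \<gamma>)) z)" if "z \<in> carrier TP" for z
    by (rule embed_tensor_one[OF K.mat_vec_hom[OF g] mat_vec_hom[OF \<gamma>] _ that, symmetric])
      (unfold free_on_simps(1), rule redv_mat_vec[OF \<gamma>, symmetric])
  show "redv {..<n} (mat_vec R n \<gamma> x) = mat_vec K n (redm n \<gamma>) (redv {..<n} x)" if "x \<in> carrier Rn" for x
    using that unfolding free_on_simps(1) by (rule redv_mat_vec[OF \<gamma>])
qed

lemma lifted_class_eq_iff: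
  assumes B: "B \<in> lifts" "B' \<in> lifts"
  shows "lifted_class B = lifted_class B' \<longleftrightarrow>
    (\<exists>\<gamma>\<in>matrices R n. redm n \<gamma> = \<one>\<^bsub>mat_ring K n\<^esub> \<and> \<gamma> \<otimes>\<^bsub>mat_ring R n\<^esub> B = B' \<otimes>\<^bsub>mat_ring R n\<^esub> \<gamma>)"
proof -
  note L = lifted_extension_is_extension[OF B(1)] and L' = lifted_extension_is_extension[OF B(2)]
  note B1 = liftsD(1)[OF B(1)] and B2 = liftsD(1)[OF B(2)]
  have "lifted_class B = lifted_class B' \<longleftrightarrow> ext_morphism (UP R) NP id id (lifted_extension B) (lifted_extension B')"
    unfolding lifted_class_def by (rule ext_class_eq_iff[OF MA_module MA_tensor_P_module L L'])
  also have "\<dots> \<longleftrightarrow> (\<exists>\<gamma>\<in>matrices R n. redm n \<gamma> = \<one>\<^bsub>mat_ring K n\<^esub> \<and> \<gamma> \<otimes>\<^bsub>mat_ring R n\<^esub> B = B' \<otimes>\<^bsub>mat_ring R n\<^esub> \<gamma>)"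
  proof
    assume "ext_morphism (UP R) NP id id (lifted_extension B) (lifted_extension B')"
    then obtain \<phi> where \<phi>0: "\<phi> \<in> mod_hom (UP R) (ext_mid (lifted_extension B)) (ext_mid (lifted_extension B'))"
      "\<And>e. e \<in> carrier (ext_mid (lifted_extension B)) \<Longrightarrow> ext_out (lifted_extension B') (\<phi> e) = id (ext_out (lifted_extension B) e)"
      by (rule ext_morphismE) blast
    note \<phi> = \<phi>0[unfolded lifted_extension_simps poly_module_simps id_apply]
    note hom = poly_module_homD[OF free_on_module free_on_module mat_vec_hom[OF B1] mat_vec_hom[OF B2] \<phi>(1)]
    obtain \<gamma> where \<gamma>: "\<gamma> \<in> matrices R n" "\<And>x. x \<in> vectors R n \<Longrightarrow> \<phi> x = mat_vec R n \<gamma> x"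
      using matrix_of_hom[OF hom(1)] by blast
    have "redm n \<gamma> = \<one>\<^bsub>mat_ring K n\<^esub>"
    proof (rule redm_eqI[OF \<gamma>(1) K.matrix_one_closed])
      fix x assume x: "x \<in> vectors R n"
      show "redv {..<n} (mat_vec R n \<gamma> x) = mat_vec K n \<one>\<^bsub>mat_ring K n\<^esub> (redv {..<n} x)"
        unfolding \<gamma>(2)[OF x, symmetric] K.mat_vec_one[OF redv_closed[OF x]]
        by (rule \<phi>(2)) (unfold free_on_simps(1), rule x)
    qed
    moreover have "\<gamma> \<otimes>\<^bsub>mat_ring R n\<^esub> B = B' \<otimes>\<^bsub>mat_ring R n\<^esub> \<gamma>"
    proof (rule matrix_eqI[OF matrix_mult_closed[OF \<gamma>(1) B1] matrix_mult_closed[OF B2 \<gamma>(1)]])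
      fix x assume x: "x \<in> vectors R n"
      show "mat_vec R n (\<gamma> \<otimes>\<^bsub>mat_ring R n\<^esub> B) x = mat_vec R n (B' \<otimes>\<^bsub>mat_ring R n\<^esub> \<gamma>) x"
        unfolding mat_vec_mult[OF \<gamma>(1) B1 x] mat_vec_mult[OF B2 \<gamma>(1) x] \<gamma>(2)[OF x, symmetric] \<gamma>(2)[OF mat_vec_closed[OF B1 x], symmetric]
        by (rule hom(2)) (unfold free_on_simps(1), rule x)
    qed
    ultimately show "\<exists>\<gamma>\<in>matrices R n. redm n \<gamma> = \<one>\<^bsub>mat_ring K n\<^esub> \<and> \<gamma> \<otimes>\<^bsub>mat_ring R n\<^esub> B = B' \<otimes>\<^bsub>mat_ring R n\<^esub> \<gamma>"
      using \<gamma>(1) by blast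
  next
    assume "\<exists>\<gamma>\<in>matrices R n. redm n \<gamma> = \<one>\<^bsub>mat_ring K n\<^esub> \<and> \<gamma> \<otimes>\<^bsub>mat_ring R n\<^esub> B = B' \<otimes>\<^bsub>mat_ring R n\<^esub> \<gamma>"
    then obtain \<gamma> where \<gamma>: "\<gamma> \<in> matrices R n" "redm n \<gamma> = \<one>\<^bsub>mat_ring K n\<^esub>" "\<gamma> \<otimes>\<^bsub>mat_ring R n\<^esub> B = B' \<otimes>\<^bsub>mat_ring R n\<^esub> \<gamma>" by blast
    have one: "mat_vec K n \<one>\<^bsub>mat_ring K n\<^esub> v = v" if "v \<in> carrier VK" for v
      using that unfolding free_on_simps(1) by (rule K.mat_vec_one)
    show "ext_morphism (UP R) NP id id (lifted_extension B) (lifted_extension B')"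
    proof (rule ext_morphism_cong[OF L lifted_morphism[OF B \<gamma>(1,3)]]; unfold \<gamma>(2) MA_simps MA_tensor_P_simps)
      show "tensor_one (mat_vec K n \<one>\<^bsub>mat_ring K n\<^esub>) z = id z" if "z \<in> carrier TP" for z
        unfolding id_apply[of z] by (rule tensor_one_ident[OF K.mat_vec_hom[OF K.matrix_one_closed] one that])
    qed (simp only: one id_apply)
  qed
  finally show ?thesis .
qed

lemma fibre_action_lifted_class:
  assumes B: "B \<in> lifts" "B' \<in> lifts" and \<gamma>: "\<gamma> \<in> matrices R n"
    and comm: "\<gamma> \<otimes>\<^bsub>mat_ring R n\<^esub> B = B' \<otimes>\<^bsub>mat_ring R n\<^esub> \<gamma>"
    and bij: "bij_betw (mat_vec K n (redm n \<gamma>)) (carrier VK) (carrier VK)"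
  shows "fibre_action R P n A (redm n \<gamma>) (lifted_class B) = lifted_class B'"
  unfolding fibre_action_def lifted_class_def free_module_eq
proof (rule ext_transport_class[OF MA_module MA_tensor_P_module lifted_extension_is_extension[OF B(1)]
      lifted_extension_is_extension[OF B(2)] _ _ lifted_morphism[OF B \<gamma> comm]]; unfold MA_simps MA_tensor_P_simps)
  show "tensor_one (mat_vec K n (redm n \<gamma>)) z \<in> carrier TP" if "z \<in> carrier TP" for z
    by (rule tensor_one_closed[OF K.mat_vec_hom[OF redv_closed[OF \<gamma>]] that])
qed (rule bij)

end

section \<open>Matrices with entries in the ideal\<close>

text \<open>From here on matrices are elements of a ring; their operations are unfolded to entries only on request.\<close>

declare free_on_simps [simp del] mat_ring_simps [simp del]

context cring begin

abbreviation "mat_smult n a C \<equiv> a \<odot>\<^bsub>free_on R ({..<n} \<times> {..<n})\<^esub> C"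

lemma mat_ring_free_on:
  "carrier (mat_ring R n) = carrier (free_on R ({..<n} \<times> {..<n}))"
  "x \<oplus>\<^bsub>mat_ring R n\<^esub> y = x \<oplus>\<^bsub>free_on R ({..<n} \<times> {..<n})\<^esub> y"
  "\<zero>\<^bsub>mat_ring R n\<^esub> = \<zero>\<^bsub>free_on R ({..<n} \<times> {..<n})\<^esub>"
  by (simp_all add: mat_ring_simps free_on_simps)

lemma mat_smult_rules:
  assumes a: "a \<in> carrier R" and C: "C \<in> carrier (mat_ring R n)"
  shows "mat_smult n a C \<in> carrier (mat_ring R n)"
    and "b \<in> carrier R \<Longrightarrow> mat_smult n (a \<oplus> b) C = mat_smult n a C \<oplus>\<^bsub>mat_ring R n\<^esub> mat_smult n b C"
    and "b \<in> carrier R \<Longrightarrow> mat_smult n (a \<otimes> b) C = mat_smult n a (mat_smult n b C)"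
    and "D \<in> carrier (mat_ring R n) \<Longrightarrow>
      mat_smult n a (C \<oplus>\<^bsub>mat_ring R n\<^esub> D) = mat_smult n a C \<oplus>\<^bsub>mat_ring R n\<^esub> mat_smult n a D"
proof -
  interpret U: module R "free_on R ({..<n} \<times> {..<n})" by (rule free_on_module)
  show "mat_smult n a C \<in> carrier (mat_ring R n)"
    "b \<in> carrier R \<Longrightarrow> mat_smult n (a \<oplus> b) C = mat_smult n a C \<oplus>\<^bsub>mat_ring R n\<^esub> mat_smult n b C"
    "b \<in> carrier R \<Longrightarrow> mat_smult n (a \<otimes> b) C = mat_smult n a (mat_smult n b C)"
    "D \<in> carrier (mat_ring R n) \<Longrightarrow>
      mat_smult n a (C \<oplus>\<^bsub>mat_ring R n\<^esub> D) = mat_smult n a C \<oplus>\<^bsub>mat_ring R n\<^esub> mat_smult n a D"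
    using a C unfolding mat_ring_free_on
    by (simp_all only: U.smult_closed U.smult_l_distr U.smult_assoc1 U.smult_r_distr)
qed

lemma mat_smult_mult:
  assumes a: "a \<in> carrier R" and C: "C \<in> carrier (mat_ring R n)" and B: "B \<in> carrier (mat_ring R n)"
  shows "mat_smult n a C \<otimes>\<^bsub>mat_ring R n\<^esub> B = mat_smult n a (C \<otimes>\<^bsub>mat_ring R n\<^esub> B)"
    and "B \<otimes>\<^bsub>mat_ring R n\<^esub> mat_smult n a C = mat_smult n a (B \<otimes>\<^bsub>mat_ring R n\<^esub> C)"
proof -
  note C' = C[unfolded mat_ring_simps(1)] and B' = B[unfolded mat_ring_simps(1)]
  note aC = mat_smult_rules(1)[OF a C, unfolded mat_ring_simps(1)]
  note CB = matrix_mult_closed[OF C' B'] and BC = matrix_mult_closed[OF B' C']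
  note aCB = mat_smult_rules(1)[OF a CB[folded mat_ring_simps(1)], unfolded mat_ring_simps(1)]
    and aBC = mat_smult_rules(1)[OF a BC[folded mat_ring_simps(1)], unfolded mat_ring_simps(1)]
  show "mat_smult n a C \<otimes>\<^bsub>mat_ring R n\<^esub> B = mat_smult n a (C \<otimes>\<^bsub>mat_ring R n\<^esub> B)"
  proof (rule matrix_eqI[OF matrix_mult_closed[OF aC B'] aCB])
    fix v assume v: "v \<in> vectors R n"
    show "mat_vec R n (mat_smult n a C \<otimes>\<^bsub>mat_ring R n\<^esub> B) v = mat_vec R n (mat_smult n a (C \<otimes>\<^bsub>mat_ring R n\<^esub> B)) v"
      unfolding mat_vec_mult[OF aC B' v] mat_vec_smult[OF CB a v] mat_vec_smult[OF C' a mat_vec_closed[OF B' v]] mat_vec_mult[OF C' B' v] ..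
  qed
  show "B \<otimes>\<^bsub>mat_ring R n\<^esub> mat_smult n a C = mat_smult n a (B \<otimes>\<^bsub>mat_ring R n\<^esub> C)"
  proof (rule matrix_eqI[OF matrix_mult_closed[OF B' aC] aBC])
    fix v assume v: "v \<in> vectors R n"
    show "mat_vec R n (B \<otimes>\<^bsub>mat_ring R n\<^esub> mat_smult n a C) v = mat_vec R n (mat_smult n a (B \<otimes>\<^bsub>mat_ring R n\<^esub> C)) v"
      unfolding mat_vec_mult[OF B' aC v] mat_vec_smult[OF BC a v] mat_vec_smult[OF C' a v] mat_vec_mult[OF B' C' v]
      by (rule mod_hom_smult[OF mat_vec_hom[OF B'] a]) (unfold free_on_simps(1), rule mat_vec_closed[OF C' v])
  qed
qed

end

context residue_matrix begin

abbreviation "MR \<equiv> mat_ring R n"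
abbreviation "MK \<equiv> mat_ring K n"
abbreviation "PM \<equiv> {..<n} \<times> {..<n} \<rightarrow>\<^sub>E P"

lemma redm_ring_hom: "redm n \<in> ring_hom MR MK"
proof (rule ring_hom_memI)
  note h = redv_hom[of "{..<n} \<times> {..<n}"]
  show "redm n B \<in> carrier MK" if "B \<in> carrier MR" for B
    using that unfolding mat_ring_simps(1) by (rule redv_closed)
  show "redm n (B \<oplus>\<^bsub>MR\<^esub> C) = redm n B \<oplus>\<^bsub>MK\<^esub> redm n C" if "B \<in> carrier MR" "C \<in> carrier MR" for B C
    using mod_hom_add[OF h that[unfolded mat_ring_free_on]] unfolding mat_ring_free_on K.mat_ring_free_on restrict_scalars_simps .
  show "redm n (B \<otimes>\<^bsub>MR\<^esub> C) = redm n B \<otimes>\<^bsub>MK\<^esub> redm n C" if BC: "B \<in> carrier MR" "C \<in> carrier MR" for B C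
  proof -
    note BC = BC[unfolded mat_ring_simps(1)]
    note rBC = redv_closed[OF BC(1)] redv_closed[OF BC(2)]
    show ?thesis
    proof (rule redm_eqI[OF matrix_mult_closed[OF BC] K.matrix_mult_closed[OF rBC]])
      fix x assume x: "x \<in> vectors R n"
      show "redv {..<n} (mat_vec R n (B \<otimes>\<^bsub>MR\<^esub> C) x) = mat_vec K n (redm n B \<otimes>\<^bsub>MK\<^esub> redm n C) (redv {..<n} x)"
        unfolding mat_vec_mult[OF BC x] redv_mat_vec[OF BC(1) mat_vec_closed[OF BC(2) x]] redv_mat_vec[OF BC(2) x]
          K.mat_vec_mult[OF rBC redv_closed[OF x]] ..
    qed
  qed
  show "redm n \<one>\<^bsub>MR\<^esub> = \<one>\<^bsub>MK\<^esub>"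
    by (rule redm_eqI[OF matrix_one_closed K.matrix_one_closed]) (simp only: mat_vec_one K.mat_vec_one redv_closed)
qed

sublocale MR: ring "mat_ring R n" by (rule mat_ring_ring)
sublocale MK: ring "mat_ring (R Quot P) n" by (rule K.mat_ring_ring)
sublocale redm: ring_hom_ring "mat_ring R n" "mat_ring (R Quot P) n" "redm n"
  by (rule ring_hom_ringI2[OF MR.ring_axioms MK.ring_axioms redm_ring_hom])

lemma redm_smult:
  assumes "r \<in> carrier R" "C \<in> carrier MR"
  shows "redm n (mat_smult n r C) = K.mat_smult n (res r) (redm n C)"
  using mod_hom_smult[OF redv_hom assms(1), of C "{..<n} \<times> {..<n}"] assms(2) unfolding mat_ring_free_on restrict_scalars_simps by simp

lemma redm_surj: "c \<in> carrier MK \<Longrightarrow> \<exists>C\<in>carrier MR. redm n C = c"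
  unfolding mat_ring_simps(1) by (rule redv_surj)

lemma PM_iff: "Y \<in> carrier MR \<Longrightarrow> Y \<in> PM \<longleftrightarrow> redm n Y = \<zero>\<^bsub>MK\<^esub>"
  unfolding K.mat_ring_free_on mat_ring_simps(1) by (rule redv_kernel[symmetric])

lemma PM_carrier: "Y \<in> PM \<Longrightarrow> Y \<in> carrier MR"
  unfolding mat_ring_simps(1) using PiE_mono[of "{..<n} \<times> {..<n}" "\<lambda>_. P" "\<lambda>_. carrier R"] P_carrier by blast

lemma PM_redm: "Y \<in> PM \<Longrightarrow> redm n Y = \<zero>\<^bsub>MK\<^esub>"
  using PM_iff[OF PM_carrier] by blast

lemma PM_closed:
  "\<zero>\<^bsub>MR\<^esub> \<in> PM" "Y \<in> PM \<Longrightarrow> Z \<in> PM \<Longrightarrow> Y \<oplus>\<^bsub>MR\<^esub> Z \<in> PM" "Y \<in> PM \<Longrightarrow> \<ominus>\<^bsub>MR\<^esub> Y \<in> PM"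
  "Y \<in> PM \<Longrightarrow> Z \<in> PM \<Longrightarrow> Y \<ominus>\<^bsub>MR\<^esub> Z \<in> PM"
  "B \<in> carrier MR \<Longrightarrow> Y \<in> PM \<Longrightarrow> B \<otimes>\<^bsub>MR\<^esub> Y \<in> PM" "Y \<in> PM \<Longrightarrow> B \<in> carrier MR \<Longrightarrow> Y \<otimes>\<^bsub>MR\<^esub> B \<in> PM"
proof -
  have PMI: "Z \<in> PM" if "Z \<in> carrier MR" "redm n Z = \<zero>\<^bsub>MK\<^esub>" for Z using PM_iff that by blast
  show "\<zero>\<^bsub>MR\<^esub> \<in> PM" by (rule PMI) simp_all
  show "\<ominus>\<^bsub>MR\<^esub> Y \<in> PM" if "Y \<in> PM" using PM_carrier[OF that] PM_redm[OF that] by (intro PMI) simp_all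
  show "Y \<oplus>\<^bsub>MR\<^esub> Z \<in> PM" "Y \<ominus>\<^bsub>MR\<^esub> Z \<in> PM" if "Y \<in> PM" "Z \<in> PM"
    using that[THEN PM_carrier] that[THEN PM_redm] unfolding a_minus_def by (intro PMI; simp)+
  show "B \<otimes>\<^bsub>MR\<^esub> Y \<in> PM" "Y \<otimes>\<^bsub>MR\<^esub> B \<in> PM" if "B \<in> carrier MR" "Y \<in> PM"
    using that(1) PM_carrier[OF that(2)] PM_redm[OF that(2)] by (intro PMI; simp)+
qed

lemma PM_mult:
  assumes Y: "Y \<in> PM" and Z: "Z \<in> PM"
  shows "Y \<otimes>\<^bsub>MR\<^esub> Z = \<zero>\<^bsub>MR\<^esub>"
proof -
  have "Y \<otimes>\<^bsub>MR\<^esub> Z = (\<lambda>(i, j)\<in>{..<n} \<times> {..<n}. \<Oplus>l\<in>{..<n}. Y (i, l) \<otimes> Z (l, j))"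
    by (simp add: mat_ring_def matrix_monoid_def)
  also have "\<dots> = (\<lambda>u\<in>{..<n} \<times> {..<n}. \<zero>)"
  proof (rule restrict_ext)
    fix u assume "u \<in> {..<n} \<times> {..<n}"
    then obtain i j where u: "u = (i, j)" "i < n" "j < n" by blast
    have "(\<Oplus>l\<in>{..<n}. Y (i, l) \<otimes> Z (l, j)) = (\<Oplus>l\<in>{..<n}. \<zero>)"
      using u PiE_app[OF Y] PiE_app[OF Z] by (intro finsum_cong') (simp_all add: P_mult)
    then show "(case u of (i, j) \<Rightarrow> \<Oplus>l\<in>{..<n}. Y (i, l) \<otimes> Z (l, j)) = \<zero>" by (simp add: u(1))
  qed
  finally show ?thesis by (simp only: mat_ring_simps)
qed

lemma PM_smult: "p \<in> P \<Longrightarrow> C \<in> carrier MR \<Longrightarrow> mat_smult n p C \<in> PM"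
proof -
  assume p: "p \<in> P" and C: "C \<in> carrier MR"
  have C': "C u \<in> carrier R" if "u \<in> {..<n} \<times> {..<n}" for u using PiE_app[OF C[unfolded mat_ring_simps(1)] that] .
  show "mat_smult n p C \<in> PM"
    unfolding free_on_simps restrict_PiE_iff by (rule ballI, rule P_closed(5)[OF C' p])
qed

lemma smult_cong_redm:
  assumes p: "p \<in> P" and C: "C \<in> carrier MR" "D \<in> carrier MR" and eq: "redm n C = redm n D"
  shows "mat_smult n p C = mat_smult n p D"
  unfolding free_on_simps
proof (rule restrict_ext)
  fix u assume u: "u \<in> {..<n} \<times> {..<n}"
  have c: "C u \<in> carrier R" "D u \<in> carrier R"
    by (rule PiE_app[OF C(1)[unfolded mat_ring_simps(1)] u], rule PiE_app[OF C(2)[unfolded mat_ring_simps(1)] u])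
  have "res (C u) = res (D u)" using fun_cong[OF eq, of u] u by (simp add: redv_def)
  then show "p \<otimes> C u = p \<otimes> D u"
    using P_space_smult[OF c(1) p] P_space_smult[OF c(2) p] m_comm[OF c(1) P_carrier[OF p]] m_comm[OF c(2) P_carrier[OF p]] by simp
qed

text \<open>The matrices \<open>pC\<close> generate, as \<open>H\<close> is the sum of its entries times elementary matrices.\<close>

lemma PM_induct [consumes 1, case_names zero smult add]:
  assumes H: "H \<in> PM" and zero: "Q \<zero>\<^bsub>MR\<^esub>"
    and smult: "\<And>p C. p \<in> P \<Longrightarrow> C \<in> carrier MR \<Longrightarrow> Q (mat_smult n p C)"
    and add: "\<And>Y Z. Y \<in> PM \<Longrightarrow> Z \<in> PM \<Longrightarrow> Q Y \<Longrightarrow> Q Z \<Longrightarrow> Q (Y \<oplus>\<^bsub>MR\<^esub> Z)"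
  shows "Q H"
proof -
  let ?I = "{..<n} \<times> {..<n}"
  interpret U: module R "free_on R ?I" by (rule free_on_module)
  let ?s = "\<lambda>u. mat_smult n (H u) (unit_vec R ?I u)"
  have e: "unit_vec R ?I u \<in> carrier MR" for u unfolding mat_ring_simps(1) by (rule unit_vec_closed)
  note Hu = PiE_app[OF H]
  have *: "finsum (free_on R ?I) ?s S \<in> PM \<and> Q (finsum (free_on R ?I) ?s S)" if "finite S" "S \<subseteq> ?I" for S
    using that
  proof (induction S rule: finite_induct)
    case empty
    show ?case unfolding U.M.finsum_empty mat_ring_free_on(3)[symmetric] using PM_closed(1) zero by (rule conjI)
  next
    case (insert u S)
    have s: "?s v \<in> PM" if "v \<in> ?I" for v by (rule PM_smult[OF Hu[OF that] e])
    have sM: "?s v \<in> carrier (free_on R ?I)" if "v \<in> ?I" for v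
      using PM_carrier[OF s[OF that]] unfolding mat_ring_free_on(1) .
    have sc: "?s \<in> S \<rightarrow> carrier (free_on R ?I)" "?s u \<in> carrier (free_on R ?I)"
      by (rule Pi_I, rule sM[OF subsetD[OF insert.prems]], erule insertI2) (rule sM[OF subsetD[OF insert.prems insertI1]])
    have u: "u \<in> ?I" using insert.prems by blast
    have IH: "finsum (free_on R ?I) ?s S \<in> PM" "Q (finsum (free_on R ?I) ?s S)" using insert by blast+
    show ?case
      unfolding U.M.finsum_insert[OF insert.hyps sc] mat_ring_free_on(2)[symmetric]
      by (rule conjI[OF PM_closed(2)[OF s[OF u] IH(1)] add[OF s[OF u] IH(1) smult[OF Hu[OF u] e] IH(2)]])
  qed
  have "H \<in> ?I \<rightarrow>\<^sub>E carrier R" using PM_carrier[OF H] unfolding mat_ring_simps(1) .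
  from lincomb_unit_vecs[OF _ this] have "finsum (free_on R ?I) ?s ?I = H" unfolding lincomb_def by simp
  with *[of ?I] show ?thesis by simp
qed

text \<open>A matrix congruent to \<open>1\<close> modulo \<open>P\<close> has the form \<open>1 - Y\<close> with inverse \<open>1 + Y\<close>. Applied to the products of \<open>\<gamma>\<close> with
a lift of \<open>h\<close>, this gives one-sided inverses on either side.\<close>

lemma invertible_lift:
  assumes \<gamma>: "\<gamma> \<in> carrier MR" and h: "h \<in> carrier MK" "redm n \<gamma> \<otimes>\<^bsub>MK\<^esub> h = \<one>\<^bsub>MK\<^esub>" "h \<otimes>\<^bsub>MK\<^esub> redm n \<gamma> = \<one>\<^bsub>MK\<^esub>"
  shows "\<exists>\<delta>\<in>carrier MR. \<gamma> \<otimes>\<^bsub>MR\<^esub> \<delta> = \<one>\<^bsub>MR\<^esub> \<and> \<delta> \<otimes>\<^bsub>MR\<^esub> \<gamma> = \<one>\<^bsub>MR\<^esub>"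
proof -
  have unit: "C \<otimes>\<^bsub>MR\<^esub> (\<one>\<^bsub>MR\<^esub> \<oplus>\<^bsub>MR\<^esub> (\<one>\<^bsub>MR\<^esub> \<ominus>\<^bsub>MR\<^esub> C)) = \<one>\<^bsub>MR\<^esub>" "(\<one>\<^bsub>MR\<^esub> \<oplus>\<^bsub>MR\<^esub> (\<one>\<^bsub>MR\<^esub> \<ominus>\<^bsub>MR\<^esub> C)) \<otimes>\<^bsub>MR\<^esub> C = \<one>\<^bsub>MR\<^esub>"
    if C: "C \<in> carrier MR" "redm n C = \<one>\<^bsub>MK\<^esub>" for C
  proof -
    define Y where "Y = \<one>\<^bsub>MR\<^esub> \<ominus>\<^bsub>MR\<^esub> C"
    have Yc: "Y \<in> carrier MR" unfolding Y_def using C by simp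
    have Y: "Y \<in> PM" using PM_iff[OF Yc] C unfolding Y_def by (simp add: a_minus_def MK.r_neg)
    have CY: "C = \<one>\<^bsub>MR\<^esub> \<ominus>\<^bsub>MR\<^esub> Y" unfolding Y_def a_minus_def using C by (simp add: MR.minus_add MR.a_ac MR.r_neg2 MR.r_neg)
    show "C \<otimes>\<^bsub>MR\<^esub> (\<one>\<^bsub>MR\<^esub> \<oplus>\<^bsub>MR\<^esub> (\<one>\<^bsub>MR\<^esub> \<ominus>\<^bsub>MR\<^esub> C)) = \<one>\<^bsub>MR\<^esub>"
      "(\<one>\<^bsub>MR\<^esub> \<oplus>\<^bsub>MR\<^esub> (\<one>\<^bsub>MR\<^esub> \<ominus>\<^bsub>MR\<^esub> C)) \<otimes>\<^bsub>MR\<^esub> C = \<one>\<^bsub>MR\<^esub>"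
      unfolding Y_def[symmetric] unfolding CY a_minus_def using Yc
      by (simp_all add: MR.l_distr MR.r_distr MR.l_minus MR.r_minus PM_mult[OF Y Y] MR.a_assoc MR.l_neg MR.r_neg)
  qed
  obtain \<gamma>' where \<gamma>': "\<gamma>' \<in> carrier MR" "redm n \<gamma>' = h" using redm_surj[OF h(1)] by blast
  have c: "\<gamma> \<otimes>\<^bsub>MR\<^esub> \<gamma>' \<in> carrier MR" "\<gamma>' \<otimes>\<^bsub>MR\<^esub> \<gamma> \<in> carrier MR" using \<gamma> \<gamma>' by simp_all
  obtain x where x: "x \<in> carrier MR" "(\<gamma> \<otimes>\<^bsub>MR\<^esub> \<gamma>') \<otimes>\<^bsub>MR\<^esub> x = \<one>\<^bsub>MR\<^esub>"
    using unit(1)[OF c(1)] c \<gamma> \<gamma>' h by (metis MR.add.m_closed MR.minus_closed MR.one_closed redm.hom_mult)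
  obtain y where y: "y \<in> carrier MR" "y \<otimes>\<^bsub>MR\<^esub> (\<gamma>' \<otimes>\<^bsub>MR\<^esub> \<gamma>) = \<one>\<^bsub>MR\<^esub>"
    using unit(2)[OF c(2)] c \<gamma> \<gamma>' h by (metis MR.add.m_closed MR.minus_closed MR.one_closed redm.hom_mult)
  have r: "\<gamma> \<otimes>\<^bsub>MR\<^esub> (\<gamma>' \<otimes>\<^bsub>MR\<^esub> x) = \<one>\<^bsub>MR\<^esub>" using x \<gamma> \<gamma>' by (simp add: MR.m_assoc)
  have l: "(y \<otimes>\<^bsub>MR\<^esub> \<gamma>') \<otimes>\<^bsub>MR\<^esub> \<gamma> = \<one>\<^bsub>MR\<^esub>" using y \<gamma> \<gamma>' by (simp add: MR.m_assoc)
  have "y \<otimes>\<^bsub>MR\<^esub> \<gamma>' = \<gamma>' \<otimes>\<^bsub>MR\<^esub> x" using MR.inv_unique[OF l r] x y \<gamma> \<gamma>' by simp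
  then show ?thesis using r l x \<gamma>' by (intro bexI[of _ "\<gamma>' \<otimes>\<^bsub>MR\<^esub> x"]) simp_all
qed

lemma lifts_diff: "B \<in> lifts \<Longrightarrow> B' \<in> lifts \<Longrightarrow> B' \<ominus>\<^bsub>MR\<^esub> B \<in> PM"
proof -
  assume "B \<in> lifts" "B' \<in> lifts"
  then have B: "B \<in> carrier MR" "redm n B = A" "B' \<in> carrier MR" "redm n B' = A" by (simp_all add: mat_ring_simps)
  have "A \<in> carrier MK" using A by (simp add: mat_ring_simps)
  then show ?thesis using PM_iff[of "B' \<ominus>\<^bsub>MR\<^esub> B"] B by (simp add: a_minus_def MK.r_neg)
qed

definition inner_derivation :: "(nat \<times> nat \<Rightarrow> 'a) \<Rightarrow> (nat \<times> nat \<Rightarrow> 'a) \<Rightarrow> nat \<times> nat \<Rightarrow> 'a" where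
  "inner_derivation B Y = Y \<otimes>\<^bsub>MR\<^esub> B \<ominus>\<^bsub>MR\<^esub> B \<otimes>\<^bsub>MR\<^esub> Y"

text \<open>An isomorphism \<open>1 + Y\<close> of lifted extensions changes the lift by the commutator of \<open>Y\<close> with \<open>B\<^sub>0\<close>. The choice of
\<open>B\<^sub>0\<close> does not affect this commutator, because two lifts differ by a matrix over \<open>P\<close>.\<close>

lemma lifted_class_eq_iff_commutator:
  assumes B: "B \<in> lifts" "B' \<in> lifts" and B0: "B0 \<in> lifts"
  shows "lifted_class B = lifted_class B' \<longleftrightarrow> (\<exists>Y\<in>PM. B' \<ominus>\<^bsub>MR\<^esub> B = inner_derivation B0 Y)"
proof -
  have c: "B \<in> carrier MR" "B' \<in> carrier MR" "B0 \<in> carrier MR" using B B0 by (simp_all add: mat_ring_simps)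
  \<comment> \<open>The differences \<open>B - B0\<close> and \<open>B' - B0\<close> are over \<open>P\<close>, so they are annihilated by \<open>Y\<close>.\<close>
  have YB: "Y \<otimes>\<^bsub>MR\<^esub> B = Y \<otimes>\<^bsub>MR\<^esub> B0" and BY: "B' \<otimes>\<^bsub>MR\<^esub> Y = B0 \<otimes>\<^bsub>MR\<^esub> Y" if Y: "Y \<in> PM" for Y
  proof -
    note Yc = PM_carrier[OF Y]
    have "Y \<otimes>\<^bsub>MR\<^esub> (B \<ominus>\<^bsub>MR\<^esub> B0) = \<zero>\<^bsub>MR\<^esub>" "(B' \<ominus>\<^bsub>MR\<^esub> B0) \<otimes>\<^bsub>MR\<^esub> Y = \<zero>\<^bsub>MR\<^esub>"
      using PM_mult[OF Y lifts_diff[OF B0 B(1)]] PM_mult[OF lifts_diff[OF B0 B(2)] Y] .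
    then show "Y \<otimes>\<^bsub>MR\<^esub> B = Y \<otimes>\<^bsub>MR\<^esub> B0" "B' \<otimes>\<^bsub>MR\<^esub> Y = B0 \<otimes>\<^bsub>MR\<^esub> Y"
      using Yc c by (simp_all add: a_minus_def MR.r_distr MR.l_distr MR.r_minus MR.l_minus)
        (metis MR.add.inv_closed MR.add.m_closed MR.m_closed MR.minus_equality MR.minus_minus)+
  qed
  have key: "(\<one>\<^bsub>MR\<^esub> \<oplus>\<^bsub>MR\<^esub> Y) \<otimes>\<^bsub>MR\<^esub> B = B' \<otimes>\<^bsub>MR\<^esub> (\<one>\<^bsub>MR\<^esub> \<oplus>\<^bsub>MR\<^esub> Y) \<longleftrightarrow> B' \<ominus>\<^bsub>MR\<^esub> B = inner_derivation B0 Y"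
    if Y: "Y \<in> PM" for Y
  proof -
    note Yc = PM_carrier[OF Y]
    have cancel: "B \<oplus>\<^bsub>MR\<^esub> u = B' \<oplus>\<^bsub>MR\<^esub> v \<longleftrightarrow> B' \<ominus>\<^bsub>MR\<^esub> B = u \<ominus>\<^bsub>MR\<^esub> v" if uv: "u \<in> carrier MR" "v \<in> carrier MR" for u v
    proof
      assume eq: "B \<oplus>\<^bsub>MR\<^esub> u = B' \<oplus>\<^bsub>MR\<^esub> v"
      have "u = \<ominus>\<^bsub>MR\<^esub> B \<oplus>\<^bsub>MR\<^esub> (B \<oplus>\<^bsub>MR\<^esub> u)" using c uv by (simp add: MR.r_neg1)
      then show "B' \<ominus>\<^bsub>MR\<^esub> B = u \<ominus>\<^bsub>MR\<^esub> v" unfolding eq a_minus_def using c uv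
        by (simp add: MR.a_assoc MR.r_neg MR.a_comm[of B' "\<ominus>\<^bsub>MR\<^esub> B"])
    next
      assume eq: "B' \<ominus>\<^bsub>MR\<^esub> B = u \<ominus>\<^bsub>MR\<^esub> v"
      have "B' = B \<oplus>\<^bsub>MR\<^esub> (B' \<ominus>\<^bsub>MR\<^esub> B)" unfolding a_minus_def using c
        by (simp add: MR.a_lcomm[of B B' "\<ominus>\<^bsub>MR\<^esub> B"] MR.r_neg)
      then have "B' \<oplus>\<^bsub>MR\<^esub> v = B \<oplus>\<^bsub>MR\<^esub> (u \<ominus>\<^bsub>MR\<^esub> v) \<oplus>\<^bsub>MR\<^esub> v" unfolding eq by simp
      also have "\<dots> = B \<oplus>\<^bsub>MR\<^esub> u" unfolding a_minus_def using c uv by (simp add: MR.a_assoc MR.l_neg)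
      finally show "B \<oplus>\<^bsub>MR\<^esub> u = B' \<oplus>\<^bsub>MR\<^esub> v" ..
    qed
    have "(\<one>\<^bsub>MR\<^esub> \<oplus>\<^bsub>MR\<^esub> Y) \<otimes>\<^bsub>MR\<^esub> B = B \<oplus>\<^bsub>MR\<^esub> Y \<otimes>\<^bsub>MR\<^esub> B0" "B' \<otimes>\<^bsub>MR\<^esub> (\<one>\<^bsub>MR\<^esub> \<oplus>\<^bsub>MR\<^esub> Y) = B' \<oplus>\<^bsub>MR\<^esub> B0 \<otimes>\<^bsub>MR\<^esub> Y"
      using c Yc by (simp_all add: MR.l_distr MR.r_distr YB[OF Y] BY[OF Y])
    then show ?thesis using cancel[of "Y \<otimes>\<^bsub>MR\<^esub> B0" "B0 \<otimes>\<^bsub>MR\<^esub> Y"] c Yc by (simp add: inner_derivation_def)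
  qed
  have "lifted_class B = lifted_class B' \<longleftrightarrow> (\<exists>Y\<in>PM. (\<one>\<^bsub>MR\<^esub> \<oplus>\<^bsub>MR\<^esub> Y) \<otimes>\<^bsub>MR\<^esub> B = B' \<otimes>\<^bsub>MR\<^esub> (\<one>\<^bsub>MR\<^esub> \<oplus>\<^bsub>MR\<^esub> Y))"
    unfolding lifted_class_eq_iff[OF B]
  proof
    assume "\<exists>\<gamma>\<in>matrices R n. redm n \<gamma> = \<one>\<^bsub>MK\<^esub> \<and> \<gamma> \<otimes>\<^bsub>MR\<^esub> B = B' \<otimes>\<^bsub>MR\<^esub> \<gamma>"
    then obtain \<gamma> where \<gamma>: "\<gamma> \<in> carrier MR" "redm n \<gamma> = \<one>\<^bsub>MK\<^esub>" "\<gamma> \<otimes>\<^bsub>MR\<^esub> B = B' \<otimes>\<^bsub>MR\<^esub> \<gamma>"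
      unfolding mat_ring_simps(1) by blast
    have "\<gamma> \<ominus>\<^bsub>MR\<^esub> \<one>\<^bsub>MR\<^esub> \<in> PM" using PM_iff[of "\<gamma> \<ominus>\<^bsub>MR\<^esub> \<one>\<^bsub>MR\<^esub>"] \<gamma> by (simp add: a_minus_def MK.r_neg)
    moreover have "\<one>\<^bsub>MR\<^esub> \<oplus>\<^bsub>MR\<^esub> (\<gamma> \<ominus>\<^bsub>MR\<^esub> \<one>\<^bsub>MR\<^esub>) = \<gamma>" unfolding a_minus_def using \<gamma>(1)
      by (simp add: MR.a_lcomm[of "\<one>\<^bsub>MR\<^esub>" \<gamma> "\<ominus>\<^bsub>MR\<^esub> \<one>\<^bsub>MR\<^esub>"] MR.r_neg)
    ultimately show "\<exists>Y\<in>PM. (\<one>\<^bsub>MR\<^esub> \<oplus>\<^bsub>MR\<^esub> Y) \<otimes>\<^bsub>MR\<^esub> B = B' \<otimes>\<^bsub>MR\<^esub> (\<one>\<^bsub>MR\<^esub> \<oplus>\<^bsub>MR\<^esub> Y)"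
      using \<gamma>(3) by (intro bexI[of _ "\<gamma> \<ominus>\<^bsub>MR\<^esub> \<one>\<^bsub>MR\<^esub>"]) (simp only:)
  next
    assume "\<exists>Y\<in>PM. (\<one>\<^bsub>MR\<^esub> \<oplus>\<^bsub>MR\<^esub> Y) \<otimes>\<^bsub>MR\<^esub> B = B' \<otimes>\<^bsub>MR\<^esub> (\<one>\<^bsub>MR\<^esub> \<oplus>\<^bsub>MR\<^esub> Y)"
    then obtain Y where Y: "Y \<in> PM" "(\<one>\<^bsub>MR\<^esub> \<oplus>\<^bsub>MR\<^esub> Y) \<otimes>\<^bsub>MR\<^esub> B = B' \<otimes>\<^bsub>MR\<^esub> (\<one>\<^bsub>MR\<^esub> \<oplus>\<^bsub>MR\<^esub> Y)" by blast
    have "redm n (\<one>\<^bsub>MR\<^esub> \<oplus>\<^bsub>MR\<^esub> Y) = \<one>\<^bsub>MK\<^esub>" using PM_carrier[OF Y(1)] PM_redm[OF Y(1)] by simp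
    moreover have "\<one>\<^bsub>MR\<^esub> \<oplus>\<^bsub>MR\<^esub> Y \<in> matrices R n" using PM_carrier[OF Y(1)] MR.a_closed[OF MR.one_closed] unfolding mat_ring_simps(1) by blast
    ultimately show "\<exists>\<gamma>\<in>matrices R n. redm n \<gamma> = \<one>\<^bsub>MK\<^esub> \<and> \<gamma> \<otimes>\<^bsub>MR\<^esub> B = B' \<otimes>\<^bsub>MR\<^esub> \<gamma>" using Y(2) by blast
  qed
  also have "\<dots> \<longleftrightarrow> (\<exists>Y\<in>PM. B' \<ominus>\<^bsub>MR\<^esub> B = inner_derivation B0 Y)" using key by blast
  finally show ?thesis .
qed

end

section \<open>The tensor product in terms of matrices\<close>

lemma matrix_monoid_mat_ring:
  "carrier (matrix_monoid K n) = carrier (mat_ring K n)"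
  "x \<otimes>\<^bsub>matrix_monoid K n\<^esub> y = x \<otimes>\<^bsub>mat_ring K n\<^esub> y"
  "\<one>\<^bsub>matrix_monoid K n\<^esub> = \<one>\<^bsub>mat_ring K n\<^esub>"
  by (simp_all add: mat_ring_def matrix_monoid_def)

context residue_matrix begin

abbreviation "ES \<equiv> Ext1_MA_space R P n A"
abbreviation "cls \<equiv> coupled_class K n A"
abbreviation "TE \<equiv> tensor_group K ES (ideal_space R P)"
abbreviation "tE \<equiv> tensor_elem K ES (ideal_space R P)"
abbreviation "entries \<equiv> {..<n} \<times> {..<n}"

lemma A_carrier: "A \<in> carrier MK" using A by (simp add: mat_ring_simps)

lemma lifts_carrier: "B \<in> lifts \<Longrightarrow> B \<in> carrier MR" by (simp add: mat_ring_simps)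

lemma ES_simps:
  "carrier ES = cls ` carrier MK"
  "c \<in> carrier MK \<Longrightarrow> c' \<in> carrier MK \<Longrightarrow> cls c \<oplus>\<^bsub>ES\<^esub> cls c' = cls (c \<oplus>\<^bsub>MK\<^esub> c')"
  "c \<in> carrier MK \<Longrightarrow> a \<in> carrier K \<Longrightarrow> a \<odot>\<^bsub>ES\<^esub> cls c = cls (K.mat_smult n a c)"
  using K.Ext1_matrix_module[OF A] K.baer_sum_coupled_class[OF A] K.smult_coupled_class[OF A]
  unfolding Ext1_MA_space_def restrict_scalars_simps
  by (simp_all add: Ext1_module_def mat_ring_simps(1))

lemma ES_cases:
  assumes "\<xi> \<in> carrier ES"
  obtains C where "C \<in> carrier MR" "\<xi> = cls (redm n C)"
  using assms redm_surj unfolding ES_simps(1) by blast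

sublocale ES: tensor_factors K ES "ideal_space R P"
proof
  show "x \<oplus>\<^bsub>ES\<^esub> y \<in> carrier ES" if "x \<in> carrier ES" "y \<in> carrier ES" for x y
    using that unfolding ES_simps(1) by (auto simp: ES_simps(2))
  show "a \<odot>\<^bsub>ES\<^esub> x \<in> carrier ES" if "a \<in> carrier K" "x \<in> carrier ES" for a x
    using that unfolding ES_simps(1) by (auto simp: ES_simps(3) K.mat_smult_rules(1))
qed (simp_all add: P_closed P_space_smult_closed)

lemma TE_comm_group: "comm_group TE" by (rule ES.tensor_comm_group)

lemma cls_closed: "c \<in> carrier MK \<Longrightarrow> cls c \<in> carrier ES" unfolding ES_simps(1) by (rule imageI)

lemma tE_closed: "c \<in> carrier MK \<Longrightarrow> p \<in> P \<Longrightarrow> tE (cls c) p \<in> carrier TE"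
  by (rule ES.tensor_elem_closed[OF cls_closed]) (simp_all only: P_space_simps)

lemma tE_add: "c \<in> carrier MK \<Longrightarrow> c' \<in> carrier MK \<Longrightarrow> p \<in> P \<Longrightarrow>
    tE (cls (c \<oplus>\<^bsub>MK\<^esub> c')) p = tE (cls c) p \<otimes>\<^bsub>TE\<^esub> tE (cls c') p"
  using ES.tensor_elem_add_left[OF cls_closed cls_closed, of c c' p] by (simp only: P_space_simps ES_simps(2))

lemma tE_add_right: "c \<in> carrier MK \<Longrightarrow> p \<in> P \<Longrightarrow> q \<in> P \<Longrightarrow>
    tE (cls c) (p \<oplus> q) = tE (cls c) p \<otimes>\<^bsub>TE\<^esub> tE (cls c) q"
  using ES.tensor_elem_add_right[OF cls_closed, of c p q] by (simp only: P_space_simps)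

lemma tE_smult: "c \<in> carrier MK \<Longrightarrow> a \<in> carrier K \<Longrightarrow> p \<in> P \<Longrightarrow>
    tE (cls (K.mat_smult n a c)) p = tE (cls c) (a \<odot>\<^bsub>ideal_space R P\<^esub> p)"
  using ES.tensor_elem_balanced[OF _ cls_closed, of a c p] by (simp only: P_space_simps ES_simps(3))

lemma tE_zero: "p \<in> P \<Longrightarrow> tE (cls \<zero>\<^bsub>MK\<^esub>) p = \<one>\<^bsub>TE\<^esub>"
proof -
  assume p: "p \<in> P"
  interpret TG: comm_group TE by (rule TE_comm_group)
  show ?thesis
    using tE_add[OF MK.zero_closed MK.zero_closed p] tE_closed[OF MK.zero_closed p] by (simp add: TG.l_cancel_one')
qed

text \<open>In coordinates, the additive map \<open>M\<^sub>n(P) \<rightarrow> Ext\<^sup>1 \<otimes> P\<close> with \<open>pC \<mapsto> [c] \<otimes> p\<close>, where \<open>c\<close> is the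
reduction of \<open>C\<close>; see \<open>matrix_tensor_smult\<close>.\<close>

definition matrix_tensor where
  "matrix_tensor H = finprod TE (\<lambda>u. tE (cls (unit_vec K entries u)) (H u)) entries"

lemma unit_mat_closed: "unit_vec K entries u \<in> carrier MK" unfolding mat_ring_simps(1) by (rule K.unit_vec_closed)

lemma matrix_tensor_closed: "H \<in> PM \<Longrightarrow> matrix_tensor H \<in> carrier TE"
proof -
  assume H: "H \<in> PM"
  interpret TG: comm_group TE by (rule TE_comm_group)
  show ?thesis
    unfolding matrix_tensor_def by (rule TG.finprod_closed, rule Pi_I, rule tE_closed[OF unit_mat_closed PiE_app[OF H]])
qed

lemma matrix_tensor_add:
  assumes H: "H \<in> PM" and H': "H' \<in> PM"
  shows "matrix_tensor (H \<oplus>\<^bsub>MR\<^esub> H') = matrix_tensor H \<otimes>\<^bsub>TE\<^esub> matrix_tensor H'"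
proof -
  interpret TG: comm_group TE by (rule TE_comm_group)
  let ?e = "\<lambda>u. cls (unit_vec K entries u)"
  note cH = tE_closed[OF unit_mat_closed PiE_app[OF H]] and cH' = tE_closed[OF unit_mat_closed PiE_app[OF H']]
  have "matrix_tensor (H \<oplus>\<^bsub>MR\<^esub> H') = finprod TE (\<lambda>u. tE (?e u) (H u) \<otimes>\<^bsub>TE\<^esub> tE (?e u) (H' u)) entries"
    unfolding matrix_tensor_def
  proof (rule TG.finprod_cong'[OF refl])
    show "(\<lambda>u. tE (?e u) (H u) \<otimes>\<^bsub>TE\<^esub> tE (?e u) (H' u)) \<in> entries \<rightarrow> carrier TE"
      by (rule Pi_I, rule TG.m_closed[OF cH cH'])
    show "tE (?e u) ((H \<oplus>\<^bsub>MR\<^esub> H') u) = tE (?e u) (H u) \<otimes>\<^bsub>TE\<^esub> tE (?e u) (H' u)" if u: "u \<in> entries" for u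
    proof -
      have "(H \<oplus>\<^bsub>MR\<^esub> H') u = H u \<oplus> H' u" unfolding mat_ring_simps using u by (rule restrict_apply')
      then show ?thesis using tE_add_right[OF unit_mat_closed PiE_app[OF H u] PiE_app[OF H' u]] by simp
    qed
  qed
  also have "\<dots> = matrix_tensor H \<otimes>\<^bsub>TE\<^esub> matrix_tensor H'"
    unfolding matrix_tensor_def by (rule TG.finprod_multf; rule Pi_I; rule cH cH'; assumption)
  finally show ?thesis .
qed

lemma matrix_tensor_smult:
  assumes p: "p \<in> P" and C: "C \<in> carrier MR"
  shows "matrix_tensor (mat_smult n p C) = tE (cls (redm n C)) p"
proof -
  interpret TG: comm_group TE by (rule TE_comm_group)
  interpret U: module K "free_on K entries" by (rule K.free_on_module)
  let ?e = "unit_vec K entries" and ?c = "redm n C"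
  have Cu: "C u \<in> carrier R" if "u \<in> entries" for u using PiE_app[OF C[unfolded mat_ring_simps(1)] that] .
  have cu: "?c u = res (C u)" if "u \<in> entries" for u unfolding redv_def using that by (rule restrict_apply')
  have h: "(\<lambda>c. tE (cls c) p) \<in> hom (add_monoid (free_on K entries)) TE"
    by (rule homI) (simp_all add: tE_closed tE_add p K.mat_ring_free_on[symmetric])
  have term_closed: "?c u \<odot>\<^bsub>free_on K entries\<^esub> ?e u \<in> carrier (free_on K entries)" if "u \<in> entries" for u
    unfolding cu[OF that]
    by (rule U.smult_closed[OF res_simps(1)[OF Cu[OF that]]]) (unfold K.mat_ring_free_on(1)[symmetric], rule unit_mat_closed)
  have "?c \<in> entries \<rightarrow>\<^sub>E carrier K" using redm.hom_closed[OF C] unfolding mat_ring_simps(1) .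
  from K.lincomb_unit_vecs[OF _ this]
  have "?c = finprod (add_monoid (free_on K entries)) (\<lambda>u. ?c u \<odot>\<^bsub>free_on K entries\<^esub> ?e u) entries"
    unfolding lincomb_def finsum_def by simp
  then have "tE (cls ?c) p = tE (cls (finprod (add_monoid (free_on K entries)) (\<lambda>u. ?c u \<odot>\<^bsub>free_on K entries\<^esub> ?e u) entries)) p"
    by (rule arg_cong)
  also have "\<dots> = finprod TE (\<lambda>u. tE (cls (?c u \<odot>\<^bsub>free_on K entries\<^esub> ?e u)) p) entries"
    by (rule hom_finprod_comm[OF U.M.a_comm_group TE_comm_group h])
      (rule Pi_I, simp only: partial_object.simps, rule term_closed)
  also have "\<dots> = matrix_tensor (mat_smult n p C)"
    unfolding matrix_tensor_def
  proof (rule TG.finprod_cong'[OF refl])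
    note pC = PiE_app[OF PM_smult[OF p C]]
    show "(\<lambda>u. tE (cls (?e u)) (mat_smult n p C u)) \<in> entries \<rightarrow> carrier TE"
      by (rule Pi_I, rule tE_closed[OF unit_mat_closed pC])
    show "tE (cls (?c u \<odot>\<^bsub>free_on K entries\<^esub> ?e u)) p = tE (cls (?e u)) (mat_smult n p C u)" if u: "u \<in> entries" for u
    proof -
      have "mat_smult n p C u = p \<otimes> C u" unfolding free_on_simps using u by (rule restrict_apply')
      also have "\<dots> = ?c u \<odot>\<^bsub>ideal_space R P\<^esub> p"
        unfolding cu[OF u] P_space_smult[OF Cu[OF u] p] by (rule m_comm[OF P_carrier[OF p] Cu[OF u]])
      finally show ?thesis using tE_smult[OF unit_mat_closed res_simps(1)[OF Cu[OF u]] p] cu[OF u] by simp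
    qed
  qed
  finally show ?thesis ..
qed

lemma matrix_tensor_zero: "matrix_tensor \<zero>\<^bsub>MR\<^esub> = \<one>\<^bsub>TE\<^esub>"
proof -
  interpret TG: comm_group TE by (rule TE_comm_group)
  show ?thesis
    using matrix_tensor_add[OF PM_closed(1) PM_closed(1)] matrix_tensor_closed[OF PM_closed(1)] by (simp add: TG.l_cancel_one')
qed

lemma matrix_tensor_diff:
  assumes H: "H \<in> PM" and H': "H' \<in> PM"
  shows "matrix_tensor (H \<ominus>\<^bsub>MR\<^esub> H') = matrix_tensor H \<otimes>\<^bsub>TE\<^esub> inv\<^bsub>TE\<^esub> matrix_tensor H'"
proof -
  interpret TG: comm_group TE by (rule TE_comm_group)
  note D = PM_closed(4)[OF H H']
  have "(H \<ominus>\<^bsub>MR\<^esub> H') \<oplus>\<^bsub>MR\<^esub> H' = H" unfolding a_minus_def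
    using PM_carrier[OF H] PM_carrier[OF H'] by (simp add: MR.a_assoc MR.l_neg)
  then have "matrix_tensor H = matrix_tensor (H \<ominus>\<^bsub>MR\<^esub> H') \<otimes>\<^bsub>TE\<^esub> matrix_tensor H'"
    using matrix_tensor_add[OF D H'] by simp
  then show ?thesis
    using TG.inv_solve_right[OF matrix_tensor_closed[OF D] matrix_tensor_closed[OF H] matrix_tensor_closed[OF H']] by simp
qed

lemma matrix_tensor_surj:
  assumes z: "z \<in> carrier TE"
  shows "\<exists>H\<in>PM. matrix_tensor H = z"
  using z
proof (induction z rule: ES.tensor_induct)
  case one
  show ?case using PM_closed(1) matrix_tensor_zero by (rule bexI[where x = "\<zero>\<^bsub>MR\<^esub>", rotated])
next
  case (elem \<xi> p)
  obtain C where C: "C \<in> carrier MR" "\<xi> = cls (redm n C)" using elem(1) by (rule ES_cases)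
  have p: "p \<in> P" using elem(2) by (simp only: P_space_simps)
  show ?case unfolding C(2) using PM_smult[OF p C(1)] matrix_tensor_smult[OF p C(1)]
    by (rule bexI[where x = "mat_smult n p C", rotated])
next
  case (diff z w)
  then obtain H H' where H: "H \<in> PM" "matrix_tensor H = z" "H' \<in> PM" "matrix_tensor H' = w" by blast
  show ?case using PM_closed(4)[OF H(1,3)] matrix_tensor_diff[OF H(1,3)] unfolding H(2,4)
    by (rule bexI[where x = "H \<ominus>\<^bsub>MR\<^esub> H'", rotated])
qed

lemma mat_smult_diff:
  assumes a: "a \<in> carrier R" and C: "C \<in> carrier MR" and D: "D \<in> carrier MR"
  shows "mat_smult n a (C \<ominus>\<^bsub>MR\<^esub> D) = mat_smult n a C \<ominus>\<^bsub>MR\<^esub> mat_smult n a D"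
proof -
  note cl = mat_smult_rules(1)[OF a]
  have "mat_smult n a (C \<ominus>\<^bsub>MR\<^esub> D) \<oplus>\<^bsub>MR\<^esub> mat_smult n a D = mat_smult n a ((C \<ominus>\<^bsub>MR\<^esub> D) \<oplus>\<^bsub>MR\<^esub> D)"
    using C D by (intro mat_smult_rules(4)[OF a, symmetric]) simp_all
  also have "(C \<ominus>\<^bsub>MR\<^esub> D) \<oplus>\<^bsub>MR\<^esub> D = C" unfolding a_minus_def using C D by (simp add: MR.a_assoc MR.l_neg)
  finally have "mat_smult n a C = mat_smult n a (C \<ominus>\<^bsub>MR\<^esub> D) \<oplus>\<^bsub>MR\<^esub> mat_smult n a D" ..
  then show ?thesis using cl[OF C] cl[OF D] cl[of "C \<ominus>\<^bsub>MR\<^esub> D"] C D by (simp add: a_minus_def MR.a_assoc MR.r_neg)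
qed

lemma inner_derivation_closed: "B \<in> carrier MR \<Longrightarrow> Y \<in> PM \<Longrightarrow> inner_derivation B Y \<in> PM"
  unfolding inner_derivation_def by (intro PM_closed(4) PM_closed(5) PM_closed(6))

lemma inner_derivation_add:
  "B \<in> carrier MR \<Longrightarrow> Y \<in> carrier MR \<Longrightarrow> Z \<in> carrier MR \<Longrightarrow>
    inner_derivation B (Y \<oplus>\<^bsub>MR\<^esub> Z) = inner_derivation B Y \<oplus>\<^bsub>MR\<^esub> inner_derivation B Z"
  unfolding inner_derivation_def a_minus_def by (simp add: MR.l_distr MR.r_distr MR.minus_add MR.a_ac)

lemma inner_derivation_zero: "B \<in> carrier MR \<Longrightarrow> inner_derivation B \<zero>\<^bsub>MR\<^esub> = \<zero>\<^bsub>MR\<^esub>"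
  unfolding inner_derivation_def by (simp add: a_minus_def)

lemma inner_derivation_minus:
  "B \<in> carrier MR \<Longrightarrow> Y \<in> carrier MR \<Longrightarrow> inner_derivation B (\<ominus>\<^bsub>MR\<^esub> Y) = \<ominus>\<^bsub>MR\<^esub> inner_derivation B Y"
  unfolding inner_derivation_def a_minus_def by (simp add: MR.l_minus MR.r_minus MR.minus_add)

text \<open>For \<open>Y = pC\<close> the commutator is \<open>p(CB - BC)\<close>, and \<open>CB - BC\<close> reduces to a commutator with \<open>A\<close>, whose class is zero.\<close>

lemma matrix_tensor_inner_derivation:
  assumes B: "B \<in> lifts" and Y: "Y \<in> PM"
  shows "matrix_tensor (inner_derivation B Y) = \<one>\<^bsub>TE\<^esub>"
  using Y
proof (induction Y rule: PM_induct)
  note Bc = lifts_carrier[OF B]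
  case zero
  show ?case unfolding inner_derivation_zero[OF Bc] by (rule matrix_tensor_zero)
next
  note Bc = lifts_carrier[OF B]
  case (smult p C)
  let ?D = "C \<otimes>\<^bsub>MR\<^esub> B \<ominus>\<^bsub>MR\<^esub> B \<otimes>\<^bsub>MR\<^esub> C" and ?c = "redm n C"
  have c: "C \<otimes>\<^bsub>MR\<^esub> B \<in> carrier MR" "B \<otimes>\<^bsub>MR\<^esub> C \<in> carrier MR" "?c \<in> carrier MK" using smult Bc by simp_all
  have e: "inner_derivation B (mat_smult n p C) = mat_smult n p ?D"
    unfolding inner_derivation_def mat_smult_mult[OF P_carrier[OF smult(1)] smult(2) Bc]
    by (rule mat_smult_diff[OF P_carrier[OF smult(1)] c(1,2), symmetric])
  have r: "redm n ?D = ?c \<otimes>\<^bsub>MK\<^esub> A \<ominus>\<^bsub>MK\<^esub> A \<otimes>\<^bsub>MK\<^esub> ?c"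
    using c smult Bc liftsD(2)[OF B] by (simp add: a_minus_def)
  have "cls (redm n ?D) = cls \<zero>\<^bsub>MK\<^esub>"
  proof -
    have D: "redm n ?D \<in> carrier MK" using c by simp
    have "redm n ?D \<oplus>\<^bsub>MK\<^esub> (\<ominus>\<^bsub>MK\<^esub> ?c) \<otimes>\<^bsub>MK\<^esub> A = A \<otimes>\<^bsub>MK\<^esub> (\<ominus>\<^bsub>MK\<^esub> ?c) \<oplus>\<^bsub>MK\<^esub> \<zero>\<^bsub>MK\<^esub>"
      unfolding r using c(3) A_carrier
      by (simp add: a_minus_def MK.l_minus MK.r_minus MK.a_comm[of "?c \<otimes>\<^bsub>MK\<^esub> A"] MK.a_assoc MK.r_neg)
    then show ?thesis
      using K.coupled_class_eq_iff[OF A D[unfolded mat_ring_simps(1)] MK.zero_closed[unfolded mat_ring_simps(1)]]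
        MK.a_inv_closed[OF c(3)] unfolding mat_ring_simps(1) by blast
  qed
  then show ?case
    unfolding e using matrix_tensor_smult[OF smult(1), of ?D] tE_zero[OF smult(1)] c by simp
next
  note Bc = lifts_carrier[OF B]
  interpret TG: comm_group TE by (rule TE_comm_group)
  case (add Y Z)
  then show ?case
    unfolding inner_derivation_add[OF Bc PM_carrier[OF add(1)] PM_carrier[OF add(2)]]
    using matrix_tensor_add[OF inner_derivation_closed[OF Bc add(1)] inner_derivation_closed[OF Bc add(2)]] by simp
qed

text \<open>Multiplication by \<open>p\<close> turns an equation modulo \<open>P\<close> into an exact one. So a commutator \<open>hA - Ah\<close> that relates \<open>c\<close> to
\<open>d\<close> over \<open>k\<close> becomes the commutator with \<open>B\<close> of \<open>p\<close> times a lift of \<open>h\<close>.\<close>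

lemma smult_cong_cls:
  assumes B: "B \<in> lifts" and C: "C \<in> carrier MR" "D \<in> carrier MR" and eq: "cls (redm n C) = cls (redm n D)" and p: "p \<in> P"
  shows "\<exists>Y\<in>PM. mat_smult n p C = inner_derivation B Y \<oplus>\<^bsub>MR\<^esub> mat_smult n p D"
proof -
  note Bc = lifts_carrier[OF B] and pc = P_carrier[OF p]
  obtain h where h: "h \<in> carrier MK" "redm n C \<oplus>\<^bsub>MK\<^esub> h \<otimes>\<^bsub>MK\<^esub> A = A \<otimes>\<^bsub>MK\<^esub> h \<oplus>\<^bsub>MK\<^esub> redm n D"
    using eq K.coupled_class_eq_iff[OF A redm.hom_closed[OF C(1), unfolded mat_ring_simps(1)] redm.hom_closed[OF C(2), unfolded mat_ring_simps(1)]]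
    unfolding mat_ring_simps(1) by blast
  obtain L where L: "L \<in> carrier MR" "redm n L = h" using redm_surj[OF h(1)] by blast
  define W where "W = mat_smult n p L"
  have W: "W \<in> PM" unfolding W_def by (rule PM_smult[OF p L(1)])
  note Wc = PM_carrier[OF W]
  have c: "L \<otimes>\<^bsub>MR\<^esub> B \<in> carrier MR" "B \<otimes>\<^bsub>MR\<^esub> L \<in> carrier MR" using L Bc by simp_all
  have "mat_smult n p (C \<oplus>\<^bsub>MR\<^esub> L \<otimes>\<^bsub>MR\<^esub> B) = mat_smult n p (B \<otimes>\<^bsub>MR\<^esub> L \<oplus>\<^bsub>MR\<^esub> D)"
    using C c L Bc h(2) liftsD(2)[OF B] by (intro smult_cong_redm[OF p]) simp_all
  then have e: "mat_smult n p C \<oplus>\<^bsub>MR\<^esub> W \<otimes>\<^bsub>MR\<^esub> B = B \<otimes>\<^bsub>MR\<^esub> W \<oplus>\<^bsub>MR\<^esub> mat_smult n p D"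
    unfolding mat_smult_rules(4)[OF pc C(1) c(1)] mat_smult_rules(4)[OF pc c(2) C(2)] mat_smult_mult[OF pc L(1) Bc, symmetric] W_def .
  note s = mat_smult_rules(1)[OF pc C(1)] mat_smult_rules(1)[OF pc C(2)]
  have WB: "W \<otimes>\<^bsub>MR\<^esub> B \<in> carrier MR" "B \<otimes>\<^bsub>MR\<^esub> W \<in> carrier MR" using Wc Bc by simp_all
  have "mat_smult n p C = (mat_smult n p C \<oplus>\<^bsub>MR\<^esub> W \<otimes>\<^bsub>MR\<^esub> B) \<ominus>\<^bsub>MR\<^esub> W \<otimes>\<^bsub>MR\<^esub> B"
    unfolding a_minus_def using s WB by (simp add: MR.a_assoc MR.r_neg)
  also have "\<dots> = inner_derivation B (\<ominus>\<^bsub>MR\<^esub> W) \<oplus>\<^bsub>MR\<^esub> mat_smult n p D"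
    unfolding e inner_derivation_minus[OF Bc Wc] unfolding inner_derivation_def a_minus_def using s WB
    by (simp add: MR.minus_add MR.a_ac)
  finally show ?thesis using PM_closed(3)[OF W] by blast
qed

text \<open>By \<open>smult_cong_cls\<close>, \<open>[c] \<otimes> p \<mapsto> pC\<close> is well defined as a map from the tensor product to \<open>M\<^sub>n(R)\<close> modulo
commutators of \<open>B\<close> with matrices over \<open>P\<close>. It is a left inverse of \<open>matrix_tensor\<close> modulo these commutators.\<close>

lemma matrix_tensor_kernel:
  assumes B: "B \<in> lifts" and H: "H \<in> PM" and H1: "matrix_tensor H = \<one>\<^bsub>TE\<^esub>"
  shows "\<exists>Y\<in>PM. H = inner_derivation B Y"
proof -
  note Bc = lifts_carrier[OF B]
  let ?G = "add_monoid MR"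
  interpret TG: comm_group TE by (rule TE_comm_group)
  define N where "N = inner_derivation B ` PM"
  have NI: "inner_derivation B Y \<in> N" if "Y \<in> PM" for Y unfolding N_def using that by (rule imageI)
  have NG: "x \<in> carrier MR" if "x \<in> N" for x
    using that PM_carrier[OF inner_derivation_closed[OF Bc]] unfolding N_def by (elim imageE) simp
  have N: "subgroup N ?G"
  proof (rule group.subgroupI[OF MR.a_group])
    show "N \<subseteq> carrier ?G" using NG by auto
    show "N \<noteq> {}" using NI[OF PM_closed(1)] by blast
    show "inv\<^bsub>?G\<^esub> x \<in> N" if x: "x \<in> N" for x
    proof -
      obtain Y where Y: "Y \<in> PM" "x = inner_derivation B Y" using x unfolding N_def by blast
      have "\<ominus>\<^bsub>MR\<^esub> inner_derivation B Y \<in> N"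
        using NI[OF PM_closed(3)[OF Y(1)]] unfolding inner_derivation_minus[OF Bc PM_carrier[OF Y(1)]] .
      then show ?thesis unfolding Y(2) a_inv_def .
    qed
    show "x \<otimes>\<^bsub>?G\<^esub> y \<in> N" if xy: "x \<in> N" "y \<in> N" for x y
    proof -
      obtain Y Z where Y: "Y \<in> PM" "x = inner_derivation B Y" "Z \<in> PM" "y = inner_derivation B Z" using xy unfolding N_def by blast
      show ?thesis using NI[OF PM_closed(2)[OF Y(1,3)]]
        unfolding Y(2,4) inner_derivation_add[OF Bc PM_carrier[OF Y(1)] PM_carrier[OF Y(3)]] by simp
    qed
  qed
  define q where "q x = N #>\<^bsub>?G\<^esub> x" for x
  let ?Q = "?G Mod N"
  have Q: "comm_group ?Q" by (rule comm_group.abelian_FactGroup[OF MR.a_comm_group N])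
  interpret Q: comm_group ?Q by (rule Q)
  have q_hom: "q \<in> hom ?G ?Q" unfolding q_def[abs_def] by (rule normal.r_coset_hom_Mod[OF comm_group.subgroup_imp_normal[OF MR.a_comm_group N]])
  have qc: "q x \<in> carrier ?Q" if "x \<in> carrier MR" for x using hom_in_carrier[OF q_hom] that by simp
  have qa: "q (x \<oplus>\<^bsub>MR\<^esub> y) = q x \<otimes>\<^bsub>?Q\<^esub> q y" if "x \<in> carrier MR" "y \<in> carrier MR" for x y
    using hom_mult[OF q_hom] that by simp
  have q_eq: "q (x \<oplus>\<^bsub>MR\<^esub> y) = q y" if x: "x \<in> N" and y: "y \<in> carrier MR" for x y
  proof -
    have "x \<oplus>\<^bsub>MR\<^esub> y \<in> N #>\<^bsub>?G\<^esub> y" unfolding r_coset_def using x by auto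
    from group.repr_independence[OF MR.a_group this _ N] y show ?thesis unfolding q_def by simp
  qed
  \<comment> \<open>Some matrix over \<open>R\<close> that represents \<open>\<xi>\<close>; the coset of its multiple by \<open>p\<close> does not depend on the choice.\<close>
  define lift where "lift \<xi> = (SOME C. C \<in> carrier MR \<and> \<xi> = cls (redm n C))" for \<xi>
  define b where "b = (\<lambda>(\<xi>, p). q (mat_smult n p (lift \<xi>)))"
  have b: "b (cls (redm n C), p) = q (mat_smult n p C)" if C: "C \<in> carrier MR" and p: "p \<in> P" for C p
  proof -
    have L: "lift (cls (redm n C)) \<in> carrier MR" "cls (redm n C) = cls (redm n (lift (cls (redm n C))))"
      using someI[of "\<lambda>D. D \<in> carrier MR \<and> cls (redm n C) = cls (redm n D)" C] C unfolding lift_def by blast+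
    obtain Y where Y: "Y \<in> PM" "mat_smult n p (lift (cls (redm n C))) = inner_derivation B Y \<oplus>\<^bsub>MR\<^esub> mat_smult n p C"
      using smult_cong_cls[OF B L(1) C L(2)[symmetric] p] by blast
    have "b (cls (redm n C), p) = q (mat_smult n p (lift (cls (redm n C))))" by (simp add: b_def)
    then show ?thesis unfolding Y(2) q_eq[OF NI[OF Y(1)] mat_smult_rules(1)[OF P_carrier[OF p] C]] .
  qed
  have s: "mat_smult n p C \<in> carrier MR" if "p \<in> P" "C \<in> carrier MR" for p C by (rule mat_smult_rules(1)[OF P_carrier[OF that(1)] that(2)])
  note Pc = P_space_simps(1)
  have b1: "b (\<xi>, p) \<in> carrier ?Q" if \<xi>: "\<xi> \<in> carrier ES" and p: "p \<in> carrier (ideal_space R P)" for \<xi> p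
  proof -
    obtain C where C: "C \<in> carrier MR" "\<xi> = cls (redm n C)" using \<xi> by (rule ES_cases)
    show ?thesis unfolding C(2) b[OF C(1) p[unfolded Pc]] by (rule qc[OF s[OF p[unfolded Pc] C(1)]])
  qed
  have b2: "b (\<xi> \<oplus>\<^bsub>ES\<^esub> \<zeta>, p) = b (\<xi>, p) \<otimes>\<^bsub>?Q\<^esub> b (\<zeta>, p)"
    if \<xi>: "\<xi> \<in> carrier ES" "\<zeta> \<in> carrier ES" and p: "p \<in> carrier (ideal_space R P)" for \<xi> \<zeta> p
  proof -
    obtain C where C: "C \<in> carrier MR" "\<xi> = cls (redm n C)" using \<xi>(1) by (rule ES_cases)
    obtain D where D: "D \<in> carrier MR" "\<zeta> = cls (redm n D)" using \<xi>(2) by (rule ES_cases)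
    note p = p[unfolded Pc]
    have e: "\<xi> \<oplus>\<^bsub>ES\<^esub> \<zeta> = cls (redm n (C \<oplus>\<^bsub>MR\<^esub> D))"
      unfolding C(2) D(2) ES_simps(2)[OF redm.hom_closed[OF C(1)] redm.hom_closed[OF D(1)]] redm.hom_add[OF C(1) D(1)] ..
    show ?thesis
      unfolding e b[OF MR.a_closed[OF C(1) D(1)] p] mat_smult_rules(4)[OF P_carrier[OF p] C(1) D(1)] qa[OF s[OF p C(1)] s[OF p D(1)]]
      unfolding C(2) D(2) b[OF C(1) p] b[OF D(1) p] ..
  qed
  have b3: "b (\<xi>, p \<oplus>\<^bsub>ideal_space R P\<^esub> p') = b (\<xi>, p) \<otimes>\<^bsub>?Q\<^esub> b (\<xi>, p')"
    if \<xi>: "\<xi> \<in> carrier ES" and p: "p \<in> carrier (ideal_space R P)" "p' \<in> carrier (ideal_space R P)" for \<xi> p p'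
  proof -
    obtain C where C: "C \<in> carrier MR" "\<xi> = cls (redm n C)" using \<xi> by (rule ES_cases)
    note p = p[unfolded Pc]
    show ?thesis
      unfolding C(2) P_space_simps(3) b[OF C(1) P_closed(2)[OF p]] b[OF C(1) p(1)] b[OF C(1) p(2)]
        mat_smult_rules(2)[OF P_carrier[OF p(1)] C(1) P_carrier[OF p(2)]] by (rule qa[OF s[OF p(1) C(1)] s[OF p(2) C(1)]])
  qed
  have b4: "b (a \<odot>\<^bsub>ES\<^esub> \<xi>, p) = b (\<xi>, a \<odot>\<^bsub>ideal_space R P\<^esub> p)"
    if a: "a \<in> carrier K" and \<xi>: "\<xi> \<in> carrier ES" and p: "p \<in> carrier (ideal_space R P)" for a \<xi> p
  proof -
    obtain C where C: "C \<in> carrier MR" "\<xi> = cls (redm n C)" using \<xi> by (rule ES_cases)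
    obtain r where r: "r \<in> carrier R" "res r = a" using res_surj[OF a] by blast
    note p = p[unfolded Pc]
    have "a \<odot>\<^bsub>ES\<^esub> \<xi> = cls (redm n (mat_smult n r C))"
      unfolding C(2) ES_simps(3)[OF redm.hom_closed[OF C(1)] a] redm_smult[OF r(1) C(1)] r(2) ..
    then have "b (a \<odot>\<^bsub>ES\<^esub> \<xi>, p) = q (mat_smult n p (mat_smult n r C))"
      using b[OF mat_smult_rules(1)[OF r(1) C(1)] p] by simp
    also have "\<dots> = q (mat_smult n (r \<otimes> p) C)"
      unfolding mat_smult_rules(3)[OF P_carrier[OF p] C(1) r(1), symmetric] m_comm[OF r(1) P_carrier[OF p]] ..
    also have "\<dots> = b (\<xi>, a \<odot>\<^bsub>ideal_space R P\<^esub> p)"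
      unfolding C(2) r(2)[symmetric] P_space_smult[OF r(1) p] b[OF C(1) P_closed(4)[OF r(1) p]] ..
    finally show ?thesis .
  qed
  note tl = ES.tensor_lift_hom[where b = b, OF Q b1 b2 b3 b4] and te = ES.tensor_lift_elem[where b = b, OF Q b1 b2 b3 b4]
  have lift_hom: "tensor_lift ?Q b \<in> hom TE ?Q" by (rule tl)
  have lift_elem: "tensor_lift ?Q b (tE \<xi> p) = b (\<xi>, p)" if "\<xi> \<in> carrier ES" "p \<in> carrier (ideal_space R P)" for \<xi> p
    by (rule te) (assumption | rule that)+
  interpret L: group_hom TE ?Q "tensor_lift ?Q b"
    by (rule group_hom.intro[OF TG.is_group Q.is_group group_hom_axioms.intro[OF lift_hom]])
  have "tensor_lift ?Q b (matrix_tensor H) = q H"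
    using H
  proof (induction H rule: PM_induct)
    case zero
    note q0 = qc[OF MR.zero_closed]
    have "q \<zero>\<^bsub>MR\<^esub> \<otimes>\<^bsub>?Q\<^esub> q \<zero>\<^bsub>MR\<^esub> = q \<zero>\<^bsub>MR\<^esub>"
      using qa[OF MR.zero_closed MR.zero_closed] unfolding MR.l_zero[OF MR.zero_closed] ..
    then have "q \<zero>\<^bsub>MR\<^esub> = \<one>\<^bsub>?Q\<^esub>" by (rule iffD1[OF Q.l_cancel_one[OF q0 q0]])
    then show ?case unfolding matrix_tensor_zero L.hom_one ..
  next
    case (smult p C)
    show ?case
      unfolding matrix_tensor_smult[OF smult] b[OF smult(2,1), symmetric]
      by (rule lift_elem[OF cls_closed[OF redm.hom_closed[OF smult(2)]]]) (unfold Pc, rule smult(1))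
  next
    case (add Y Z)
    show ?case
      unfolding matrix_tensor_add[OF add(1,2)] qa[OF PM_carrier[OF add(1)] PM_carrier[OF add(2)]]
        L.hom_mult[OF matrix_tensor_closed[OF add(1)] matrix_tensor_closed[OF add(2)]] add(3,4) ..
  qed
  then have "q H = N" unfolding H1 L.hom_one by (simp add: FactGroup_def)
  moreover have "H \<in> q H"
    unfolding q_def by (rule group.rcos_self[OF MR.a_group _ N]) (use PM_carrier[OF H] in simp)
  ultimately show ?thesis unfolding N_def by blast
qed

section \<open>The equivariant bijection\<close>

lemma Ext1_MA_tensor_P_carrier: "carrier (Ext1_MA_tensor_P R P n A) = carrier TE"
  by (simp add: Ext1_MA_tensor_P_def tensor_module_def)

text \<open>On \<open>H = pC\<close> both sides are \<open>[gcg\<^sup>-\<^sup>1] \<otimes> p\<close>: the block matrix \<open>diag(g, g)\<close> is a morphism from the extension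
given by \<open>c\<close> to the one given by \<open>gcg\<^sup>-\<^sup>1\<close>.\<close>

lemma matrix_tensor_conjugate:
  assumes \<gamma>: "\<gamma> \<in> carrier MR" "\<delta> \<in> carrier MR" "\<gamma> \<otimes>\<^bsub>MR\<^esub> \<delta> = \<one>\<^bsub>MR\<^esub>" "\<delta> \<otimes>\<^bsub>MR\<^esub> \<gamma> = \<one>\<^bsub>MR\<^esub>"
    and comm: "redm n \<gamma> \<otimes>\<^bsub>MK\<^esub> A = A \<otimes>\<^bsub>MK\<^esub> redm n \<gamma>" and H: "H \<in> PM"
  shows "matrix_tensor (\<gamma> \<otimes>\<^bsub>MR\<^esub> H \<otimes>\<^bsub>MR\<^esub> \<delta>) = Ext1_MA_tensor_P_action R P n A (redm n \<gamma>) (matrix_tensor H)"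
proof -
  let ?g = "redm n \<gamma>" and ?h = "redm n \<delta>"
  let ?tr = "ext_transport (UP K) VM VM (mat_vec K n ?g) (mat_vec K n ?g)"
  interpret TG: comm_group TE by (rule TE_comm_group)
  have g: "?g \<in> carrier MK" "?h \<in> carrier MK" using \<gamma> by simp_all
  have gh: "?g \<otimes>\<^bsub>MK\<^esub> ?h = \<one>\<^bsub>MK\<^esub>" "?h \<otimes>\<^bsub>MK\<^esub> ?g = \<one>\<^bsub>MK\<^esub>"
    using redm.hom_mult[OF \<gamma>(1,2)] redm.hom_mult[OF \<gamma>(2,1)] \<gamma>(3,4) by simp_all
  have tr: "?tr (cls c) = cls (?g \<otimes>\<^bsub>MK\<^esub> c \<otimes>\<^bsub>MK\<^esub> ?h)" if c: "c \<in> carrier MK" for c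
  proof -
    have cc: "?g \<otimes>\<^bsub>MK\<^esub> c \<otimes>\<^bsub>MK\<^esub> ?h \<in> carrier MK" using c g by simp
    note G = g(1)[unfolded mat_ring_simps(1)] and C = c[unfolded mat_ring_simps(1)] and CC = cc[unfolded mat_ring_simps(1)]
    have gA: "mat_vec K n ?g (mat_vec K n A x) = mat_vec K n A (mat_vec K n ?g x)" if "x \<in> carrier VK" for x
      using K.mat_vec_mult[OF G A, of x] K.mat_vec_mult[OF A G, of x] comm that unfolding free_on_simps(1) by simp
    have gc: "mat_vec K n ?g (mat_vec K n c y) = mat_vec K n (?g \<otimes>\<^bsub>MK\<^esub> c \<otimes>\<^bsub>MK\<^esub> ?h) (mat_vec K n ?g y)" if "y \<in> carrier VK" for y
    proof -
      have "?g \<otimes>\<^bsub>MK\<^esub> c \<otimes>\<^bsub>MK\<^esub> ?h \<otimes>\<^bsub>MK\<^esub> ?g = ?g \<otimes>\<^bsub>MK\<^esub> c" using g c gh by (simp add: MK.m_assoc)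
      then show ?thesis
        using K.mat_vec_mult[OF G C, of y] K.mat_vec_mult[OF CC G, of y] that unfolding free_on_simps(1) by simp
    qed
    note hg = K.mat_vec_hom[OF G]
    show ?thesis
      by (rule K.ext_transport_coupled_class[OF A C CC hg gA hg gA
            K.mat_vec_bij[OF g[unfolded mat_ring_simps(1)] gh] gc])
  qed
  have conj: "?g \<otimes>\<^bsub>MK\<^esub> c \<otimes>\<^bsub>MK\<^esub> ?h \<in> carrier MK" if "c \<in> carrier MK" for c using g that by simp
  have tr1: "?tr \<xi> \<in> carrier ES" if "\<xi> \<in> carrier ES" for \<xi>
    using that tr cls_closed[OF conj] unfolding ES_simps(1) by force
  have tr2: "?tr (\<xi> \<oplus>\<^bsub>ES\<^esub> \<zeta>) = ?tr \<xi> \<oplus>\<^bsub>ES\<^esub> ?tr \<zeta>" if \<xi>: "\<xi> \<in> carrier ES" "\<zeta> \<in> carrier ES" for \<xi> \<zeta>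
  proof -
    obtain c d where c: "c \<in> carrier MK" "\<xi> = cls c" "d \<in> carrier MK" "\<zeta> = cls d" using \<xi> unfolding ES_simps(1) by blast
    show ?thesis
      unfolding c(2,4) ES_simps(2)[OF c(1,3)] tr[OF c(1)] tr[OF c(3)] tr[OF MK.a_closed[OF c(1,3)]] ES_simps(2)[OF conj[OF c(1)] conj[OF c(3)]]
      using c g by (simp add: MK.l_distr MK.r_distr)
  qed
  have tr3: "?tr (a \<odot>\<^bsub>ES\<^esub> \<xi>) = a \<odot>\<^bsub>ES\<^esub> ?tr \<xi>" if a: "a \<in> carrier K" and \<xi>: "\<xi> \<in> carrier ES" for a \<xi>
  proof -
    obtain c where c: "c \<in> carrier MK" "\<xi> = cls c" using \<xi> unfolding ES_simps(1) by blast
    have gc: "?g \<otimes>\<^bsub>MK\<^esub> c \<in> carrier MK" using g c by simp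
    show ?thesis
      unfolding c(2) ES_simps(3)[OF c(1) a] tr[OF c(1)] tr[OF K.mat_smult_rules(1)[OF a c(1)]] ES_simps(3)[OF conj[OF c(1)] a]
        K.mat_smult_mult(2)[OF a c(1) g(1)] K.mat_smult_mult(1)[OF a gc g(2)] ..
  qed
  note act = ES.tensor_map_bilinear[where f = ?tr, OF tr1 tr2 tr3, folded Ext1_MA_tensor_P_action_def]
  have act_hom: "Ext1_MA_tensor_P_action R P n A ?g \<in> hom TE TE" by (rule act(1))
  have act_elem: "Ext1_MA_tensor_P_action R P n A ?g (tE \<xi> p) = tE (?tr \<xi>) p"
    if "\<xi> \<in> carrier ES" "p \<in> carrier (ideal_space R P)" for \<xi> p
    by (rule act(2)) (assumption | rule that)+
  interpret act: group_hom TE TE "Ext1_MA_tensor_P_action R P n A ?g"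
    by (rule group_hom.intro[OF TG.is_group TG.is_group group_hom_axioms.intro[OF act_hom]])
  show ?thesis
    using H
  proof (induction H rule: PM_induct)
    case zero
    have "\<gamma> \<otimes>\<^bsub>MR\<^esub> \<zero>\<^bsub>MR\<^esub> \<otimes>\<^bsub>MR\<^esub> \<delta> = \<zero>\<^bsub>MR\<^esub>" using \<gamma> by simp
    then show ?case by (simp only: matrix_tensor_zero act.hom_one)
  next
    case (smult p C)
    note pc = P_carrier[OF smult(1)]
    have gC: "\<gamma> \<otimes>\<^bsub>MR\<^esub> C \<in> carrier MR" "\<gamma> \<otimes>\<^bsub>MR\<^esub> C \<otimes>\<^bsub>MR\<^esub> \<delta> \<in> carrier MR" using \<gamma> smult by simp_all
    have "redm n (\<gamma> \<otimes>\<^bsub>MR\<^esub> C \<otimes>\<^bsub>MR\<^esub> \<delta>) = ?g \<otimes>\<^bsub>MK\<^esub> redm n C \<otimes>\<^bsub>MK\<^esub> ?h" using \<gamma> smult by simp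
    then show ?case
      unfolding mat_smult_mult(2)[OF pc smult(2) \<gamma>(1)] mat_smult_mult(1)[OF pc gC(1) \<gamma>(2)] matrix_tensor_smult[OF smult]
        matrix_tensor_smult[OF smult(1) gC(2)]
      using act_elem[OF cls_closed[OF redm.hom_closed[OF smult(2)]], of p] tr[OF redm.hom_closed[OF smult(2)]] smult(1)
      by (simp only: P_space_simps)
  next
    case (add Y Z)
    have cY: "\<gamma> \<otimes>\<^bsub>MR\<^esub> Y \<otimes>\<^bsub>MR\<^esub> \<delta> \<in> PM" if "Y \<in> PM" for Y
      by (rule PM_closed(6)[OF PM_closed(5)[OF \<gamma>(1) that] \<gamma>(2)])
    have "\<gamma> \<otimes>\<^bsub>MR\<^esub> (Y \<oplus>\<^bsub>MR\<^esub> Z) \<otimes>\<^bsub>MR\<^esub> \<delta> = \<gamma> \<otimes>\<^bsub>MR\<^esub> Y \<otimes>\<^bsub>MR\<^esub> \<delta> \<oplus>\<^bsub>MR\<^esub> \<gamma> \<otimes>\<^bsub>MR\<^esub> Z \<otimes>\<^bsub>MR\<^esub> \<delta>"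
      using \<gamma> PM_carrier[OF add(1)] PM_carrier[OF add(2)] by (simp add: MR.l_distr MR.r_distr)
    then show ?case
      using matrix_tensor_add[OF cY[OF add(1)] cY[OF add(2)]] matrix_tensor_add[OF add(1,2)] add(3,4)
        act.hom_mult[OF matrix_tensor_closed[OF add(1)] matrix_tensor_closed[OF add(2)]] by simp
  qed
qed

text \<open>The bijection is \<open>[B] \<mapsto> matrix_tensor (B - B\<^sub>0)\<close> with \<open>B\<^sub>0\<close> from \<open>centralizer_lift\<close>. Then
\<open>\<gamma>B\<gamma>\<^sup>-\<^sup>1 - B\<^sub>0 = \<gamma>(B - B\<^sub>0)\<gamma>\<^sup>-\<^sup>1\<close> for a lift \<open>\<gamma>\<close> of \<open>g\<close> that commutes with \<open>B\<^sub>0\<close>.\<close>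

lemma equivariant_bijection:
  "\<exists>f. bij_betw f (omega_fibre R P n A) (carrier (Ext1_MA_tensor_P R P n A)) \<and>
    (\<forall>g\<in>GL_centralizer K n A. \<forall>\<xi>\<in>omega_fibre R P n A.
      f (fibre_action R P n A g \<xi>) = Ext1_MA_tensor_P_action R P n A g (f \<xi>))"
proof -
  interpret TG: comm_group TE by (rule TE_comm_group)
  obtain B0 where B0': "B0 \<in> matrices R n" "redm n B0 = A"
    and lift_comm: "\<And>g. g \<in> matrices K n \<Longrightarrow> g \<otimes>\<^bsub>MK\<^esub> A = A \<otimes>\<^bsub>MK\<^esub> g \<Longrightarrow>
      \<exists>\<gamma>. \<gamma> \<in> matrices R n \<and> redm n \<gamma> = g \<and> \<gamma> \<otimes>\<^bsub>MR\<^esub> B0 = B0 \<otimes>\<^bsub>MR\<^esub> \<gamma>"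
    using centralizer_lift[OF A] by metis
  have B0: "B0 \<in> lifts" using B0' by blast
  note B0c = lifts_carrier[OF B0]
  \<comment> \<open>Different lifts of the same class have the same image, by the fact \<open>same\<close> below.\<close>
  define lift where "lift \<xi> = (SOME B. B \<in> lifts \<and> lifted_class B = \<xi>)" for \<xi>
  define f where "f \<xi> = matrix_tensor (lift \<xi> \<ominus>\<^bsub>MR\<^esub> B0)" for \<xi>
  have diff_diff: "(B' \<ominus>\<^bsub>MR\<^esub> B0) \<ominus>\<^bsub>MR\<^esub> (B \<ominus>\<^bsub>MR\<^esub> B0) = B' \<ominus>\<^bsub>MR\<^esub> B" if "B \<in> lifts" "B' \<in> lifts" for B B'
    using lifts_carrier[OF that(1)] lifts_carrier[OF that(2)] B0c
    by (simp add: a_minus_def MR.minus_add MR.a_assoc MR.r_neg1 MR.a_comm[of "\<ominus>\<^bsub>MR\<^esub> B" B0])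
  have same: "matrix_tensor (B \<ominus>\<^bsub>MR\<^esub> B0) = matrix_tensor (B' \<ominus>\<^bsub>MR\<^esub> B0) \<longleftrightarrow> lifted_class B = lifted_class B'"
    if B: "B \<in> lifts" "B' \<in> lifts" for B B'
  proof -
    note D = lifts_diff[OF B0 B(1)] lifts_diff[OF B0 B(2)]
    have "matrix_tensor (B \<ominus>\<^bsub>MR\<^esub> B0) = matrix_tensor (B' \<ominus>\<^bsub>MR\<^esub> B0) \<longleftrightarrow> matrix_tensor (B' \<ominus>\<^bsub>MR\<^esub> B) = \<one>\<^bsub>TE\<^esub>"
      unfolding diff_diff[OF B, symmetric] matrix_tensor_diff[OF D(2,1)]
      using matrix_tensor_closed[OF D(1)] matrix_tensor_closed[OF D(2)]
      by (metis TG.inv_closed TG.inv_inv TG.inv_equality TG.r_inv)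
    also have "\<dots> \<longleftrightarrow> (\<exists>Y\<in>PM. B' \<ominus>\<^bsub>MR\<^esub> B = inner_derivation B0 Y)"
      using matrix_tensor_kernel[OF B0 lifts_diff[OF B]] matrix_tensor_inner_derivation[OF B0] by metis
    finally show ?thesis unfolding lifted_class_eq_iff_commutator[OF B B0] .
  qed
  have f: "f (lifted_class B) = matrix_tensor (B \<ominus>\<^bsub>MR\<^esub> B0)" if B: "B \<in> lifts" for B
  proof -
    have "lift (lifted_class B) \<in> lifts \<and> lifted_class (lift (lifted_class B)) = lifted_class B"
      unfolding lift_def by (rule someI[of _ B]) (use B in simp)
    then show ?thesis unfolding f_def using same[of "lift (lifted_class B)" B] B by blast
  qed
  have "bij_betw f (omega_fibre R P n A) (carrier TE)"
    unfolding bij_betw_def omega_fibre_eq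
  proof
    show "inj_on f (lifted_class ` lifts)"
    proof (rule inj_onI)
      fix \<xi> \<zeta> assume "\<xi> \<in> lifted_class ` lifts" "\<zeta> \<in> lifted_class ` lifts" "f \<xi> = f \<zeta>"
      then obtain B B' where B: "B \<in> lifts" "\<xi> = lifted_class B" "B' \<in> lifts" "\<zeta> = lifted_class B'" by blast
      show "\<xi> = \<zeta>" using \<open>f \<xi> = f \<zeta>\<close> unfolding B(2,4) f[OF B(1)] f[OF B(3)] same[OF B(1,3)] .
    qed
    show "f ` lifted_class ` lifts = carrier TE"
    proof (intro equalityI subsetI)
      fix z assume "z \<in> f ` lifted_class ` lifts"
      then obtain B where B: "B \<in> lifts" "z = f (lifted_class B)" by blast
      show "z \<in> carrier TE" unfolding B(2) f[OF B(1)] by (rule matrix_tensor_closed[OF lifts_diff[OF B0 B(1)]])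
    next
      fix z assume "z \<in> carrier TE"
      then obtain H where H: "H \<in> PM" "matrix_tensor H = z" using matrix_tensor_surj by blast
      note Hc = PM_carrier[OF H(1)]
      have "B0 \<oplus>\<^bsub>MR\<^esub> H \<in> carrier MR" "redm n (B0 \<oplus>\<^bsub>MR\<^esub> H) = A"
        using B0c Hc PM_redm[OF H(1)] B0'(2) A_carrier by simp_all
      then have B: "B0 \<oplus>\<^bsub>MR\<^esub> H \<in> lifts" unfolding mat_ring_simps(1) by blast
      have "(B0 \<oplus>\<^bsub>MR\<^esub> H) \<ominus>\<^bsub>MR\<^esub> B0 = H"
        using B0c Hc by (simp add: a_minus_def MR.a_comm[of B0 H] MR.a_assoc MR.r_neg)
      then have "f (lifted_class (B0 \<oplus>\<^bsub>MR\<^esub> H)) = z" using f[OF B] H(2) by simp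
      with B show "z \<in> f ` lifted_class ` lifts" by blast
    qed
  qed
  moreover have "f (fibre_action R P n A g \<xi>) = Ext1_MA_tensor_P_action R P n A g (f \<xi>)"
    if g: "g \<in> GL_centralizer K n A" and \<xi>: "\<xi> \<in> omega_fibre R P n A" for g \<xi>
  proof -
    obtain B where B: "B \<in> lifts" "\<xi> = lifted_class B" using \<xi> unfolding omega_fibre_eq by blast
    note Bc = lifts_carrier[OF B(1)]
    obtain h where h: "g \<in> carrier MK" "h \<in> carrier MK" "g \<otimes>\<^bsub>MK\<^esub> h = \<one>\<^bsub>MK\<^esub>" "h \<otimes>\<^bsub>MK\<^esub> g = \<one>\<^bsub>MK\<^esub>" "g \<otimes>\<^bsub>MK\<^esub> A = A \<otimes>\<^bsub>MK\<^esub> g"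
      using g unfolding GL_centralizer_def Units_def matrix_monoid_mat_ring by blast
    obtain \<gamma> where \<gamma>: "\<gamma> \<in> carrier MR" "redm n \<gamma> = g" "\<gamma> \<otimes>\<^bsub>MR\<^esub> B0 = B0 \<otimes>\<^bsub>MR\<^esub> \<gamma>"
      using lift_comm[OF h(1)[unfolded mat_ring_simps(1)] h(5)] unfolding mat_ring_simps(1) by blast
    obtain \<delta> where \<delta>: "\<delta> \<in> carrier MR" "\<gamma> \<otimes>\<^bsub>MR\<^esub> \<delta> = \<one>\<^bsub>MR\<^esub>" "\<delta> \<otimes>\<^bsub>MR\<^esub> \<gamma> = \<one>\<^bsub>MR\<^esub>"
      using invertible_lift[OF \<gamma>(1) h(2)] h unfolding \<gamma>(2) by blast
    define B' where "B' = \<gamma> \<otimes>\<^bsub>MR\<^esub> B \<otimes>\<^bsub>MR\<^esub> \<delta>"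
    have B'c: "B' \<in> carrier MR" unfolding B'_def using \<gamma> \<delta> Bc by simp
    have "redm n B' = A \<otimes>\<^bsub>MK\<^esub> redm n (\<gamma> \<otimes>\<^bsub>MR\<^esub> \<delta>)"
      unfolding B'_def using \<gamma> \<delta>(1) Bc liftsD(2)[OF B(1)] h A_carrier by (simp add: MK.m_assoc)
    then have "redm n B' = A" unfolding \<delta>(2) using A_carrier by simp
    then have B': "B' \<in> lifts" using B'c unfolding mat_ring_simps(1) by blast
    have comm: "\<gamma> \<otimes>\<^bsub>MR\<^esub> B = B' \<otimes>\<^bsub>MR\<^esub> \<gamma>" unfolding B'_def using \<gamma>(1) \<delta> Bc by (simp add: MR.m_assoc)
    have act: "fibre_action R P n A g \<xi> = lifted_class B'"
      unfolding B(2) using fibre_action_lifted_class[OF B(1) B' \<gamma>(1)[unfolded mat_ring_simps(1)] comm]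
        K.mat_vec_bij[OF h(1,2)[unfolded mat_ring_simps(1)] h(3,4)] unfolding \<gamma>(2) by simp
    have "B' \<ominus>\<^bsub>MR\<^esub> B0 = \<gamma> \<otimes>\<^bsub>MR\<^esub> (B \<ominus>\<^bsub>MR\<^esub> B0) \<otimes>\<^bsub>MR\<^esub> \<delta>"
    proof -
      have "\<gamma> \<otimes>\<^bsub>MR\<^esub> B0 \<otimes>\<^bsub>MR\<^esub> \<delta> = B0" unfolding \<gamma>(3) using \<gamma>(1) \<delta> B0c by (simp add: MR.m_assoc)
      then show ?thesis
        unfolding B'_def a_minus_def using \<gamma>(1) \<delta>(1) Bc B0c by (simp add: MR.l_distr MR.r_distr MR.l_minus MR.r_minus)
    qed
    then show ?thesis
      unfolding act f[OF B'] unfolding B(2) f[OF B(1)]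
      using matrix_tensor_conjugate[OF \<gamma>(1) \<delta> _ lifts_diff[OF B0 B(1)]] h(5) unfolding \<gamma>(2) by simp
  qed
  ultimately show ?thesis unfolding Ext1_MA_tensor_P_carrier by blast
qed

end

theorem theorem10p3:
  fixes R :: "('r, 'x) ring_scheme" and P :: "'r set" and n :: nat
    and A :: "nat \<times> nat \<Rightarrow> 'r set"
  assumes "local_ring R P"
    and "P \<cdot>\<^bsub>R\<^esub> P = {\<zero>\<^bsub>R\<^esub>}"
    and "A \<in> carrier (matrix_monoid (R Quot P) n)"
  shows "\<exists>f. bij_betw f (omega_fibre R P n A) (carrier (Ext1_MA_tensor_P R P n A)) \<and>
    (\<forall>g\<in>GL_centralizer (R Quot P) n A. \<forall>\<xi>\<in>omega_fibre R P n A.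
      f (fibre_action R P n A g \<xi>) = Ext1_MA_tensor_P_action R P n A g (f \<xi>))"
proof -
  interpret residue_matrix R P n A
    using assms
    by (simp add: residue_matrix_def residue_matrix_axioms_def residue_setup_def residue_setup_axioms_def local_ring_def
        matrix_monoid_def)
  show ?thesis by (rule equivariant_bijection)
qed

end
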